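(* Let $N\ge1$, $p\in(1,\infty)$, let $\Omega\subseteq\mathbb{R}^N$ be a bounded domain with Lipschitz boundary, let $\mu\in(-\infty,0)$, and let $g:\Omega\times\mathbb{R}\to\mathbb{R}$ be a Carathéodory function satisfying, with $h(t):=|t|^{p-2}t$: ($g_1$) $g\in L^\infty(\Omega\times K)$ for every compact $K\subset\mathbb{R}$; ($g_2$) $\lim_{|t|\to\infty}\frac{g(x,t)}{h(t)\ln|t|}=0$ uniformly in $\Omega$; ($g_3$) there exists $f\in L^\infty(\Omega)$ with $\lim_{t\to0}\frac{g(x,t)}{h(t)}=f(x)$ uniformly in $\Omega$. Then the problem $$L_{\Delta_p}u=g(x,u)+\mu|u|^{p-2}u\ln|u|\ \text{ in }\Omega,\qquad u=0\ \text{ in }\mathbb{R}^N\setminus\Omega,$$ has a nontrivial least energy (weak) solution $u$ that is bounded, i.e. $u\in L^\infty(\Omega)$. Moreover: (i) if $G(x,t)\le G(x,|t|)$ for all $t\in\mathbb{R}$ and a.e. $x\in\Omega$, where $G(x,t):=\int_0^tg(x,\tau)\,d\tau$, then every least energy solution of the problem has constant sign in $\Omega$; (ii) if $g(x,\cdot)\in C^1(\mathbb{R})$ and $(p-1)t\,g(x,t)-g'(x,t)t^2-\mu t^p\ge0$ for all $t\ge0$ and a.e. $x\in\Omega$ (with $g'=\partial_tg$), then the nontrivial nonnegative least energy solution is unique, i.e. there is at most one nontrivial nonnegative least energy solution.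
   Context: Convention: $|t|^{p}\ln|t|=0$ and $h(t)\ln|t|=0$ at $t=0$. Functions on $\Omega$ are extended by $0$ to $\mathbb{R}^N$. $C_{N,p}:=\frac{p\,\Gamma(N/2)}{2\pi^{N/2}}$, $\;[u]_{X_{L_{\Delta_p}}(\Omega)}^p:=C_{N,p}\iint_{x,y\in\mathbb{R}^N,\,|x-y|\le 1}\frac{|u(x)-u(y)|^p}{|x-y|^N}\,dx\,dy$, and $X_{L_{\Delta_p}}(\Omega):=\{u\in L^p(\Omega): [u]_{X_{L_{\Delta_p}}(\Omega)}<\infty,\ u=0\text{ in }\mathbb{R}^N\setminus\Omega\}$ with norm $(\|u\|_{L^p(\Omega)}^p+[u]_{X_{L_{\Delta_p}}(\Omega)}^p)^{1/p}$. Let $\Upsilon(z_1,z_2,t_1,t_2):=h(z_1-z_2)(t_1-t_2)-h(z_1)t_1-h(z_2)t_2$. For $u,v\in X_{L_{\Delta_p}}(\Omega)$, $$\mathcal{E}_{L_{\Delta_p}}(u,v):=\frac{C_{N,p}}{2}\iint_{|x-y|\le1}\frac{h(u(x)-u(y))(v(x)-v(y))}{|x-y|^N}dxdy+\frac{C_{N,p}}{2}\iint_{|x-y|\ge1}\frac{\Upsilon(u(x),u(y),v(x),v(y))}{|x-y|^N}dxdy+\rho_N\int_{\mathbb{R}^N}h(u)v\,dx,$$ where $\rho_N:=2\ln2-\gamma_E+\frac p2\psi_0(\frac N2)$, $\gamma_E=-\Gamma'(1)$, $\psi_0=\Gamma'/\Gamma$. A weak solution of the problem is a $u\in X_{L_{\Delta_p}}(\Omega)$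 with $\mathcal{E}_{L_{\Delta_p}}(u,v)=\int_\Omega g(x,u)v\,dx+\mu\int_\Omega h(u)\ln|u|\,v\,dx$ for all $v\in X_{L_{\Delta_p}}(\Omega)$. The energy functional is $$J_{L_{\Delta_p}}(u):=\frac1p\mathcal{E}_{L_{\Delta_p}}(u,u)-\int_\Omega G(x,u)\,dx-\frac{\mu}{p^2}\int_\Omega|u|^p(\ln|u|^p-1)\,dx,$$ and the Nehari manifold is $\mathcal{N}_{L_{\Delta_p}}:=\{u\in X_{L_{\Delta_p}}(\Omega)\setminus\{0\}:\mathcal{E}_{L_{\Delta_p}}(u,u)=\int_\Omega g(x,u)u\,dx+\mu\int_\Omega|u|^p\ln|u|\,dx\}$. A weak solution $u$ is of least energy if $J_{L_{\Delta_p}}(u)=\inf_{v\in\mathcal{N}_{L_{\Delta_p}}}J_{L_{\Delta_p}}(v)$. "Constant sign" means $u\ge0$ a.e. in $\Omega$ or $u\le0$ a.e. in $\Omega$. *)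

theory Defs
  imports "HOL-Analysis.Analysis"
begin

text \<open>
  Throughout, the Euclidean space of dimension \<open>N \<ge> 1\<close> is a type of class
  \<open>euclidean_space\<close>, so \<open>N\<close> is \<open>DIM('a)\<close>.  Elements of function spaces are Lebesgue
  measurable representatives; identities between them are only meaningful almost everywhere.
\<close>

text \<open>
  Near each boundary point, \<open>\<Omega>\<close> is the strict epigraph, in some direction \<open>e\<close>, of a Lipschitz
  function on the hyperplane orthogonal to \<open>e\<close>.  The vector \<open>y - (y \<bullet> e) *\<^sub>R e\<close> is the orthogonal
  projection of \<open>y\<close> to that hyperplane.
\<close>

definition lipschitz_boundary :: "'a::euclidean_space set \<Rightarrow> bool" where
  "lipschitz_boundary \<Omega> \<longleftrightarrow>
     (\<forall>x0\<in>frontier \<Omega>. \<exists>r>0. \<exists>e L \<phi>. norm e = 1 \<and> L-lipschitz_on {z. z \<bullet> e = 0} \<phi> \<and>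
        \<Omega> \<inter> ball x0 r = {y \<in> ball x0 r. \<phi> (y - (y \<bullet> e) *\<^sub>R e) < y \<bullet> e})"

definition bounded_lipschitz_domain :: "'a::euclidean_space set \<Rightarrow> bool" where
  "bounded_lipschitz_domain \<Omega> \<longleftrightarrow>
     open \<Omega> \<and> connected \<Omega> \<and> \<Omega> \<noteq> {} \<and> bounded \<Omega> \<and> lipschitz_boundary \<Omega>"

definition in_Linf :: "'b::euclidean_space set \<Rightarrow> ('b \<Rightarrow> real) \<Rightarrow> bool" where
  "in_Linf S f \<longleftrightarrow> f \<in> borel_measurable (lebesgue_on S) \<and>
     (\<exists>C. AE x in lebesgue_on S. \<bar>f x\<bar> \<le> C)"

definition in_Lp :: "real \<Rightarrow> 'b::euclidean_space set \<Rightarrow> ('b \<Rightarrow> real) \<Rightarrow> bool" where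
  "in_Lp p S f \<longleftrightarrow> f \<in> borel_measurable (lebesgue_on S) \<and>
     integrable (lebesgue_on S) (\<lambda>x. \<bar>f x\<bar> powr p)"

text \<open>Only the values \<open>g x t\<close> with \<open>x \<in> \<Omega>\<close> matter.\<close>

definition caratheodory :: "'a::euclidean_space set \<Rightarrow> ('a \<Rightarrow> real \<Rightarrow> real) \<Rightarrow> bool" where
  "caratheodory \<Omega> g \<longleftrightarrow>
     (\<forall>t. (\<lambda>x. g x t) \<in> borel_measurable (lebesgue_on \<Omega>)) \<and>
     (AE x in lebesgue_on \<Omega>. continuous_on UNIV (g x))"

text \<open>
  Since \<open>0 powr a = 0\<close> and \<open>ln 0 = 0\<close> in the library, the conventions \<open>|t|^p ln |t| = 0\<close> and
  \<open>h(t) ln |t| = 0\<close> at \<open>t = 0\<close> hold automatically.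
\<close>

definition h :: "real \<Rightarrow> real \<Rightarrow> real" where
  "h p t = \<bar>t\<bar> powr (p - 2) * t"

definition primitive :: "('a \<Rightarrow> real \<Rightarrow> real) \<Rightarrow> 'a \<Rightarrow> real \<Rightarrow> real" where
  "primitive g x t = (LBINT \<tau>=ereal 0..ereal t. g x \<tau>)"

definition C_const :: "nat \<Rightarrow> real \<Rightarrow> real" where
  "C_const N p = p * Gamma (real N / 2) / (2 * pi powr (real N / 2))"

definition rho_const :: "nat \<Rightarrow> real \<Rightarrow> real" where
  "rho_const N p = 2 * ln 2 - euler_mascheroni + p / 2 * Digamma (real N / 2)"

text \<open>
  Double integrals are taken over the product \<open>lebesgue \<Otimes>\<^sub>M lebesgue\<close>: all integrands below are
  measurable for it, and its completion is Lebesgue measure on the product space.  The kernel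
  \<open>1 / |x - y|^N\<close> is \<open>0\<close> on the diagonal, a null set.
\<close>

definition X_seminorm_pow :: "real \<Rightarrow> ('a::euclidean_space \<Rightarrow> real) \<Rightarrow> ennreal" where
  "X_seminorm_pow p u = ennreal (C_const DIM('a) p) *
     (\<integral>\<^sup>+z\<in>{(x, y). norm (x - y) \<le> 1}.
        (case z of (x, y) \<Rightarrow> ennreal (\<bar>u x - u y\<bar> powr p / norm (x - y) ^ DIM('a)))
      \<partial>(lebesgue \<Otimes>\<^sub>M lebesgue))"

definition X_space :: "real \<Rightarrow> 'a::euclidean_space set \<Rightarrow> ('a \<Rightarrow> real) set" where
  "X_space p \<Omega> = {u. in_Lp p \<Omega> u \<and> X_seminorm_pow p u < \<infinity> \<and> (\<forall>x. x \<notin> \<Omega> \<longrightarrow> u x = 0)}"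

definition Upsilon :: "real \<Rightarrow> real \<Rightarrow> real \<Rightarrow> real \<Rightarrow> real \<Rightarrow> real" where
  "Upsilon p z1 z2 t1 t2 = h p (z1 - z2) * (t1 - t2) - h p z1 * t1 - h p z2 * t2"

definition E_form :: "real \<Rightarrow> ('a::euclidean_space \<Rightarrow> real) \<Rightarrow> ('a \<Rightarrow> real) \<Rightarrow> real" where
  "E_form p u v =
     C_const DIM('a) p / 2 *
       (LINT z:{(x, y). norm (x - y) \<le> 1}|(lebesgue \<Otimes>\<^sub>M lebesgue).
          (case z of (x, y) \<Rightarrow> h p (u x - u y) * (v x - v y) / norm (x - y) ^ DIM('a)))
     + C_const DIM('a) p / 2 *
       (LINT z:{(x, y). norm (x - y) \<ge> 1}|(lebesgue \<Otimes>\<^sub>M lebesgue).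
          (case z of (x, y) \<Rightarrow> Upsilon p (u x) (u y) (v x) (v y) / norm (x - y) ^ DIM('a)))
     + rho_const DIM('a) p * (LINT x|lebesgue. h p (u x) * v x)"

definition weak_solution ::
  "real \<Rightarrow> 'a::euclidean_space set \<Rightarrow> ('a \<Rightarrow> real \<Rightarrow> real) \<Rightarrow> real \<Rightarrow> ('a \<Rightarrow> real) \<Rightarrow> bool" where
  "weak_solution p \<Omega> g \<mu> u \<longleftrightarrow> u \<in> X_space p \<Omega> \<and>
     (\<forall>v\<in>X_space p \<Omega>. E_form p u v =
        (LINT x|lebesgue_on \<Omega>. g x (u x) * v x)
        + \<mu> * (LINT x|lebesgue_on \<Omega>. h p (u x) * ln \<bar>u x\<bar> * v x))"

definition J_energy ::
  "real \<Rightarrow> 'a::euclidean_space set \<Rightarrow> ('a \<Rightarrow> real \<Rightarrow> real) \<Rightarrow> real \<Rightarrow> ('a \<Rightarrow> real) \<Rightarrow> real" where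
  "J_energy p \<Omega> g \<mu> u = 1 / p * E_form p u u
     - (LINT x|lebesgue_on \<Omega>. primitive g x (u x))
     - \<mu> / p\<^sup>2 * (LINT x|lebesgue_on \<Omega>. \<bar>u x\<bar> powr p * (ln (\<bar>u x\<bar> powr p) - 1))"

definition nontrivial :: "('a::euclidean_space \<Rightarrow> real) \<Rightarrow> bool" where
  "nontrivial u \<longleftrightarrow> \<not> (AE x in lebesgue. u x = 0)"

definition nehari ::
  "real \<Rightarrow> 'a::euclidean_space set \<Rightarrow> ('a \<Rightarrow> real \<Rightarrow> real) \<Rightarrow> real \<Rightarrow> ('a \<Rightarrow> real) set" where
  "nehari p \<Omega> g \<mu> = {u \<in> X_space p \<Omega>. nontrivial u \<and>
     E_form p u u = (LINT x|lebesgue_on \<Omega>. g x (u x) * u x)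
       + \<mu> * (LINT x|lebesgue_on \<Omega>. \<bar>u x\<bar> powr p * ln \<bar>u x\<bar>)}"

text \<open>
  The infimum is taken in the extended reals, so that it has its usual meaning without a separate
  proof that the Nehari manifold is nonempty and that the energy is bounded below on it.
\<close>

definition least_energy_solution ::
  "real \<Rightarrow> 'a::euclidean_space set \<Rightarrow> ('a \<Rightarrow> real \<Rightarrow> real) \<Rightarrow> real \<Rightarrow> ('a \<Rightarrow> real) \<Rightarrow> bool" where
  "least_energy_solution p \<Omega> g \<mu> u \<longleftrightarrow> weak_solution p \<Omega> g \<mu> u \<and>
     ereal (J_energy p \<Omega> g \<mu> u) = (INF v\<in>nehari p \<Omega> g \<mu>. ereal (J_energy p \<Omega> g \<mu> v))"

definition nonnegative_on :: "'a::euclidean_space set \<Rightarrow> ('a \<Rightarrow> real) \<Rightarrow> bool" where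
  "nonnegative_on \<Omega> u \<longleftrightarrow> (AE x in lebesgue_on \<Omega>. 0 \<le> u x)"

definition constant_sign_on :: "'a::euclidean_space set \<Rightarrow> ('a \<Rightarrow> real) \<Rightarrow> bool" where
  "constant_sign_on \<Omega> u \<longleftrightarrow>
     (AE x in lebesgue_on \<Omega>. 0 \<le> u x) \<or> (AE x in lebesgue_on \<Omega>. u x \<le> 0)"

end

theory Submission
  imports Defs "HOL-Real_Asymp.Real_Asymp" "HOL-Complex_Analysis.Great_Picard"
begin

text \<open>
  Since \<open>\<mu> < 0\<close>, the logarithm makes the energy \<open>J\<close> coercive at infinity and negative on small functions,
  so the least energy solutions are exactly the global minimisers of \<open>J\<close> on the whole space.
  Truncating at a large level strictly lowers \<open>J\<close>; this bounds minimisers and minimising sequences.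
  A minimiser exists because convolving with cut-off kernels of diverging mass makes sequences bounded
  in \<open>X\<close> and in the supremum norm precompact in \<open>L\<^sup>1\<close>.
  Replacing \<open>u\<close> by \<open>\<bar>u\<bar>\<close> lowers \<open>J\<close> strictly if \<open>u\<close> changes sign.
  For uniqueness, \<open>J\<close> is convex along \<open>((1 - s) u\<^sup>p + s w\<^sup>p)\<^sup>1\<^sup>/\<^sup>p\<close>, so that two nonnegative minimisers are
  proportional.  If they differ, the hypothesis on \<open>g\<close> near \<open>0\<close> keeps their positive values away from \<open>0\<close>,
  which is impossible because a minimiser cannot jump at the boundary of its support.
\<close>

subsection \<open>Powers of real numbers\<close>

text \<open>The kernel has order zero, so the seminorm controls only a logarithm more than the
  \<open>p\<close>-th power norm. The quantitative steps rest on one fact: the kernel has mass of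
  order \<open>j\<close> outside the ball of radius \<open>1 / 2 ^ j\<close>, even within a half
  space. This gives integrability of \<open>\<bar>u\<bar> powr p * ln (1 + \<bar>u\<bar>)\<close>,
  without which the energy would not be meaningful on all of the space, and then the compactness and
  the estimate at the edge of the support. In the limit passage, sup bounds obtained by truncation
  make the far and local terms converge by dominated convergence; only the near term needs Fatou.
  Uniqueness has no continuity of solutions and no strong maximum principle at its disposal. Two
  proportional minimisers \<open>u\<close> and \<open>c * u\<close> are compared by testing both
  equations with \<open>u\<close>: the nonlocal terms are homogeneous and cancel, and the local
  remainder would vanish only if \<open>u\<close> had no small positive values. Excluding such a gap
  takes a barrier placed at an extreme point of the essential support, where a whole half space of
  zeros lies on one side.\<close>

lemma h_sgn: "h p t = sgn t * \<bar>t\<bar> powr (p - 1)"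
proof (cases "t = 0")
  case False
  have "\<bar>t\<bar> powr (p - 1) = \<bar>t\<bar> powr (p - 2) * \<bar>t\<bar>"
    using powr_add[of "\<bar>t\<bar>" "p - 2" 1] False by simp
  then show ?thesis by (simp add: h_def mult.commute mult.left_commute abs_sgn[symmetric] sgn_if)
qed (simp add: h_def)

lemma h_0 [simp]: "h p 0 = 0"
  by (simp add: h_def)

lemma h_minus [simp]: "h p (- t) = - h p t"
  by (simp add: h_def)

lemma abs_h: "\<bar>h p t\<bar> = \<bar>t\<bar> powr (p - 1)"
  by (simp add: h_sgn abs_mult sgn_if)

lemma h_mult_self: "h p t * t = \<bar>t\<bar> powr p"
proof (cases "t = 0")
  case False
  have "h p t * t = \<bar>t\<bar> powr (p - 1) * \<bar>t\<bar>"
    by (simp add: h_sgn sgn_if)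
  also have "\<dots> = \<bar>t\<bar> powr p"
    using powr_add[of "\<bar>t\<bar>" "p - 1" 1] False by simp
  finally show ?thesis .
qed simp

lemma h_nonneg: "0 \<le> t \<Longrightarrow> h p t = t powr (p - 1)"
  by (simp add: h_sgn sgn_if)

lemma h_strict_mono:
  assumes "1 < p" "s < t"
  shows "h p s < h p t"
proof -
  consider "0 \<le> s" | "s < 0" "0 \<le> t" | "t < 0" using assms by linarith
  then show ?thesis
  proof cases
    case 1 then show ?thesis using assms by (simp add: h_nonneg powr_less_mono2)
  next
    case 2 then have "h p s < 0" "0 \<le> h p t" by (simp_all add: h_sgn sgn_if)
    then show ?thesis by simp
  next
    case 3 then show ?thesis using assms by (simp add: h_sgn sgn_if powr_less_mono2)
  qed
qed

text \<open>The limit hypothesis is exactly differentiability at 0 of the even extension, with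
  derivative 0; the factor \<open>sgn t\<close> gives this value whatever \<open>f' 0\<close> is.
  The powers of \<open>\<bar>t\<bar>\<close> with and without logarithm are treated by the same
  argument.\<close>

lemma has_real_derivative_abs_comp:
  fixes f f' :: "real \<Rightarrow> real"
  assumes f: "\<And>t. 0 < t \<Longrightarrow> (f has_real_derivative f' t) (at t)"
    and "f 0 = 0" and lim: "((\<lambda>t. f t / t) \<longlongrightarrow> 0) (at_right 0)"
  shows "((\<lambda>t. f \<bar>t\<bar>) has_real_derivative sgn t * f' \<bar>t\<bar>) (at t)"
proof -
  consider "0 < t" | "t < 0" | "t = 0" by linarith
  then show ?thesis
  proof cases
    case 1
    have "((\<lambda>t. f \<bar>t\<bar>) has_real_derivative f' t) (at t)"
    proof (rule has_field_derivative_transform_within_open[OF f[OF 1], of "{0<..}"])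
    qed (use 1 in auto)
    with 1 show ?thesis by simp
  next
    case 2
    have "((\<lambda>t. f (- t)) has_real_derivative f' (- t) * (- 1)) (at t)"
      by (rule DERIV_chain'[OF _ f]) (use 2 in \<open>auto intro!: derivative_eq_intros\<close>)
    then have "((\<lambda>t. f \<bar>t\<bar>) has_real_derivative f' (- t) * (- 1)) (at t)"
    proof (rule has_field_derivative_transform_within_open[of _ _ _ "{..<0}"])
    qed (use 2 in auto)
    with 2 show ?thesis by simp
  next
    case 3
    have R: "((\<lambda>t. f \<bar>t\<bar> / t) \<longlongrightarrow> 0) (at_right 0)"
      by (rule Lim_transform_eventually[OF lim])
         (auto intro: eventually_mono[OF eventually_at_right_less[of 0]])
    have "((\<lambda>t. - (f t / t)) \<longlongrightarrow> 0) (at_right 0)"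
      using tendsto_minus[OF lim] by simp
    then have "((\<lambda>t. f \<bar>-t\<bar> / (-t)) \<longlongrightarrow> 0) (at_right 0)"
      by (rule Lim_transform_eventually)
         (auto intro: eventually_mono[OF eventually_at_right_less[of 0]])
    then have L: "((\<lambda>t. f \<bar>t\<bar> / t) \<longlongrightarrow> 0) (at_left 0)"
      by (simp add: filterlim_at_left_to_right)
    have "((\<lambda>t. f \<bar>t\<bar> / t) \<longlongrightarrow> 0) (at 0)"
      using L R by (simp add: filterlim_split_at)
    then show ?thesis using 3 \<open>f 0 = 0\<close> by (simp add: has_field_derivative_iff)
  qed
qed

lemma has_real_derivative_abs_powr:
  assumes "1 < p"
  shows "((\<lambda>t. \<bar>t\<bar> powr p) has_real_derivative p * h p t) (at t)"
proof -
  have "((\<lambda>t. \<bar>t\<bar> powr p) has_real_derivative sgn t * (p * \<bar>t\<bar> powr (p - 1))) (at t)"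
  proof (rule has_real_derivative_abs_comp)
    show "((\<lambda>t. t powr p / t) \<longlongrightarrow> 0) (at_right 0)"
      using assms by real_asymp
  qed (auto intro!: derivative_eq_intros)
  then show ?thesis by (simp add: h_sgn mult_ac)
qed

text \<open>The \<open>- 1\<close> in the energy cancels the term that comes from differentiating
  the logarithm, so that only \<open>h p t * ln \<bar>t\<bar>\<close> remains.\<close>

lemma has_real_derivative_abs_powr_ln:
  assumes "1 < p"
  shows "((\<lambda>t. \<bar>t\<bar> powr p * (ln (\<bar>t\<bar> powr p) - 1)) has_real_derivative p\<^sup>2 * (h p t * ln \<bar>t\<bar>)) (at t)"
proof -
  have "((\<lambda>t. \<bar>t\<bar> powr p * (p * ln \<bar>t\<bar> - 1)) has_real_derivative
      sgn t * (p\<^sup>2 * (\<bar>t\<bar> powr (p - 1) * ln \<bar>t\<bar>))) (at t)"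
  proof (rule has_real_derivative_abs_comp)
    show "((\<lambda>t. t powr p * (p * ln t - 1) / t) \<longlongrightarrow> 0) (at_right 0)"
      using assms by real_asymp
    show "((\<lambda>t. t powr p * (p * ln t - 1)) has_real_derivative p\<^sup>2 * (t powr (p - 1) * ln t)) (at t)"
      if "0 < t" for t
      using that powr_add[of t "p - 1" 1]
      by (auto intro!: derivative_eq_intros simp: field_simps power2_eq_square)
  qed auto
  moreover have "\<bar>t\<bar> powr p * (ln (\<bar>t\<bar> powr p) - 1) = \<bar>t\<bar> powr p * (p * ln \<bar>t\<bar> - 1)" for t
    by (cases "t = 0") (auto simp: ln_powr)
  ultimately show ?thesis by (simp add: h_sgn mult_ac)
qed

lemma borel_measurable_h [measurable]: "h p \<in> borel_measurable borel"
  unfolding h_def by measurable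

text \<open>The mean value theorem turns strict monotonicity of \<open>h p\<close> into strict
  convexity. The strict form is the source of the equality case that makes two minimisers
  proportional.\<close>

lemma abs_powr_tangent:
  fixes x y :: real
  assumes "1 < p"
  shows "\<bar>x\<bar> powr p + p * h p x * (y - x) \<le> \<bar>y\<bar> powr p"
    and "x \<noteq> y \<Longrightarrow> \<bar>x\<bar> powr p + p * h p x * (y - x) < \<bar>y\<bar> powr p"
proof -
  have D: "DERIV (\<lambda>t. \<bar>t\<bar> powr p) t :> p * h p t" for t
    using has_real_derivative_abs_powr[OF assms] .
  show *: "\<bar>x\<bar> powr p + p * h p x * (y - x) < \<bar>y\<bar> powr p" if neq: "x \<noteq> y" for y
  proof -
    consider "x < y" | "y < x" using neq by linarith
    then show ?thesis
    proof cases
      case 1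
      obtain z where z: "x < z" "z < y" "\<bar>y\<bar> powr p - \<bar>x\<bar> powr p = (y - x) * (p * h p z)"
        using MVT2[OF 1 D] by blast
      have "(y - x) * (p * h p x) < (y - x) * (p * h p z)"
        using z 1 assms h_strict_mono[of p x z] by simp
      then show ?thesis using z by (simp add: mult_ac)
    next
      case 2
      obtain z where z: "y < z" "z < x" "\<bar>x\<bar> powr p - \<bar>y\<bar> powr p = (x - y) * (p * h p z)"
        using MVT2[OF 2 D] by blast
      have "(x - y) * (p * h p z) < (x - y) * (p * h p x)"
        using z 2 assms h_strict_mono[of p z x] by simp
      then show ?thesis using z by (simp add: algebra_simps)
    qed
  qed
  show "\<bar>x\<bar> powr p + p * h p x * (y - x) \<le> \<bar>y\<bar> powr p"
    using *[of y] by (cases "x = y") auto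
qed

lemma powr_add_le:
  fixes a b :: real
  assumes "0 < p" "0 \<le> a" "0 \<le> b"
  shows "(a + b) powr p \<le> 2 powr p * (a powr p + b powr p)"
proof -
  have "(a + b) powr p \<le> (2 * max a b) powr p"
    using assms by (intro powr_mono2) auto
  also have "\<dots> = 2 powr p * max a b powr p"
    using assms by (simp add: powr_mult)
  also have "max a b powr p \<le> a powr p + b powr p"
    by (simp add: max_def)
  finally show ?thesis by (simp add: mult_left_mono)
qed

lemma abs_add_powr_le:
  fixes a b :: real
  assumes "0 < p"
  shows "\<bar>a + b\<bar> powr p \<le> 2 powr p * (\<bar>a\<bar> powr p + \<bar>b\<bar> powr p)"
  using order_trans[OF powr_mono2[of p "\<bar>a + b\<bar>" "\<bar>a\<bar> + \<bar>b\<bar>"] powr_add_le[of p "\<bar>a\<bar>" "\<bar>b\<bar>"]] assms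
  by auto

lemma abs_diff_powr_le:
  fixes a b :: real
  assumes "0 < p"
  shows "\<bar>a - b\<bar> powr p \<le> 2 powr p * (\<bar>a\<bar> powr p + \<bar>b\<bar> powr p)"
  using abs_add_powr_le[of p a "- b"] assms by simp

text \<open>Both factors are bounded through the larger of \<open>\<bar>a\<bar>\<close> and
  \<open>\<bar>b\<bar>\<close>, which gives constant 1. This majorant serves the near, far and
  zeroth-order terms of \<open>E_form\<close> alike.\<close>

lemma h_young:
  assumes "1 < p"
  shows "\<bar>h p a * b\<bar> \<le> \<bar>a\<bar> powr p + \<bar>b\<bar> powr p"
proof -
  let ?m = "max \<bar>a\<bar> \<bar>b\<bar>"
  have "\<bar>h p a * b\<bar> \<le> ?m powr (p - 1) * ?m"
    unfolding abs_mult abs_h using assms by (intro mult_mono powr_mono2) auto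
  also have "\<dots> = ?m powr p"
    using h_mult_self[of p ?m] h_nonneg[of ?m p] by simp
  also have "\<dots> \<le> \<bar>a\<bar> powr p + \<bar>b\<bar> powr p"
    by (simp add: max_def)
  finally show ?thesis .
qed

text \<open>Tangents at \<open>a\<close> and at \<open>a + s * b\<close> enclose the difference from
  both sides. The bound is linear in \<open>\<bar>s\<bar>\<close>, as required to dominate
  difference quotients.\<close>

lemma abs_powr_diff_le:
  fixes a b s :: real
  assumes "1 < p" "\<bar>s\<bar> \<le> 1"
  shows "\<bar>\<bar>a + s * b\<bar> powr p - \<bar>a\<bar> powr p\<bar> \<le> \<bar>s\<bar> * (p * (\<bar>a\<bar> + \<bar>b\<bar>) powr p)"
proof -
  let ?m = "\<bar>a\<bar> + \<bar>b\<bar>"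
  have sb: "\<bar>s * b\<bar> \<le> \<bar>b\<bar>" using assms by (simp add: abs_mult mult_left_le_one_le)
  have *: "\<bar>p * h p c * (s * b)\<bar> \<le> \<bar>s\<bar> * (p * ?m powr p)" if "\<bar>c\<bar> \<le> ?m" for c
  proof -
    have "\<bar>p * h p c * (s * b)\<bar> = \<bar>s\<bar> * (p * (\<bar>c\<bar> powr (p - 1) * \<bar>b\<bar>))"
      using assms by (simp add: abs_mult abs_h)
    also have "\<dots> \<le> \<bar>s\<bar> * (p * (?m powr (p - 1) * ?m))"
      using that assms by (intro mult_left_mono mult_mono powr_mono2) auto
    also have "?m powr (p - 1) * ?m = ?m powr p"
      using h_mult_self[of p ?m] h_nonneg[of ?m p] by simp
    finally show ?thesis .
  qed
  have "\<bar>a\<bar> powr p + p * h p a * (s * b) \<le> \<bar>a + s * b\<bar> powr p"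
    using abs_powr_tangent(1)[OF assms(1), of a "a + s * b"] by simp
  moreover have "\<bar>a + s * b\<bar> powr p + p * h p (a + s * b) * (- (s * b)) \<le> \<bar>a\<bar> powr p"
    using abs_powr_tangent(1)[OF assms(1), of "a + s * b" a] by simp
  moreover note *[of a] *[of "a + s * b"]
  moreover have "\<bar>a + s * b\<bar> \<le> ?m" using sb by linarith
  ultimately show ?thesis by (simp add: abs_le_iff)
qed

subsection \<open>The kernel\<close>

text \<open>The cut-off at distance 1 is built in, and division by zero gives the value 0 at the
  origin, in accordance with the double integrals of the problem.\<close>

definition kern :: "'a::euclidean_space \<Rightarrow> real" where
  "kern z = indicator (cball 0 1) z / norm z ^ DIM('a)"

lemma kern_nonneg [simp]: "0 \<le> kern z"
  by (simp add: kern_def)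

lemma kern_0 [simp]: "kern (0 :: 'a::euclidean_space) = 0"
  by (simp add: kern_def)

lemma borel_measurable_kern [measurable]: "kern \<in> borel_measurable borel"
  unfolding kern_def
  by (intro borel_measurable_divide borel_measurable_indicator borel_measurable_power
      borel_measurable_norm measurable_ident) auto

lemma kern_ge:
  fixes z :: "'a::euclidean_space"
  assumes "z \<noteq> 0" "norm z \<le> 1 / 2 ^ j"
  shows "(2 ^ j) ^ DIM('a) \<le> kern z"
proof -
  have "norm z \<le> 1" using assms(2) by (rule order_trans) (simp add: divide_le_eq)
  then have "kern z = (1 / norm z) ^ DIM('a)" by (simp add: kern_def power_divide)
  moreover have "2 ^ j \<le> 1 / norm z" using assms by (simp add: field_simps)
  ultimately show ?thesis by (simp add: power_mono)
qed

lemma kern_le: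
  fixes z :: "'a::euclidean_space"
  assumes "1 / 2 ^ j \<le> norm z"
  shows "kern z \<le> (2 ^ j) ^ DIM('a)"
proof -
  have "0 < norm z" using assms by (rule less_le_trans[rotated]) simp
  then have "kern z \<le> (1 / norm z) ^ DIM('a)"
    by (auto simp: kern_def power_divide indicator_def)
  also have "1 / norm z \<le> 2 ^ j" using assms \<open>0 < norm z\<close> by (simp add: field_simps)
  then have "(1 / norm z) ^ DIM('a) \<le> (2 ^ j) ^ DIM('a)" by (intro power_mono) auto
  finally show ?thesis .
qed

text \<open>Reflection and translation invariance. The double integrals use the completed measure,
  whereas kernel masses are computed with \<open>lborel\<close>; this is the passage between
  them.\<close>

lemma nn_integral_lebesgue_diff:
  fixes f :: "'a::euclidean_space \<Rightarrow> ennreal"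
  assumes [measurable]: "f \<in> borel_measurable borel"
  shows "(\<integral>\<^sup>+y. f (x - y) \<partial>lebesgue) = (\<integral>\<^sup>+z. f z \<partial>lborel)"
proof -
  have "(\<integral>\<^sup>+z. f z \<partial>lborel) = (\<integral>\<^sup>+z. f z \<partial>density (distr lborel borel (\<lambda>y. x + (-1) *\<^sub>R y)) (\<lambda>_. \<bar>-1::real\<bar> ^ DIM('a)))"
    using lborel_affine[of "-1::real" x] by simp
  also have "\<dots> = (\<integral>\<^sup>+y. f (x - y) \<partial>lborel)"
    by (simp add: nn_integral_density nn_integral_distr)
  finally show ?thesis by (simp add: nn_integral_completion)
qed

lemma nn_integral_lebesgue_diff':
  fixes f :: "'a::euclidean_space \<Rightarrow> ennreal"
  assumes [measurable]: "f \<in> borel_measurable borel"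
  shows "(\<integral>\<^sup>+y. f (y - x) \<partial>lebesgue) = (\<integral>\<^sup>+z. f z \<partial>lborel)"
  using nn_integral_lebesgue_diff[of "\<lambda>z. f (- z)" x] nn_integral_lebesgue_diff[of f 0]
    nn_integral_lebesgue_diff[of "\<lambda>z. f (- z)" 0]
  by (simp add: nn_integral_completion)

abbreviation ball_vol :: "'a::euclidean_space itself \<Rightarrow> real" where
  "ball_vol _ \<equiv> unit_ball_vol (real DIM('a))"

text \<open>At every dyadic scale a ball centred on the axis \<open>e\<close>, with radius a quarter
  of the scale, contributes the same amount, since kernel size and ball volume scale inversely.
  Confinement to a half space is what the argument at the edge of the support exploits.\<close>

lemma nn_integral_kern_lower:
  fixes e :: "'a::euclidean_space"
  assumes e: "norm e = 1"
  shows "ennreal (real J * (ball_vol TYPE('a) / 4 ^ DIM('a)))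
    \<le> (\<integral>\<^sup>+z. ennreal (kern z) * indicator {z. 1 / 2 ^ J < z \<bullet> e} z \<partial>lborel)"
proof (induction J)
  case (Suc J)
  let ?c = "ball_vol TYPE('a) / 4 ^ DIM('a)"
  let ?B = "ball ((3 / 4 / 2 ^ J) *\<^sub>R e) (1 / 4 / 2 ^ J)"
  have ee: "e \<bullet> e = 1" using e by (simp add: dot_square_norm)
  \<comment> \<open>The ball lies in the slab between two consecutive scales, so it is disjoint from
    the region of the induction hypothesis.\<close>
  have B: "1 / 2 ^ Suc J < z \<bullet> e \<and> z \<bullet> e \<le> 1 / 2 ^ J \<and> norm z \<le> 1 / 2 ^ J" if "z \<in> ?B" for z
  proof -
    have 1: "norm (z - (3 / 4 / 2 ^ J) *\<^sub>R e) < 1 / 4 / 2 ^ J"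
      using that by (simp add: dist_norm norm_minus_commute)
    have "\<bar>(z - (3 / 4 / 2 ^ J) *\<^sub>R e) \<bullet> e\<bar> \<le> norm (z - (3 / 4 / 2 ^ J) *\<^sub>R e)"
      using Cauchy_Schwarz_ineq2[of "z - (3 / 4 / 2 ^ J) *\<^sub>R e" e] e by simp
    with 1 have 2: "\<bar>z \<bullet> e - 3 / 4 / 2 ^ J\<bar> < 1 / 4 / 2 ^ J"
      by (simp add: inner_diff_left ee)
    have 3: "1 / 2 ^ Suc J = 3 / 4 / 2 ^ J - 1 / 4 / (2::real) ^ J"
      and 4: "1 / 2 ^ J = 3 / 4 / 2 ^ J + 1 / 4 / (2::real) ^ J"
      by (simp_all add: field_simps)
    have "norm z \<le> norm (z - (3 / 4 / 2 ^ J) *\<^sub>R e) + norm ((3 / 4 / 2 ^ J) *\<^sub>R e)"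
      using norm_triangle_ineq[of "z - (3 / 4 / 2 ^ J) *\<^sub>R e" "(3 / 4 / 2 ^ J) *\<^sub>R e"] by simp
    also have "norm ((3 / 4 / 2 ^ J) *\<^sub>R e) = 3 / 4 / 2 ^ J" using e by simp
    finally have 5: "norm z \<le> norm (z - (3 / 4 / 2 ^ J) *\<^sub>R e) + 3 / 4 / 2 ^ J" .
    show ?thesis
    proof (intro conjI)
      show "1 / 2 ^ Suc J < z \<bullet> e" unfolding 3 using 2 by linarith
      show "z \<bullet> e \<le> 1 / 2 ^ J" "norm z \<le> 1 / 2 ^ J" unfolding 4 using 1 2 5 by linarith+
    qed
  qed
  have [measurable]: "?B \<in> sets borel" by simp
  have em: "emeasure lborel ?B = ennreal (ball_vol TYPE('a) * (1 / 4 / 2 ^ J) ^ DIM('a))"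
    by (rule emeasure_ball) simp
  have "ennreal ?c = ennreal ((2 ^ J) ^ DIM('a)) * emeasure lborel ?B"
    unfolding em by (subst ennreal_mult[symmetric]) (auto simp: power_divide)
  also have "\<dots> = (\<integral>\<^sup>+z. ennreal ((2 ^ J) ^ DIM('a)) * indicator ?B z \<partial>lborel)"
    by (rule nn_integral_cmult_indicator[symmetric]) simp
  also have "\<dots> \<le> (\<integral>\<^sup>+z. ennreal (kern z) * indicator ?B z \<partial>lborel)"
  proof (intro nn_integral_mono)
    fix z show "ennreal ((2 ^ J) ^ DIM('a)) * indicator ?B z \<le> ennreal (kern z) * indicator ?B z"
    proof (cases "z \<in> ?B")
      case True
      then have "z \<noteq> 0" using B[OF True] by (auto simp: field_simps)
      then show ?thesis using B[OF True] True kern_ge[of z J] by (simp add: ennreal_leI)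
    qed simp
  qed
  finally have step: "ennreal ?c \<le> (\<integral>\<^sup>+z. ennreal (kern z) * indicator ?B z \<partial>lborel)" .
  have "ennreal (real (Suc J) * ?c) = ennreal (real J * ?c) + ennreal ?c"
    by (subst ennreal_plus[symmetric]) (auto simp: algebra_simps add_divide_distrib)
  also have "\<dots> \<le> (\<integral>\<^sup>+z. ennreal (kern z) * indicator {z. 1 / 2 ^ J < z \<bullet> e} z \<partial>lborel)
      + (\<integral>\<^sup>+z. ennreal (kern z) * indicator ?B z \<partial>lborel)"
    using Suc.IH step by (rule add_mono)
  also have "\<dots> = (\<integral>\<^sup>+z. ennreal (kern z) * indicator {z. 1 / 2 ^ J < z \<bullet> e} z + ennreal (kern z) * indicator ?B z \<partial>lborel)"
    by (rule nn_integral_add[symmetric]) measurable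
  also have "\<dots> \<le> (\<integral>\<^sup>+z. ennreal (kern z) * indicator {z. 1 / 2 ^ Suc J < z \<bullet> e} z \<partial>lborel)"
  proof (intro nn_integral_mono)
    fix z
    have "1 / 2 ^ Suc J < z \<bullet> e" if "1 / 2 ^ J < z \<bullet> e"
    proof -
      have "1 / 2 ^ Suc J \<le> 1 / (2::real) ^ J" by (simp add: field_simps)
      with that show ?thesis by linarith
    qed
    then show "ennreal (kern z) * indicator {z. 1 / 2 ^ J < z \<bullet> e} z + ennreal (kern z) * indicator ?B z
      \<le> ennreal (kern z) * indicator {z. 1 / 2 ^ Suc J < z \<bullet> e} z"
      using B[of z] by (auto simp: indicator_def simp del: mem_ball)
  qed
  finally show ?case .
qed simp

text \<open>Between the radii \<open>1 / 2 ^ Suc J\<close> and \<open>1 / 2 ^ J\<close> the kernel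
  is at most \<open>(2 ^ Suc J) ^ DIM('a)\<close>, against a volume proportional to
  \<open>(1 / 2 ^ J) ^ DIM('a)\<close>. For \<open>J = 0\<close> only the unit sphere is left, a
  null set.\<close>

lemma nn_integral_kern_upper:
  "(\<integral>\<^sup>+(z::'a). ennreal (kern z) * indicator {z. 1 / 2 ^ J \<le> norm z} z \<partial>lborel)
    \<le> ennreal (real J * (ball_vol TYPE('a::euclidean_space) * 2 ^ DIM('a)))"
proof (induction J)
  case 0
  have "ennreal (kern z) * indicator {z. 1 / 2 ^ 0 \<le> norm z} z \<le> indicator (sphere 0 1) z" for z :: 'a
    by (auto simp: kern_def indicator_def)
  note * = this
  have "(\<integral>\<^sup>+(z::'a). ennreal (kern z) * indicator {z. 1 / 2 ^ 0 \<le> norm z} z \<partial>lborel)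
      \<le> (\<integral>\<^sup>+z. indicator (sphere 0 1 :: 'a set) z \<partial>lborel)"
    by (intro nn_integral_mono *)
  also have "\<dots> = 0"
  proof -
    have "sphere (0::'a) 1 \<in> null_sets lborel"
      using negligible_sphere[of "0::'a" 1] by (auto simp: null_sets_completion_iff negligible_iff_null_sets)
    then show ?thesis by auto
  qed
  finally show ?case by simp
next
  case (Suc J)
  let ?C = "ball_vol TYPE('a) * 2 ^ DIM('a)"
  let ?B = "cball (0::'a) (1 / 2 ^ J)"
  have [measurable]: "?B \<in> sets borel" by simp
  have em: "emeasure lborel ?B = ennreal (ball_vol TYPE('a) * (1 / 2 ^ J) ^ DIM('a))"
    by (rule emeasure_cball) simp
  have "(\<integral>\<^sup>+(z::'a). ennreal (kern z) * indicator {z. 1 / 2 ^ Suc J \<le> norm z} z \<partial>lborel)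
    \<le> (\<integral>\<^sup>+z. ennreal (kern z) * indicator {z. 1 / 2 ^ J \<le> norm z} z
        + ennreal ((2 ^ Suc J) ^ DIM('a)) * indicator ?B z \<partial>lborel)"
  proof (intro nn_integral_mono)
    fix z :: 'a
    show "ennreal (kern z) * indicator {z. 1 / 2 ^ Suc J \<le> norm z} z
      \<le> ennreal (kern z) * indicator {z. 1 / 2 ^ J \<le> norm z} z
        + ennreal ((2 ^ Suc J) ^ DIM('a)) * indicator ?B z"
      using kern_le[of "Suc J" z] by (auto simp: indicator_def ennreal_leI)
  qed
  also have "\<dots> = (\<integral>\<^sup>+(z::'a). ennreal (kern z) * indicator {z. 1 / 2 ^ J \<le> norm z} z \<partial>lborel)
      + (\<integral>\<^sup>+z. ennreal ((2 ^ Suc J) ^ DIM('a)) * indicator ?B z \<partial>lborel)"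
    by (rule nn_integral_add) measurable
  also have "\<dots> \<le> ennreal (real J * ?C) + ennreal ((2 ^ Suc J) ^ DIM('a)) * emeasure lborel ?B"
    using Suc.IH by (intro add_mono nn_integral_cmult_indicator[THEN eq_refl]) simp_all
  also have "ennreal ((2 ^ Suc J) ^ DIM('a)) * emeasure lborel ?B = ennreal ?C"
    unfolding em by (subst ennreal_mult[symmetric]) (auto simp: power_divide power_mult_distrib)
  also have "ennreal (real J * ?C) + ennreal ?C = ennreal (real (Suc J) * ?C)"
    by (subst ennreal_plus[symmetric]) (auto simp: algebra_simps)
  finally show ?case .
qed

text \<open>The weight turns the constant contributions of the dyadic shells into a geometric series
  with ratio \<open>2 powr (- q)\<close>. Scaling makes the bound independent of \<open>J\<close>,
  which is what a barrier of slope growing with \<open>J\<close> requires.\<close>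

lemma nn_integral_kern_power:
  assumes "0 < q"
  shows "(\<integral>\<^sup>+(z::'a). ennreal (kern z * (2 ^ J * norm z) powr q) * indicator (cball 0 (1 / 2 ^ J)) z \<partial>lborel)
    \<le> ennreal (ball_vol TYPE('a::euclidean_space) * 2 ^ DIM('a) / (1 - 2 powr (- q)))"
proof -
  let ?C = "ball_vol TYPE('a) * 2 ^ DIM('a)"
  define t :: real where "t = 2 powr (- q)"
  have t: "0 < t" "t < 1" unfolding t_def using assms using powr_less_mono[of "- q" 0 2] by simp_all
  define B where "B i = cball (0::'a) (1 / 2 ^ (J + i))" for i
  have [measurable]: "B i \<in> sets borel" for i by (simp add: B_def)
  have em: "emeasure lborel (B i) = ennreal (ball_vol TYPE('a) * (1 / 2 ^ (J + i)) ^ DIM('a))" for i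
    unfolding B_def by (rule emeasure_cball) simp
  have ptw: "ennreal (kern z * (2 ^ J * norm z) powr q) * indicator (cball 0 (1 / 2 ^ J)) z
    \<le> (\<Sum>i. ennreal (t ^ i * (2 ^ Suc (J + i)) ^ DIM('a)) * indicator (B i) z)" for z :: 'a
  proof (cases "z \<noteq> 0 \<and> norm z \<le> 1 / 2 ^ J")
    case True
    then have "0 < 2 ^ J * norm z" by simp
    then obtain n where "(1 / 2) ^ n < 2 ^ J * norm z"
      using real_arch_pow_inv[of "2 ^ J * norm z" "1 / 2 :: real"] by auto
    then have ex: "1 / 2 ^ (J + n) \<le> norm z" by (simp add: power_add field_simps)
    \<comment> \<open>The index of the shell containing \<open>z\<close>, that is,
      \<open>1 / 2 ^ (J + Suc i) \<le> norm z \<le> 1 / 2 ^ (J + i)\<close>.\<close>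
    define i where "i = (LEAST n. 1 / 2 ^ (J + Suc n) \<le> norm z)"
    have "1 / (2::real) ^ (J + Suc n) \<le> 1 / 2 ^ (J + n)" by (simp add: field_simps)
    with ex have ex': "1 / 2 ^ (J + Suc n) \<le> norm z" by linarith
    then have i1: "1 / 2 ^ (J + Suc i) \<le> norm z" unfolding i_def by (rule LeastI)
    have i2: "norm z \<le> 1 / 2 ^ (J + i)"
    proof (cases i)
      case 0 then show ?thesis using True by simp
    next
      case (Suc k)
      have "k < (LEAST n. 1 / 2 ^ (J + Suc n) \<le> norm z)" using Suc i_def by simp
      then have "\<not> 1 / 2 ^ (J + Suc k) \<le> norm z" by (rule not_less_Least)
      then show ?thesis using Suc by simp
    qed
    have "(2 ^ J * norm z) powr q \<le> (1 / 2 ^ i) powr q"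
      using i2 assms by (intro powr_mono2) (auto simp: field_simps power_add)
    also have "(1 / 2 ^ i) powr q = t ^ i"
    proof -
      have "(1 / 2 ^ i :: real) = 2 powr (- real i)"
        by (simp add: powr_minus powr_realpow divide_inverse)
      then have "(1 / 2 ^ i) powr q = 2 powr (- real i * q)" by (simp add: powr_powr)
      also have "\<dots> = t ^ i" by (simp add: t_def powr_power mult.commute)
      finally show ?thesis .
    qed
    finally have "kern z * (2 ^ J * norm z) powr q \<le> (2 ^ Suc (J + i)) ^ DIM('a) * t ^ i"
      using kern_le[of "Suc (J + i)" z] i1 by (intro mult_mono) auto
    then have "ennreal (kern z * (2 ^ J * norm z) powr q) * indicator (cball 0 (1 / 2 ^ J)) z
        \<le> ennreal (t ^ i * (2 ^ Suc (J + i)) ^ DIM('a)) * indicator (B i) z"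
      using i2 True by (auto simp: B_def mult.commute ennreal_leI)
    also have "\<dots> \<le> (\<Sum>i. ennreal (t ^ i * (2 ^ Suc (J + i)) ^ DIM('a)) * indicator (B i) z)"
      using sum_le_suminf[OF summableI, of "{i}" "\<lambda>i. ennreal (t ^ i * (2 ^ Suc (J + i)) ^ DIM('a)) * indicator (B i) z"]
      by (simp only: sum.insert sum.empty finite.emptyI finite_insert empty_iff not_False_eq_True add_0_right zero_le simp_thms)
    finally show ?thesis .
  qed auto
  have "(\<integral>\<^sup>+(z::'a). ennreal (kern z * (2 ^ J * norm z) powr q) * indicator (cball 0 (1 / 2 ^ J)) z \<partial>lborel)
    \<le> (\<integral>\<^sup>+z. (\<Sum>i. ennreal (t ^ i * (2 ^ Suc (J + i)) ^ DIM('a)) * indicator (B i) z) \<partial>lborel)"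
    by (intro nn_integral_mono ptw)
  also have "\<dots> = (\<Sum>i. \<integral>\<^sup>+z. ennreal (t ^ i * (2 ^ Suc (J + i)) ^ DIM('a)) * indicator (B i) z \<partial>lborel)"
    by (rule nn_integral_suminf) measurable
  also have "\<dots> = (\<Sum>i. ennreal (?C * t ^ i))"
  proof (rule suminf_cong)
    fix i
    have "(\<integral>\<^sup>+(z::'a). ennreal (t ^ i * (2 ^ Suc (J + i)) ^ DIM('a)) * indicator (B i) z \<partial>lborel)
      = ennreal (t ^ i * (2 ^ Suc (J + i)) ^ DIM('a)) * emeasure lborel (B i)"
      by (rule nn_integral_cmult_indicator) simp
    also have "\<dots> = ennreal (?C * t ^ i)"
      unfolding em using t
      by (subst ennreal_mult[symmetric]) (auto simp: power_divide power_mult_distrib)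
    finally show "(\<integral>\<^sup>+z. ennreal (t ^ i * (2 ^ Suc (J + i)) ^ DIM('a)) * indicator (B i) z \<partial>lborel)
      = ennreal (?C * t ^ i)" .
  qed
  also have "\<dots> = ennreal (\<Sum>i. ?C * t ^ i)"
    using t by (intro suminf_ennreal2) auto
  also have "(\<Sum>i. ?C * t ^ i) = ?C / (1 - t)"
    using t by (subst suminf_mult) (auto simp: suminf_geometric)
  finally show ?thesis by (simp add: t_def)
qed

subsection \<open>The double integrals and the function space\<close>

interpretation lebesgue: sigma_finite_measure "lebesgue :: 'a::euclidean_space measure"
proof
  obtain A :: "'a set set" where "countable A" "A \<subseteq> sets lborel" "\<Union> A = space lborel"
    "\<forall>a\<in>A. emeasure lborel a \<noteq> \<infinity>"
    using lborel.sigma_finite_countable by blast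
  then show "\<exists>A. countable A \<and> A \<subseteq> sets lebesgue \<and> \<Union> A = space (lebesgue :: 'a measure) \<and> (\<forall>a\<in>A. emeasure lebesgue a \<noteq> \<infinity>)"
    by (intro exI[of _ A]) (auto simp: subset_eq)
qed

interpretation lebesgue_pair: pair_sigma_finite "lebesgue :: 'a::euclidean_space measure" "lebesgue :: 'a measure" ..

abbreviation LL :: "('a::euclidean_space \<times> 'a) measure" where
  "LL \<equiv> lebesgue \<Otimes>\<^sub>M lebesgue"

lemma measurable_ident_lebesgue [measurable]: "(\<lambda>x. x) \<in> borel_measurable lebesgue"
  by (rule measurable_completion) simp

lemma measurable_fst_LL [measurable]: "fst \<in> LL \<rightarrow>\<^sub>M borel"
  and measurable_snd_LL [measurable]: "snd \<in> LL \<rightarrow>\<^sub>M borel"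
  using measurable_compose[OF measurable_fst measurable_ident_lebesgue]
    measurable_compose[OF measurable_snd measurable_ident_lebesgue] by auto

text \<open>With the kernel moved into the measure, the seminorm and the singular double integral
  become plain integrals, to which the convergence theorems apply directly.\<close>

definition near :: "('a::euclidean_space \<times> 'a) measure" where
  "near = density LL (\<lambda>z. ennreal (kern (fst z - snd z)))"

text \<open>\<open>Upsilon\<close> vanishes as soon as one of the two points lies outside \<Omega>,
  so restricting to pairs in \<Omega> changes no integral. It makes the weighted measure finite,
  because the kernel is at most 1 at distance at least 1.\<close>

definition kfar :: "'a::euclidean_space set \<Rightarrow> 'a \<times> 'a \<Rightarrow> real" where
  "kfar \<Omega> z = indicator {z. 1 \<le> norm (fst z - snd z)} z * indicator \<Omega> (fst z) * indicator \<Omega> (snd z)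
     / norm (fst z - snd z) ^ DIM('a)"

definition far :: "'a::euclidean_space set \<Rightarrow> ('a \<times> 'a) measure" where
  "far \<Omega> = density LL (\<lambda>z. ennreal (kfar \<Omega> z))"

lemma sets_near [measurable_cong, simp]: "sets near = sets LL"
  and space_near [simp]: "space near = UNIV"
  and sets_far [measurable_cong, simp]: "sets (far \<Omega>) = sets LL"
  and space_far [simp]: "space (far \<Omega>) = UNIV"
  by (simp_all add: near_def far_def space_pair_measure)

lemma kfar_nonneg [simp]: "0 \<le> kfar \<Omega> z"
  by (simp add: kfar_def)

lemma kfar_le: "kfar \<Omega> z \<le> indicator \<Omega> (fst z) * indicator \<Omega> (snd z)"
  by (auto simp: kfar_def indicator_def divide_le_eq)

lemma measurable_kfar [measurable]:
  assumes [measurable]: "\<Omega> \<in> sets lebesgue"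
  shows "kfar \<Omega> \<in> borel_measurable LL"
  unfolding kfar_def by measurable

lemma nn_integral_near:
  assumes [measurable]: "f \<in> borel_measurable LL"
  shows "(\<integral>\<^sup>+z. f z \<partial>near) = (\<integral>\<^sup>+x. \<integral>\<^sup>+y. ennreal (kern (x - y)) * f (x, y) \<partial>lebesgue \<partial>lebesgue)"
    and "(\<integral>\<^sup>+z. f z \<partial>near) = (\<integral>\<^sup>+y. \<integral>\<^sup>+x. ennreal (kern (x - y)) * f (x, y) \<partial>lebesgue \<partial>lebesgue)"
proof -
  have "(\<integral>\<^sup>+z. f z \<partial>near) = (\<integral>\<^sup>+z. ennreal (kern (fst z - snd z)) * f z \<partial>LL)"
    unfolding near_def by (intro nn_integral_density) measurable
  then show "(\<integral>\<^sup>+z. f z \<partial>near) = (\<integral>\<^sup>+x. \<integral>\<^sup>+y. ennreal (kern (x - y)) * f (x, y) \<partial>lebesgue \<partial>lebesgue)"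
    and "(\<integral>\<^sup>+z. f z \<partial>near) = (\<integral>\<^sup>+y. \<integral>\<^sup>+x. ennreal (kern (x - y)) * f (x, y) \<partial>lebesgue \<partial>lebesgue)"
    using lebesgue.nn_integral_fst[of "\<lambda>z. ennreal (kern (fst z - snd z)) * f z" lebesgue]
      lebesgue_pair.nn_integral_snd[of "\<lambda>z. ennreal (kern (fst z - snd z)) * f z"]
    by simp_all
qed

lemma integral_near:
  fixes F :: "'a::euclidean_space \<times> 'a \<Rightarrow> real"
  assumes [measurable]: "F \<in> borel_measurable LL"
  shows "(LINT z:{(x, y). norm (x - y) \<le> 1}|LL. F z / norm (fst z - snd z) ^ DIM('a)) = (LINT z|near. F z)"
proof -
  have "(LINT z|near. F z) = (LINT z|LL. kern (fst z - snd z) *\<^sub>R F z)"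
    unfolding near_def by (rule integral_density) auto
  also have "\<dots> = (LINT z:{(x, y). norm (x - y) \<le> 1}|LL. F z / norm (fst z - snd z) ^ DIM('a))"
    unfolding set_lebesgue_integral_def
    by (intro Bochner_Integration.integral_cong) (auto simp: kern_def indicator_def)
  finally show ?thesis ..
qed

lemma integral_far:
  fixes F :: "'a::euclidean_space \<times> 'a \<Rightarrow> real"
  assumes [measurable]: "F \<in> borel_measurable LL" "\<Omega> \<in> sets lebesgue"
    and "\<And>z. fst z \<notin> \<Omega> \<Longrightarrow> F z = 0" "\<And>z. snd z \<notin> \<Omega> \<Longrightarrow> F z = 0"
  shows "(LINT z:{(x, y). norm (x - y) \<ge> 1}|LL. F z / norm (fst z - snd z) ^ DIM('a)) = (LINT z|far \<Omega>. F z)"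
proof -
  have "(LINT z|far \<Omega>. F z) = (LINT z|LL. kfar \<Omega> z *\<^sub>R F z)"
    unfolding far_def by (rule integral_density) auto
  also have "\<dots> = (LINT z:{(x, y). norm (x - y) \<ge> 1}|LL. F z / norm (fst z - snd z) ^ DIM('a))"
    unfolding set_lebesgue_integral_def
    using assms(3,4)
    by (intro Bochner_Integration.integral_cong) (auto simp: kfar_def indicator_def)
  finally show ?thesis ..
qed

lemma nn_integral_far_le:
  fixes f :: "'a::euclidean_space \<Rightarrow> ennreal"
  assumes [measurable]: "f \<in> borel_measurable lebesgue" "\<Omega> \<in> sets lebesgue"
  shows "(\<integral>\<^sup>+z. f (fst z) \<partial>far \<Omega>) \<le> emeasure lebesgue \<Omega> * (\<integral>\<^sup>+x. f x \<partial>lebesgue)"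
    and "(\<integral>\<^sup>+z. f (snd z) \<partial>far \<Omega>) \<le> emeasure lebesgue \<Omega> * (\<integral>\<^sup>+x. f x \<partial>lebesgue)"
proof -
  have k: "ennreal (kfar \<Omega> z) \<le> indicator \<Omega> (fst z)" "ennreal (kfar \<Omega> z) \<le> indicator \<Omega> (snd z)" for z
    using kfar_le[of \<Omega> z] kfar_nonneg[of \<Omega> z]
    by (cases "fst z \<in> \<Omega>"; cases "snd z \<in> \<Omega>"; simp)+
  have "(\<integral>\<^sup>+z. f (fst z) \<partial>far \<Omega>) = (\<integral>\<^sup>+z. ennreal (kfar \<Omega> z) * f (fst z) \<partial>LL)"
    unfolding far_def by (intro nn_integral_density) measurable
  also have "\<dots> \<le> (\<integral>\<^sup>+z. indicator \<Omega> (snd z) * f (fst z) \<partial>LL)"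
    by (intro nn_integral_mono mult_right_mono k) auto
  also have "\<dots> = (\<integral>\<^sup>+x. \<integral>\<^sup>+y. indicator \<Omega> y * f x \<partial>lebesgue \<partial>lebesgue)"
    using lebesgue.nn_integral_fst[of "\<lambda>z. indicator \<Omega> (snd z) * f (fst z)" lebesgue] by simp
  also have "\<dots> = emeasure lebesgue \<Omega> * (\<integral>\<^sup>+x. f x \<partial>lebesgue)"
    by (simp add: nn_integral_multc nn_integral_cmult)
  finally show "(\<integral>\<^sup>+z. f (fst z) \<partial>far \<Omega>) \<le> emeasure lebesgue \<Omega> * (\<integral>\<^sup>+x. f x \<partial>lebesgue)" .
  have "(\<integral>\<^sup>+z. f (snd z) \<partial>far \<Omega>) = (\<integral>\<^sup>+z. ennreal (kfar \<Omega> z) * f (snd z) \<partial>LL)"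
    unfolding far_def by (intro nn_integral_density) measurable
  also have "\<dots> \<le> (\<integral>\<^sup>+z. indicator \<Omega> (fst z) * f (snd z) \<partial>LL)"
    by (intro nn_integral_mono mult_right_mono k) auto
  also have "\<dots> = (\<integral>\<^sup>+x. \<integral>\<^sup>+y. indicator \<Omega> x * f y \<partial>lebesgue \<partial>lebesgue)"
    using lebesgue.nn_integral_fst[of "\<lambda>z. indicator \<Omega> (fst z) * f (snd z)" lebesgue] by simp
  also have "\<dots> = emeasure lebesgue \<Omega> * (\<integral>\<^sup>+x. f x \<partial>lebesgue)"
    by (simp add: nn_integral_multc nn_integral_cmult)
  finally show "(\<integral>\<^sup>+z. f (snd z) \<partial>far \<Omega>) \<le> emeasure lebesgue \<Omega> * (\<integral>\<^sup>+x. f x \<partial>lebesgue)" .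
qed

lemma integral_far_le:
  fixes f :: "'a::euclidean_space \<Rightarrow> real"
  assumes f: "integrable lebesgue f" "\<And>x. 0 \<le> f x" and \<Omega>: "\<Omega> \<in> lmeasurable"
  shows "integrable (far \<Omega>) (\<lambda>z. f (fst z))" "integrable (far \<Omega>) (\<lambda>z. f (snd z))"
    and "(LINT z|far \<Omega>. f (fst z)) \<le> measure lebesgue \<Omega> * (LINT x|lebesgue. f x)"
    and "(LINT z|far \<Omega>. f (snd z)) \<le> measure lebesgue \<Omega> * (LINT x|lebesgue. f x)"
proof -
  have [measurable]: "f \<in> borel_measurable lebesgue" "\<Omega> \<in> sets lebesgue"
    using f \<Omega> by auto
  have \<Omega>': "emeasure lebesgue \<Omega> = ennreal (measure lebesgue \<Omega>)"
    using \<Omega> by (simp add: emeasure_eq_measure2)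
  have I: "(\<integral>\<^sup>+x. ennreal (f x) \<partial>lebesgue) = ennreal (LINT x|lebesgue. f x)"
    using f by (intro nn_integral_eq_integral) auto
  have n1: "(\<integral>\<^sup>+z. ennreal (f (fst z)) \<partial>far \<Omega>) \<le> ennreal (measure lebesgue \<Omega> * (LINT x|lebesgue. f x))"
    and n2: "(\<integral>\<^sup>+z. ennreal (f (snd z)) \<partial>far \<Omega>) \<le> ennreal (measure lebesgue \<Omega> * (LINT x|lebesgue. f x))"
    using nn_integral_far_le[of "\<lambda>x. ennreal (f x)" \<Omega>] f
    by (simp_all add: I \<Omega>' ennreal_mult integral_nonneg_AE)
  show "integrable (far \<Omega>) (\<lambda>z. f (fst z))" "integrable (far \<Omega>) (\<lambda>z. f (snd z))"
    using n1 n2 f(2) by (auto intro!: integrableI_nonneg simp: le_less_trans[OF _ ennreal_less_top])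
  then show "(LINT z|far \<Omega>. f (fst z)) \<le> measure lebesgue \<Omega> * (LINT x|lebesgue. f x)"
    "(LINT z|far \<Omega>. f (snd z)) \<le> measure lebesgue \<Omega> * (LINT x|lebesgue. f x)"
    using n1 n2 f by (simp_all add: nn_integral_eq_integral integral_nonneg_AE)
qed

lemma AE_near:
  assumes "AE z in LL. P z" shows "AE z in near. P z"
proof -
  have m: "(\<lambda>z::'a \<times> 'a. ennreal (kern (fst z - snd z))) \<in> borel_measurable LL" by measurable
  show ?thesis unfolding near_def AE_density[OF m] using assms(1) by (rule eventually_mono) simp
qed

lemma AE_far:
  assumes [measurable]: "\<Omega> \<in> sets lebesgue" and "AE z in LL. P z" shows "AE z in far \<Omega>. P z"
proof -
  have m: "(\<lambda>z. ennreal (kfar \<Omega> z)) \<in> borel_measurable LL" by measurable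
  show ?thesis unfolding far_def AE_density[OF m] using assms(2) by (rule eventually_mono) simp
qed

lemma AE_LL_fst: "AE x in lebesgue. P x \<Longrightarrow> AE z in LL. P (fst z)"
  and AE_LL_snd: "AE x in lebesgue. P x \<Longrightarrow> AE z in LL. P (snd z)"
proof -
  assume "AE x in lebesgue. P x"
  then obtain N where N: "N \<in> null_sets lebesgue" "{x. \<not> P x} \<subseteq> N"
    unfolding eventually_ae_filter by auto
  have "N \<times> UNIV \<in> null_sets LL" "UNIV \<times> N \<in> null_sets LL"
    using N(1) lebesgue.times_in_null_sets1[of N lebesgue UNIV] lebesgue.times_in_null_sets2[of N lebesgue UNIV]
    by auto
  then show "AE z in LL. P (fst z)" "AE z in LL. P (snd z)"
    using N(2) by - (rule AE_I'[of "N \<times> UNIV"], auto, rule AE_I'[of "UNIV \<times> N"], auto)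
qed

section \<open>The space \<open>X\<close>: characterisation, membership criteria and the bilinear
  form\<close>

lemma C_const_pos:
  assumes "0 < p" "0 < N"
  shows "0 < C_const N p"
  using assms by (simp add: C_const_def Gamma_real_pos)

text \<open>Because members vanish outside \<Omega>, measurability and integrability on \<Omega> and
  on the whole space agree, and finiteness of the seminorm is integrability with respect to
  \<open>near\<close>.\<close>

lemma X_space_iff:
  fixes \<Omega> :: "'a::euclidean_space set"
  assumes p: "1 < p" and [measurable]: "\<Omega> \<in> sets lebesgue"
  shows "u \<in> X_space p \<Omega> \<longleftrightarrow> u \<in> borel_measurable lebesgue \<and> integrable lebesgue (\<lambda>x. \<bar>u x\<bar> powr p)
    \<and> integrable near (\<lambda>z. \<bar>u (fst z) - u (snd z)\<bar> powr p) \<and> (\<forall>x. x \<notin> \<Omega> \<longrightarrow> u x = 0)"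
proof (cases "\<forall>x. x \<notin> \<Omega> \<longrightarrow> u x = 0")
  case True
  have i1: "(\<lambda>x. indicator \<Omega> x *\<^sub>R u x) = u"
    using True by (auto simp: fun_eq_iff indicator_def split: if_splits)
  have i2: "(\<lambda>x. indicator \<Omega> x *\<^sub>R \<bar>u x\<bar> powr p) = (\<lambda>x. \<bar>u x\<bar> powr p)"
    using True by (auto simp: fun_eq_iff indicator_def split: if_splits)
  have m: "u \<in> borel_measurable (lebesgue_on \<Omega>) \<longleftrightarrow> u \<in> borel_measurable lebesgue"
    using borel_measurable_restrict_space_iff[of \<Omega> lebesgue u] i1 by simp
  have L: "integrable (lebesgue_on \<Omega>) (\<lambda>x. \<bar>u x\<bar> powr p) \<longleftrightarrow> integrable lebesgue (\<lambda>x. \<bar>u x\<bar> powr p)"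
    using integrable_restrict_space[of \<Omega> lebesgue "\<lambda>x. \<bar>u x\<bar> powr p"] i2 by simp
  have S: "X_seminorm_pow p u < \<infinity> \<longleftrightarrow> integrable near (\<lambda>z. \<bar>u (fst z) - u (snd z)\<bar> powr p)"
    if [measurable]: "u \<in> borel_measurable lebesgue"
  proof -
    have "(\<integral>\<^sup>+z\<in>{(x, y). norm (x - y) \<le> 1}.
        (case z of (x, y) \<Rightarrow> ennreal (\<bar>u x - u y\<bar> powr p / norm (x - y) ^ DIM('a))) \<partial>LL)
      = (\<integral>\<^sup>+z. ennreal (kern (fst z - snd z)) * ennreal (\<bar>u (fst z) - u (snd z)\<bar> powr p) \<partial>LL)"
      by (intro nn_integral_cong) (auto simp: kern_def indicator_def ennreal_mult[symmetric])
    also have "\<dots> = (\<integral>\<^sup>+z. ennreal (\<bar>u (fst z) - u (snd z)\<bar> powr p) \<partial>near)"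
      unfolding near_def by (intro nn_integral_density[symmetric]) measurable
    finally have "X_seminorm_pow p u = ennreal (C_const DIM('a) p) * (\<integral>\<^sup>+z. ennreal (\<bar>u (fst z) - u (snd z)\<bar> powr p) \<partial>near)"
      by (simp add: X_seminorm_pow_def)
    then have "X_seminorm_pow p u < \<infinity> \<longleftrightarrow> (\<integral>\<^sup>+z. ennreal (\<bar>u (fst z) - u (snd z)\<bar> powr p) \<partial>near) < \<infinity>"
      using C_const_pos[of p "DIM('a)"] p by (auto simp: ennreal_mult_less_top)
    also have "\<dots> \<longleftrightarrow> integrable near (\<lambda>z. \<bar>u (fst z) - u (snd z)\<bar> powr p)"
      by (auto simp: integrable_iff_bounded)
    finally show ?thesis .
  qed
  show ?thesis using True m L S by (auto simp: X_space_def in_Lp_def)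
qed (auto simp: X_space_def)

text \<open>A positive power of the distance removes the logarithmic divergence of the kernel. This
  is the majorant through which Lipschitz ingredients such as bumps and cones enter
  \<open>X\<close>.\<close>

lemma integrable_near_power:
  assumes "0 < q" and \<Omega>: "\<Omega> \<in> lmeasurable"
  shows "integrable near (\<lambda>z::'a::euclidean_space \<times> 'a. norm (fst z - snd z) powr q * (indicator \<Omega> (fst z) + indicator \<Omega> (snd z)))"
proof (rule integrableI_nonneg)
  have [measurable]: "\<Omega> \<in> sets lebesgue" using \<Omega> by auto
  define D where "D = (\<integral>\<^sup>+z. ennreal (kern z * norm z powr q) \<partial>(lborel :: 'a measure))"
  have "D = (\<integral>\<^sup>+z. ennreal (kern z * (2 ^ 0 * norm z) powr q) * indicator (cball 0 (1 / 2 ^ 0)) z \<partial>(lborel :: 'a measure))"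
    unfolding D_def by (intro nn_integral_cong) (auto simp: kern_def indicator_def)
  also have "\<dots> \<le> ennreal (ball_vol TYPE('a) * 2 ^ DIM('a) / (1 - 2 powr (- q)))"
    by (rule nn_integral_kern_power[OF \<open>0 < q\<close>])
  finally have D: "D < \<infinity>" by (simp add: le_less_trans)
  have meas[measurable]: "(\<lambda>z. ennreal (norm (fst z - snd z) powr q * indicator \<Omega> (fst z))) \<in> borel_measurable LL"
    "(\<lambda>z. ennreal (norm (fst z - snd z) powr q * indicator \<Omega> (snd z))) \<in> borel_measurable LL"
    by measurable
  have 1: "(\<integral>\<^sup>+z. ennreal (norm (fst z - snd z) powr q * indicator \<Omega> (fst z)) \<partial>near) = D * emeasure lebesgue \<Omega>"
  proof -
    have "(\<integral>\<^sup>+z. ennreal (norm (fst z - snd z) powr q * indicator \<Omega> (fst z)) \<partial>near)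
      = (\<integral>\<^sup>+x. \<integral>\<^sup>+y. ennreal (kern (x - y) * norm (x - y) powr q) * indicator \<Omega> x \<partial>lebesgue \<partial>lebesgue)"
      by (subst nn_integral_near(1)[OF meas(1)]) (auto intro!: nn_integral_cong simp: indicator_def ennreal_mult)
    also have "\<dots> = (\<integral>\<^sup>+x. D * indicator \<Omega> x \<partial>lebesgue)"
      using nn_integral_lebesgue_diff[of "\<lambda>z::'a. ennreal (kern z * norm z powr q)"]
      by (auto simp: D_def nn_integral_multc intro!: nn_integral_cong)
    also have "\<dots> = D * emeasure lebesgue \<Omega>" by (rule nn_integral_cmult_indicator) simp
    finally show ?thesis .
  qed
  have 2: "(\<integral>\<^sup>+z. ennreal (norm (fst z - snd z) powr q * indicator \<Omega> (snd z)) \<partial>near) = D * emeasure lebesgue \<Omega>"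
  proof -
    have "(\<integral>\<^sup>+z. ennreal (norm (fst z - snd z) powr q * indicator \<Omega> (snd z)) \<partial>near)
      = (\<integral>\<^sup>+y. \<integral>\<^sup>+x. ennreal (kern (x - y) * norm (x - y) powr q) * indicator \<Omega> y \<partial>lebesgue \<partial>lebesgue)"
      by (subst nn_integral_near(2)[OF meas(2)]) (auto intro!: nn_integral_cong simp: indicator_def ennreal_mult)
    also have "\<dots> = (\<integral>\<^sup>+x. D * indicator \<Omega> x \<partial>lebesgue)"
      using nn_integral_lebesgue_diff'[of "\<lambda>z::'a. ennreal (kern z * norm z powr q)"]
      by (auto simp: D_def nn_integral_multc intro!: nn_integral_cong)
    also have "\<dots> = D * emeasure lebesgue \<Omega>" by (rule nn_integral_cmult_indicator) simp
    finally show ?thesis .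
  qed
  have "(\<integral>\<^sup>+z. ennreal (norm (fst z - snd z) powr q * (indicator \<Omega> (fst z) + indicator \<Omega> (snd z))) \<partial>near)
    = (\<integral>\<^sup>+z. ennreal (norm (fst z - snd z) powr q * indicator \<Omega> (fst z)) + ennreal (norm (fst z - snd z) powr q * indicator \<Omega> (snd z)) \<partial>near)"
    by (intro nn_integral_cong) (auto simp: ring_distribs ennreal_plus[symmetric] simp del: ennreal_plus)
  also have "\<dots> = D * emeasure lebesgue \<Omega> + D * emeasure lebesgue \<Omega>"
    by (subst nn_integral_add) (auto simp: 1 2)
  also have "\<dots> < \<infinity>" using D fmeasurableD2[OF \<Omega>] by (auto simp: ennreal_mult_less_top less_top)
  finally show "(\<integral>\<^sup>+z. ennreal (norm (fst z - snd z) powr q * (indicator \<Omega> (fst z) + indicator \<Omega> (snd z))) \<partial>near) < \<infinity>" .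
  show "(\<lambda>z. norm (fst z - snd z) powr q * (indicator \<Omega> (fst z) + indicator \<Omega> (snd z))) \<in> borel_measurable near"
    by measurable
qed auto

text \<open>A common criterion: the terms in \<open>u\<close> and \<open>w\<close> cover
  contractions, linear combinations and power means, the distance term covers Lipschitz
  functions.\<close>

lemma X_space_dominated:
  fixes \<Omega> :: "'a::euclidean_space set"
  assumes p: "1 < p" and \<Omega>: "\<Omega> \<in> lmeasurable" and u: "u \<in> X_space p \<Omega>" and w: "w \<in> X_space p \<Omega>"
    and v [measurable]: "v \<in> borel_measurable lebesgue" and v0: "\<And>x. x \<notin> \<Omega> \<Longrightarrow> v x = 0"
    and b: "\<And>x. x \<in> \<Omega> \<Longrightarrow> \<bar>v x\<bar> powr p \<le> K * (\<bar>u x\<bar> powr p + \<bar>w x\<bar> powr p + 1)"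
    and d: "\<And>x y. \<bar>v x - v y\<bar> powr p \<le> K * (\<bar>u x - u y\<bar> powr p + \<bar>w x - w y\<bar> powr p
        + norm (x - y) powr p * (indicator \<Omega> x + indicator \<Omega> y))"
  shows "v \<in> X_space p \<Omega>"
proof -
  have [measurable]: "\<Omega> \<in> sets lebesgue" using \<Omega> by auto
  note iff = X_space_iff[OF p \<open>\<Omega> \<in> sets lebesgue\<close>]
  have U: "integrable lebesgue (\<lambda>x. \<bar>u x\<bar> powr p)" "integrable near (\<lambda>z. \<bar>u (fst z) - u (snd z)\<bar> powr p)"
   and W: "integrable lebesgue (\<lambda>x. \<bar>w x\<bar> powr p)" "integrable near (\<lambda>z. \<bar>w (fst z) - w (snd z)\<bar> powr p)"
    using u w iff by auto
  have "integrable lebesgue (\<lambda>x. K * (\<bar>u x\<bar> powr p + \<bar>w x\<bar> powr p + indicator \<Omega> x))"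
    using U W \<Omega> by (intro integrable_mult_right Bochner_Integration.integrable_add integrable_real_indicator)
      (auto simp: fmeasurable_def)
  then have 1: "integrable lebesgue (\<lambda>x. \<bar>v x\<bar> powr p)"
  proof (rule Bochner_Integration.integrable_bound)
    have "u x = 0" "w x = 0" if "x \<notin> \<Omega>" for x using that u w by (auto simp: X_space_def)
    then show "AE x in lebesgue. norm (\<bar>v x\<bar> powr p) \<le> norm (K * (\<bar>u x\<bar> powr p + \<bar>w x\<bar> powr p + indicator \<Omega> x))"
      using b v0 by (auto simp: indicator_def intro!: order_trans[OF _ abs_ge_self])
  qed measurable
  have "integrable near (\<lambda>z. K * (\<bar>u (fst z) - u (snd z)\<bar> powr p + \<bar>w (fst z) - w (snd z)\<bar> powr p
        + norm (fst z - snd z) powr p * (indicator \<Omega> (fst z) + indicator \<Omega> (snd z))))"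
    using U W p integrable_near_power[OF _ \<Omega>] by (intro integrable_mult_right Bochner_Integration.integrable_add) auto
  then have 2: "integrable near (\<lambda>z. \<bar>v (fst z) - v (snd z)\<bar> powr p)"
  proof (rule Bochner_Integration.integrable_bound)
    show "AE z in near. norm (\<bar>v (fst z) - v (snd z)\<bar> powr p) \<le> norm (K * (\<bar>u (fst z) - u (snd z)\<bar> powr p + \<bar>w (fst z) - w (snd z)\<bar> powr p
        + norm (fst z - snd z) powr p * (indicator \<Omega> (fst z) + indicator \<Omega> (snd z))))"
      using d by (auto intro!: AE_I2 order_trans[OF _ abs_ge_self])
  qed measurable
  show ?thesis using 1 2 v0 by (simp add: iff)
qed

lemma powr_minus_one_mult_self: "0 \<le> (t::real) \<Longrightarrow> t powr (p - 1) * t = t powr p"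
  using h_mult_self[of p t] h_nonneg[of t p] by simp

lemma Upsilon_diag: "Upsilon p a b a b = \<bar>a - b\<bar> powr p - \<bar>a\<bar> powr p - \<bar>b\<bar> powr p"
  by (simp add: Upsilon_def h_mult_self)

lemma abs_Upsilon_le:
  assumes "1 < p"
  shows "\<bar>Upsilon p a b s t\<bar> \<le> (2 powr p + 1) * (\<bar>a\<bar> powr p + \<bar>b\<bar> powr p + \<bar>s\<bar> powr p + \<bar>t\<bar> powr p)"
  using h_young[OF assms, of "a - b" "s - t"] h_young[OF assms, of a s] h_young[OF assms, of b t]
    abs_diff_powr_le[of p a b] abs_diff_powr_le[of p s t] assms
  unfolding Upsilon_def by (simp add: algebra_simps) linarith

lemma measurable_Upsilon [measurable]:
  assumes [measurable]: "a \<in> borel_measurable M" "b \<in> borel_measurable M" "c \<in> borel_measurable M" "d \<in> borel_measurable M"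
  shows "(\<lambda>z. Upsilon p (a z) (b z) (c z) (d z)) \<in> borel_measurable M"
  unfolding Upsilon_def by measurable

text \<open>The factor in front of both double integrals of \<open>E_form\<close>. The argument
  \<open>\<Omega>\<close> serves only to fix the dimension through its type.\<close>

definition half_const :: "'a::euclidean_space set \<Rightarrow> real \<Rightarrow> real" where
  "half_const \<Omega> p = C_const DIM('a) p / 2"

locale log_space =
  fixes \<Omega> :: "'a::euclidean_space set" and p :: real
  assumes p: "1 < p" and open_Omega: "open \<Omega>" and bounded_Omega: "bounded \<Omega>" and nonempty_Omega: "\<Omega> \<noteq> {}"
begin

abbreviation X where "X \<equiv> X_space p \<Omega>"

abbreviation cN where "cN \<equiv> half_const \<Omega> p"

lemma lmeasurable_Omega [simp]: "\<Omega> \<in> lmeasurable"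
  using bounded_Omega open_Omega by (rule lmeasurable_open)

lemma sets_Omega [measurable, simp]: "\<Omega> \<in> sets lebesgue"
  using lmeasurable_Omega by (rule fmeasurableD)

lemma cN_pos: "0 < cN"
  using C_const_pos[of p "DIM('a)"] p by (simp add: half_const_def)

lemmas X_iff = X_space_iff[OF p sets_Omega]

lemma X_measurable [measurable_dest]: "u \<in> X \<Longrightarrow> u \<in> borel_measurable lebesgue"
  and X_powr: "u \<in> X \<Longrightarrow> integrable lebesgue (\<lambda>x. \<bar>u x\<bar> powr p)"
  and X_near: "u \<in> X \<Longrightarrow> integrable near (\<lambda>z. \<bar>u (fst z) - u (snd z)\<bar> powr p)"
  and X_zero: "u \<in> X \<Longrightarrow> x \<notin> \<Omega> \<Longrightarrow> u x = 0"
  by (auto simp: X_iff)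

lemma restrict_Omega:
  fixes f :: "'a \<Rightarrow> real"
  assumes "\<And>x. x \<notin> \<Omega> \<Longrightarrow> f x = 0"
  shows "(LINT x|lebesgue. f x) = (LINT x|lebesgue_on \<Omega>. f x)"
    and "integrable (lebesgue_on \<Omega>) f \<longleftrightarrow> integrable lebesgue f"
    and "f \<in> borel_measurable (lebesgue_on \<Omega>) \<longleftrightarrow> f \<in> borel_measurable lebesgue"
proof -
  have f: "(\<lambda>x. indicator \<Omega> x *\<^sub>R f x) = f"
    using assms by (auto simp: fun_eq_iff indicator_def split: if_splits)
  show "(LINT x|lebesgue. f x) = (LINT x|lebesgue_on \<Omega>. f x)"
    using integral_restrict_space[of \<Omega> lebesgue f] f by simp
  show "integrable (lebesgue_on \<Omega>) f \<longleftrightarrow> integrable lebesgue f"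
    using integrable_restrict_space[of \<Omega> lebesgue f] f by simp
  show "f \<in> borel_measurable (lebesgue_on \<Omega>) \<longleftrightarrow> f \<in> borel_measurable lebesgue"
    using borel_measurable_restrict_space_iff[of \<Omega> lebesgue f] f by simp
qed

lemma finite_measure_Omega: "finite_measure (lebesgue_on \<Omega>)"
  using lmeasurable_Omega by (rule finite_measure_lebesgue_on)

lemma integrable_h_near:
  assumes u: "u \<in> X" and v: "v \<in> X"
  shows "integrable near (\<lambda>z. h p (u (fst z) - u (snd z)) * (v (fst z) - v (snd z)))"
proof (rule Bochner_Integration.integrable_bound)
  note [measurable] = X_measurable[OF u] X_measurable[OF v]
  show "integrable near (\<lambda>z. \<bar>u (fst z) - u (snd z)\<bar> powr p + \<bar>v (fst z) - v (snd z)\<bar> powr p)"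
    using X_near u v by auto
  show "(\<lambda>z. h p (u (fst z) - u (snd z)) * (v (fst z) - v (snd z))) \<in> borel_measurable near"
    by measurable
qed (use h_young[OF p] in \<open>auto intro!: AE_I2 order_trans[OF _ abs_ge_self]\<close>)

lemma integrable_far_powr:
  assumes u: "u \<in> X"
  shows "integrable (far \<Omega>) (\<lambda>z. \<bar>u (fst z)\<bar> powr p)" "integrable (far \<Omega>) (\<lambda>z. \<bar>u (snd z)\<bar> powr p)"
  using integral_far_le(1,2)[of "\<lambda>x. \<bar>u x\<bar> powr p" \<Omega>] X_powr[OF u] by auto

lemma integrable_Upsilon:
  assumes u: "u \<in> X" and v: "v \<in> X"
  shows "integrable (far \<Omega>) (\<lambda>z. Upsilon p (u (fst z)) (u (snd z)) (v (fst z)) (v (snd z)))"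
proof (rule Bochner_Integration.integrable_bound)
  note [measurable] = X_measurable[OF u] X_measurable[OF v]
  show "integrable (far \<Omega>) (\<lambda>z. (2 powr p + 1) * (\<bar>u (fst z)\<bar> powr p + \<bar>u (snd z)\<bar> powr p + \<bar>v (fst z)\<bar> powr p + \<bar>v (snd z)\<bar> powr p))"
    using u v by (intro integrable_mult_right Bochner_Integration.integrable_add integrable_far_powr) auto
  show "(\<lambda>z. Upsilon p (u (fst z)) (u (snd z)) (v (fst z)) (v (snd z))) \<in> borel_measurable (far \<Omega>)"
    by measurable
qed (use abs_Upsilon_le[OF p] in \<open>auto intro!: AE_I2 order_trans[OF _ abs_ge_self]\<close>)

lemma integrable_h_mult:
  assumes u: "u \<in> X" and v: "v \<in> X"
  shows "integrable lebesgue (\<lambda>x. h p (u x) * v x)"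
proof (rule Bochner_Integration.integrable_bound)
  note [measurable] = X_measurable[OF u] X_measurable[OF v]
  show "integrable lebesgue (\<lambda>x. \<bar>u x\<bar> powr p + \<bar>v x\<bar> powr p)"
    using u v X_powr by auto
  show "(\<lambda>x. h p (u x) * v x) \<in> borel_measurable lebesgue" by measurable
qed (use h_young[OF p] in \<open>auto intro!: AE_I2 order_trans[OF _ abs_ge_self]\<close>)

lemma E_form_eq:
  assumes u: "u \<in> X" and v: "v \<in> X"
  shows "E_form p u v = cN * (LINT z|near. h p (u (fst z) - u (snd z)) * (v (fst z) - v (snd z)))
    + cN * (LINT z|far \<Omega>. Upsilon p (u (fst z)) (u (snd z)) (v (fst z)) (v (snd z)))
    + rho_const DIM('a) p * (LINT x|lebesgue_on \<Omega>. h p (u x) * v x)"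
proof -
  note [measurable] = X_measurable[OF u] X_measurable[OF v]
  have 1: "(LINT z:{(x, y). norm (x - y) \<le> 1}|LL.
          (case z of (x, y) \<Rightarrow> h p (u x - u y) * (v x - v y) / norm (x - y) ^ DIM('a)))
    = (LINT z|near. h p (u (fst z) - u (snd z)) * (v (fst z) - v (snd z)))"
    by (subst integral_near[symmetric]) (auto simp: case_prod_unfold)
  have 2: "(LINT z:{(x, y). norm (x - y) \<ge> 1}|LL.
          (case z of (x, y) \<Rightarrow> Upsilon p (u x) (u y) (v x) (v y) / norm (x - y) ^ DIM('a)))
    = (LINT z|far \<Omega>. Upsilon p (u (fst z)) (u (snd z)) (v (fst z)) (v (snd z)))"
    by (subst integral_far[symmetric]) (auto simp: case_prod_unfold Upsilon_def X_zero[OF u] X_zero[OF v])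
  have 3: "(LINT x|lebesgue. h p (u x) * v x) = (LINT x|lebesgue_on \<Omega>. h p (u x) * v x)"
    by (rule restrict_Omega) (simp add: X_zero[OF u])
  show ?thesis unfolding E_form_def 1 2 3 half_const_def ..
qed

lemma E_form_diag:
  assumes u: "u \<in> X"
  shows "E_form p u u = cN * (LINT z|near. \<bar>u (fst z) - u (snd z)\<bar> powr p)
    + cN * (LINT z|far \<Omega>. \<bar>u (fst z) - u (snd z)\<bar> powr p - \<bar>u (fst z)\<bar> powr p - \<bar>u (snd z)\<bar> powr p)
    + rho_const DIM('a) p * (LINT x|lebesgue_on \<Omega>. \<bar>u x\<bar> powr p)"
  by (simp add: E_form_eq[OF u u] h_mult_self Upsilon_diag)

lemma integrable_far_diag:
  assumes u: "u \<in> X"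
  shows "integrable (far \<Omega>) (\<lambda>z. \<bar>u (fst z) - u (snd z)\<bar> powr p - \<bar>u (fst z)\<bar> powr p - \<bar>u (snd z)\<bar> powr p)"
  using integrable_Upsilon[OF u u] by (simp add: Upsilon_diag)

lemma zero_in_X [simp]: "(\<lambda>x. 0) \<in> X"
  using p by (simp add: X_iff)

lemma X_add_scaled:
  assumes u: "u \<in> X" and v: "v \<in> X"
  shows "(\<lambda>x. u x + s * v x) \<in> X"
proof (rule X_space_dominated[OF p lmeasurable_Omega u v])
  note [measurable] = X_measurable[OF u] X_measurable[OF v]
  show "(\<lambda>x. u x + s * v x) \<in> borel_measurable lebesgue" by measurable
  show "u x + s * v x = 0" if "x \<notin> \<Omega>" for x using that u v by (simp add: X_zero)
  let ?K = "2 powr p * (1 + \<bar>s\<bar> powr p)"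
  have *: "\<bar>a + s * b\<bar> powr p \<le> ?K * (\<bar>a\<bar> powr p + \<bar>b\<bar> powr p)" for a b
  proof -
    have "\<bar>a + s * b\<bar> powr p \<le> 2 powr p * (\<bar>a\<bar> powr p + \<bar>s\<bar> powr p * \<bar>b\<bar> powr p)"
      using abs_add_powr_le[of p a "s * b"] p by (simp add: abs_mult powr_mult)
    also have "\<dots> \<le> 2 powr p * ((1 + \<bar>s\<bar> powr p) * (\<bar>a\<bar> powr p + \<bar>b\<bar> powr p))"
      by (intro mult_left_mono) (auto simp: algebra_simps)
    finally show ?thesis by (simp add: mult.assoc)
  qed
  show "\<bar>u x + s * v x\<bar> powr p \<le> ?K * (\<bar>u x\<bar> powr p + \<bar>v x\<bar> powr p + 1)" for x
    by (rule order_trans[OF *]) (intro mult_left_mono, auto)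
  show "\<bar>(u x + s * v x) - (u y + s * v y)\<bar> powr p \<le> ?K * (\<bar>u x - u y\<bar> powr p + \<bar>v x - v y\<bar> powr p
        + norm (x - y) powr p * (indicator \<Omega> x + indicator \<Omega> y))" for x y
  proof -
    have "\<bar>(u x + s * v x) - (u y + s * v y)\<bar> powr p = \<bar>(u x - u y) + s * (v x - v y)\<bar> powr p"
      by (simp add: algebra_simps)
    also have "\<dots> \<le> ?K * (\<bar>u x - u y\<bar> powr p + \<bar>v x - v y\<bar> powr p)" by (rule *)
    also have "\<dots> \<le> ?K * (\<bar>u x - u y\<bar> powr p + \<bar>v x - v y\<bar> powr p
        + norm (x - y) powr p * (indicator \<Omega> x + indicator \<Omega> y))"
      by (intro mult_left_mono) auto
    finally show ?thesis .
  qed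
qed

text \<open>Used for the absolute value and for truncation, neither of which increases
  \<open>\<bar>u x - u y\<bar>\<close>.\<close>

lemma X_contraction:
  assumes u: "u \<in> X" and T: "\<And>a b. \<bar>T a - T b\<bar> \<le> \<bar>a - b :: real\<bar>" "T 0 = 0" "T \<in> borel_measurable borel"
  shows "(\<lambda>x. T (u x) :: real) \<in> X"
proof (rule X_space_dominated[OF p lmeasurable_Omega u zero_in_X, where K = 1])
  note [measurable] = X_measurable[OF u] T(3)
  show "(\<lambda>x. T (u x)) \<in> borel_measurable lebesgue" by measurable
  show "T (u x) = 0" if "x \<notin> \<Omega>" for x using that u T by (simp add: X_zero)
  have "\<bar>T a\<bar> powr p \<le> \<bar>a\<bar> powr p" for a using T(1)[of a 0] T(2) p by (intro powr_mono2) auto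
  then show "\<bar>T (u x)\<bar> powr p \<le> 1 * (\<bar>u x\<bar> powr p + \<bar>0\<bar> powr p + 1)" for x
    by (simp add: add_increasing2)
  have "\<bar>T a - T b\<bar> powr p \<le> \<bar>a - b\<bar> powr p" for a b using T(1)[of a b] p by (intro powr_mono2) auto
  then show "\<bar>T (u x) - T (u y)\<bar> powr p \<le> 1 * (\<bar>u x - u y\<bar> powr p + \<bar>0 - 0\<bar> powr p
        + norm (x - y) powr p * (indicator \<Omega> x + indicator \<Omega> y))" for x y
    by (simp add: add_increasing2)
qed

lemma X_abs: "u \<in> X \<Longrightarrow> (\<lambda>x. \<bar>u x\<bar>) \<in> X"
  by (rule X_contraction) auto

text \<open>
  For \<open>t = \<bar>u x\<bar>\<close> large, Chebyshev's inequality makes \<open>{\<bar>u\<bar> > t / 2}\<close> so small that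
  the kernel integrated over its complement in the unit ball around \<open>x\<close> is still of order \<open>ln t\<close>.
\<close>

lemma log_sobolev_pointwise:
  fixes u :: "'a \<Rightarrow> real"
  assumes u: "u \<in> X" and t: "1 \<le> \<bar>u x\<bar>"
  defines "A \<equiv> (LINT x|lebesgue. \<bar>u x\<bar> powr p)" and "c \<equiv> ball_vol TYPE('a) / 4 ^ DIM('a)"
  shows "ennreal (c * p / (DIM('a) * ln 2) * (\<bar>u x\<bar> powr p * ln (1 + \<bar>u x\<bar>)))
    \<le> ennreal (2 powr p) * (\<integral>\<^sup>+y. ennreal (kern (x - y) * \<bar>u x - u y\<bar> powr p) \<partial>lebesgue)
      + ennreal ((4 powr p * A + c) * \<bar>u x\<bar> powr p)"
proof -
  note [measurable] = X_measurable[OF u]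
  define t where "t = \<bar>u x\<bar>"
  have t1: "1 \<le> t" using t by (simp add: t_def)
  have A0: "0 \<le> A" unfolding A_def by simp
  have c0: "0 < c" unfolding c_def by simp
  \<comment> \<open>The largest integer with \<open>(2 ^ J) ^ DIM('a) \<le> (1 + t) powr p\<close>.
    The kernel bound at distance \<open>1 / 2 ^ J\<close> is then compensated by the Chebyshev bound
    on the measure of \<open>S\<close>, while \<open>J\<close> itself is still of order
    \<open>ln t\<close>.\<close>
  define J where "J = nat \<lfloor>p / DIM('a) * log 2 (1 + t)\<rfloor>"
  have J0: "0 \<le> p / DIM('a) * log 2 (1 + t)" using p t1 by simp
  then have J1: "real J \<le> p / DIM('a) * log 2 (1 + t)" and J2: "p / DIM('a) * log 2 (1 + t) - 1 \<le> real J"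
    unfolding J_def by linarith+
  have J3: "(2 ^ J) ^ DIM('a) \<le> (1 + t) powr p"
  proof -
    have "(2 ^ J) ^ DIM('a) = 2 powr (real J * DIM('a))" by (simp add: powr_realpow[symmetric] powr_powr)
    also have "\<dots> \<le> 2 powr (p * log 2 (1 + t))"
      using J1 by (intro powr_mono) (simp_all add: field_simps)
    also have "\<dots> = (2 powr log 2 (1 + t)) powr p" by (simp add: powr_powr mult.commute)
    also have "\<dots> = (1 + t) powr p" using t1 by simp
    finally show ?thesis .
  qed
  define S where "S = {y. t / 2 < \<bar>u y\<bar>}"
  have S[measurable]: "S \<in> sets lebesgue"
    unfolding S_def using measurable_sets[OF X_measurable[OF u], of "{y. t / 2 < \<bar>y\<bar>}"]
    by (simp add: vimage_def)
  have SA: "ennreal ((t / 2) powr p) * emeasure lebesgue S \<le> ennreal A"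
  proof -
    have "ennreal ((t / 2) powr p) * emeasure lebesgue S = (\<integral>\<^sup>+y. ennreal ((t / 2) powr p) * indicator S y \<partial>lebesgue)"
      by (rule nn_integral_cmult_indicator[symmetric]) simp
    also have "\<dots> \<le> (\<integral>\<^sup>+y. ennreal (\<bar>u y\<bar> powr p) \<partial>lebesgue)"
      using t1 p by (intro nn_integral_mono) (auto simp: S_def indicator_def intro!: ennreal_leI powr_mono2)
    also have "\<dots> = ennreal A" unfolding A_def using X_powr[OF u] by (intro nn_integral_eq_integral) auto
    finally show ?thesis .
  qed
  obtain e :: 'a where e: "norm e = 1" using norm_Basis SOME_Basis by blast
  let ?H = "{z. 1 / 2 ^ J < z \<bullet> e}"
  \<comment> \<open>In the half space the distance exceeds \<open>1 / 2 ^ J\<close>, so on the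
    exceptional set \<open>S\<close> the kernel may be replaced by a constant.\<close>
  have split: "ennreal (kern z) * indicator ?H z
      \<le> ennreal (kern z) * indicator (- S) (x - z) + ennreal ((2 ^ J) ^ DIM('a)) * indicator S (x - z)" for z
  proof (cases "z \<in> ?H")
    case True
    then have "1 / 2 ^ J \<le> norm z" using Cauchy_Schwarz_ineq2[of z e] e by auto
    then have "kern z \<le> (2 ^ J) ^ DIM('a)" by (rule kern_le)
    then show ?thesis by (auto simp: indicator_def ennreal_leI)
  qed simp
  let ?I = "\<integral>\<^sup>+y. ennreal (kern (x - y) * \<bar>u x - u y\<bar> powr p) \<partial>lebesgue"
  have "ennreal (real J * c) \<le> (\<integral>\<^sup>+z. ennreal (kern z) * indicator ?H z \<partial>lborel)"
    unfolding c_def by (rule nn_integral_kern_lower[OF e])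
  also have "\<dots> = (\<integral>\<^sup>+y. ennreal (kern (x - y)) * indicator ?H (x - y) \<partial>lebesgue)"
    by (rule nn_integral_lebesgue_diff[symmetric]) measurable
  also have "\<dots> \<le> (\<integral>\<^sup>+y. ennreal (kern (x - y)) * indicator (- S) y + ennreal ((2 ^ J) ^ DIM('a)) * indicator S y \<partial>lebesgue)"
    using split[of "x - y" for y] by (intro nn_integral_mono) simp
  also have "\<dots> = (\<integral>\<^sup>+y. ennreal (kern (x - y)) * indicator (- S) y \<partial>lebesgue) + ennreal ((2 ^ J) ^ DIM('a)) * emeasure lebesgue S"
    by (subst nn_integral_add) (auto simp: nn_integral_cmult_indicator)
  finally have main: "ennreal (real J * c) \<le> (\<integral>\<^sup>+y. ennreal (kern (x - y)) * indicator (- S) y \<partial>lebesgue)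
      + ennreal ((2 ^ J) ^ DIM('a)) * emeasure lebesgue S" .
  have "ennreal (t powr p * (real J * c)) = ennreal (2 powr p) * (ennreal ((t / 2) powr p) * ennreal (real J * c))"
    using t1 c0 by (simp add: ennreal_mult[symmetric] powr_divide)
  also have "\<dots> \<le> ennreal (2 powr p) * (ennreal ((t / 2) powr p) * ((\<integral>\<^sup>+y. ennreal (kern (x - y)) * indicator (- S) y \<partial>lebesgue)
      + ennreal ((2 ^ J) ^ DIM('a)) * emeasure lebesgue S))"
    by (intro mult_left_mono main) auto
  also have "\<dots> = ennreal (2 powr p) * (ennreal ((t / 2) powr p) * (\<integral>\<^sup>+y. ennreal (kern (x - y)) * indicator (- S) y \<partial>lebesgue))
      + ennreal (2 powr p) * (ennreal ((2 ^ J) ^ DIM('a)) * (ennreal ((t / 2) powr p) * emeasure lebesgue S))"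
    by (simp add: distrib_left mult_ac)
  also have "\<dots> \<le> ennreal (2 powr p) * ?I + ennreal (2 powr p) * (ennreal ((1 + t) powr p) * ennreal A)"
  proof (intro add_mono mult_left_mono mult_mono SA)
    have "ennreal ((t / 2) powr p) * (\<integral>\<^sup>+y. ennreal (kern (x - y)) * indicator (- S) y \<partial>lebesgue)
      = (\<integral>\<^sup>+y. ennreal ((t / 2) powr p) * (ennreal (kern (x - y)) * indicator (- S) y) \<partial>lebesgue)"
      by (rule nn_integral_cmult[symmetric]) measurable
    also have "\<dots> \<le> ?I"
    proof (intro nn_integral_mono)
      fix y
      have "(t / 2) powr p \<le> \<bar>u x - u y\<bar> powr p" if "y \<notin> S"
      proof (intro powr_mono2)
        have "\<bar>u x\<bar> \<le> \<bar>u x - u y\<bar> + \<bar>u y\<bar>" by linarith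
        then show "t / 2 \<le> \<bar>u x - u y\<bar>" using that by (simp add: S_def t_def)
      qed (use p t1 in auto)
      then have "kern (x - y) * (t / 2) powr p \<le> kern (x - y) * \<bar>u x - u y\<bar> powr p" if "y \<notin> S"
        using that by (intro mult_left_mono) auto
      then show "ennreal ((t / 2) powr p) * (ennreal (kern (x - y)) * indicator (- S) y)
        \<le> ennreal (kern (x - y) * \<bar>u x - u y\<bar> powr p)"
        by (auto simp: indicator_def ennreal_mult[symmetric] mult.commute intro!: ennreal_leI)
    qed
    finally show "ennreal ((t / 2) powr p) * (\<integral>\<^sup>+y. ennreal (kern (x - y)) * indicator (- S) y \<partial>lebesgue) \<le> ?I" .
    show "ennreal ((2 ^ J) ^ DIM('a)) \<le> ennreal ((1 + t) powr p)" using J3 by (rule ennreal_leI)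
  qed auto
  also have "ennreal (2 powr p) * (ennreal ((1 + t) powr p) * ennreal A) = ennreal (2 powr p * (1 + t) powr p * A)"
    using A0 by (simp add: ennreal_mult mult.assoc)
  also have "\<dots> \<le> ennreal (4 powr p * t powr p * A)"
  proof (intro ennreal_leI mult_right_mono A0)
    have "2 powr p * (1 + t) powr p = (2 * (1 + t)) powr p" using t1 by (subst powr_mult) simp_all
    also have "\<dots> \<le> (4 * t) powr p" using t1 p by (intro powr_mono2) auto
    also have "\<dots> = 4 powr p * t powr p" using t1 by (simp add: powr_mult)
    finally show "2 powr p * (1 + t) powr p \<le> 4 powr p * t powr p" .
  qed
  finally have fin: "ennreal (t powr p * (real J * c)) \<le> ennreal (2 powr p) * ?I + ennreal (4 powr p * t powr p * A)"
    by (simp add: add_left_mono)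
  \<comment> \<open>Rounding \<open>J\<close> down loses at most 1, which accounts for the extra
    \<open>c * t powr p\<close>.\<close>
  have "c * p / (DIM('a) * ln 2) * (t powr p * ln (1 + t)) = t powr p * ((p / DIM('a) * log 2 (1 + t)) * c)"
    by (simp add: log_def field_simps)
  also have "\<dots> \<le> t powr p * ((real J + 1) * c)"
    using J2 c0 by (intro mult_left_mono mult_right_mono) auto
  also have "\<dots> = t powr p * (real J * c) + c * t powr p" by (simp add: algebra_simps)
  finally have "ennreal (c * p / (DIM('a) * ln 2) * (t powr p * ln (1 + t))) \<le> ennreal (t powr p * (real J * c)) + ennreal (c * t powr p)"
    using c0 by (simp add: ennreal_leI ennreal_plus[symmetric] del: ennreal_plus)
  also have "\<dots> \<le> (ennreal (2 powr p) * ?I + ennreal (4 powr p * t powr p * A)) + ennreal (c * t powr p)"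
    by (intro add_right_mono fin)
  also have "\<dots> = ennreal (2 powr p) * ?I + ennreal ((4 powr p * A + c) * t powr p)"
    using A0 c0 by (simp add: add.assoc ennreal_plus[symmetric] algebra_simps del: ennreal_plus)
  finally show ?thesis unfolding t_def .
qed

text \<open>The pointwise bound is integrated where \<open>\<bar>u\<bar>\<close> is at least 1;
  elsewhere \<open>ln (1 + \<bar>u\<bar>)\<close> is at most 1. This makes the logarithmic part of
  the energy finite on the whole of \<open>X\<close>.\<close>

lemma log_sobolev:
  assumes u: "u \<in> X"
  shows "integrable lebesgue (\<lambda>x. \<bar>u x\<bar> powr p * ln (1 + \<bar>u x\<bar>))"
proof (rule integrableI_nonneg)
  note [measurable] = X_measurable[OF u]
  define A where "A = (LINT x|lebesgue. \<bar>u x\<bar> powr p)"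
  define c where "c = ball_vol TYPE('a) / 4 ^ DIM('a)"
  define d where "d = c * p / (DIM('a) * ln 2)"
  have A0: "0 \<le> A" unfolding A_def by simp
  have c0: "0 < c" unfolding c_def by simp
  have d0: "0 < d" unfolding d_def using c0 p by simp
  let ?I = "\<lambda>x. \<integral>\<^sup>+y. ennreal (kern (x - y) * \<bar>u x - u y\<bar> powr p) \<partial>lebesgue"
  have Im: "?I \<in> borel_measurable lebesgue"
    by (intro lebesgue.borel_measurable_nn_integral) (simp add: case_prod_beta)
  have I: "(\<integral>\<^sup>+x. ?I x \<partial>lebesgue) < \<infinity>"
  proof -
    have "(\<integral>\<^sup>+x. ?I x \<partial>lebesgue) = (\<integral>\<^sup>+z. ennreal (\<bar>u (fst z) - u (snd z)\<bar> powr p) \<partial>near)"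
      by (subst nn_integral_near(1)) (auto simp: ennreal_mult)
    also have "\<dots> < \<infinity>" using X_near[OF u] by (auto simp: integrable_iff_bounded)
    finally show ?thesis .
  qed
  have P: "(\<integral>\<^sup>+x. ennreal (\<bar>u x\<bar> powr p) \<partial>lebesgue) < \<infinity>"
    using X_powr[OF u] by (auto simp: integrable_iff_bounded)
  have pt: "ennreal (\<bar>u x\<bar> powr p * ln (1 + \<bar>u x\<bar>)) \<le> ennreal (2 powr p / d) * ?I x + ennreal ((4 powr p * A + c) / d + 1) * ennreal (\<bar>u x\<bar> powr p)" for x
  proof (cases "1 \<le> \<bar>u x\<bar>")
    case True
    have "ennreal (\<bar>u x\<bar> powr p * ln (1 + \<bar>u x\<bar>)) = ennreal (1 / d) * ennreal (d * (\<bar>u x\<bar> powr p * ln (1 + \<bar>u x\<bar>)))"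
      using d0 by (simp add: ennreal_mult[symmetric])
    also have "\<dots> \<le> ennreal (1 / d) * (ennreal (2 powr p) * ?I x + ennreal ((4 powr p * A + c) * \<bar>u x\<bar> powr p))"
      using log_sobolev_pointwise[OF u True] unfolding A_def c_def d_def by (intro mult_left_mono) auto
    also have "\<dots> = ennreal (2 powr p / d) * ?I x + ennreal ((4 powr p * A + c) / d) * ennreal (\<bar>u x\<bar> powr p)"
      using d0 A0 c0 by (simp add: distrib_left ennreal_mult[symmetric] mult.assoc[symmetric] add_divide_distrib distrib_right)
    also have "\<dots> \<le> ennreal (2 powr p / d) * ?I x + ennreal ((4 powr p * A + c) / d + 1) * ennreal (\<bar>u x\<bar> powr p)"
      by (intro add_left_mono mult_right_mono ennreal_leI) auto
    finally show ?thesis .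
  next
    case False
    have "ln (1 + \<bar>u x\<bar>) \<le> 1" using False ln_add_one_self_le_self[of "\<bar>u x\<bar>"] by linarith
    then have "\<bar>u x\<bar> powr p * ln (1 + \<bar>u x\<bar>) \<le> 1 * \<bar>u x\<bar> powr p"
      using mult_left_mono[of _ _ "\<bar>u x\<bar> powr p"] by fastforce
    also have "\<dots> \<le> ((4 powr p * A + c) / d + 1) * \<bar>u x\<bar> powr p"
      using A0 c0 d0 by (intro mult_right_mono) auto
    finally have "ennreal (\<bar>u x\<bar> powr p * ln (1 + \<bar>u x\<bar>)) \<le> ennreal ((4 powr p * A + c) / d + 1) * ennreal (\<bar>u x\<bar> powr p)"
      using A0 c0 d0 by (subst ennreal_mult[symmetric]) (auto intro!: ennreal_leI simp del: ennreal_plus)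
    then show ?thesis by (simp add: add_increasing)
  qed
  have "(\<integral>\<^sup>+x. ennreal (\<bar>u x\<bar> powr p * ln (1 + \<bar>u x\<bar>)) \<partial>lebesgue)
    \<le> (\<integral>\<^sup>+x. ennreal (2 powr p / d) * ?I x + ennreal ((4 powr p * A + c) / d + 1) * ennreal (\<bar>u x\<bar> powr p) \<partial>lebesgue)"
    by (intro nn_integral_mono pt)
  also have "\<dots> = ennreal (2 powr p / d) * (\<integral>\<^sup>+x. ?I x \<partial>lebesgue) + ennreal ((4 powr p * A + c) / d + 1) * (\<integral>\<^sup>+x. ennreal (\<bar>u x\<bar> powr p) \<partial>lebesgue)"
    using Im by (simp add: nn_integral_add nn_integral_cmult)
  also have "\<dots> < \<infinity>" using I P by (auto simp: ennreal_mult_less_top)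
  finally show "(\<integral>\<^sup>+x. ennreal (\<bar>u x\<bar> powr p * ln (1 + \<bar>u x\<bar>)) \<partial>lebesgue) < \<infinity>" .
  show "(\<lambda>x. \<bar>u x\<bar> powr p * ln (1 + \<bar>u x\<bar>)) \<in> borel_measurable lebesgue" by measurable
qed auto

end

subsection \<open>Growth and measurability of the nonlinearity\<close>

text \<open>A violation at one point persists on an open set, which is not negligible. The strict
  bound on \<open>\<bar>t\<bar>\<close> keeps that set inside the interval where the hypothesis
  applies.\<close>

lemma AE_imp_continuous_bound:
  fixes f :: "real \<Rightarrow> real"
  assumes ae: "AE t in lborel. \<bar>t\<bar> \<le> T \<longrightarrow> \<bar>f t\<bar> \<le> C" and f: "continuous_on UNIV f" and t: "\<bar>t\<bar> < T"
  shows "\<bar>f t\<bar> \<le> C"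
proof (rule ccontr)
  assume "\<not> \<bar>f t\<bar> \<le> C"
  define U where "U = {-T<..<T} \<inter> {s. C < \<bar>f s\<bar>}"
  have "open U"
    unfolding U_def using f by (intro open_Int open_Collect_less continuous_intros) auto
  moreover have "t \<in> U" using t \<open>\<not> \<bar>f t\<bar> \<le> C\<close> by (auto simp: U_def)
  ultimately have "\<not> negligible U" by (intro open_not_negligible) auto
  moreover have "AE s in lebesgue. s \<notin> U"
    using AE_completion[OF ae] by eventually_elim (auto simp: U_def)
  then have "negligible U"
    using \<open>open U\<close> by (simp add: negligible_iff_null_sets AE_iff_null_sets[symmetric] borel_open)
  ultimately show False by simp
qed

text \<open>This is \<open>ln r \<le> r - 1\<close> at
  \<open>r = 1 / \<bar>t\<bar> powr q\<close>.\<close>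

lemma powr_abs_ln_le:
  fixes q t :: real
  assumes "0 < q" "\<bar>t\<bar> \<le> 1"
  shows "\<bar>t\<bar> powr q * \<bar>ln \<bar>t\<bar>\<bar> \<le> 1 / q"
proof (cases "t = 0")
  case False
  define s where "s = \<bar>t\<bar> powr q"
  have s: "0 < s" using False by (simp add: s_def)
  have "ln (1 / s) \<le> 1 / s - 1" using s by (intro ln_le_minus_one) simp
  moreover have "ln (1 / s) = q * \<bar>ln \<bar>t\<bar>\<bar>"
    using False assms s by (simp add: s_def ln_div ln_powr abs_if)
  ultimately have "s * (q * \<bar>ln \<bar>t\<bar>\<bar>) \<le> s * (1 / s)"
    using s by (intro mult_left_mono) auto
  then show ?thesis using assms s by (simp add: s_def[symmetric] field_simps)
qed (use assms in simp)

lemma borel_measurable_lebesgue_AE: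
  fixes f f' :: "'a::euclidean_space \<Rightarrow> real"
  assumes f'[measurable]: "f' \<in> borel_measurable lebesgue" and e: "AE x in lebesgue. f' x = f x"
  shows "f \<in> borel_measurable lebesgue"
proof (rule measurableI)
  fix A :: "real set" assume A: "A \<in> sets borel"
  obtain B where B: "B \<in> null_sets lebesgue" "{x. f' x \<noteq> f x} \<subseteq> B"
    using e unfolding eventually_ae_filter by auto
  have eq: "f -` A = (f' -` A - B) \<union> (f -` A \<inter> B)"
  proof -
    have "f' x = f x" if "x \<notin> B" for x using B(2) that by blast
    then show ?thesis by auto
  qed
  have "f -` A \<inter> B \<in> null_sets lebesgue"
    using B(1) by (rule null_sets_completion_subset[rotated]) auto
  moreover have "f' -` A \<in> sets lebesgue" using measurable_sets[OF f' A] by simp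
  ultimately have "(f' -` A - B) \<union> (f -` A \<inter> B) \<in> sets lebesgue" using B(1) by (auto simp: null_sets_def)
  then show "f -` A \<inter> space lebesgue \<in> sets lebesgue" using eq by simp
qed simp

locale log_problem = log_space \<Omega> p
  for \<Omega> :: "'a::euclidean_space set" and p :: real +
  fixes g :: "'a \<Rightarrow> real \<Rightarrow> real" and \<mu> :: real
  assumes mu: "\<mu> < 0"
    and carath: "caratheodory \<Omega> g"
    and g1: "\<And>K. compact K \<Longrightarrow> in_Linf (\<Omega> \<times> K) (\<lambda>(x, t). g x t)"
    and g2: "uniform_limit \<Omega> (\<lambda>t x. g x t / (h p t * ln \<bar>t\<bar>)) (\<lambda>x. 0) at_infinity"
    and g3: "\<exists>f. in_Linf \<Omega> f \<and> uniform_limit \<Omega> (\<lambda>t x. g x t / h p t) f (at 0)"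
begin

lemma AE_continuous: "AE x in lebesgue_on \<Omega>. continuous_on UNIV (g x)"
  using carath by (simp add: caratheodory_def)

text \<open>The hypothesis bounds \<open>g\<close> almost everywhere on a product set. Fubini gives,
  for almost every \<open>x\<close>, a bound for almost every \<open>t\<close>, and continuity in
  \<open>t\<close> extends it to all \<open>t\<close>, so that arbitrary functions may be
  substituted.\<close>

lemma AE_bound:
  "\<exists>C\<ge>0. AE x in lebesgue_on \<Omega>. \<forall>t. \<bar>t\<bar> < T \<longrightarrow> \<bar>g x t\<bar> \<le> C"
proof -
  obtain C where C: "AE z in lebesgue_on (\<Omega> \<times> cball 0 T). \<bar>g (fst z) (snd z)\<bar> \<le> C"
    using g1[of "cball 0 T"] by (auto simp: in_Linf_def case_prod_beta)
  have "\<Omega> \<times> cball 0 T \<in> sets (borel :: ('a \<times> real) measure)"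
    unfolding borel_prod[symmetric] using open_Omega by (intro pair_measureI) auto
  then have "\<Omega> \<times> cball 0 T \<in> sets (lebesgue :: ('a \<times> real) measure)" by auto
  with C have "AE z in lebesgue. z \<in> \<Omega> \<times> cball 0 T \<longrightarrow> \<bar>g (fst z) (snd z)\<bar> \<le> C"
    by (simp add: AE_restrict_space_iff)
  then have "AE z in (lborel :: 'a measure) \<Otimes>\<^sub>M (lborel :: real measure). z \<in> \<Omega> \<times> cball 0 T \<longrightarrow> \<bar>g (fst z) (snd z)\<bar> \<le> C"
    unfolding lborel_prod by (simp add: AE_completion_iff)
  then have "AE x in lborel. AE t in lborel. (x, t) \<in> \<Omega> \<times> cball 0 T \<longrightarrow> \<bar>g x t\<bar> \<le> C"
    using lborel_pair.AE_pair by fastforce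
  then have "AE x in lebesgue. AE t in lborel. (x, t) \<in> \<Omega> \<times> cball 0 T \<longrightarrow> \<bar>g x t\<bar> \<le> C"
    by (rule AE_completion)
  then have "AE x in lebesgue_on \<Omega>. AE t in lborel. \<bar>t\<bar> \<le> T \<longrightarrow> \<bar>g x t\<bar> \<le> C"
    by (simp add: AE_restrict_space_iff) (auto elim!: eventually_mono)
  then have "AE x in lebesgue_on \<Omega>. \<forall>t. \<bar>t\<bar> < T \<longrightarrow> \<bar>g x t\<bar> \<le> max C 0"
    using AE_continuous
    by eventually_elim (auto dest: AE_imp_continuous_bound intro: max.coboundedI1)
  then show ?thesis by (intro exI[of _ "max C 0"]) auto
qed

text \<open>Three regimes are glued: the limit at 0 for small \<open>t\<close>, the local bound in
  between, the limit at infinity for large \<open>t\<close>. The arbitrary \<open>\<epsilon>\<close>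
  in front of the logarithm lets the coefficient \<open>\<mu>\<close> absorb \<open>g\<close>
  later.\<close>

lemma growth:
  assumes "0 < \<epsilon>"
  shows "\<exists>C>0. AE x in lebesgue_on \<Omega>. \<forall>t. \<bar>g x t\<bar> \<le> \<bar>t\<bar> powr (p - 1) * (\<epsilon> * ln (1 + \<bar>t\<bar>) + C)"
proof -
  obtain f where f: "in_Linf \<Omega> f" and ul: "uniform_limit \<Omega> (\<lambda>t x. g x t / h p t) f (at 0)"
    using g3 by blast
  obtain Cf where Cf: "AE x in lebesgue_on \<Omega>. \<bar>f x\<bar> \<le> Cf" using f by (auto simp: in_Linf_def)
  obtain t0 where t0: "0 < t0" "\<And>t x. t \<noteq> 0 \<Longrightarrow> \<bar>t\<bar> < t0 \<Longrightarrow> x \<in> \<Omega> \<Longrightarrow> \<bar>g x t / h p t - f x\<bar> < 1"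
    using uniform_limitD[OF ul, of 1] by (auto simp: eventually_at dist_real_def)
  obtain T0 where T0: "\<And>t x. T0 \<le> \<bar>t\<bar> \<Longrightarrow> x \<in> \<Omega> \<Longrightarrow> \<bar>g x t / (h p t * ln \<bar>t\<bar>)\<bar> < \<epsilon>"
    using uniform_limitD[OF g2 \<open>0 < \<epsilon>\<close>] by (auto simp: eventually_at_infinity dist_real_def)
  define T where "T = max T0 2"
  obtain C1 where C1: "0 \<le> C1" "AE x in lebesgue_on \<Omega>. \<forall>t. \<bar>t\<bar> < T \<longrightarrow> \<bar>g x t\<bar> \<le> C1"
    using AE_bound by blast
  \<comment> \<open>The quotient \<open>C1 / t0 powr (p - 1)\<close> serves the middle regime, where
    \<open>\<bar>t\<bar> powr (p - 1)\<close> is at least \<open>t0 powr (p - 1)\<close>.\<close>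
  define C where "C = \<bar>Cf\<bar> + 1 + C1 / t0 powr (p - 1)"
  have "0 < C" unfolding C_def using C1 t0 by (simp add: add_pos_nonneg)
  have A: "\<bar>g x t\<bar> \<le> \<bar>t\<bar> powr (p - 1) * (\<bar>Cf\<bar> + 1)"
    if "x \<in> \<Omega>" "\<bar>f x\<bar> \<le> Cf" "t \<noteq> 0" "\<bar>t\<bar> < t0" for x t
  proof -
    have "\<bar>g x t / h p t\<bar> \<le> \<bar>Cf\<bar> + 1" using t0(2)[of t x] that by linarith
    then have "\<bar>g x t\<bar> / \<bar>t\<bar> powr (p - 1) \<le> \<bar>Cf\<bar> + 1" by (simp add: abs_divide abs_h)
    then show ?thesis using that by (simp add: field_simps)
  qed
  have "AE x in lebesgue_on \<Omega>. x \<in> \<Omega>" by (rule AE_I2) simp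
  then have "AE x in lebesgue_on \<Omega>. \<forall>t. \<bar>g x t\<bar> \<le> \<bar>t\<bar> powr (p - 1) * (\<epsilon> * ln (1 + \<bar>t\<bar>) + C)"
    using C1(2) Cf AE_continuous
  proof eventually_elim
    case (elim x)
    show ?case
    proof
      fix t
      have l0: "0 \<le> \<epsilon> * ln (1 + \<bar>t\<bar>)" using \<open>0 < \<epsilon>\<close> by simp
      consider "t = 0" | "t \<noteq> 0" "\<bar>t\<bar> < t0" | "t0 \<le> \<bar>t\<bar>" "\<bar>t\<bar> < T" | "T \<le> \<bar>t\<bar>"
        by linarith
      then show "\<bar>g x t\<bar> \<le> \<bar>t\<bar> powr (p - 1) * (\<epsilon> * ln (1 + \<bar>t\<bar>) + C)"
      proof cases
        case 1
        \<comment> \<open>The limit at 0 says nothing about \<open>t = 0\<close> itself; continuity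
          carries the bound over and forces \<open>g x 0 = 0\<close>.\<close>
        have "isCont (g x) 0" using elim by (simp add: continuous_on_eq_continuous_at)
        then have c: "((\<lambda>t. \<bar>g x t\<bar>) \<longlongrightarrow> \<bar>g x 0\<bar>) (at 0)" by (auto simp: isCont_def intro: tendsto_rabs)
        have z: "((\<lambda>t. \<bar>t\<bar> powr (p - 1) * (\<bar>Cf\<bar> + 1)) \<longlongrightarrow> 0 * (\<bar>Cf\<bar> + 1)) (at 0)"
          using tendsto_powr'[OF tendsto_rabs[OF tendsto_ident_at[of 0 UNIV]] tendsto_const[of "p - 1"]] p
          by (intro tendsto_mult tendsto_const) auto
        have "\<bar>g x 0\<bar> \<le> 0 * (\<bar>Cf\<bar> + 1)"
        proof (rule tendsto_le[OF _ z c])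
          show "eventually (\<lambda>t. \<bar>g x t\<bar> \<le> \<bar>t\<bar> powr (p - 1) * (\<bar>Cf\<bar> + 1)) (at 0)"
            using t0(1) elim A by (auto simp: eventually_at dist_real_def intro!: exI[of _ t0])
        qed simp
        with 1 show ?thesis by simp
      next
        case 2
        have "\<bar>g x t\<bar> \<le> \<bar>t\<bar> powr (p - 1) * (\<bar>Cf\<bar> + 1)" using A elim 2 by blast
        also have "\<dots> \<le> \<bar>t\<bar> powr (p - 1) * (\<epsilon> * ln (1 + \<bar>t\<bar>) + C)"
          using l0 C1 unfolding C_def by (intro mult_left_mono) (auto simp: add_increasing add_increasing2)
        finally show ?thesis .
      next
        case 3
        have "\<bar>g x t\<bar> \<le> C1" using elim 3 by blast
        also have "\<dots> = t0 powr (p - 1) * (C1 / t0 powr (p - 1))" using t0 by simp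
        also have "\<dots> \<le> \<bar>t\<bar> powr (p - 1) * (\<epsilon> * ln (1 + \<bar>t\<bar>) + C)"
          using l0 C1 3 t0 p unfolding C_def by (intro mult_mono powr_mono2) (auto simp: add_increasing add_increasing2)
        finally show ?thesis .
      next
        case 4
        have t2: "2 \<le> \<bar>t\<bar>" "T0 \<le> \<bar>t\<bar>" using 4 by (auto simp: T_def)
        have ln0: "0 < ln \<bar>t\<bar>" using t2 by simp
        have "\<bar>g x t\<bar> / (\<bar>t\<bar> powr (p - 1) * ln \<bar>t\<bar>) < \<epsilon>"
          using T0[of t x] t2 elim ln0 by (simp add: abs_divide abs_mult abs_h)
        then have "\<bar>g x t\<bar> < \<epsilon> * (\<bar>t\<bar> powr (p - 1) * ln \<bar>t\<bar>)"
          using t2 ln0 by (subst (asm) pos_divide_less_eq) auto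
        then have "\<bar>g x t\<bar> \<le> \<bar>t\<bar> powr (p - 1) * (\<epsilon> * ln \<bar>t\<bar>)" by (simp add: mult_ac)
        also have "\<dots> \<le> \<bar>t\<bar> powr (p - 1) * (\<epsilon> * ln (1 + \<bar>t\<bar>) + C)"
        proof (intro mult_left_mono)
          have "ln \<bar>t\<bar> \<le> ln (1 + \<bar>t\<bar>)" using t2 by simp
          then have "\<epsilon> * ln \<bar>t\<bar> \<le> \<epsilon> * ln (1 + \<bar>t\<bar>)" using \<open>0 < \<epsilon>\<close> by simp
          then show "\<epsilon> * ln \<bar>t\<bar> \<le> \<epsilon> * ln (1 + \<bar>t\<bar>) + C" using \<open>0 < C\<close> by linarith
        qed simp
        finally show ?thesis .
      qed
    qed
  qed
  with \<open>0 < C\<close> show ?thesis by blast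
qed

lemma AE_g_0: "AE x in lebesgue_on \<Omega>. g x 0 = 0"
proof -
  obtain C where "AE x in lebesgue_on \<Omega>. \<forall>t. \<bar>g x t\<bar> \<le> \<bar>t\<bar> powr (p - 1) * (1 * ln (1 + \<bar>t\<bar>) + C)"
    using growth[of 1] by auto
  then show ?thesis by eventually_elim (metis abs_zero abs_le_zero_iff powr_zero_eq_one powr_0 mult_zero_left)
qed

text \<open>
  The version is the pointwise limit of the piecewise constant interpolations of \<open>g x\<close>.
\<close>

lemma jointly_measurable_version:
  obtains g' where "(\<lambda>z. g' (fst z) (snd z)) \<in> borel_measurable (lebesgue_on \<Omega> \<Otimes>\<^sub>M borel)"
    and "AE x in lebesgue_on \<Omega>. g' x = g x"
proof -
  obtain B where B: "B \<in> null_sets (lebesgue_on \<Omega>)" "{x \<in> space (lebesgue_on \<Omega>). \<not> continuous_on UNIV (g x)} \<subseteq> B"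
    using AE_continuous unfolding eventually_ae_filter by blast
  have Bm: "- B \<inter> \<Omega> \<in> sets (lebesgue_on \<Omega>)"
    using B(1) sets.compl_sets[of B "lebesgue_on \<Omega>"] by (auto simp: null_sets_def Diff_eq Int_commute)
  \<comment> \<open>Zero on the exceptional null set, so that the interpolations converge at every
    point and not just almost everywhere.\<close>
  define g' where "g' x t = indicator (- B \<inter> \<Omega>) x * g x t" for x t
  have gm: "(\<lambda>x. g x t) \<in> borel_measurable (lebesgue_on \<Omega>)" for t
    using carath by (simp add: caratheodory_def)
  define G where "G k z = indicator (- B \<inter> \<Omega>) (fst z) * g (fst z) (of_int \<lfloor>2 ^ k * snd z\<rfloor> / 2 ^ k)" for k :: nat and z :: "'a \<times> real"
  have "G k \<in> borel_measurable (lebesgue_on \<Omega> \<Otimes>\<^sub>M borel)" for k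
  proof -
    have "(\<lambda>z::'a \<times> real. g (fst z) (of_int \<lfloor>2 ^ k * snd z\<rfloor> / 2 ^ k)) \<in> borel_measurable (lebesgue_on \<Omega> \<Otimes>\<^sub>M borel)"
    proof (rule measurable_compose_countable[where f = "\<lambda>i z::'a \<times> real. g (fst z) (of_int i / 2 ^ k)" and g = "\<lambda>z::'a \<times> real. \<lfloor>2 ^ k * snd z\<rfloor>"])
      show "(\<lambda>z. g (fst z) (of_int i / 2 ^ k)) \<in> borel_measurable (lebesgue_on \<Omega> \<Otimes>\<^sub>M borel)" for i
        by (rule measurable_compose[OF measurable_fst gm])
    qed measurable
    moreover have "(\<lambda>z. indicator (- B \<inter> \<Omega>) (fst z) :: real) \<in> borel_measurable (lebesgue_on \<Omega> \<Otimes>\<^sub>M borel)"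
      by (rule measurable_compose[OF measurable_fst]) (use Bm in simp)
    ultimately show ?thesis unfolding G_def by measurable
  qed
  then have "(\<lambda>z. g' (fst z) (snd z)) \<in> borel_measurable (lebesgue_on \<Omega> \<Otimes>\<^sub>M borel)"
  proof (rule borel_measurable_LIMSEQ_real[rotated])
    fix z :: "'a \<times> real"
    show "(\<lambda>k. G k z) \<longlonglongrightarrow> g' (fst z) (snd z)"
    proof (cases "fst z \<in> - B \<inter> \<Omega>")
      case True
      then have c: "isCont (g (fst z)) (snd z)"
        using B(2) by (auto simp: continuous_on_eq_continuous_at)
      have "(\<lambda>k. of_int \<lfloor>2 ^ k * snd z\<rfloor> / 2 ^ k) \<longlonglongrightarrow> snd z"
      proof (rule real_tendsto_sandwich)
        have "(\<lambda>k. snd z - (1 / 2) ^ k) \<longlonglongrightarrow> snd z - 0"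
          by (intro tendsto_diff tendsto_const LIMSEQ_power_zero) auto
        then show "(\<lambda>k. snd z - (1 / 2) ^ k) \<longlonglongrightarrow> snd z" by simp
        have "2 ^ k * (snd z - (1 / 2) ^ k) \<le> of_int \<lfloor>2 ^ k * snd z\<rfloor>" for k
        proof -
          have "2 ^ k * (snd z - (1 / 2) ^ k) = 2 ^ k * snd z - 1" by (simp add: algebra_simps power_divide)
          then show ?thesis by linarith
        qed
        then show "eventually (\<lambda>k. snd z - (1 / 2) ^ k \<le> of_int \<lfloor>2 ^ k * snd z\<rfloor> / 2 ^ k) sequentially"
          by (intro always_eventually allI) (subst pos_le_divide_eq, simp_all add: mult.commute)
        show "eventually (\<lambda>k. of_int \<lfloor>2 ^ k * snd z\<rfloor> / 2 ^ k \<le> snd z) sequentially"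
          by (intro always_eventually allI) (subst pos_divide_le_eq, simp, metis mult.commute of_int_floor_le)
      qed simp
      then have "(\<lambda>k. g (fst z) (of_int \<lfloor>2 ^ k * snd z\<rfloor> / 2 ^ k)) \<longlonglongrightarrow> g (fst z) (snd z)"
        by (rule isCont_tendsto_compose[OF c])
      with True show ?thesis by (simp add: G_def g'_def)
    qed (simp add: G_def g'_def)
  qed
  moreover have "AE x in lebesgue_on \<Omega>. g' x = g x"
    using AE_not_in[OF B(1)] by (rule AE_mp) (auto intro!: AE_I2 simp: g'_def fun_eq_iff)
  ultimately show ?thesis by (rule that)
qed

lemma measurable_AE_Omega:
  fixes f f' :: "'a \<Rightarrow> real"
  assumes "f' \<in> borel_measurable (lebesgue_on \<Omega>)" "AE x in lebesgue_on \<Omega>. f' x = f x"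
  shows "f \<in> borel_measurable (lebesgue_on \<Omega>)"
proof -
  have e: "AE x in lebesgue. indicator \<Omega> x *\<^sub>R f' x = indicator \<Omega> x *\<^sub>R f x"
    using assms(2) by (auto simp: AE_restrict_space_iff elim!: eventually_mono)
  have "(\<lambda>x. indicator \<Omega> x *\<^sub>R f' x) \<in> borel_measurable lebesgue"
    using assms(1) borel_measurable_restrict_space_iff[of \<Omega> lebesgue f'] by simp
  then have "(\<lambda>x. indicator \<Omega> x *\<^sub>R f x) \<in> borel_measurable lebesgue"
    using e by (rule borel_measurable_lebesgue_AE)
  then show ?thesis using borel_measurable_restrict_space_iff[of \<Omega> lebesgue f] by simp
qed

lemma measurable_g_comp:
  assumes [measurable]: "u \<in> borel_measurable (lebesgue_on \<Omega>)"
  shows "(\<lambda>x. g x (u x)) \<in> borel_measurable (lebesgue_on \<Omega>)"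
proof -
  obtain g' where [measurable]: "(\<lambda>z. g' (fst z) (snd z)) \<in> borel_measurable (lebesgue_on \<Omega> \<Otimes>\<^sub>M borel)"
    and g': "AE x in lebesgue_on \<Omega>. g' x = g x"
    by (rule jointly_measurable_version)
  have "(\<lambda>x. (x, u x)) \<in> lebesgue_on \<Omega> \<rightarrow>\<^sub>M lebesgue_on \<Omega> \<Otimes>\<^sub>M borel" by measurable
  from measurable_compose[OF this, of "\<lambda>z. g' (fst z) (snd z)" borel]
  have "(\<lambda>x. g' x (u x)) \<in> borel_measurable (lebesgue_on \<Omega>)" by simp
  moreover have "AE x in lebesgue_on \<Omega>. g' x (u x) = g x (u x)"
    using g' by eventually_elim simp
  ultimately show ?thesis by (rule measurable_AE_Omega)
qed

lemma measurable_primitive_comp: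
  assumes [measurable]: "u \<in> borel_measurable (lebesgue_on \<Omega>)"
  shows "(\<lambda>x. primitive g x (u x)) \<in> borel_measurable (lebesgue_on \<Omega>)"
proof -
  obtain g' where g'm[measurable]: "(\<lambda>z. g' (fst z) (snd z)) \<in> borel_measurable (lebesgue_on \<Omega> \<Otimes>\<^sub>M borel)"
    and g': "AE x in lebesgue_on \<Omega>. g' x = g x"
    by (rule jointly_measurable_version)
  have [measurable]: "(\<lambda>z. g' (fst z) (snd z)) \<in> borel_measurable (lebesgue_on \<Omega> \<Otimes>\<^sub>M lborel)"
    using g'm by simp
  \<comment> \<open>Both orientations of the interval integral are written as integrals over the
    whole line with the endpoint inside the integrand; measurability of parameter integrals then
    applies with \<open>t = u x\<close>.\<close>
  have eq: "primitive g' x t = (\<integral>\<tau>. (if 0 < \<tau> \<and> \<tau> < t then g' x \<tau> else 0) \<partial>lborel)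
    - (\<integral>\<tau>. (if t < \<tau> \<and> \<tau> < 0 then g' x \<tau> else 0) \<partial>lborel)" for x t
  proof (cases "0 \<le> t")
    case True
    have "(\<lambda>\<tau>. indicat_real {0<..<t} \<tau> *\<^sub>R g' x \<tau>) = (\<lambda>\<tau>. if 0 < \<tau> \<and> \<tau> < t then g' x \<tau> else 0)"
      "(\<lambda>\<tau>. if t < \<tau> \<and> \<tau> < 0 then g' x \<tau> else 0) = (\<lambda>\<tau>. 0)"
      using True by (auto simp: fun_eq_iff)
    then show ?thesis using True
      by (simp add: primitive_def interval_lebesgue_integral_def set_lebesgue_integral_def zero_ereal_def)
  next
    case False
    have "(\<lambda>\<tau>. indicat_real {t<..<0} \<tau> *\<^sub>R g' x \<tau>) = (\<lambda>\<tau>. if t < \<tau> \<and> \<tau> < 0 then g' x \<tau> else 0)"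
      "(\<lambda>\<tau>. if 0 < \<tau> \<and> \<tau> < t then g' x \<tau> else 0) = (\<lambda>\<tau>. 0)"
      using False by (auto simp: fun_eq_iff)
    then show ?thesis using False
      by (simp add: primitive_def interval_lebesgue_integral_def set_lebesgue_integral_def zero_ereal_def)
  qed
  have "(\<lambda>z. if 0 < snd z \<and> snd z < u (fst z) then g' (fst z) (snd z) else 0) \<in> borel_measurable (lebesgue_on \<Omega> \<Otimes>\<^sub>M lborel)"
    "(\<lambda>z. if u (fst z) < snd z \<and> snd z < 0 then g' (fst z) (snd z) else 0) \<in> borel_measurable (lebesgue_on \<Omega> \<Otimes>\<^sub>M lborel)"
    by measurable
  then have "(\<lambda>x. primitive g' x (u x)) \<in> borel_measurable (lebesgue_on \<Omega>)"
    unfolding eq by (intro borel_measurable_diff lborel.borel_measurable_lebesgue_integral) (simp_all add: case_prod_beta)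
  moreover have "AE x in lebesgue_on \<Omega>. primitive g' x (u x) = primitive g x (u x)"
    using g' by eventually_elim (simp add: primitive_def)
  ultimately show ?thesis by (rule measurable_AE_Omega)
qed

lemma primitive_0 [simp]: "primitive g x 0 = 0"
  by (simp add: primitive_def zero_ereal_def interval_lebesgue_integral_def set_lebesgue_integral_def)

lemma has_real_derivative_primitive:
  assumes "continuous_on UNIV (g x)"
  shows "(primitive g x has_real_derivative g x t) (at t)"
proof -
  let ?b = "\<bar>t\<bar> + 1"
  have "((\<lambda>u. LBINT y=0..u. g x y) has_vector_derivative g x t) (at t within {-?b..?b})"
    using interval_integral_FTC2[of "-?b" 0 ?b "g x" t] continuous_on_subset[OF assms, of "{-?b..?b}"]
    by (auto simp: zero_ereal_def)
  moreover have "at t within {-?b..?b} = at t"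
    by (rule at_within_interior) (auto simp: interior_atLeastAtMost_real)
  ultimately show ?thesis
    by (simp add: has_real_derivative_iff_has_vector_derivative primitive_def[abs_def] zero_ereal_def)
qed

end

subsection \<open>The potential and the energy\<close>

text \<open>The majorant of all local terms, integrable along every member of \<open>X\<close> by
  \<open>log_sobolev\<close>. The argument \<open>1 + \<bar>t\<bar>\<close> of the logarithm keeps
  it nonnegative and monotone in \<open>\<bar>t\<bar>\<close>.\<close>

definition pot_growth :: "real \<Rightarrow> real \<Rightarrow> real" where
  "pot_growth p t = 1 + \<bar>t\<bar> powr p + \<bar>t\<bar> powr p * ln (1 + \<bar>t\<bar>)"

lemma pot_growth_ge_1: "1 \<le> pot_growth p t"
  by (simp add: pot_growth_def)

lemma pot_growth_mono: "0 < p \<Longrightarrow> \<bar>s\<bar> \<le> \<bar>t\<bar> \<Longrightarrow> pot_growth p s \<le> pot_growth p t"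
  unfolding pot_growth_def by (intro add_mono mult_mono powr_mono2) auto

lemma measurable_pot_growth [measurable]: "pot_growth p \<in> borel_measurable borel"
  unfolding pot_growth_def by measurable

text \<open>The local density of the energy. It also absorbs the zeroth-order term of
  \<open>E_form\<close>, so that \<open>J\<close> consists of a near, a far and a local
  integral.\<close>

definition (in log_problem) pot :: "'a \<Rightarrow> real \<Rightarrow> real" where
  "pot x t = rho_const DIM('a) p / p * \<bar>t\<bar> powr p - primitive g x t
     - \<mu> / p\<^sup>2 * (\<bar>t\<bar> powr p * (ln (\<bar>t\<bar> powr p) - 1))"

definition (in log_problem) dpot :: "'a \<Rightarrow> real \<Rightarrow> real" where
  "dpot x t = rho_const DIM('a) p * h p t - g x t - \<mu> * (h p t * ln \<bar>t\<bar>)"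

context log_problem
begin

lemma pot_0 [simp]: "pot x 0 = 0"
  by (simp add: pot_def)

lemma has_real_derivative_pot:
  assumes "continuous_on UNIV (g x)"
  shows "(pot x has_real_derivative dpot x t) (at t)"
proof -
  have "((\<lambda>t. rho_const DIM('a) p / p * \<bar>t\<bar> powr p - primitive g x t - \<mu> / p\<^sup>2 * (\<bar>t\<bar> powr p * (ln (\<bar>t\<bar> powr p) - 1)))
    has_real_derivative rho_const DIM('a) p / p * (p * h p t) - g x t - \<mu> / p\<^sup>2 * (p\<^sup>2 * (h p t * ln \<bar>t\<bar>))) (at t)"
    by (intro DERIV_diff DERIV_cmult has_real_derivative_abs_powr has_real_derivative_abs_powr_ln
        has_real_derivative_primitive p assms)
  then show ?thesis using p by (simp add: pot_def[abs_def] dpot_def)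
qed

lemma measurable_pot:
  assumes [measurable]: "u \<in> borel_measurable (lebesgue_on \<Omega>)"
  shows "(\<lambda>x. pot x (u x)) \<in> borel_measurable (lebesgue_on \<Omega>)"
  unfolding pot_def using measurable_primitive_comp[OF assms] by measurable

lemma measurable_dpot:
  assumes [measurable]: "u \<in> borel_measurable (lebesgue_on \<Omega>)"
  shows "(\<lambda>x. dpot x (u x)) \<in> borel_measurable (lebesgue_on \<Omega>)"
  unfolding dpot_def using measurable_g_comp[OF assms] by measurable

text \<open>Two variables are allowed because the bound is used with
  \<open>s = \<bar>u x\<bar> + \<bar>v x\<bar>\<close>, both for products
  \<open>dpot x (u x) * v x\<close> and for intermediate points of the mean value theorem.\<close>

lemma dpot_mult_bound:
  "\<exists>C>0. AE x in lebesgue_on \<Omega>. \<forall>t s. \<bar>t\<bar> \<le> \<bar>s\<bar> \<longrightarrow> \<bar>dpot x t\<bar> * \<bar>s\<bar> \<le> C * pot_growth p s"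
proof -
  obtain C1 where C1: "0 < C1" "AE x in lebesgue_on \<Omega>. \<forall>t. \<bar>g x t\<bar> \<le> \<bar>t\<bar> powr (p - 1) * (1 * ln (1 + \<bar>t\<bar>) + C1)"
    using growth[of 1] by auto
  define R where "R = \<bar>rho_const DIM('a) p\<bar>"
  define C where "C = R + C1 + \<bar>\<mu>\<bar> + 1 + 2 * (\<bar>\<mu>\<bar> / (p - 1))"
  have "0 < C" unfolding C_def R_def using C1 p by (simp add: add_pos_nonneg)
  moreover have "AE x in lebesgue_on \<Omega>. \<forall>t s. \<bar>t\<bar> \<le> \<bar>s\<bar> \<longrightarrow> \<bar>dpot x t\<bar> * \<bar>s\<bar> \<le> C * pot_growth p s"
    using C1(2)
  proof eventually_elim
    case (elim x)
    show ?case
    proof (intro allI impI)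
      fix t s :: real assume ts: "\<bar>t\<bar> \<le> \<bar>s\<bar>"
      define a where "a = \<bar>t\<bar>"
      define b where "b = \<bar>s\<bar>"
      have ab: "0 \<le> a" "a \<le> b" using ts by (auto simp: a_def b_def)
      define L where "L = ln (1 + b)"
      have L0: "0 \<le> L" "ln (1 + a) \<le> L" using ab by (auto simp: L_def)
      \<comment> \<open>For \<open>a \<le> 1\<close> the logarithm is unbounded but tamed by the
        positive power; beyond 1 it is controlled by \<open>ln (1 + b)\<close>.\<close>
      have aln: "a powr (p - 1) * \<bar>ln a\<bar> \<le> b powr (p - 1) * L + 1 / (p - 1)"
      proof (cases "a \<le> 1")
        case True
        have "a powr (p - 1) * \<bar>ln a\<bar> \<le> 1 / (p - 1)" using powr_abs_ln_le[of "p - 1" a] p True ab by simp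
        then show ?thesis using L0 by (simp add: add_increasing)
      next
        case False
        have "\<bar>ln a\<bar> \<le> L" using False ab by (simp add: L_def)
        then have "a powr (p - 1) * \<bar>ln a\<bar> \<le> b powr (p - 1) * L" using ab p by (intro mult_mono powr_mono2) auto
        then show ?thesis using p by (simp add: add_increasing2)
      qed
      have P: "a powr (p - 1) \<le> b powr (p - 1)" using ab p by (intro powr_mono2) auto
      have "\<bar>dpot x t\<bar> \<le> R * a powr (p - 1) + \<bar>g x t\<bar> + \<bar>\<mu>\<bar> * (a powr (p - 1) * \<bar>ln a\<bar>)"
        unfolding dpot_def R_def a_def
        by (rule order_trans[OF abs_triangle_ineq4]) (intro add_mono order_trans[OF abs_triangle_ineq4], simp_all add: abs_mult abs_h)
      also have "\<bar>g x t\<bar> \<le> a powr (p - 1) * (ln (1 + a) + C1)" using elim[rule_format, of t] by (simp add: a_def)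
      also have "\<dots> \<le> b powr (p - 1) * (L + C1)" using P L0 ab C1 by (intro mult_mono) auto
      also have "R * a powr (p - 1) \<le> R * b powr (p - 1)" using P by (intro mult_left_mono) (simp_all add: R_def)
      finally have "\<bar>dpot x t\<bar> \<le> R * b powr (p - 1) + b powr (p - 1) * (L + C1) + \<bar>\<mu>\<bar> * (b powr (p - 1) * L + 1 / (p - 1))"
        using mult_left_mono[OF aln, of "\<bar>\<mu>\<bar>"] by linarith
      then have "\<bar>dpot x t\<bar> * b \<le> (R * b powr (p - 1) + b powr (p - 1) * (L + C1) + \<bar>\<mu>\<bar> * (b powr (p - 1) * L + 1 / (p - 1))) * b"
        using ab by (intro mult_right_mono) auto
      also have "\<dots> = (R + C1) * (b powr (p - 1) * b) + (1 + \<bar>\<mu>\<bar>) * ((b powr (p - 1) * b) * L) + \<bar>\<mu>\<bar> / (p - 1) * b"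
        by (simp add: algebra_simps)
      also have "b powr (p - 1) * b = b powr p" using ab by (intro powr_minus_one_mult_self) auto
      \<comment> \<open>The constant from small \<open>a\<close> was multiplied by \<open>b\<close>;
        a linear term lies below \<open>1 + b powr p\<close>.\<close>
      also have "\<bar>\<mu>\<bar> / (p - 1) * b \<le> \<bar>\<mu>\<bar> / (p - 1) * (1 + b powr p)"
      proof (intro mult_left_mono)
        show "b \<le> 1 + b powr p"
        proof (cases "b \<le> 1")
          case False
          then have "b powr 1 \<le> b powr p" using p by (intro powr_mono) auto
          then show ?thesis using False by simp
        qed (simp add: add_increasing2)
      qed (use p in simp)
      also have "(R + C1) * b powr p + (1 + \<bar>\<mu>\<bar>) * (b powr p * L) + \<bar>\<mu>\<bar> / (p - 1) * (1 + b powr p)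
        \<le> C * b powr p + C * (b powr p * L) + C * 1"
      proof -
        have "\<bar>\<mu>\<bar> / (p - 1) \<ge> 0" using p by simp
        then have "R + C1 + \<bar>\<mu>\<bar> / (p - 1) \<le> C" "1 + \<bar>\<mu>\<bar> \<le> C" "\<bar>\<mu>\<bar> / (p - 1) \<le> C"
          unfolding C_def R_def using C1(1) by linarith+
        then have "(R + C1 + \<bar>\<mu>\<bar> / (p - 1)) * b powr p \<le> C * b powr p" "(1 + \<bar>\<mu>\<bar>) * (b powr p * L) \<le> C * (b powr p * L)"
          "\<bar>\<mu>\<bar> / (p - 1) \<le> C" using L0 by (auto intro!: mult_right_mono)
        then show ?thesis by (simp add: algebra_simps add_divide_distrib)
      qed
      also have "\<dots> = C * pot_growth p s" by (simp add: pot_growth_def L_def b_def algebra_simps)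
      finally show "\<bar>dpot x t\<bar> * \<bar>s\<bar> \<le> C * pot_growth p s" by (simp add: b_def)
    qed
  qed
  ultimately show ?thesis by blast
qed

text \<open>The mean value theorem along the segment from \<open>a\<close> to
  \<open>a + s * b\<close>. Being linear in \<open>\<bar>s\<bar>\<close>, the bound dominates the
  difference quotients of the local energy.\<close>

lemma pot_diff_bound:
  "\<exists>C>0. AE x in lebesgue_on \<Omega>. \<forall>a b s. \<bar>s\<bar> \<le> 1 \<longrightarrow> \<bar>pot x (a + s * b) - pot x a\<bar> \<le> \<bar>s\<bar> * (C * pot_growth p (\<bar>a\<bar> + \<bar>b\<bar>))"
proof -
  obtain C where C: "0 < C" "AE x in lebesgue_on \<Omega>. \<forall>t s. \<bar>t\<bar> \<le> \<bar>s\<bar> \<longrightarrow> \<bar>dpot x t\<bar> * \<bar>s\<bar> \<le> C * pot_growth p s"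
    using dpot_mult_bound by blast
  have "AE x in lebesgue_on \<Omega>. \<forall>a b s. \<bar>s\<bar> \<le> 1 \<longrightarrow> \<bar>pot x (a + s * b) - pot x a\<bar> \<le> \<bar>s\<bar> * (C * pot_growth p (\<bar>a\<bar> + \<bar>b\<bar>))"
    using C(2) AE_continuous
  proof eventually_elim
    case (elim x)
    show ?case
    proof (intro allI impI)
      fix a b s :: real assume s: "\<bar>s\<bar> \<le> 1"
      let ?m = "\<bar>a\<bar> + \<bar>b\<bar>"
      have sb: "\<bar>s * b\<bar> \<le> \<bar>b\<bar>" using s by (simp add: abs_mult mult_left_le_one_le)
      have D: "DERIV (\<lambda>r. pot x (a + r * (s * b))) r :> dpot x (a + r * (s * b)) * (s * b)" for r
        by (rule DERIV_chain2[OF has_real_derivative_pot[OF elim(2)]]) (auto intro!: derivative_eq_intros)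
      obtain r where r: "0 < r" "r < 1" "pot x (a + 1 * (s * b)) - pot x (a + 0 * (s * b)) = (1 - 0) * (dpot x (a + r * (s * b)) * (s * b))"
        using MVT2[of 0 1 "\<lambda>r. pot x (a + r * (s * b))", OF _ D] by auto
      have "\<bar>r * (s * b)\<bar> \<le> \<bar>b\<bar>" using r sb by (simp add: abs_mult) (meson abs_ge_zero less_eq_real_def mult_left_le_one_le order_trans mult_nonneg_nonneg)
      then have "\<bar>a + r * (s * b)\<bar> \<le> \<bar>?m\<bar>" by linarith
      then have *: "\<bar>dpot x (a + r * (s * b))\<bar> * \<bar>?m\<bar> \<le> C * pot_growth p ?m" using elim(1) by blast
      have "\<bar>pot x (a + s * b) - pot x a\<bar> = \<bar>s\<bar> * (\<bar>dpot x (a + r * (s * b))\<bar> * \<bar>b\<bar>)"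
        using r by (simp add: abs_mult mult_ac)
      also have "\<dots> \<le> \<bar>s\<bar> * (\<bar>dpot x (a + r * (s * b))\<bar> * \<bar>?m\<bar>)"
        by (intro mult_left_mono) auto
      also have "\<dots> \<le> \<bar>s\<bar> * (C * pot_growth p ?m)" using * by (intro mult_left_mono) auto
      finally show "\<bar>pot x (a + s * b) - pot x a\<bar> \<le> \<bar>s\<bar> * (C * pot_growth p (\<bar>a\<bar> + \<bar>b\<bar>))" .
    qed
  qed
  with C(1) show ?thesis by blast
qed

lemma pot_bound:
  "\<exists>C>0. AE x in lebesgue_on \<Omega>. \<forall>t. \<bar>pot x t\<bar> \<le> C * pot_growth p t"
proof -
  obtain C where C: "0 < C" "AE x in lebesgue_on \<Omega>. \<forall>a b s. \<bar>s\<bar> \<le> 1 \<longrightarrow> \<bar>pot x (a + s * b) - pot x a\<bar> \<le> \<bar>s\<bar> * (C * pot_growth p (\<bar>a\<bar> + \<bar>b\<bar>))"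
    using pot_diff_bound by blast
  have "AE x in lebesgue_on \<Omega>. \<forall>t. \<bar>pot x t\<bar> \<le> C * pot_growth p t"
    using C(2)
  proof eventually_elim
    case (elim x)
    show ?case
    proof
      fix t
      show "\<bar>pot x t\<bar> \<le> C * pot_growth p t"
        using elim[rule_format, of 1 0 t] by (simp add: pot_growth_def)
    qed
  qed
  with C(1) show ?thesis by blast
qed

lemma integrable_pot_growth:
  assumes u: "u \<in> X"
  shows "integrable (lebesgue_on \<Omega>) (\<lambda>x. pot_growth p (u x))"
proof -
  have "integrable (lebesgue_on \<Omega>) (\<lambda>x. \<bar>u x\<bar> powr p)" "integrable (lebesgue_on \<Omega>) (\<lambda>x. \<bar>u x\<bar> powr p * ln (1 + \<bar>u x\<bar>))"
    using X_powr[OF u] log_sobolev[OF u] by (subst restrict_Omega; simp add: X_zero[OF u])+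
  then show ?thesis unfolding pot_growth_def
    by (intro Bochner_Integration.integrable_add finite_measure.integrable_const[OF finite_measure_Omega])
qed

lemma X_measurable_Omega [measurable_dest]: "u \<in> X \<Longrightarrow> u \<in> borel_measurable (lebesgue_on \<Omega>)"
  using restrict_Omega(3)[of u] X_zero X_measurable by blast

lemma integrable_pot:
  assumes u: "u \<in> X"
  shows "integrable (lebesgue_on \<Omega>) (\<lambda>x. pot x (u x))"
proof -
  obtain C where C: "0 < C" "AE x in lebesgue_on \<Omega>. \<forall>t. \<bar>pot x t\<bar> \<le> C * pot_growth p t"
    using pot_bound by blast
  have "integrable (lebesgue_on \<Omega>) (\<lambda>x. C * pot_growth p (u x))" using integrable_pot_growth[OF u] by simp
  then show ?thesis
  proof (rule Bochner_Integration.integrable_bound)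
    show "(\<lambda>x. pot x (u x)) \<in> borel_measurable (lebesgue_on \<Omega>)" by (rule measurable_pot[OF X_measurable_Omega[OF u]])
    show "AE x in lebesgue_on \<Omega>. norm (pot x (u x)) \<le> norm (C * pot_growth p (u x))"
      using C(2) by eventually_elim (auto intro: order_trans[OF _ abs_ge_self])
  qed
qed

lemma integrable_X_bound:
  assumes u: "u \<in> X" and m: "f \<in> borel_measurable (lebesgue_on \<Omega>)"
    and b: "AE x in lebesgue_on \<Omega>. \<bar>f x\<bar> \<le> C * pot_growth p (u x)"
  shows "integrable (lebesgue_on \<Omega>) (f :: 'a \<Rightarrow> real)"
proof -
  have "integrable (lebesgue_on \<Omega>) (\<lambda>x. C * pot_growth p (u x))" using integrable_pot_growth[OF u] by simp
  then show ?thesis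
    by (rule Bochner_Integration.integrable_bound[OF _ m]) (use b in \<open>eventually_elim, auto intro: order_trans[OF _ abs_ge_self]\<close>)
qed

lemma powr_ln_bound: "\<bar>\<bar>t\<bar> powr p * (ln (\<bar>t\<bar> powr p) - 1)\<bar> \<le> (p + 1) * pot_growth p t"
proof -
  have *: "\<bar>t\<bar> powr p * \<bar>ln \<bar>t\<bar>\<bar> \<le> pot_growth p t"
  proof (cases "\<bar>t\<bar> \<le> 1")
    case True
    have "1 / p \<le> 1" using p by simp
    then show ?thesis using powr_abs_ln_le[of p t] p True pot_growth_ge_1[of p t] by linarith
  next
    case False
    then have "\<bar>t\<bar> powr p * \<bar>ln \<bar>t\<bar>\<bar> \<le> \<bar>t\<bar> powr p * ln (1 + \<bar>t\<bar>)" by (intro mult_left_mono) auto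
    then show ?thesis by (simp add: pot_growth_def add_increasing)
  qed
  have "\<bar>\<bar>t\<bar> powr p * (ln (\<bar>t\<bar> powr p) - 1)\<bar> = \<bar>\<bar>t\<bar> powr p * (p * ln \<bar>t\<bar> - 1)\<bar>"
    by (cases "t = 0") (auto simp: ln_powr)
  also have "\<dots> \<le> p * (\<bar>t\<bar> powr p * \<bar>ln \<bar>t\<bar>\<bar>) + \<bar>t\<bar> powr p"
    using abs_triangle_ineq4[of "p * (\<bar>t\<bar> powr p * ln \<bar>t\<bar>)" "\<bar>t\<bar> powr p"] p
    by (simp add: abs_mult algebra_simps)
  also have "\<dots> \<le> p * pot_growth p t + pot_growth p t"
    using * p by (intro add_mono mult_left_mono) (auto simp: pot_growth_def add_increasing)
  finally show ?thesis by (simp add: algebra_simps)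
qed

lemma integrable_powr_ln:
  assumes u: "u \<in> X"
  shows "integrable (lebesgue_on \<Omega>) (\<lambda>x. \<bar>u x\<bar> powr p * (ln (\<bar>u x\<bar> powr p) - 1))"
proof (rule integrable_X_bound[OF u])
  note [measurable] = X_measurable_Omega[OF u]
  show "(\<lambda>x. \<bar>u x\<bar> powr p * (ln (\<bar>u x\<bar> powr p) - 1)) \<in> borel_measurable (lebesgue_on \<Omega>)" by measurable
qed (rule AE_I2, rule powr_ln_bound)

lemma X_powr_Omega: "u \<in> X \<Longrightarrow> integrable (lebesgue_on \<Omega>) (\<lambda>x. \<bar>u x\<bar> powr p)"
  using X_powr restrict_Omega(2)[of "\<lambda>x. \<bar>u x\<bar> powr p"] by (simp add: X_zero)

lemma integrable_primitive:
  assumes u: "u \<in> X"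
  shows "integrable (lebesgue_on \<Omega>) (\<lambda>x. primitive g x (u x))"
proof -
  have "integrable (lebesgue_on \<Omega>) (\<lambda>x. rho_const DIM('a) p / p * \<bar>u x\<bar> powr p - \<mu> / p\<^sup>2 * (\<bar>u x\<bar> powr p * (ln (\<bar>u x\<bar> powr p) - 1)) - pot x (u x))"
    using integrable_pot[OF u] integrable_powr_ln[OF u] X_powr_Omega[OF u]
    by (intro Bochner_Integration.integrable_diff integrable_mult_right)
  then show ?thesis by (simp add: pot_def)
qed

abbreviation near_energy where
  "near_energy u \<equiv> LINT z|near. \<bar>u (fst z) - u (snd z :: 'a)\<bar> powr p"

abbreviation far_energy where
  "far_energy u \<equiv> LINT z|far \<Omega>. \<bar>u (fst z) - u (snd z)\<bar> powr p - \<bar>u (fst z)\<bar> powr p - \<bar>u (snd z)\<bar> powr p"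

abbreviation J where "J \<equiv> J_energy p \<Omega> g \<mu>"

lemma J_eq:
  assumes u: "u \<in> X"
  shows "J u = cN / p * (near_energy u + far_energy u) + (LINT x|lebesgue_on \<Omega>. pot x (u x))"
proof -
  have "(LINT x|lebesgue_on \<Omega>. pot x (u x)) = rho_const DIM('a) p / p * (LINT x|lebesgue_on \<Omega>. \<bar>u x\<bar> powr p)
    - (LINT x|lebesgue_on \<Omega>. primitive g x (u x)) - \<mu> / p\<^sup>2 * (LINT x|lebesgue_on \<Omega>. \<bar>u x\<bar> powr p * (ln (\<bar>u x\<bar> powr p) - 1))"
    unfolding pot_def using X_powr_Omega[OF u] integrable_primitive[OF u] integrable_powr_ln[OF u]
    by (simp add: Bochner_Integration.integral_diff)
  then show ?thesis by (simp add: J_energy_def E_form_diag[OF u] algebra_simps add_divide_distrib)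
qed

text \<open>
  The logarithm has a negative coefficient \<open>\<mu>\<close>, so it dominates every multiple of \<open>\<bar>t\<bar>\<^sup>p\<close> at infinity.
\<close>

lemma pot_coercive:
  "\<exists>M\<ge>1. AE x in lebesgue_on \<Omega>. \<forall>t. M \<le> \<bar>t\<bar> \<longrightarrow>
     K * (\<bar>t\<bar> powr p - M powr p) \<le> pot x t - pot x (max (- M) (min M t))"
proof -
  \<comment> \<open>Half of the logarithmic term pays for the growth of \<open>g\<close>, the other
    half remains for coercivity.\<close>
  define \<epsilon> where "\<epsilon> = - \<mu> / 2"
  have e: "0 < \<epsilon>" using mu by (simp add: \<epsilon>_def)
  obtain C where C: "0 < C" "AE x in lebesgue_on \<Omega>. \<forall>t. \<bar>g x t\<bar> \<le> \<bar>t\<bar> powr (p - 1) * (\<epsilon> * ln (1 + \<bar>t\<bar>) + C)"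
    using growth[OF e] by auto
  define R where "R = \<bar>rho_const DIM('a) p\<bar> + C + \<epsilon> * ln 2 + \<bar>K * p\<bar>"
  \<comment> \<open>Beyond this level \<open>\<epsilon> * ln \<bar>t\<bar>\<close> exceeds
    \<open>R\<close>, the sum of all constants that stand in front of
    \<open>\<bar>t\<bar> powr (p - 1)\<close>.\<close>
  define M where "M = max 1 (exp (R / \<epsilon>))"
  have M1: "1 \<le> M" by (simp add: M_def)
  have "AE x in lebesgue_on \<Omega>. \<forall>t. M \<le> \<bar>t\<bar> \<longrightarrow>
     K * (\<bar>t\<bar> powr p - M powr p) \<le> pot x t - pot x (max (- M) (min M t))"
    using C(2) AE_continuous
  proof eventually_elim
    case (elim x)
    have key: "K * p * \<bar>t\<bar> powr (p - 1) \<le> sgn t * dpot x t" if "M \<le> \<bar>t\<bar>" for t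
    proof -
      define a where "a = \<bar>t\<bar>"
      have a: "1 \<le> a" "M \<le> a" using that M1 by (auto simp: a_def)
      have "R / \<epsilon> \<le> ln a"
        using a by (simp add: M_def ln_ge_iff)
      then have RL: "R \<le> \<epsilon> * ln a" using e by (simp add: field_simps)
      have "ln (1 + a) \<le> ln (2 * a)" using a by simp
      then have l2: "ln (1 + a) \<le> ln 2 + ln a" using a by (simp add: ln_mult)
      have "sgn t * dpot x t = rho_const DIM('a) p * a powr (p - 1) - sgn t * g x t - \<mu> * (a powr (p - 1) * ln a)"
        using a by (cases "0 < t") (auto simp: dpot_def h_sgn a_def algebra_simps)
      moreover have "sgn t * g x t \<le> a powr (p - 1) * (\<epsilon> * ln (1 + a) + C)"
        using elim(1)[rule_format, of t] a by (auto simp: a_def abs_if sgn_if split: if_splits)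
      moreover have "a powr (p - 1) * (\<epsilon> * ln (1 + a) + C) \<le> a powr (p - 1) * (\<epsilon> * ln 2 + \<epsilon> * ln a + C)"
        using mult_left_mono[OF l2, of \<epsilon>] e by (intro mult_left_mono) (auto simp: algebra_simps)
      moreover have "- \<bar>rho_const DIM('a) p\<bar> * a powr (p - 1) \<le> rho_const DIM('a) p * a powr (p - 1)"
        by (intro mult_right_mono) auto
      moreover have "a powr (p - 1) * R \<le> a powr (p - 1) * (\<epsilon> * ln a)" using RL by (intro mult_left_mono) auto
      moreover have "K * p * a powr (p - 1) \<le> \<bar>K * p\<bar> * a powr (p - 1)" by (intro mult_right_mono) auto
      moreover have "\<mu> = - 2 * \<epsilon>" by (simp add: \<epsilon>_def)
      ultimately show ?thesis unfolding a_def[symmetric] R_def by (simp add: algebra_simps)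
    qed
    show ?case
    proof (intro allI impI)
      fix t assume t: "M \<le> \<bar>t\<bar>"
      \<comment> \<open>By \<open>key\<close>, \<open>q\<close> is monotone in the outward direction
        beyond \<open>M\<close> on either side; comparison with its value at the truncated point is
        the claim.\<close>
      define q where "q s = pot x s - K * \<bar>s\<bar> powr p" for s
      have D: "DERIV q s :> dpot x s - K * (p * h p s)" for s
        unfolding q_def by (intro DERIV_diff DERIV_cmult has_real_derivative_abs_powr has_real_derivative_pot p elim)
      show "K * (\<bar>t\<bar> powr p - M powr p) \<le> pot x t - pot x (max (- M) (min M t))"
      proof (cases "0 \<le> t")
        case True
        have "q M \<le> q t"
        proof (rule DERIV_nonneg_imp_nondecreasing[where f = q and a = M and b = t])
          fix s assume s: "M \<le> s" "s \<le> t"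
          then have "0 \<le> dpot x s - K * (p * h p s)"
            using key[of s] M1 by (simp add: h_sgn)
          then show "\<exists>y. DERIV q s :> y \<and> 0 \<le> y" using D by blast
        qed (use t True in simp)
        then show ?thesis using True t M1 by (simp add: q_def algebra_simps)
      next
        case False
        have "q (- M) \<le> q t"
        proof (rule DERIV_nonpos_imp_nonincreasing[where f = q and a = t and b = "- M"])
          fix s assume s: "t \<le> s" "s \<le> - M"
          then have "dpot x s - K * (p * h p s) \<le> 0"
            using key[of s] M1 by (simp add: h_sgn)
          then show "\<exists>y. DERIV q s :> y \<and> y \<le> 0" using D by blast
        qed (use t False in simp)
        then show ?thesis using False t M1 by (simp add: q_def algebra_simps)
      qed
    qed
  qed
  with M1 show ?thesis by blast
qed

end

subsection \<open>Truncation\<close>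

definition trunc :: "real \<Rightarrow> real \<Rightarrow> real" where
  "trunc M t = max (- M) (min M t)"

lemma abs_trunc_diff: "\<bar>trunc M a - trunc M b\<bar> \<le> \<bar>a - b\<bar>"
  unfolding trunc_def by linarith

lemma abs_trunc_le: "0 \<le> M \<Longrightarrow> \<bar>trunc M a\<bar> \<le> M"
  by (auto simp: trunc_def)

lemma abs_trunc_le_abs: "0 \<le> M \<Longrightarrow> \<bar>trunc M a\<bar> \<le> \<bar>a\<bar>"
  by (auto simp: trunc_def)

lemma trunc_id: "\<bar>a\<bar> \<le> M \<Longrightarrow> trunc M a = a"
  by (auto simp: trunc_def)

lemma abs_trunc_eq: "0 \<le> M \<Longrightarrow> M \<le> \<bar>a\<bar> \<Longrightarrow> \<bar>trunc M a\<bar> = M"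
  by (auto simp: trunc_def)

lemma measurable_trunc [measurable]: "trunc M \<in> borel_measurable borel"
  unfolding trunc_def by measurable

context log_problem
begin

lemma X_trunc: "0 \<le> M \<Longrightarrow> u \<in> X \<Longrightarrow> (\<lambda>x. trunc M (u x)) \<in> X"
  by (rule X_contraction) (auto simp: abs_trunc_diff trunc_def)

lemma near_energy_nonneg: "0 \<le> near_energy u"
  by (rule integral_nonneg_AE) simp

text \<open>Coercivity compares large values with the level \<open>M\<close>, and up to that level
  \<open>pot\<close> is bounded. The coefficient \<open>K\<close> is free and can offset the
  negative far energy.\<close>

lemma pot_lower: "\<exists>C. AE x in lebesgue_on \<Omega>. \<forall>t. K * \<bar>t\<bar> powr p - C \<le> pot x t"
proof -
  obtain M where M: "1 \<le> M" "AE x in lebesgue_on \<Omega>. \<forall>t. M \<le> \<bar>t\<bar> \<longrightarrow>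
     K * (\<bar>t\<bar> powr p - M powr p) \<le> pot x t - pot x (max (- M) (min M t))"
    using pot_coercive by blast
  obtain C where C: "0 < C" "AE x in lebesgue_on \<Omega>. \<forall>t. \<bar>pot x t\<bar> \<le> C * pot_growth p t"
    using pot_bound by blast
  have "AE x in lebesgue_on \<Omega>. \<forall>t. K * \<bar>t\<bar> powr p - (\<bar>K\<bar> * M powr p + C * pot_growth p M) \<le> pot x t"
    using M(2) C(2)
  proof eventually_elim
    case (elim x)
    have small: "- (C * pot_growth p M) \<le> pot x s" if "\<bar>s\<bar> \<le> M" for s
    proof -
      have "C * pot_growth p s \<le> C * pot_growth p M"
        using that p C(1) by (intro mult_left_mono pot_growth_mono) auto
      then show ?thesis using elim(2)[rule_format, of s] by linarith
    qed
    show ?case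
    proof
      fix t
      show "K * \<bar>t\<bar> powr p - (\<bar>K\<bar> * M powr p + C * pot_growth p M) \<le> pot x t"
      proof (cases "M \<le> \<bar>t\<bar>")
        case True
        have "- (C * pot_growth p M) \<le> pot x (max (- M) (min M t))"
          using M(1) by (intro small) auto
        moreover have "K * M powr p \<le> \<bar>K\<bar> * M powr p" by (intro mult_right_mono) auto
        ultimately show ?thesis using elim(1)[rule_format, OF True] by (simp add: algebra_simps)
      next
        case False
        have "K * \<bar>t\<bar> powr p \<le> \<bar>K\<bar> * M powr p" using False p by (intro mult_mono powr_mono2) auto
        then show ?thesis using small[of t] False by simp
      qed
    qed
  qed
  then show ?thesis by blast
qed

lemma far_fst_snd:
  assumes f: "integrable lebesgue f" "\<And>x. 0 \<le> f x" and z: "\<And>x. x \<notin> \<Omega> \<Longrightarrow> f x = (0::real)"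
  shows "integrable (far \<Omega>) (\<lambda>z. f (fst z) + f (snd z))"
    and "(LINT z|far \<Omega>. f (fst z) + f (snd z)) \<le> 2 * measure lebesgue \<Omega> * (LINT x|lebesgue_on \<Omega>. f x)"
  using integral_far_le[OF f lmeasurable_Omega] restrict_Omega(1)[of f] z
  by (auto simp: Bochner_Integration.integral_add)

lemma far_energy_lower:
  assumes u: "u \<in> X"
  shows "- (2 * measure lebesgue \<Omega> * (LINT x|lebesgue_on \<Omega>. \<bar>u x\<bar> powr p)) \<le> far_energy u"
proof -
  note f = far_fst_snd[of "\<lambda>x. \<bar>u x\<bar> powr p", OF X_powr[OF u]]
  have "- (LINT z|far \<Omega>. \<bar>u (fst z)\<bar> powr p + \<bar>u (snd z)\<bar> powr p) \<le> far_energy u"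
    unfolding integral_minus[symmetric]
  proof (rule integral_mono)
    show "integrable (far \<Omega>) (\<lambda>z. - (\<bar>u (fst z)\<bar> powr p + \<bar>u (snd z)\<bar> powr p))"
      using f(1) X_zero[OF u] by (intro Bochner_Integration.integrable_minus) auto
  qed (auto intro: integrable_far_diag[OF u])
  then show ?thesis using f(2) X_zero[OF u] by simp
qed

text \<open>The choice of \<open>K\<close> cancels the worst case of the far energy exactly, so the
  near energy survives undiminished; this bounds the seminorm along minimising sequences.\<close>

lemma J_lower: "\<exists>B. \<forall>u\<in>X. cN / p * near_energy u - B \<le> J u"
proof -
  define K where "K = cN / p * (2 * measure lebesgue \<Omega>)"
  obtain C where C: "AE x in lebesgue_on \<Omega>. \<forall>t. K * \<bar>t\<bar> powr p - C \<le> pot x t"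
    using pot_lower by blast
  interpret finite_measure "lebesgue_on \<Omega>" by (rule finite_measure_Omega)
  define B where "B = (LINT x|lebesgue_on \<Omega>. C)"
  have "cN / p * near_energy u - B \<le> J u" if u: "u \<in> X" for u
  proof -
    have i: "integrable (lebesgue_on \<Omega>) (\<lambda>x. K * \<bar>u x\<bar> powr p)"
      using X_powr_Omega[OF u] by simp
    have "(LINT x|lebesgue_on \<Omega>. K * \<bar>u x\<bar> powr p) - B = (LINT x|lebesgue_on \<Omega>. K * \<bar>u x\<bar> powr p - C)"
      unfolding B_def using i by (simp add: Bochner_Integration.integral_diff)
    also have "\<dots> \<le> (LINT x|lebesgue_on \<Omega>. pot x (u x))"
      using i C by (intro integral_mono_AE integrable_pot[OF u] Bochner_Integration.integrable_diff integrable_const)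
        (auto elim: eventually_mono)
    finally have "K * (LINT x|lebesgue_on \<Omega>. \<bar>u x\<bar> powr p) - B \<le> (LINT x|lebesgue_on \<Omega>. pot x (u x))"
      by simp
    moreover have "cN / p * (- (2 * measure lebesgue \<Omega> * (LINT x|lebesgue_on \<Omega>. \<bar>u x\<bar> powr p))) \<le> cN / p * far_energy u"
      using cN_pos p by (intro mult_left_mono far_energy_lower[OF u]) auto
    ultimately show ?thesis unfolding J_eq[OF u] K_def by (simp add: algebra_simps)
  qed
  then show ?thesis by blast
qed

text \<open>
  Truncation does not increase \<open>\<bar>u x - u y\<bar>\<close>, so the far part grows by at most a multiple of
  \<open>\<bar>u\<bar>\<^sup>p - \<bar>trunc M u\<bar>\<^sup>p\<close>, and the potential pays for that.
\<close>

lemma J_trunc: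
  "\<exists>M\<ge>1. \<forall>u\<in>X. J (\<lambda>x. trunc M (u x)) + (LINT x|lebesgue_on \<Omega>. \<bar>u x\<bar> powr p - \<bar>trunc M (u x)\<bar> powr p) \<le> J u"
proof -
  \<comment> \<open>The second summand pays for the far energy. The summand 1 is surplus and leaves
    the \<open>p\<close>-th power defect as a strict gain.\<close>
  define K where "K = 1 + cN / p * (2 * measure lebesgue \<Omega>)"
  obtain M where M: "1 \<le> M" "AE x in lebesgue_on \<Omega>. \<forall>t. M \<le> \<bar>t\<bar> \<longrightarrow>
     K * (\<bar>t\<bar> powr p - M powr p) \<le> pot x t - pot x (max (- M) (min M t))"
    using pot_coercive by blast
  have "J (\<lambda>x. trunc M (u x)) + (LINT x|lebesgue_on \<Omega>. \<bar>u x\<bar> powr p - \<bar>trunc M (u x)\<bar> powr p) \<le> J u" if u: "u \<in> X" for u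
  proof -
    let ?v = "\<lambda>x. trunc M (u x)"
    have v: "?v \<in> X" using u M by (intro X_trunc) auto
    note [measurable] = X_measurable[OF u] X_measurable[OF v]
    define f where "f x = \<bar>u x\<bar> powr p - \<bar>?v x\<bar> powr p" for x
    have f0: "0 \<le> f x" for x using abs_trunc_le_abs[of M "u x"] M p by (simp add: f_def powr_mono2)
    have fz: "f x = 0" if "x \<notin> \<Omega>" for x using that X_zero[OF u] X_zero[OF v] by (simp add: f_def)
    have fi: "integrable lebesgue f" unfolding f_def using X_powr[OF u] X_powr[OF v] by simp
    have fi': "integrable (lebesgue_on \<Omega>) f" using fi restrict_Omega(2)[of f] fz by simp
    have T: "\<bar>?v x - ?v y\<bar> powr p \<le> \<bar>u x - u y\<bar> powr p" for x y
      using abs_trunc_diff[of M "u x" "u y"] p by (intro powr_mono2) auto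
    have near: "near_energy ?v \<le> near_energy u"
      using X_near[OF u] X_near[OF v] T by (intro integral_mono) auto
    have "far_energy ?v - far_energy u = (LINT z|far \<Omega>. (\<bar>?v (fst z) - ?v (snd z)\<bar> powr p - \<bar>?v (fst z)\<bar> powr p - \<bar>?v (snd z)\<bar> powr p)
        - (\<bar>u (fst z) - u (snd z)\<bar> powr p - \<bar>u (fst z)\<bar> powr p - \<bar>u (snd z)\<bar> powr p))"
      by (rule Bochner_Integration.integral_diff[symmetric]) (intro integrable_far_diag u v)+
    also have "\<dots> \<le> (LINT z|far \<Omega>. f (fst z) + f (snd z))"
    proof (rule integral_mono)
      show "integrable (far \<Omega>) (\<lambda>z. f (fst z) + f (snd z))" by (rule far_fst_snd(1)[OF fi f0 fz])
      show "(\<bar>?v (fst z) - ?v (snd z)\<bar> powr p - \<bar>?v (fst z)\<bar> powr p - \<bar>?v (snd z)\<bar> powr p)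
        - (\<bar>u (fst z) - u (snd z)\<bar> powr p - \<bar>u (fst z)\<bar> powr p - \<bar>u (snd z)\<bar> powr p) \<le> f (fst z) + f (snd z)" for z
        using T[of "fst z" "snd z"] by (simp add: f_def)
    qed (intro Bochner_Integration.integrable_diff integrable_far_diag u v)
    also have "\<dots> \<le> 2 * measure lebesgue \<Omega> * (LINT x|lebesgue_on \<Omega>. f x)" by (rule far_fst_snd(2)[OF fi f0 fz])
    finally have far: "far_energy ?v \<le> far_energy u + 2 * measure lebesgue \<Omega> * (LINT x|lebesgue_on \<Omega>. f x)" by simp
    have "K * (LINT x|lebesgue_on \<Omega>. f x) + (LINT x|lebesgue_on \<Omega>. pot x (?v x)) = (LINT x|lebesgue_on \<Omega>. K * f x + pot x (?v x))"
      using fi' integrable_pot[OF v] by (simp add: Bochner_Integration.integral_add)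
    also have "\<dots> \<le> (LINT x|lebesgue_on \<Omega>. pot x (u x))"
    proof (rule integral_mono_AE)
      show "AE x in lebesgue_on \<Omega>. K * f x + pot x (?v x) \<le> pot x (u x)"
        using M(2)
      proof eventually_elim
        case (elim x)
        show ?case
        proof (cases "M \<le> \<bar>u x\<bar>")
          case True
          then show ?thesis using elim[rule_format, OF True] abs_trunc_eq[of M "u x"] M(1)
            by (simp add: f_def trunc_def[symmetric])
        next
          case False
          then show ?thesis by (simp add: trunc_id f_def)
        qed
      qed
      show "integrable (lebesgue_on \<Omega>) (\<lambda>x. K * f x + pot x (?v x))"
        using fi' integrable_pot[OF v] by simp
    qed (rule integrable_pot[OF u])
    finally have pot: "K * (LINT x|lebesgue_on \<Omega>. f x) + (LINT x|lebesgue_on \<Omega>. pot x (?v x)) \<le> (LINT x|lebesgue_on \<Omega>. pot x (u x))" .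
    have "cN / p * (near_energy ?v + far_energy ?v) \<le> cN / p * (near_energy u + (far_energy u + 2 * measure lebesgue \<Omega> * (LINT x|lebesgue_on \<Omega>. f x)))"
      using near far cN_pos p by (intro mult_left_mono) auto
    with pot show ?thesis unfolding J_eq[OF u] J_eq[OF v] f_def[symmetric] K_def
      by (simp add: algebra_simps)
  qed
  with M(1) show ?thesis by blast
qed

definition minimizer :: "('a \<Rightarrow> real) \<Rightarrow> bool" where
  "minimizer u \<longleftrightarrow> u \<in> X \<and> (\<forall>v\<in>X. J u \<le> J v)"

text \<open>A minimiser cannot gain by truncation, so the nonnegative defect in
  \<open>J_trunc\<close> vanishes. The level \<open>M\<close> is the same for all
  minimisers.\<close>

lemma minimizer_bounded: "\<exists>M\<ge>1. \<forall>u. minimizer u \<longrightarrow> (AE x in lebesgue_on \<Omega>. \<bar>u x\<bar> \<le> M)"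
proof -
  obtain M where M: "1 \<le> M" "\<And>u. u \<in> X \<Longrightarrow> J (\<lambda>x. trunc M (u x)) + (LINT x|lebesgue_on \<Omega>. \<bar>u x\<bar> powr p - \<bar>trunc M (u x)\<bar> powr p) \<le> J u"
    using J_trunc by blast
  have "AE x in lebesgue_on \<Omega>. \<bar>u x\<bar> \<le> M" if m: "minimizer u" for u
  proof -
    have u: "u \<in> X" using m by (simp add: minimizer_def)
    let ?v = "\<lambda>x. trunc M (u x)"
    have v: "?v \<in> X" using u M by (intro X_trunc) auto
    define f where "f x = \<bar>u x\<bar> powr p - \<bar>?v x\<bar> powr p" for x
    have f0: "0 \<le> f x" for x using abs_trunc_le_abs[of M "u x"] M p by (simp add: f_def powr_mono2)
    have fi: "integrable (lebesgue_on \<Omega>) f" unfolding f_def using X_powr_Omega[OF u] X_powr_Omega[OF v] by simp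
    have "(LINT x|lebesgue_on \<Omega>. f x) \<le> 0"
      using M(2)[OF u] m v unfolding minimizer_def f_def by fastforce
    then have "(LINT x|lebesgue_on \<Omega>. f x) = 0" using f0 by (intro antisym integral_nonneg_AE) auto
    then have "AE x in lebesgue_on \<Omega>. f x = 0"
      using fi f0 by (subst (asm) integral_nonneg_eq_0_iff_AE) auto
    then show ?thesis
    proof eventually_elim
      case (elim x)
      show ?case
      proof (rule ccontr)
        assume n: "\<not> \<bar>u x\<bar> \<le> M"
        then have "M powr p < \<bar>u x\<bar> powr p" using M(1) p by (intro powr_less_mono2) auto
        then show False using elim n M(1) abs_trunc_eq[of M "u x"] by (simp add: f_def)
      qed
    qed
  qed
  with M(1) show ?thesis by blast
qed

end

subsection \<open>Compactness and existence of a minimiser\<close>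

text \<open>
  The kernel, cut off at distance \<open>2\<^sup>-\<^sup>m\<close>.  It is bounded, but its mass diverges as \<open>m\<close> grows, so that
  the normalised convolution approximates \<open>u\<close> with an error controlled by the seminorm.
\<close>

definition moll :: "nat \<Rightarrow> 'a::euclidean_space \<Rightarrow> real" where
  "moll m z = max 0 (1 - norm z) / max (norm z) (1 / 2 ^ m) ^ DIM('a)"

lemma moll_denominator_pos: "0 < max (norm z) (1 / 2 ^ m :: real) ^ n"
  by (intro zero_less_power max.strict_coboundedI2) simp

lemma moll_nonneg [simp]: "0 \<le> moll m z"
  unfolding moll_def by (intro divide_nonneg_pos moll_denominator_pos) simp

text \<open>This is what keeps the smoothing error under control uniformly in \<open>m\<close>: it
  is measured by the seminorm, whose kernel does not depend on \<open>m\<close>.\<close>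

lemma moll_le_kern:
  fixes z :: "'a::euclidean_space"
  assumes "z \<noteq> 0"
  shows "moll m z \<le> kern z"
proof (cases "norm z \<le> 1")
  case True
  have "moll m z \<le> 1 / max (norm z) (1 / 2 ^ m) ^ DIM('a)"
    unfolding moll_def by (intro divide_right_mono less_imp_le[OF moll_denominator_pos]) auto
  also have "\<dots> \<le> 1 / norm z ^ DIM('a)"
    using assms by (intro divide_left_mono power_mono mult_pos_pos zero_less_power) (auto simp: less_max_iff_disj)
  also have "\<dots> = kern z" using True by (simp add: kern_def)
  finally show ?thesis .
qed (simp add: moll_def)

lemma moll_le:
  fixes z :: "'a::euclidean_space"
  shows "moll m z \<le> (2 ^ m) ^ DIM('a)"
proof -
  have "moll m z \<le> 1 / max (norm z) (1 / 2 ^ m) ^ DIM('a)"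
    unfolding moll_def by (intro divide_right_mono less_imp_le[OF moll_denominator_pos]) auto
  also have "\<dots> \<le> 1 / (1 / 2 ^ m) ^ DIM('a)"
    by (intro divide_left_mono power_mono mult_pos_pos zero_less_power) (auto simp: less_max_iff_disj)
  finally show ?thesis by (simp add: power_divide)
qed

lemma continuous_on_moll: "continuous_on UNIV (moll m :: 'a::euclidean_space \<Rightarrow> real)"
proof -
  have "max (norm z) (1 / 2 ^ m) \<noteq> 0" for z :: 'a
    using zero_less_divide_1_iff[of "2 ^ m :: real"] by (metis max.strict_coboundedI2 less_irrefl zero_less_numeral zero_less_power)
  then show ?thesis unfolding moll_def by (intro continuous_intros) auto
qed

lemma measurable_moll [measurable]: "moll m \<in> borel_measurable borel"
  using continuous_on_moll by (rule borel_measurable_continuous_onI)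

lemma nn_integral_moll_finite: "(\<integral>\<^sup>+(z::'a::euclidean_space). ennreal (moll m z) \<partial>lborel) < \<infinity>"
proof -
  have "(\<integral>\<^sup>+(z::'a). ennreal (moll m z) \<partial>lborel) \<le> (\<integral>\<^sup>+(z::'a). ennreal ((2 ^ m) ^ DIM('a)) * indicator (cball 0 1) z \<partial>lborel)"
    by (intro nn_integral_mono) (auto simp: indicator_def moll_le intro!: ennreal_leI, simp add: moll_def)
  also have "\<dots> = ennreal ((2 ^ m) ^ DIM('a)) * emeasure lborel (cball (0::'a) 1)"
    by (rule nn_integral_cmult_indicator) simp
  also have "\<dots> < \<infinity>"
    using emeasure_lborel_cball_finite[of "0::'a" 1] by (auto simp: ennreal_mult_less_top)
  finally show ?thesis .
qed

definition moll_mass :: "'a::euclidean_space itself \<Rightarrow> nat \<Rightarrow> real" where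
  "moll_mass _ m = (LINT z|lborel. moll m (z :: 'a))"

lemma nn_integral_moll: "(\<integral>\<^sup>+(z::'a::euclidean_space). ennreal (moll m z) \<partial>lborel) = ennreal (moll_mass TYPE('a) m)"
  using nn_integral_moll_finite[where 'a = 'a, of m] unfolding moll_mass_def
  by (intro nn_integral_eq_integral) (auto simp: integrable_iff_bounded)

text \<open>For \<open>1 / 2 ^ m \<le> norm z < 1 / 2\<close> the continuous taper costs at most a
  factor 2, and the kernel mass outside the ball of radius 1/2 is bounded. What remains is the
  divergent mass of the kernel in a half space.\<close>

lemma moll_mass_lower:
  "real m * (ball_vol TYPE('a::euclidean_space) / 4 ^ DIM('a)) - ball_vol TYPE('a) * 2 ^ DIM('a) \<le> 2 * moll_mass TYPE('a) m"
proof -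
  let ?c = "real m * (ball_vol TYPE('a) / 4 ^ DIM('a))" and ?C = "ball_vol TYPE('a) * 2 ^ DIM('a)"
  obtain e :: 'a where e: "norm e = 1" using norm_Basis SOME_Basis by blast
  have A0: "0 \<le> moll_mass TYPE('a) m" unfolding moll_mass_def by (rule integral_nonneg_AE) simp
  have pt: "ennreal (kern z) * indicator {z. 1 / 2 ^ m < z \<bullet> e} z
    \<le> ennreal 2 * ennreal (moll m z) + ennreal (kern z) * indicator {z. 1 / 2 ^ 1 \<le> norm z} z" for z :: 'a
  proof (cases "1 / 2 ^ m < z \<bullet> e \<and> norm z < 1 / 2")
    case True
    have "z \<bullet> e \<le> norm z" using Cauchy_Schwarz_ineq2[of z e] e by auto
    then have "1 / 2 ^ m \<le> norm z" using True by linarith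
    then have "kern z \<le> 2 * moll m z"
      using True by (auto simp: kern_def moll_def max_def divide_right_mono)
    then have "ennreal (kern z) \<le> ennreal 2 * ennreal (moll m z)"
      by (subst ennreal_mult[symmetric]) (auto intro: ennreal_leI)
    then show ?thesis using True by simp
  qed (auto simp: indicator_def)
  have "ennreal ?c \<le> (\<integral>\<^sup>+z. ennreal (kern z) * indicator {z. 1 / 2 ^ m < z \<bullet> e} z \<partial>lborel)"
    by (rule nn_integral_kern_lower[OF e])
  also have "\<dots> \<le> (\<integral>\<^sup>+z. ennreal 2 * ennreal (moll m z) + ennreal (kern z) * indicator {z. 1 / 2 ^ 1 \<le> norm z} z \<partial>(lborel :: 'a measure))"
    by (intro nn_integral_mono pt)
  also have "\<dots> = ennreal 2 * (\<integral>\<^sup>+(z::'a). ennreal (moll m z) \<partial>lborel) + (\<integral>\<^sup>+(z::'a). ennreal (kern z) * indicator {z. 1 / 2 ^ 1 \<le> norm z} z \<partial>lborel)"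
    by (subst nn_integral_add) (auto simp: nn_integral_cmult)
  also have "\<dots> \<le> ennreal 2 * ennreal (moll_mass TYPE('a) m) + ennreal (real 1 * ?C)"
    unfolding nn_integral_moll by (intro add_left_mono nn_integral_kern_upper)
  also have "\<dots> = ennreal (2 * moll_mass TYPE('a) m + ?C)"
    using A0 by (simp add: ennreal_mult)
  finally have "?c \<le> 2 * moll_mass TYPE('a) m + ?C"
    using A0 by (subst (asm) ennreal_le_iff) (auto intro: add_nonneg_nonneg)
  then show ?thesis by simp
qed

lemma moll_mass_large: "\<exists>m. B < moll_mass TYPE('a::euclidean_space) m"
proof -
  let ?c = "ball_vol TYPE('a) / 4 ^ DIM('a)" and ?C = "ball_vol TYPE('a) * 2 ^ DIM('a)"
  have c: "0 < ?c" by simp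
  obtain m :: nat where "(2 * B + ?C) / ?c < real m" using reals_Archimedean2 by blast
  then have "2 * B + ?C < real m * ?c" using c by (subst (asm) pos_divide_less_eq) auto
  then show ?thesis using moll_mass_lower[where 'a = 'a, of m] by (intro exI[of _ m]) linarith
qed

text \<open>Differences beyond \<open>\<delta>\<close> are paid for by their \<open>p\<close>-th
  power. An error in the mean is thus traded for the seminorm plus a term as small as
  desired.\<close>

lemma abs_le_delta_powr:
  fixes d \<delta> :: real
  assumes "1 < p" "0 < \<delta>"
  shows "\<bar>d\<bar> \<le> \<delta> + \<delta> powr (1 - p) * \<bar>d\<bar> powr p"
proof (cases "\<bar>d\<bar> \<le> \<delta>")
  case False
  have "\<bar>d\<bar> = \<delta> powr (1 - p) * (\<delta> powr (p - 1) * \<bar>d\<bar>)"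
    using assms powr_add[of \<delta> "1 - p" "p - 1"] by simp
  also have "\<dots> \<le> \<delta> powr (1 - p) * (\<bar>d\<bar> powr (p - 1) * \<bar>d\<bar>)"
    using False assms by (intro mult_left_mono mult_right_mono powr_mono2) auto
  also have "\<dots> = \<delta> powr (1 - p) * \<bar>d\<bar> powr p" by (simp add: powr_minus_one_mult_self)
  finally show ?thesis using assms by linarith
qed (simp add: add_increasing2)

context log_space
begin

text \<open>Left unnormalised; comparisons are made with \<open>moll_mass\<close> times
  \<open>u\<close>, and the division takes place only at the end.\<close>

definition mollify :: "nat \<Rightarrow> ('a \<Rightarrow> real) \<Rightarrow> 'a \<Rightarrow> real" where
  "mollify m u x = (LINT y|lebesgue_on \<Omega>. u y * moll m (x - y))"

lemma measurable_id_Omega [measurable]: "(\<lambda>x. x) \<in> borel_measurable (lebesgue_on \<Omega>)"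
  by (rule measurable_restrict_space1) simp

context
  fixes u :: "'a \<Rightarrow> real" and M :: real
  assumes um: "u \<in> borel_measurable (lebesgue_on \<Omega>)" and ub: "\<And>x. \<bar>u x\<bar> \<le> M"
begin

lemma M_nonneg: "0 \<le> M"
  using ub[of undefined] by linarith

lemma integrable_mollify: "integrable (lebesgue_on \<Omega>) (\<lambda>y. u y * moll m (x - y))"
proof (rule finite_measure.integrable_const_bound[OF finite_measure_Omega, where B = "M * (2 ^ m) ^ DIM('a)"])
  note [measurable] = um
  show "(\<lambda>y. u y * moll m (x - y)) \<in> borel_measurable (lebesgue_on \<Omega>)" by measurable
  show "AE y in lebesgue_on \<Omega>. norm (u y * moll m (x - y)) \<le> M * (2 ^ m) ^ DIM('a)"
    using ub M_nonneg by (auto intro!: AE_I2 mult_mono simp: abs_mult moll_le)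
qed

lemma abs_mollify_le: "\<bar>mollify m u x\<bar> \<le> (2 ^ m) ^ DIM('a) * (M * measure lebesgue \<Omega>)"
proof -
  have "\<bar>mollify m u x\<bar> \<le> (LINT y|lebesgue_on \<Omega>. \<bar>u y * moll m (x - y)\<bar>)"
    unfolding mollify_def by (rule integral_abs_bound)
  also have "\<dots> \<le> (LINT y|lebesgue_on \<Omega>. M * (2 ^ m) ^ DIM('a))"
    using integrable_mollify ub M_nonneg
    by (intro integral_mono integrable_abs finite_measure.integrable_const[OF finite_measure_Omega])
      (auto intro!: mult_mono simp: abs_mult moll_le)
  also have "\<dots> = (2 ^ m) ^ DIM('a) * (M * measure lebesgue \<Omega>)"
    by (simp add: measure_restrict_space)
  finally show ?thesis .
qed

text \<open>Since \<open>u\<close> enters the right-hand side only through \<open>M\<close>, this is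
  equicontinuity of the mollified family for fixed \<open>m\<close>.\<close>

lemma mollify_diff_le:
  "\<bar>mollify m u x - mollify m u x'\<bar> \<le> M * (LINT y|lebesgue_on \<Omega>. \<bar>moll m (x - y) - moll m (x' - y)\<bar>)"
proof -
  have i: "integrable (lebesgue_on \<Omega>) (\<lambda>y. \<bar>moll m (x - y) - moll m (x' - y)\<bar>)"
  proof (rule finite_measure.integrable_const_bound[OF finite_measure_Omega, where B = "2 * (2 ^ m) ^ DIM('a)"])
    have "\<bar>moll m (x - y) - moll m (x' - y)\<bar> \<le> 2 * (2 ^ m) ^ DIM('a)" for y
      using moll_le[of m "x - y"] moll_le[of m "x' - y"] moll_nonneg[of m "x - y"] moll_nonneg[of m "x' - y"] by linarith
    then show "AE y in lebesgue_on \<Omega>. norm \<bar>moll m (x - y) - moll m (x' - y)\<bar> \<le> 2 * (2 ^ m) ^ DIM('a)" by simp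
  qed measurable
  have "mollify m u x - mollify m u x' = (LINT y|lebesgue_on \<Omega>. u y * moll m (x - y) - u y * moll m (x' - y))"
    unfolding mollify_def by (rule Bochner_Integration.integral_diff[symmetric]) (rule integrable_mollify)+
  also have "\<bar>\<dots>\<bar> \<le> (LINT y|lebesgue_on \<Omega>. \<bar>u y * moll m (x - y) - u y * moll m (x' - y)\<bar>)"
    by (rule integral_abs_bound)
  also have "\<dots> \<le> (LINT y|lebesgue_on \<Omega>. M * \<bar>moll m (x - y) - moll m (x' - y)\<bar>)"
  proof (rule integral_mono)
    show "integrable (lebesgue_on \<Omega>) (\<lambda>y. \<bar>u y * moll m (x - y) - u y * moll m (x' - y)\<bar>)"
      by (intro integrable_abs Bochner_Integration.integrable_diff integrable_mollify)
    show "\<bar>u y * moll m (x - y) - u y * moll m (x' - y)\<bar> \<le> M * \<bar>moll m (x - y) - moll m (x' - y)\<bar>" for y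
      using ub by (simp add: right_diff_distrib[symmetric] abs_mult mult_right_mono)
  qed (use i in simp)
  finally show ?thesis by simp
qed

lemma integrable_bounded_Omega: "integrable (lebesgue_on \<Omega>) u"
  by (rule finite_measure.integrable_const_bound[OF finite_measure_Omega, where B = M]) (use ub um in auto)

lemma measurable_mollify: "mollify m u \<in> borel_measurable (lebesgue_on \<Omega>)"
proof -
  note [measurable] = um
  interpret finite_measure "lebesgue_on \<Omega>" by (rule finite_measure_Omega)
  have "(\<lambda>z. u (snd z) * moll m (fst z - snd z)) \<in> borel_measurable (lebesgue_on \<Omega> \<Otimes>\<^sub>M lebesgue_on \<Omega>)"
    by measurable
  then show ?thesis unfolding mollify_def
    by (intro borel_measurable_lebesgue_integral) (simp add: case_prod_beta)
qed

end

text \<open>The difference is the integral of \<open>(u x - u y) * moll m (x - y)\<close> over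
  \<open>y\<close>. The part with \<open>\<delta>\<close> carries the full mass, the rest is bounded
  by the seminorm independently of \<open>m\<close>; after division by the diverging mass only
  \<open>\<delta>\<close> remains.\<close>

lemma mollify_L1:
  assumes u: "u \<in> X" and ub: "\<And>x. \<bar>u x\<bar> \<le> M" and \<delta>: "0 < \<delta>"
  defines "E \<equiv> (LINT z|near. \<bar>u (fst z) - u (snd z)\<bar> powr p)"
  shows "(LINT x|lebesgue_on \<Omega>. \<bar>moll_mass TYPE('a) m * u x - mollify m u x\<bar>)
    \<le> \<delta> * moll_mass TYPE('a) m * measure lebesgue \<Omega> + \<delta> powr (1 - p) * E"
proof -
  let ?A = "moll_mass TYPE('a) m"
  note [measurable] = X_measurable[OF u]
  have um: "u \<in> borel_measurable (lebesgue_on \<Omega>)" using restrict_Omega(3)[of u] X_zero[OF u] X_measurable[OF u] by blast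
  have A0: "0 \<le> ?A" unfolding moll_mass_def by (rule integral_nonneg_AE) simp
  have E0: "0 \<le> E" unfolding E_def by (rule integral_nonneg_AE) simp
  have mm: "(\<integral>\<^sup>+y. ennreal (moll m (x - y)) \<partial>lebesgue) = ennreal ?A" for x :: 'a
    using nn_integral_lebesgue_diff[of "\<lambda>z. ennreal (moll m z)" x] nn_integral_moll[where 'a = 'a] by simp
  have moi: "integrable lebesgue (\<lambda>y. moll m (x - y))" and mo: "(LINT y|lebesgue. moll m (x - y)) = ?A" for x :: 'a
  proof -
    show i: "integrable lebesgue (\<lambda>y. moll m (x - y))"
      by (rule integrableI_nonneg) (auto simp: mm)
    have "ennreal (LINT y|lebesgue. moll m (x - y)) = ennreal ?A"
      using mm[of x] i by (subst (asm) nn_integral_eq_integral) auto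
    then show "(LINT y|lebesgue. moll m (x - y)) = ?A" using A0 by (simp add: integral_nonneg_AE)
  qed
  have uy: "integrable lebesgue (\<lambda>y. u y * moll m (x - y))" and uy': "(LINT y|lebesgue. u y * moll m (x - y)) = mollify m u x" for x
    using integrable_mollify[OF um ub, of m x] restrict_Omega(1,2)[of "\<lambda>y. u y * moll m (x - y)"] X_zero[OF u]
    by (auto simp: mollify_def)
  have pt: "ennreal \<bar>?A * u x - mollify m u x\<bar> \<le> ennreal (\<delta> * ?A) + ennreal (\<delta> powr (1 - p)) * (\<integral>\<^sup>+y. ennreal (kern (x - y)) * ennreal (\<bar>u x - u y\<bar> powr p) \<partial>lebesgue)" for x
  proof -
    have "?A * u x - mollify m u x = (LINT y|lebesgue. u x * moll m (x - y) - u y * moll m (x - y))"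
      using moi[of x] uy[of x] by (subst Bochner_Integration.integral_diff) (auto simp: mo uy')
    also have "\<dots> = (LINT y|lebesgue. (u x - u y) * moll m (x - y))"
      by (simp add: algebra_simps)
    finally have "ennreal \<bar>?A * u x - mollify m u x\<bar> \<le> (\<integral>\<^sup>+y. ennreal (norm ((u x - u y) * moll m (x - y))) \<partial>lebesgue)"
      using integral_norm_bound_ennreal[of lebesgue "\<lambda>y. (u x - u y) * moll m (x - y)"] moi[of x] uy[of x]
      by (simp add: left_diff_distrib)
    also have "\<dots> \<le> (\<integral>\<^sup>+y. ennreal \<delta> * ennreal (moll m (x - y)) + ennreal (\<delta> powr (1 - p)) * (ennreal (kern (x - y)) * ennreal (\<bar>u x - u y\<bar> powr p)) \<partial>lebesgue)"
    proof (intro nn_integral_mono)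
      fix y
      show "ennreal (norm ((u x - u y) * moll m (x - y)))
        \<le> ennreal \<delta> * ennreal (moll m (x - y)) + ennreal (\<delta> powr (1 - p)) * (ennreal (kern (x - y)) * ennreal (\<bar>u x - u y\<bar> powr p))"
      proof (cases "x = y")
        case False
        have "norm ((u x - u y) * moll m (x - y)) \<le> (\<delta> + \<delta> powr (1 - p) * \<bar>u x - u y\<bar> powr p) * moll m (x - y)"
          using abs_le_delta_powr[OF p \<delta>] by (simp add: abs_mult mult_right_mono)
        also have "\<dots> \<le> \<delta> * moll m (x - y) + \<delta> powr (1 - p) * (kern (x - y) * \<bar>u x - u y\<bar> powr p)"
          using mult_left_mono[OF moll_le_kern[of "x - y" m], of "\<delta> powr (1 - p) * \<bar>u x - u y\<bar> powr p"] False
          by (simp add: algebra_simps)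
        finally show ?thesis using \<delta>
          by (simp add: ennreal_mult[symmetric] ennreal_plus[symmetric] ennreal_leI del: ennreal_plus)
      qed simp
    qed
    also have "\<dots> = ennreal \<delta> * (\<integral>\<^sup>+y. ennreal (moll m (x - y)) \<partial>lebesgue) + ennreal (\<delta> powr (1 - p)) * (\<integral>\<^sup>+y. ennreal (kern (x - y)) * ennreal (\<bar>u x - u y\<bar> powr p) \<partial>lebesgue)"
      by (simp add: nn_integral_add nn_integral_cmult)
    finally show ?thesis using \<delta> A0 by (simp add: mm ennreal_mult)
  qed
  have nE: "(\<integral>\<^sup>+x. \<integral>\<^sup>+y. ennreal (kern (x - y)) * ennreal (\<bar>u x - u y\<bar> powr p) \<partial>lebesgue \<partial>lebesgue) = ennreal E"
    using nn_integral_near(1)[of "\<lambda>z. ennreal (\<bar>u (fst z) - u (snd z)\<bar> powr p)"] X_near[OF u]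
    unfolding E_def by (simp add: nn_integral_eq_integral)
  let ?I = "\<lambda>x. \<integral>\<^sup>+y. ennreal (kern (x - y)) * ennreal (\<bar>u x - u y\<bar> powr p) \<partial>lebesgue"
  have Im: "?I \<in> borel_measurable lebesgue"
    by (intro lebesgue.borel_measurable_nn_integral) (simp add: case_prod_beta)
  have ci: "integrable (lebesgue_on \<Omega>) (\<lambda>x. ?A * u x - mollify m u x)"
  proof (rule finite_measure.integrable_const_bound[OF finite_measure_Omega, where B = "?A * M + (2 ^ m) ^ DIM('a) * (M * measure lebesgue \<Omega>)"])
    have "\<bar>?A * u x - mollify m u x\<bar> \<le> ?A * M + (2 ^ m) ^ DIM('a) * (M * measure lebesgue \<Omega>)" for x
      using abs_mollify_le[OF um ub, of m x] mult_left_mono[OF ub A0, of x] A0 abs_triangle_ineq4[of "?A * u x" "mollify m u x"]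
      by (simp add: abs_mult)
    then show "AE x in lebesgue_on \<Omega>. norm (?A * u x - mollify m u x) \<le> ?A * M + (2 ^ m) ^ DIM('a) * (M * measure lebesgue \<Omega>)" by simp
    show "(\<lambda>x. ?A * u x - mollify m u x) \<in> borel_measurable (lebesgue_on \<Omega>)"
      using um measurable_mollify[OF um ub, of m] by measurable
  qed
  have "ennreal (LINT x|lebesgue_on \<Omega>. \<bar>?A * u x - mollify m u x\<bar>) = (\<integral>\<^sup>+x. ennreal \<bar>?A * u x - mollify m u x\<bar> \<partial>lebesgue_on \<Omega>)"
    using ci by (intro nn_integral_eq_integral[symmetric]) auto
  also have "\<dots> = (\<integral>\<^sup>+x. ennreal \<bar>?A * u x - mollify m u x\<bar> * indicator \<Omega> x \<partial>lebesgue)"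
    by (rule nn_integral_restrict_space) simp
  also have "\<dots> \<le> (\<integral>\<^sup>+x. ennreal (\<delta> * ?A) * indicator \<Omega> x + ennreal (\<delta> powr (1 - p)) * ?I x \<partial>lebesgue)"
    using pt by (intro nn_integral_mono) (auto simp: indicator_def)
  also have "\<dots> = ennreal (\<delta> * ?A) * emeasure lebesgue \<Omega> + ennreal (\<delta> powr (1 - p)) * ennreal E"
    using Im by (simp add: nn_integral_add nn_integral_cmult nn_integral_cmult_indicator nE)
  also have "\<dots> = ennreal (\<delta> * ?A * measure lebesgue \<Omega> + \<delta> powr (1 - p) * E)"
    using \<delta> A0 E0 lmeasurable_Omega by (simp add: emeasure_eq_measure2 ennreal_mult)
  finally show ?thesis using \<delta> A0 E0 by (subst (asm) ennreal_le_iff) auto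
qed

text \<open>Arzela-Ascoli in pointwise form: a diagonal sequence converges on a countable dense set
  for all \<open>m\<close> at once, and equicontinuity spreads the Cauchy property to every
  point.\<close>

lemma mollify_convergent:
  fixes u :: "nat \<Rightarrow> 'a \<Rightarrow> real"
  assumes um: "\<And>n. u n \<in> borel_measurable (lebesgue_on \<Omega>)" and ub: "\<And>n x. \<bar>u n x\<bar> \<le> M"
  obtains k :: "nat \<Rightarrow> nat" where "strict_mono k" "\<And>m x. convergent (\<lambda>n. mollify m (u (k n)) x)"
proof -
  obtain D :: "'a set" where D: "countable D" "\<And>S. open S \<Longrightarrow> S \<noteq> {} \<Longrightarrow> \<exists>d\<in>D. d \<in> S"
    using countable_dense_exists[where 'a = 'a] by blast
  have cl: "x \<in> closure D" for x
    unfolding closure_approachable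
    by (metis D(2) ball_eq_empty dist_commute linorder_not_le mem_ball open_ball)
  \<comment> \<open>The division makes the bound uniform in \<open>m\<close>, so that one diagonal
    selection covers all pairs of an index and a point.\<close>
  let ?f = "\<lambda>n z. mollify (fst z) (u n) (snd z) / (2 ^ fst z) ^ DIM('a)"
  have "countable ((UNIV :: nat set) \<times> D)" using D by auto
  moreover have "norm (?f n z) \<le> M * measure lebesgue \<Omega>" for n z
    using abs_mollify_le[of "u n" M "fst z" "snd z", OF um ub]
    by (simp add: divide_le_eq mult.commute)
  ultimately obtain k where k: "strict_mono k" "\<And>z. z \<in> UNIV \<times> D \<Longrightarrow> \<exists>l. (\<lambda>n. ?f (k n) z) \<longlonglongrightarrow> l"
    using function_convergent_subsequence[of "UNIV \<times> D" ?f "M * measure lebesgue \<Omega>"] by blast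
  have kD: "convergent (\<lambda>n. mollify m (u (k n)) x)" if x: "x \<in> D" for m x
  proof -
    obtain l where "(\<lambda>n. ?f (k n) (m, x)) \<longlonglongrightarrow> l" using k(2)[of "(m, x)"] x by auto
    then have "(\<lambda>n. (2 ^ m) ^ DIM('a) * ?f (k n) (m, x)) \<longlonglongrightarrow> (2 ^ m) ^ DIM('a) * l"
      by (intro tendsto_mult tendsto_const)
    then show ?thesis by (auto simp: convergent_def)
  qed
  have M0: "0 \<le> M" using ub[of 0 undefined] by linarith
  have "Cauchy (\<lambda>n. mollify m (u (k n)) x)" for m x
  proof (rule metric_CauchyI)
    fix \<epsilon> :: real assume e: "0 < \<epsilon>"
    obtain d where d: "\<And>j. d j \<in> D" "d \<longlonglongrightarrow> x" using cl[of x] unfolding closure_sequential by blast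
    let ?I = "\<lambda>x'. LINT y|lebesgue_on \<Omega>. \<bar>moll m (x - y) - moll m (x' - y)\<bar>"
    have "(\<lambda>j. ?I (d j)) \<longlonglongrightarrow> (LINT y|lebesgue_on \<Omega>. 0)"
    proof (rule integral_dominated_convergence)
      show "integrable (lebesgue_on \<Omega>) (\<lambda>y. 2 * (2 ^ m) ^ DIM('a) :: real)"
        by (rule finite_measure.integrable_const[OF finite_measure_Omega])
      have "\<bar>moll m (x - y) - moll m (d j - y)\<bar> \<le> 2 * (2 ^ m) ^ DIM('a)" for j y
        using moll_le[of m "x - y"] moll_le[of m "d j - y"] moll_nonneg[of m "x - y"] moll_nonneg[of m "d j - y"] by linarith
      then show "AE y in lebesgue_on \<Omega>. norm \<bar>moll m (x - y) - moll m (d j - y)\<bar> \<le> 2 * (2 ^ m) ^ DIM('a)" for j by simp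
      have "(\<lambda>j. \<bar>moll m (x - y) - moll m (d j - y)\<bar>) \<longlonglongrightarrow> \<bar>moll m (x - y) - moll m (x - y)\<bar>" for y
        using continuous_on_moll[of m] d(2)
        by (intro tendsto_intros isCont_tendsto_compose[of _ "moll m"]) (auto simp: continuous_on_eq_continuous_at)
      then show "AE y in lebesgue_on \<Omega>. (\<lambda>j. \<bar>moll m (x - y) - moll m (d j - y)\<bar>) \<longlonglongrightarrow> 0" by simp
    qed measurable
    then have "(\<lambda>j. M * ?I (d j)) \<longlonglongrightarrow> M * 0" by (intro tendsto_mult tendsto_const) simp
    then have "eventually (\<lambda>j. M * ?I (d j) < \<epsilon> / 3) sequentially"
      using e by (intro order_tendstoD(2)[of _ "M * 0"]) auto
    then obtain j where j: "M * ?I (d j) < \<epsilon> / 3" by (auto simp: eventually_sequentially)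
    have nr: "\<bar>mollify m (u i) x - mollify m (u i) (d j)\<bar> < \<epsilon> / 3" for i
      using mollify_diff_le[of "u i" M m x "d j", OF um ub] j by linarith
    obtain n0 where n0: "\<And>a b. n0 \<le> a \<Longrightarrow> n0 \<le> b \<Longrightarrow> dist (mollify m (u (k a)) (d j)) (mollify m (u (k b)) (d j)) < \<epsilon> / 3"
      using kD[OF d(1)[of j], of m] e unfolding Cauchy_convergent_iff[symmetric] Cauchy_def
      by (meson divide_pos_pos zero_less_numeral)
    show "\<exists>n0. \<forall>a\<ge>n0. \<forall>b\<ge>n0. dist (mollify m (u (k a)) x) (mollify m (u (k b)) x) < \<epsilon>"
    proof (intro exI allI impI)
      fix a b assume "n0 \<le> a" "n0 \<le> b"
      then show "dist (mollify m (u (k a)) x) (mollify m (u (k b)) x) < \<epsilon>"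
        using n0[of a b] nr[of "k a"] nr[of "k b"] unfolding dist_real_def by linarith
    qed
  qed
  then show ?thesis using k(1) that by (simp add: Cauchy_convergent_iff)
qed

lemma X_measurable_on: "u \<in> X \<Longrightarrow> u \<in> borel_measurable (lebesgue_on \<Omega>)"
  using restrict_Omega(3)[of u] X_zero X_measurable by blast

text \<open>The mollified sequence converges in the mean by dominated convergence, and each
  \<open>u i\<close> is close in the mean to its normalised mollification, uniformly in
  \<open>i\<close>.\<close>

lemma L1_Cauchy:
  fixes u :: "nat \<Rightarrow> 'a \<Rightarrow> real"
  assumes u: "\<And>n. u n \<in> X" and ub: "\<And>n x. \<bar>u n x\<bar> \<le> M"
    and E: "\<And>n. (LINT z|near. \<bar>u n (fst z) - u n (snd z)\<bar> powr p) \<le> E"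
    and conv: "\<And>m x. convergent (\<lambda>n. mollify m (u n) x)" and e: "0 < \<epsilon>"
  shows "\<exists>n0. \<forall>i\<ge>n0. \<forall>j\<ge>n0. (LINT x|lebesgue_on \<Omega>. \<bar>u i x - u j x\<bar>) < \<epsilon>"
proof -
  note um = X_measurable_on[OF u]
  have M0: "0 \<le> M" using ub[of 0 undefined] by linarith
  have E0: "0 \<le> E" by (rule order_trans[OF integral_nonneg_AE E[of 0]]) simp
  define a where "a = measure lebesgue \<Omega>"
  have a0: "0 \<le> a" by (simp add: a_def)
  define \<delta> where "\<delta> = \<epsilon> / (8 * (a + 1))"
  have \<delta>: "0 < \<delta>" "\<delta> * a \<le> \<epsilon> / 8" using e a0 by (auto simp: \<delta>_def field_simps)
  \<comment> \<open>Only after \<open>\<delta>\<close> is fixed, \<open>m\<close> is taken so large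
    that the mass outweighs the seminorm term \<open>\<delta> powr (1 - p) * E\<close>.\<close>
  obtain m where m: "max 0 (8 * (\<delta> powr (1 - p) * E) / \<epsilon>) < moll_mass TYPE('a) m" using moll_mass_large by blast
  define A where "A = moll_mass TYPE('a) m"
  have A: "0 < A" "\<delta> powr (1 - p) * E \<le> A * (\<epsilon> / 8)" using m e by (auto simp: A_def field_simps)
  define v where "v i = mollify m (u i)" for i
  define V where "V x = lim (\<lambda>i. v i x)" for x
  have vV: "(\<lambda>i. v i x) \<longlonglongrightarrow> V x" for x
    using conv[of m x] by (simp add: V_def v_def convergent_LIMSEQ_iff)
  have vm: "v i \<in> borel_measurable (lebesgue_on \<Omega>)" for i unfolding v_def by (rule measurable_mollify[OF um ub])
  have Vm: "V \<in> borel_measurable (lebesgue_on \<Omega>)" by (rule borel_measurable_LIMSEQ_real[OF vV vm])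
  define B where "B = (2 ^ m) ^ DIM('a) * (M * measure lebesgue \<Omega>)"
  have vB: "\<bar>v i x\<bar> \<le> B" for i x unfolding v_def B_def by (rule abs_mollify_le[OF um ub])
  have VB: "\<bar>V x\<bar> \<le> B" for x
    by (rule LIMSEQ_le_const2[OF tendsto_rabs[OF vV]]) (use vB in auto)
  note fin = finite_measure.integrable_const_bound[OF finite_measure_Omega]
  have vi: "integrable (lebesgue_on \<Omega>) (v i)" for i by (rule fin[where B = B]) (use vB vm in auto)
  have Vi: "integrable (lebesgue_on \<Omega>) V" by (rule fin[where B = B]) (use VB Vm in auto)
  have ui: "integrable (lebesgue_on \<Omega>) (u i)" for i by (rule integrable_bounded_Omega[OF um ub])
  have "(\<lambda>i. LINT x|lebesgue_on \<Omega>. \<bar>v i x - V x\<bar>) \<longlonglongrightarrow> (LINT x|lebesgue_on \<Omega>. 0)"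
  proof (rule integral_dominated_convergence)
    show "integrable (lebesgue_on \<Omega>) (\<lambda>x. 2 * B)" by (rule finite_measure.integrable_const[OF finite_measure_Omega])
    have "\<bar>v i x - V x\<bar> \<le> 2 * B" for i x using vB[of i x] VB[of x] by linarith
    then show "AE x in lebesgue_on \<Omega>. norm \<bar>v i x - V x\<bar> \<le> 2 * B" for i by simp
    have "(\<lambda>i. \<bar>v i x - V x\<bar>) \<longlonglongrightarrow> \<bar>V x - V x\<bar>" for x by (intro tendsto_intros vV)
    then show "AE x in lebesgue_on \<Omega>. (\<lambda>i. \<bar>v i x - V x\<bar>) \<longlonglongrightarrow> 0" by simp
  qed (use vm Vm in measurable)
  then have "eventually (\<lambda>i. (LINT x|lebesgue_on \<Omega>. \<bar>v i x - V x\<bar>) < A * (\<epsilon> / 8)) sequentially"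
    using A e by (intro order_tendstoD(2)[of _ 0]) auto
  then obtain n0 where n0: "\<And>i. n0 \<le> i \<Longrightarrow> (LINT x|lebesgue_on \<Omega>. \<bar>v i x - V x\<bar>) < A * (\<epsilon> / 8)"
    by (auto simp: eventually_sequentially)
  have L1: "(LINT x|lebesgue_on \<Omega>. \<bar>A * u i x - v i x\<bar>) \<le> A * (\<epsilon> / 4)" for i
  proof -
    have "(LINT x|lebesgue_on \<Omega>. \<bar>A * u i x - v i x\<bar>) \<le> \<delta> * A * a + \<delta> powr (1 - p) * (LINT z|near. \<bar>u i (fst z) - u i (snd z)\<bar> powr p)"
      unfolding A_def v_def a_def by (rule mollify_L1[OF u ub \<delta>(1)])
    also have "\<dots> \<le> \<delta> * A * a + \<delta> powr (1 - p) * E" using E by (intro add_left_mono mult_left_mono) auto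
    also have "\<delta> * A * a \<le> A * (\<epsilon> / 8)" using mult_left_mono[OF \<delta>(2), of A] A by (simp add: mult_ac)
    finally show ?thesis using A by simp
  qed
  show ?thesis
  proof (intro exI[of _ n0] allI impI)
    fix i j assume ij: "n0 \<le> i" "n0 \<le> j"
    have i1: "integrable (lebesgue_on \<Omega>) (\<lambda>x. \<bar>A * u i x - v i x\<bar>)" for i using ui vi by auto
    have i2: "integrable (lebesgue_on \<Omega>) (\<lambda>x. \<bar>v i x - V x\<bar>)" for i using vi Vi by auto
    have "A * (LINT x|lebesgue_on \<Omega>. \<bar>u i x - u j x\<bar>) = (LINT x|lebesgue_on \<Omega>. A * \<bar>u i x - u j x\<bar>)" by simp
    also have "\<dots> \<le> (LINT x|lebesgue_on \<Omega>. (\<bar>A * u i x - v i x\<bar> + \<bar>v i x - V x\<bar>) + (\<bar>A * u j x - v j x\<bar> + \<bar>v j x - V x\<bar>))"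
    proof (rule integral_mono)
      show "integrable (lebesgue_on \<Omega>) (\<lambda>x. A * \<bar>u i x - u j x\<bar>)" using ui by auto
      show "integrable (lebesgue_on \<Omega>) (\<lambda>x. (\<bar>A * u i x - v i x\<bar> + \<bar>v i x - V x\<bar>) + (\<bar>A * u j x - v j x\<bar> + \<bar>v j x - V x\<bar>))"
        using i1 i2 by (intro Bochner_Integration.integrable_add) auto
      have "A * \<bar>u i x - u j x\<bar> = \<bar>A * u i x - A * u j x\<bar>" for x using A by (simp add: abs_mult right_diff_distrib[symmetric])
      then show "A * \<bar>u i x - u j x\<bar> \<le> (\<bar>A * u i x - v i x\<bar> + \<bar>v i x - V x\<bar>) + (\<bar>A * u j x - v j x\<bar> + \<bar>v j x - V x\<bar>)" for x
        by simp
    qed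
    also have "\<dots> = ((LINT x|lebesgue_on \<Omega>. \<bar>A * u i x - v i x\<bar>) + (LINT x|lebesgue_on \<Omega>. \<bar>v i x - V x\<bar>))
        + ((LINT x|lebesgue_on \<Omega>. \<bar>A * u j x - v j x\<bar>) + (LINT x|lebesgue_on \<Omega>. \<bar>v j x - V x\<bar>))"
      using i1 i2 by (simp add: Bochner_Integration.integral_add)
    also have "\<dots> < A * \<epsilon>"
      using L1[of i] L1[of j] n0[OF ij(1)] n0[OF ij(2)] mult_pos_pos[OF A(1) e] by (simp add: field_simps)
    finally show "(LINT x|lebesgue_on \<Omega>. \<bar>u i x - u j x\<bar>) < \<epsilon>" using A by simp
  qed
qed

text \<open>The Riesz-Fischer argument: along a fast subsequence the increments are summable in the
  mean, hence summable almost everywhere.\<close>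

lemma L1_Cauchy_AE_subseq:
  fixes u :: "nat \<Rightarrow> 'a \<Rightarrow> real"
  assumes ui: "\<And>n. integrable (lebesgue_on \<Omega>) (u n)"
    and C: "\<And>\<epsilon>. 0 < \<epsilon> \<Longrightarrow> \<exists>n0. \<forall>i\<ge>n0. \<forall>j\<ge>n0. (LINT x|lebesgue_on \<Omega>. \<bar>u i x - u j x\<bar>) < \<epsilon>"
  obtains s :: "nat \<Rightarrow> nat" where "strict_mono s" "AE x in lebesgue_on \<Omega>. convergent (\<lambda>n. u (s n) x)"
proof -
  have "\<exists>n0. \<forall>i\<ge>n0. \<forall>j\<ge>n0. (LINT x|lebesgue_on \<Omega>. \<bar>u i x - u j x\<bar>) < (1 / 2) ^ n" for n :: nat
    by (rule C) simp
  then obtain n0 where n0: "\<And>n i j. n0 n \<le> i \<Longrightarrow> n0 n \<le> j \<Longrightarrow> (LINT x|lebesgue_on \<Omega>. \<bar>u i x - u j x\<bar>) < (1 / 2) ^ n"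
    by metis
  \<comment> \<open>Partial sums of successors are strictly increasing and dominate each
    \<open>n0 n\<close>.\<close>
  define s where "s n = (\<Sum>i\<le>n. Suc (n0 i))" for n
  have s: "strict_mono s" by (rule strict_mono_Suc_iff[THEN iffD2]) (simp add: s_def)
  have sn: "n0 n \<le> s n" for n
    using member_le_sum[of n "{..n}" "\<lambda>i. Suc (n0 i)"] by (simp add: s_def)
  define d where "d n x = u (s (Suc n)) x - u (s n) x" for n x
  have di: "integrable (lebesgue_on \<Omega>) (\<lambda>x. \<bar>d n x\<bar>)" for n unfolding d_def using ui by auto
  have dn: "(\<integral>\<^sup>+x. ennreal \<bar>d n x\<bar> \<partial>lebesgue_on \<Omega>) \<le> ennreal ((1 / 2) ^ n)" for n
  proof -
    have "s n \<le> s (Suc n)" using s by (simp add: strict_mono_less_eq)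
    then have "(LINT x|lebesgue_on \<Omega>. \<bar>d n x\<bar>) < (1 / 2) ^ n"
      unfolding d_def using sn[of n] by (intro n0) auto
    then show ?thesis using di[of n] by (subst nn_integral_eq_integral) (auto intro!: ennreal_leI)
  qed
  have "(\<integral>\<^sup>+x. (\<Sum>n. ennreal \<bar>d n x\<bar>) \<partial>lebesgue_on \<Omega>) = (\<Sum>n. \<integral>\<^sup>+x. ennreal \<bar>d n x\<bar> \<partial>lebesgue_on \<Omega>)"
    by (rule nn_integral_suminf) (use di in \<open>auto intro!: measurable_compose[OF borel_measurable_integrable[OF di]]\<close>)
  also have "\<dots> \<le> (\<Sum>n. ennreal ((1 / 2) ^ n))" by (intro suminf_le summableI dn)
  also have "\<dots> = ennreal (\<Sum>n. (1 / 2) ^ n)" by (intro suminf_ennreal2) auto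
  also have "\<dots> < \<infinity>" by simp
  finally have fin: "(\<integral>\<^sup>+x. (\<Sum>n. ennreal \<bar>d n x\<bar>) \<partial>lebesgue_on \<Omega>) \<noteq> \<infinity>" by simp
  have "AE x in lebesgue_on \<Omega>. (\<Sum>n. ennreal \<bar>d n x\<bar>) \<noteq> \<infinity>"
    by (rule nn_integral_PInf_AE[OF _ fin])
      (use di in \<open>auto intro!: borel_measurable_suminf_order measurable_compose[OF borel_measurable_integrable[OF di]]\<close>)
  then have "AE x in lebesgue_on \<Omega>. convergent (\<lambda>n. u (s n) x)"
  proof eventually_elim
    case (elim x)
    have "summable (\<lambda>n. \<bar>d n x\<bar>)" using elim by (intro summable_suminf_not_top) auto
    then have "summable (\<lambda>n. d n x)" by (rule summable_rabs_cancel)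
    then have "convergent (\<lambda>n. \<Sum>i<n. d i x)" by (simp add: summable_iff_convergent)
    moreover have "(\<Sum>i<n. d i x) = u (s n) x - u (s 0) x" for n
      unfolding d_def using sum_lessThan_telescope[of "\<lambda>n. u (s n) x" n] by simp
    ultimately have "convergent (\<lambda>n. u (s n) x - u (s 0) x)" by simp
    then show ?case by (simp add: convergent_diff_const_right_iff)
  qed
  with s show ?thesis by (rule that)
qed

lemma X_compactness:
  fixes u :: "nat \<Rightarrow> 'a \<Rightarrow> real"
  assumes u: "\<And>n. u n \<in> X" and ub: "\<And>n x. \<bar>u n x\<bar> \<le> M"
    and E: "\<And>n. (LINT z|near. \<bar>u n (fst z) - u n (snd z)\<bar> powr p) \<le> E"
  obtains r w where "strict_mono (r :: nat \<Rightarrow> nat)" "w \<in> borel_measurable lebesgue" "\<And>x. \<bar>w x\<bar> \<le> M"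
    "\<And>x. x \<notin> \<Omega> \<Longrightarrow> w x = 0" "AE x in lebesgue. (\<lambda>n. u (r n) x) \<longlonglongrightarrow> w x"
proof -
  note um = X_measurable_on[OF u]
  have M0: "0 \<le> M" using ub[of 0 undefined] by linarith
  obtain k where k: "strict_mono k" "\<And>m x. convergent (\<lambda>n. mollify m (u (k n)) x)"
    using mollify_convergent[of u M] um ub by blast
  have C: "\<exists>n0. \<forall>i\<ge>n0. \<forall>j\<ge>n0. (LINT x|lebesgue_on \<Omega>. \<bar>u (k i) x - u (k j) x\<bar>) < \<epsilon>" if "0 < \<epsilon>" for \<epsilon>
    by (rule L1_Cauchy[of "\<lambda>n. u (k n)", OF u ub E k(2) that])
  obtain s where s: "strict_mono s" "AE x in lebesgue_on \<Omega>. convergent (\<lambda>n. u (k (s n)) x)"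
    using L1_Cauchy_AE_subseq[of "\<lambda>n. u (k n)", OF integrable_bounded_Omega[OF um ub] C] by blast
  define r where "r = k \<circ> s"
  have r: "strict_mono r" unfolding r_def using k(1) s(1) by (rule strict_mono_o)
  \<comment> \<open>Truncation makes the bound hold at every point, including those of the null set
    where \<open>lim\<close> has no meaning.\<close>
  define w where "w x = trunc M (lim (\<lambda>n. u (r n) x))" for x
  have w0: "w x = 0" if "x \<notin> \<Omega>" for x
    using that M0 by (simp add: w_def X_zero[OF u] trunc_def)
  have "AE x in lebesgue. (\<lambda>n. u (r n) x) \<longlonglongrightarrow> w x"
  proof -
    have "AE x in lebesgue. x \<in> \<Omega> \<longrightarrow> convergent (\<lambda>n. u (r n) x)"
      using s(2) by (simp add: AE_restrict_space_iff r_def)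
    then show ?thesis
    proof eventually_elim
      case (elim x)
      show ?case
      proof (cases "x \<in> \<Omega>")
        case True
        then have L: "(\<lambda>n. u (r n) x) \<longlonglongrightarrow> lim (\<lambda>n. u (r n) x)" using elim by (simp add: convergent_LIMSEQ_iff)
        have "\<bar>lim (\<lambda>n. u (r n) x)\<bar> \<le> M"
          by (rule LIMSEQ_le_const2[OF tendsto_rabs[OF L]]) (use ub in auto)
        then show ?thesis using L by (simp add: w_def trunc_id)
      next
        case False then show ?thesis by (simp add: w0 X_zero[OF u])
      qed
    qed
  qed
  moreover have "w \<in> borel_measurable lebesgue"
    unfolding w_def using X_measurable[OF u] by (intro measurable_compose[OF _ measurable_trunc] borel_measurable_lim_metric)
  moreover have "\<bar>w x\<bar> \<le> M" for x unfolding w_def using M0 by (rule abs_trunc_le)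
  ultimately show ?thesis using r w0 by (intro that)
qed

end

section \<open>Existence of a minimiser by the direct method\<close>

context log_problem
begin

text \<open>For a truncated minimising sequence the far and the local terms converge by dominated
  convergence. Convergence of \<open>J\<close> then forces the near energies to converge too, and
  Fatou's lemma shows that the limit function does not exceed their limit.\<close>

lemma exists_minimizer: "\<exists>u. minimizer u"
proof -
  obtain B where B: "\<And>u. u \<in> X \<Longrightarrow> cN / p * near_energy u - B \<le> J u" using J_lower by blast
  obtain M where M: "1 \<le> M" "\<And>u. u \<in> X \<Longrightarrow> J (\<lambda>x. trunc M (u x)) + (LINT x|lebesgue_on \<Omega>. \<bar>u x\<bar> powr p - \<bar>trunc M (u x)\<bar> powr p) \<le> J u"
    using J_trunc by blast
  have cp: "0 < cN / p" using cN_pos p by simp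
  have JB: "- B \<le> J u" if "u \<in> X" for u
    using B[OF that] mult_nonneg_nonneg[OF less_imp_le[OF cp] near_energy_nonneg, of u] by linarith
  define I where "I = Inf (J ` X)"
  have bdd: "bdd_below (J ` X)" using JB by (auto intro!: bdd_belowI[of _ "- B"])
  have Xne: "J ` X \<noteq> {}" using zero_in_X by blast
  have I: "I \<le> J u" if "u \<in> X" for u unfolding I_def using that bdd by (intro cInf_lower) auto
  have "\<exists>v\<in>X. J v < I + 1 / real (Suc n)" for n
    using cInf_lessD[OF Xne, of "I + 1 / real (Suc n)"] by (auto simp: I_def)
  then obtain v where v: "\<And>n. v n \<in> X" "\<And>n. J (v n) < I + 1 / real (Suc n)" by metis
  \<comment> \<open>Truncation does not raise the energy, so the sequence stays minimising and
    acquires a uniform bound.\<close>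
  define u where "u n x = trunc M (v n x)" for n x
  have uX: "u n \<in> X" for n unfolding u_def using v M by (intro X_trunc) auto
  have ub: "\<bar>u n x\<bar> \<le> M" for n x unfolding u_def using M by (intro abs_trunc_le) auto
  have Ju: "J (u n) < I + 1 / real (Suc n)" for n
  proof -
    have "0 \<le> (LINT x|lebesgue_on \<Omega>. \<bar>v n x\<bar> powr p - \<bar>trunc M (v n x)\<bar> powr p)"
      using M p by (intro integral_nonneg_AE AE_I2) (auto intro!: powr_mono2 abs_trunc_le_abs)
    then show ?thesis using M(2)[OF v(1)[of n]] v(2)[of n] by (simp add: u_def[abs_def])
  qed
  have nE: "near_energy (u n) \<le> (I + 1 + B) / (cN / p)" for n
  proof -
    have "1 / real (Suc n) \<le> 1" by simp
    then have "cN / p * near_energy (u n) \<le> I + 1 + B" using B[OF uX[of n]] Ju[of n] by linarith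
    then show ?thesis unfolding pos_le_divide_eq[OF cp] by (simp only: mult.commute)
  qed
  obtain r w where r: "strict_mono r" and wm: "w \<in> borel_measurable lebesgue" and wb: "\<And>x. \<bar>w x\<bar> \<le> M"
    and w0: "\<And>x. x \<notin> \<Omega> \<Longrightarrow> w x = 0" and lim: "AE x in lebesgue. (\<lambda>n. u (r n) x) \<longlonglongrightarrow> w x"
    by (rule X_compactness[of u, OF uX ub nE]) (rule that)
  have wm': "w \<in> borel_measurable (lebesgue_on \<Omega>)" using restrict_Omega(3)[of w] w0 wm by blast
  note [measurable] = wm X_measurable[OF uX]
  have limLL: "AE z in LL. (\<lambda>n. u (r n) (fst z)) \<longlonglongrightarrow> w (fst z) \<and> (\<lambda>n. u (r n) (snd z)) \<longlonglongrightarrow> w (snd z)"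
    using AE_LL_fst[OF lim] AE_LL_snd[OF lim] by eventually_elim simp
  have tp: "(\<lambda>n. \<bar>f n\<bar> powr p) \<longlonglongrightarrow> \<bar>l\<bar> powr p" if "f \<longlonglongrightarrow> l" for f and l :: real
    by (intro tendsto_powr' tendsto_rabs that tendsto_const) (use p in auto)
  have Jlim: "(\<lambda>n. J (u (r n))) \<longlonglongrightarrow> I"
  proof (rule real_tendsto_sandwich)
    show "eventually (\<lambda>n. I \<le> J (u (r n))) sequentially" using I uX by simp
    show "eventually (\<lambda>n. J (u (r n)) \<le> I + 1 / real (Suc n)) sequentially"
    proof (intro always_eventually allI)
      fix n
      have "1 / real (Suc (r n)) \<le> 1 / real (Suc n)"
        using seq_suble[OF r, of n] by (intro divide_left_mono) auto
      then show "J (u (r n)) \<le> I + 1 / real (Suc n)" using Ju[of "r n"] by linarith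
    qed
    have "(\<lambda>n. I + 1 / real (Suc n)) \<longlonglongrightarrow> I + 0"
      by (intro tendsto_add tendsto_const) (use LIMSEQ_inverse_real_of_nat in \<open>simp add: divide_inverse\<close>)
    then show "(\<lambda>n. I + 1 / real (Suc n)) \<longlonglongrightarrow> I" by simp
  qed simp
  have farlim: "(\<lambda>n. far_energy (u (r n))) \<longlonglongrightarrow> far_energy w"
  proof (rule integral_dominated_convergence)
    let ?b = "\<lambda>z. 2 powr p * 2 * M powr p * (indicator \<Omega> (fst z) + indicator \<Omega> (snd z))"
    have "integrable lebesgue (indicat_real \<Omega>)"
      using lmeasurable_Omega by (intro integrable_real_indicator) (auto simp: fmeasurable_def)
    then show "integrable (far \<Omega>) ?b"
      using far_fst_snd(1)[of "indicat_real \<Omega>"] by simp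
    show "AE z in far \<Omega>. norm (\<bar>u (r n) (fst z) - u (r n) (snd z)\<bar> powr p - \<bar>u (r n) (fst z)\<bar> powr p - \<bar>u (r n) (snd z)\<bar> powr p) \<le> ?b z" for n
    proof (rule AE_I2)
      fix z
      let ?a = "u (r n) (fst z)" and ?c = "u (r n) (snd z)"
      have q: "\<bar>u (r n) x\<bar> powr p \<le> M powr p * indicator \<Omega> x" for x
        using ub[of "r n" x] X_zero[OF uX[of "r n"], of x] p by (auto simp: indicator_def intro!: powr_mono2)
      have "1 \<le> 2 powr p" using p by (simp add: ge_one_powr_ge_zero)
      then have "\<bar>?a\<bar> powr p + \<bar>?c\<bar> powr p \<le> 2 powr p * (\<bar>?a\<bar> powr p + \<bar>?c\<bar> powr p)"
        using mult_right_mono[of 1 "2 powr p" "\<bar>?a\<bar> powr p + \<bar>?c\<bar> powr p"] by simp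
      moreover have "0 \<le> \<bar>?a - ?c\<bar> powr p" "\<bar>?a - ?c\<bar> powr p \<le> 2 powr p * (\<bar>?a\<bar> powr p + \<bar>?c\<bar> powr p)"
        using abs_diff_powr_le[of p ?a ?c] p by auto
      moreover have "0 \<le> \<bar>?a\<bar> powr p" "0 \<le> \<bar>?c\<bar> powr p" by simp_all
      ultimately have "\<bar>\<bar>?a - ?c\<bar> powr p - \<bar>?a\<bar> powr p - \<bar>?c\<bar> powr p\<bar> \<le> 2 * (2 powr p * (\<bar>?a\<bar> powr p + \<bar>?c\<bar> powr p))"
        by linarith
      also have "\<dots> \<le> 2 * (2 powr p * (M powr p * indicator \<Omega> (fst z) + M powr p * indicator \<Omega> (snd z)))"
        using q[of "fst z"] q[of "snd z"] by (intro mult_left_mono add_mono) auto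
      finally show "norm (\<bar>?a - ?c\<bar> powr p - \<bar>?a\<bar> powr p - \<bar>?c\<bar> powr p) \<le> ?b z"
        by (simp add: algebra_simps)
    qed
    show "AE z in far \<Omega>. (\<lambda>n. \<bar>u (r n) (fst z) - u (r n) (snd z)\<bar> powr p - \<bar>u (r n) (fst z)\<bar> powr p - \<bar>u (r n) (snd z)\<bar> powr p)
      \<longlonglongrightarrow> \<bar>w (fst z) - w (snd z)\<bar> powr p - \<bar>w (fst z)\<bar> powr p - \<bar>w (snd z)\<bar> powr p"
      using limLL by (intro AE_far sets_Omega, eventually_elim) (intro tendsto_diff tp; simp)
  qed measurable
  have wpot: "integrable (lebesgue_on \<Omega>) (\<lambda>x. \<bar>w x\<bar> powr p)"
    by (rule finite_measure.integrable_const_bound[OF finite_measure_Omega, where B = "M powr p"])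
      (use wb wm' p in \<open>auto intro!: powr_mono2\<close>)
  obtain C where C: "0 < C" "AE x in lebesgue_on \<Omega>. \<forall>t. \<bar>pot x t\<bar> \<le> C * pot_growth p t" using pot_bound by blast
  have potlim: "(\<lambda>n. LINT x|lebesgue_on \<Omega>. pot x (u (r n) x)) \<longlonglongrightarrow> (LINT x|lebesgue_on \<Omega>. pot x (w x))"
  proof (rule integral_dominated_convergence)
    show "(\<lambda>x. pot x (w x)) \<in> borel_measurable (lebesgue_on \<Omega>)" by (rule measurable_pot[OF wm'])
    show "(\<lambda>x. pot x (u (r n) x)) \<in> borel_measurable (lebesgue_on \<Omega>)" for n
      by (rule measurable_pot[OF X_measurable_Omega[OF uX]])
    show "integrable (lebesgue_on \<Omega>) (\<lambda>x. C * pot_growth p M)"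
      by (rule finite_measure.integrable_const[OF finite_measure_Omega])
    show "AE x in lebesgue_on \<Omega>. norm (pot x (u (r n) x)) \<le> C * pot_growth p M" for n
      using C(2)
    proof eventually_elim
      case (elim x)
      have "C * pot_growth p (u (r n) x) \<le> C * pot_growth p M"
        using ub[of "r n" x] C p M by (intro mult_left_mono pot_growth_mono) auto
      then show ?case using elim[rule_format, of "u (r n) x"] by simp
    qed
    have "AE x in lebesgue_on \<Omega>. (\<lambda>n. u (r n) x) \<longlonglongrightarrow> w x"
      using lim by (auto simp: AE_restrict_space_iff elim: eventually_mono)
    then show "AE x in lebesgue_on \<Omega>. (\<lambda>n. pot x (u (r n) x)) \<longlonglongrightarrow> pot x (w x)"
      using AE_continuous
      by eventually_elim (rule isCont_tendsto_compose[OF DERIV_isCont[OF has_real_derivative_pot]])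
  qed
  \<comment> \<open>The limit of the near energies, read off from the decomposition of
    \<open>J\<close>; it is not yet known to be the near energy of \<open>w\<close>.\<close>
  define L where "L = (I - (LINT x|lebesgue_on \<Omega>. pot x (w x))) / (cN / p) - far_energy w"
  have nlim: "(\<lambda>n. near_energy (u (r n))) \<longlonglongrightarrow> L"
  proof -
    have "near_energy (u (r n)) = (J (u (r n)) - (LINT x|lebesgue_on \<Omega>. pot x (u (r n) x))) / (cN / p) - far_energy (u (r n))" for n
    proof -
      have "J (u (r n)) - (LINT x|lebesgue_on \<Omega>. pot x (u (r n) x)) = cN / p * (near_energy (u (r n)) + far_energy (u (r n)))"
        unfolding J_eq[OF uX] by simp
      then show ?thesis using less_imp_neq[OF cp, symmetric] by (simp only: nonzero_mult_div_cancel_left) simp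
    qed
    moreover have "(\<lambda>n. (J (u (r n)) - (LINT x|lebesgue_on \<Omega>. pot x (u (r n) x))) / (cN / p) - far_energy (u (r n))) \<longlonglongrightarrow> L"
      unfolding L_def using cp by (intro tendsto_intros Jlim potlim farlim) auto
    ultimately show ?thesis by simp
  qed
  have "(\<integral>\<^sup>+z. ennreal (\<bar>w (fst z) - w (snd z)\<bar> powr p) \<partial>near) = (\<integral>\<^sup>+z. liminf (\<lambda>n. ennreal (\<bar>u (r n) (fst z) - u (r n) (snd z)\<bar> powr p)) \<partial>near)"
  proof (rule nn_integral_cong_AE, rule AE_near)
    show "AE z in LL. ennreal (\<bar>w (fst z) - w (snd z)\<bar> powr p) = liminf (\<lambda>n. ennreal (\<bar>u (r n) (fst z) - u (r n) (snd z)\<bar> powr p))"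
      using limLL
    proof eventually_elim
      case (elim z)
      have *: "(\<lambda>n. ennreal (\<bar>u (r n) (fst z) - u (r n) (snd z)\<bar> powr p)) \<longlonglongrightarrow> ennreal (\<bar>w (fst z) - w (snd z)\<bar> powr p)"
        using elim by (intro tendsto_ennrealI tp tendsto_diff) auto
      show ?case by (rule lim_imp_Liminf[OF _ *, symmetric]) simp
    qed
  qed
  also have "\<dots> \<le> liminf (\<lambda>n. \<integral>\<^sup>+z. ennreal (\<bar>u (r n) (fst z) - u (r n) (snd z)\<bar> powr p) \<partial>near)"
    by (rule nn_integral_liminf) measurable
  also have "\<dots> = liminf (\<lambda>n. ennreal (near_energy (u (r n))))"
    using X_near[OF uX] by (subst nn_integral_eq_integral) auto
  also have "\<dots> = ennreal L" using nlim by (intro lim_imp_Liminf tendsto_ennrealI) auto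
  finally have F: "(\<integral>\<^sup>+z. ennreal (\<bar>w (fst z) - w (snd z)\<bar> powr p) \<partial>near) \<le> ennreal L" .
  have L0: "0 \<le> L" by (rule LIMSEQ_le_const[OF nlim]) (use near_energy_nonneg in auto)
  have wn: "integrable near (\<lambda>z. \<bar>w (fst z) - w (snd z)\<bar> powr p)"
    using F by (intro integrableI_nonneg) (auto simp: le_less_trans[OF _ ennreal_less_top])
  have wX: "w \<in> X"
    using wn wm w0 wpot restrict_Omega(2)[of "\<lambda>x. \<bar>w x\<bar> powr p"] by (simp add: X_iff)
  have "near_energy w \<le> L" using F wn L0 by (subst (asm) nn_integral_eq_integral) auto
  then have "cN / p * (near_energy w + far_energy w) \<le> cN / p * (L + far_energy w)" using cp by (intro mult_left_mono) auto
  also have "\<dots> = I - (LINT x|lebesgue_on \<Omega>. pot x (w x))" using cp cN_pos p by (simp add: L_def)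
  finally have "J w \<le> I" unfolding J_eq[OF wX] by simp
  then have "minimizer w" unfolding minimizer_def using wX I by force
  then show ?thesis by blast
qed

end

subsection \<open>The first variation and the least energy\<close>

text \<open>Dominated convergence for the quotients along arbitrary null sequences. Only the
  derivative at 0 is required of the integrand, which suits integrands known to be differentiable
  for almost every point only.\<close>

lemma has_real_derivative_integral:
  fixes f :: "'b \<Rightarrow> real \<Rightarrow> real"
  assumes f: "\<And>s. integrable M (\<lambda>z. f z s)"
    and f'm: "f' \<in> borel_measurable M"
    and f': "AE z in M. (f z has_real_derivative f' z) (at 0)"
    and w: "integrable M w" "AE z in M. \<forall>s. \<bar>s\<bar> \<le> 1 \<longrightarrow> \<bar>f z s - f z 0\<bar> \<le> \<bar>s\<bar> * w z"
  shows "((\<lambda>s. LINT z|M. f z s) has_real_derivative (LINT z|M. f' z)) (at 0)"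
  unfolding DERIV_def
proof (rule LIMSEQ_SEQ_conv[THEN iffD1], intro allI impI, elim conjE)
  fix S :: "nat \<Rightarrow> real" assume S: "\<forall>n. S n \<noteq> 0" "S \<longlonglongrightarrow> 0"
  \<comment> \<open>Set to 0 while \<open>\<bar>S n\<bar>\<close> exceeds 1, so that the majorant
    holds for every \<open>n\<close> and not just eventually.\<close>
  define q where "q n z = (if \<bar>S n\<bar> \<le> 1 then (f z (S n) - f z 0) / S n else 0)" for n z
  have ev: "eventually (\<lambda>n. \<bar>S n\<bar> \<le> 1) sequentially"
    using order_tendstoD(2)[OF tendsto_rabs[OF S(2)], of 1] by (auto elim: eventually_mono)
  have "(\<lambda>n. LINT z|M. q n z) \<longlonglongrightarrow> (LINT z|M. f' z)"
  proof (rule integral_dominated_convergence[OF f'm _ w(1)])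
    show "q n \<in> borel_measurable M" for n
      unfolding q_def using borel_measurable_integrable[OF f] by measurable
    show "AE z in M. (\<lambda>n. q n z) \<longlonglongrightarrow> f' z"
      using f'
    proof eventually_elim
      case (elim z)
      then have "(\<lambda>n. (f z (0 + S n) - f z 0) / S n) \<longlonglongrightarrow> f' z"
        using S unfolding DERIV_def LIMSEQ_SEQ_conv[symmetric] by blast
      then show ?case
        by (rule Lim_transform_eventually) (use ev in \<open>eventually_elim, simp add: q_def\<close>)
    qed
    show "AE z in M. norm (q n z) \<le> w z" for n
      using w(2)
    proof eventually_elim
      case (elim z)
      have "0 \<le> w z" using elim[rule_format, of 1] by (simp add: order_trans[OF abs_ge_zero])
      then show ?case using elim[rule_format, of "S n"] S(1)
        by (auto simp: q_def abs_divide divide_le_eq mult.commute)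
    qed
  qed
  then show "(\<lambda>n. ((LINT z|M. f z (0 + S n)) - (LINT z|M. f z 0)) / S n) \<longlonglongrightarrow> (LINT z|M. f' z)"
  proof (rule Lim_transform_eventually)
    show "eventually (\<lambda>n. (LINT z|M. q n z) = ((LINT z|M. f z (0 + S n)) - (LINT z|M. f z 0)) / S n) sequentially"
      using ev
    proof eventually_elim
      case (elim n)
      then have "(LINT z|M. q n z) = (LINT z|M. (f z (S n) - f z 0) / S n)" by (simp add: q_def)
      also have "\<dots> = ((LINT z|M. f z (S n)) - (LINT z|M. f z 0)) / S n"
        using f by (simp add: Bochner_Integration.integral_diff)
      finally show ?case by simp
    qed
  qed
qed

lemma DERIV_abs_powr_affine:
  assumes "1 < p"
  shows "((\<lambda>s. \<bar>a + s * b\<bar> powr p) has_real_derivative p * (h p a * b)) (at 0)"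
proof -
  have "((\<lambda>s. \<bar>a + s * b\<bar> powr p) has_real_derivative (p * h p (a + 0 * b)) * b) (at 0)"
    by (rule DERIV_chain2[where f = "\<lambda>t. \<bar>t\<bar> powr p"])
      (auto intro!: derivative_eq_intros has_real_derivative_abs_powr assms)
  then show ?thesis by (simp add: mult_ac)
qed

context log_problem
begin

lemma integrable_dpot_mult:
  assumes u: "u \<in> X" and v: "v \<in> X"
  shows "integrable (lebesgue_on \<Omega>) (\<lambda>x. dpot x (u x) * v x)"
proof -
  have uv: "(\<lambda>x. \<bar>u x\<bar> + 1 * \<bar>v x\<bar>) \<in> X" using u v by (intro X_add_scaled X_abs)
  obtain C where C: "0 < C" "AE x in lebesgue_on \<Omega>. \<forall>t s. \<bar>t\<bar> \<le> \<bar>s\<bar> \<longrightarrow> \<bar>dpot x t\<bar> * \<bar>s\<bar> \<le> C * pot_growth p s"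
    using dpot_mult_bound by blast
  show ?thesis
  proof (rule integrable_X_bound[OF uv, where C = C])
    note [measurable] = X_measurable_Omega[OF u] X_measurable_Omega[OF v] measurable_dpot[OF X_measurable_Omega[OF u]]
    show "(\<lambda>x. dpot x (u x) * v x) \<in> borel_measurable (lebesgue_on \<Omega>)" by measurable
    show "AE x in lebesgue_on \<Omega>. \<bar>dpot x (u x) * v x\<bar> \<le> C * pot_growth p (\<bar>u x\<bar> + 1 * \<bar>v x\<bar>)"
      using C(2)
    proof eventually_elim
      case (elim x)
      have "\<bar>dpot x (u x) * v x\<bar> \<le> \<bar>dpot x (u x)\<bar> * \<bar>\<bar>u x\<bar> + 1 * \<bar>v x\<bar>\<bar>"
        unfolding abs_mult by (intro mult_left_mono) auto
      also have "\<dots> \<le> C * pot_growth p (\<bar>u x\<bar> + 1 * \<bar>v x\<bar>)"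
        using elim[rule_format, of "u x" "\<bar>u x\<bar> + 1 * \<bar>v x\<bar>"] by simp
      finally show ?case .
    qed
  qed
qed

lemma integrable_g_mult:
  assumes u: "u \<in> X" and v: "v \<in> X"
  shows "integrable (lebesgue_on \<Omega>) (\<lambda>x. g x (u x) * v x)"
proof -
  have uv: "(\<lambda>x. \<bar>u x\<bar> + 1 * \<bar>v x\<bar>) \<in> X" using u v by (intro X_add_scaled X_abs)
  obtain C where C: "0 < C" "AE x in lebesgue_on \<Omega>. \<forall>t. \<bar>g x t\<bar> \<le> \<bar>t\<bar> powr (p - 1) * (1 * ln (1 + \<bar>t\<bar>) + C)"
    using growth[of 1] by auto
  show ?thesis
  proof (rule integrable_X_bound[OF uv, where C = "1 + C"])
    note [measurable] = X_measurable_Omega[OF u] X_measurable_Omega[OF v] measurable_g_comp[OF X_measurable_Omega[OF u]]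
    show "(\<lambda>x. g x (u x) * v x) \<in> borel_measurable (lebesgue_on \<Omega>)" by measurable
    show "AE x in lebesgue_on \<Omega>. \<bar>g x (u x) * v x\<bar> \<le> (1 + C) * pot_growth p (\<bar>u x\<bar> + 1 * \<bar>v x\<bar>)"
      using C(2)
    proof eventually_elim
      case (elim x)
      let ?s = "\<bar>u x\<bar> + \<bar>v x\<bar>"
      have "\<bar>g x (u x) * v x\<bar> \<le> (\<bar>u x\<bar> powr (p - 1) * (1 * ln (1 + \<bar>u x\<bar>) + C)) * \<bar>v x\<bar>"
        unfolding abs_mult using elim by (intro mult_right_mono) auto
      also have "\<dots> \<le> (?s powr (p - 1) * (ln (1 + ?s) + C)) * ?s"
        using p C(1) by (intro mult_mono powr_mono2) auto
      also have "\<dots> = (?s powr (p - 1) * ?s) * (ln (1 + ?s) + C)" by simp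
      also have "?s powr (p - 1) * ?s = ?s powr p" by (intro powr_minus_one_mult_self) auto
      also have "?s powr p * (ln (1 + ?s) + C) \<le> (1 + C) * pot_growth p ?s"
        using C(1) by (simp add: pot_growth_def algebra_simps)
      finally show ?case by simp
    qed
  qed
qed

lemma integrable_h_mult_Omega:
  assumes u: "u \<in> X" and v: "v \<in> X"
  shows "integrable (lebesgue_on \<Omega>) (\<lambda>x. h p (u x) * v x)"
  using integrable_h_mult[OF u v] restrict_Omega(2)[of "\<lambda>x. h p (u x) * v x"] by (simp add: X_zero[OF v])

text \<open>The definition of \<open>dpot\<close> is solved for the logarithmic term, dividing by
  the nonzero \<open>\<mu>\<close>; the other terms are already known to be integrable.\<close>

lemma integrable_h_ln_mult:
  assumes u: "u \<in> X" and v: "v \<in> X"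
  shows "integrable (lebesgue_on \<Omega>) (\<lambda>x. h p (u x) * ln \<bar>u x\<bar> * v x)"
proof -
  have "integrable (lebesgue_on \<Omega>) (\<lambda>x. (1 / \<mu>) * (rho_const DIM('a) p * (h p (u x) * v x) - g x (u x) * v x - dpot x (u x) * v x))"
    using integrable_h_mult_Omega[OF u v] integrable_g_mult[OF u v] integrable_dpot_mult[OF u v]
    by (intro integrable_mult_right Bochner_Integration.integrable_diff)
  moreover have "(1 / \<mu>) * (rho_const DIM('a) p * (h p (u x) * v x) - g x (u x) * v x - dpot x (u x) * v x) = h p (u x) * ln \<bar>u x\<bar> * v x" for x
    using mu by (simp add: dpot_def algebra_simps)
  ultimately show ?thesis by simp
qed

text \<open>The defect in the weak equation tested with \<open>v\<close>. It is also the derivative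
  of \<open>J\<close> at \<open>u\<close> in direction \<open>v\<close>, which links minimisers to
  solutions.\<close>

definition weak_residual :: "('a \<Rightarrow> real) \<Rightarrow> ('a \<Rightarrow> real) \<Rightarrow> real" where
  "weak_residual u v = E_form p u v - ((LINT x|lebesgue_on \<Omega>. g x (u x) * v x)
        + \<mu> * (LINT x|lebesgue_on \<Omega>. h p (u x) * ln \<bar>u x\<bar> * v x))"

lemma weak_residual_eq:
  assumes u: "u \<in> X" and v: "v \<in> X"
  shows "weak_residual u v = cN * (LINT z|near. h p (u (fst z) - u (snd z)) * (v (fst z) - v (snd z)))
    + cN * (LINT z|far \<Omega>. Upsilon p (u (fst z)) (u (snd z)) (v (fst z)) (v (snd z)))
    + (LINT x|lebesgue_on \<Omega>. dpot x (u x) * v x)"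
proof -
  have "(LINT x|lebesgue_on \<Omega>. dpot x (u x) * v x) = (LINT x|lebesgue_on \<Omega>. rho_const DIM('a) p * (h p (u x) * v x) - g x (u x) * v x - \<mu> * (h p (u x) * ln \<bar>u x\<bar> * v x))"
    by (intro Bochner_Integration.integral_cong) (auto simp: dpot_def algebra_simps)
  also have "\<dots> = rho_const DIM('a) p * (LINT x|lebesgue_on \<Omega>. h p (u x) * v x) - (LINT x|lebesgue_on \<Omega>. g x (u x) * v x)
      - \<mu> * (LINT x|lebesgue_on \<Omega>. h p (u x) * ln \<bar>u x\<bar> * v x)"
    using integrable_h_mult_Omega[OF u v] integrable_g_mult[OF u v] integrable_h_ln_mult[OF u v]
    by (simp add: Bochner_Integration.integral_diff)
  finally show ?thesis unfolding weak_residual_def E_form_eq[OF u v] by simp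
qed

lemma has_real_derivative_J:
  assumes u: "u \<in> X" and v: "v \<in> X"
  shows "((\<lambda>s. J (\<lambda>x. u x + s * v x)) has_real_derivative weak_residual u v) (at 0)"
proof -
  have uv: "(\<lambda>x. u x + s * v x) \<in> X" for s using u v by (rule X_add_scaled)
  note [measurable] = X_measurable[OF u] X_measurable[OF v]
  let ?du = "\<lambda>z. u (fst z) - u (snd z)" and ?dv = "\<lambda>z. v (fst z) - v (snd z)"
  let ?K = "\<lambda>a b. p * (2 powr p * (\<bar>a\<bar> powr p + \<bar>b\<bar> powr p))"
  have bound: "\<bar>\<bar>a + s * b\<bar> powr p - \<bar>a\<bar> powr p\<bar> \<le> \<bar>s\<bar> * ?K a b" if "\<bar>s\<bar> \<le> 1" for a b s
  proof -
    have "(\<bar>a\<bar> + \<bar>b\<bar>) powr p \<le> 2 powr p * (\<bar>a\<bar> powr p + \<bar>b\<bar> powr p)" using p by (intro powr_add_le) auto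
    then have "\<bar>s\<bar> * (p * (\<bar>a\<bar> + \<bar>b\<bar>) powr p) \<le> \<bar>s\<bar> * ?K a b" using p by (intro mult_left_mono) auto
    then show ?thesis using abs_powr_diff_le[OF p that, of a b] by linarith
  qed
  have near: "((\<lambda>s. LINT z|near. \<bar>?du z + s * ?dv z\<bar> powr p) has_real_derivative (LINT z|near. p * (h p (?du z) * ?dv z))) (at 0)"
  proof (rule has_real_derivative_integral[where w = "\<lambda>z. ?K (?du z) (?dv z)"])
    show "integrable near (\<lambda>z. \<bar>?du z + s * ?dv z\<bar> powr p)" for s
      using X_near[OF uv[of s]] by (simp add: algebra_simps)
    show "integrable near (\<lambda>z. ?K (?du z) (?dv z))"
      using X_near[OF u] X_near[OF v] by (intro integrable_mult_right Bochner_Integration.integrable_add)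
    show "AE z in near. \<forall>s. \<bar>s\<bar> \<le> 1 \<longrightarrow> \<bar>\<bar>?du z + s * ?dv z\<bar> powr p - \<bar>?du z + 0 * ?dv z\<bar> powr p\<bar> \<le> \<bar>s\<bar> * ?K (?du z) (?dv z)"
      using bound by (intro AE_I2) simp
    show "AE z in near. ((\<lambda>s. \<bar>?du z + s * ?dv z\<bar> powr p) has_real_derivative p * (h p (?du z) * ?dv z)) (at 0)"
      by (intro AE_I2 DERIV_abs_powr_affine p)
  qed measurable
  let ?F = "\<lambda>z s. \<bar>?du z + s * ?dv z\<bar> powr p - \<bar>u (fst z) + s * v (fst z)\<bar> powr p - \<bar>u (snd z) + s * v (snd z)\<bar> powr p"
  have far: "((\<lambda>s. LINT z|far \<Omega>. ?F z s) has_real_derivative (LINT z|far \<Omega>. p * Upsilon p (u (fst z)) (u (snd z)) (v (fst z)) (v (snd z)))) (at 0)"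
  \<comment> \<open>The majorant rests on bounding the power of a difference by powers of the
    separate values, the only quantities known to be integrable for \<open>far\<close>; the final
    factor 2 covers the difference term and the two separate ones together.\<close>
  proof (rule has_real_derivative_integral[where w = "\<lambda>z. 2 powr p * (?K (u (fst z)) (v (fst z)) + ?K (u (snd z)) (v (snd z))) * 2"])
    show "integrable (far \<Omega>) (\<lambda>z. ?F z s)" for s
      using integrable_far_diag[OF uv[of s]] by (simp add: algebra_simps)
    show "integrable (far \<Omega>) (\<lambda>z. 2 powr p * (?K (u (fst z)) (v (fst z)) + ?K (u (snd z)) (v (snd z))) * 2)"
      using integrable_far_powr[OF u] integrable_far_powr[OF v]
      by (intro integrable_mult_left integrable_mult_right Bochner_Integration.integrable_add)
    show "AE z in far \<Omega>. \<forall>s. \<bar>s\<bar> \<le> 1 \<longrightarrow> \<bar>?F z s - ?F z 0\<bar> \<le> \<bar>s\<bar> * (2 powr p * (?K (u (fst z)) (v (fst z)) + ?K (u (snd z)) (v (snd z))) * 2)"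
    proof (intro AE_I2 allI impI)
      fix z s assume s: "\<bar>s :: real\<bar> \<le> 1"
      let ?K1 = "?K (u (fst z)) (v (fst z))" and ?K2 = "?K (u (snd z)) (v (snd z))"
      have K0: "0 \<le> ?K1" "0 \<le> ?K2" using p by auto
      have one: "1 \<le> 2 powr p" using p by (simp add: ge_one_powr_ge_zero)
      have "?K (?du z) (?dv z) \<le> p * (2 powr p * (2 powr p * (\<bar>u (fst z)\<bar> powr p + \<bar>u (snd z)\<bar> powr p) + 2 powr p * (\<bar>v (fst z)\<bar> powr p + \<bar>v (snd z)\<bar> powr p)))"
        using p by (intro mult_left_mono add_mono abs_diff_powr_le) auto
      also have "\<dots> = 2 powr p * (?K1 + ?K2)" by (simp add: algebra_simps)
      finally have "\<bar>s\<bar> * ?K (?du z) (?dv z) \<le> \<bar>s\<bar> * (2 powr p * (?K1 + ?K2))" by (intro mult_left_mono) auto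
      moreover have "\<bar>s\<bar> * (?K1 + ?K2) \<le> \<bar>s\<bar> * (2 powr p * (?K1 + ?K2))"
        using mult_right_mono[OF one, of "?K1 + ?K2"] K0 by (intro mult_left_mono) auto
      moreover note bound[OF s, of "?du z" "?dv z"] bound[OF s, of "u (fst z)" "v (fst z)"] bound[OF s, of "u (snd z)" "v (snd z)"]
      moreover have "\<bar>(a1 - b1 - c1) - (a0 - b0 - c0)\<bar> \<le> \<bar>a1 - a0\<bar> + (\<bar>b1 - b0\<bar> + \<bar>c1 - c0\<bar>)" for a1 b1 c1 a0 b0 c0 :: real
        by linarith
      note this[of "\<bar>?du z + s * ?dv z\<bar> powr p" "\<bar>u (fst z) + s * v (fst z)\<bar> powr p" "\<bar>u (snd z) + s * v (snd z)\<bar> powr p"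
          "\<bar>?du z\<bar> powr p" "\<bar>u (fst z)\<bar> powr p" "\<bar>u (snd z)\<bar> powr p"]
      moreover have "\<bar>s\<bar> * (?K1 + ?K2) = \<bar>s\<bar> * ?K1 + \<bar>s\<bar> * ?K2" by (rule distrib_left)
      moreover have "\<bar>s\<bar> * (2 powr p * (?K1 + ?K2) * 2) = \<bar>s\<bar> * (2 powr p * (?K1 + ?K2)) + \<bar>s\<bar> * (2 powr p * (?K1 + ?K2))" by simp
      ultimately show "\<bar>?F z s - ?F z 0\<bar> \<le> \<bar>s\<bar> * (2 powr p * (?K1 + ?K2) * 2)"
        unfolding mult_zero_left add_0_right by linarith
    qed
    show "AE z in far \<Omega>. ((\<lambda>s. ?F z s) has_real_derivative p * Upsilon p (u (fst z)) (u (snd z)) (v (fst z)) (v (snd z))) (at 0)"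
    proof (rule AE_I2)
      fix z
      have "((\<lambda>s. ?F z s) has_real_derivative p * (h p (?du z) * ?dv z) - p * (h p (u (fst z)) * v (fst z)) - p * (h p (u (snd z)) * v (snd z))) (at 0)"
        by (intro DERIV_diff DERIV_abs_powr_affine p)
      then show "((\<lambda>s. ?F z s) has_real_derivative p * Upsilon p (u (fst z)) (u (snd z)) (v (fst z)) (v (snd z))) (at 0)"
        by (simp add: Upsilon_def algebra_simps)
    qed
  qed measurable
  obtain C where C: "0 < C" "AE x in lebesgue_on \<Omega>. \<forall>a b s. \<bar>s\<bar> \<le> 1 \<longrightarrow> \<bar>pot x (a + s * b) - pot x a\<bar> \<le> \<bar>s\<bar> * (C * pot_growth p (\<bar>a\<bar> + \<bar>b\<bar>))"
    using pot_diff_bound by blast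
  have pot: "((\<lambda>s. LINT x|lebesgue_on \<Omega>. pot x (u x + s * v x)) has_real_derivative (LINT x|lebesgue_on \<Omega>. dpot x (u x) * v x)) (at 0)"
  proof (rule has_real_derivative_integral[where w = "\<lambda>x. C * pot_growth p (\<bar>u x\<bar> + 1 * \<bar>v x\<bar>)"])
    show "integrable (lebesgue_on \<Omega>) (\<lambda>x. pot x (u x + s * v x))" for s by (rule integrable_pot[OF uv])
    show "(\<lambda>x. dpot x (u x) * v x) \<in> borel_measurable (lebesgue_on \<Omega>)"
      by (rule borel_measurable_integrable[OF integrable_dpot_mult[OF u v]])
    show "integrable (lebesgue_on \<Omega>) (\<lambda>x. C * pot_growth p (\<bar>u x\<bar> + 1 * \<bar>v x\<bar>))"
      using u v by (intro integrable_mult_right integrable_pot_growth X_add_scaled X_abs)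
    show "AE x in lebesgue_on \<Omega>. \<forall>s. \<bar>s\<bar> \<le> 1 \<longrightarrow> \<bar>pot x (u x + s * v x) - pot x (u x + 0 * v x)\<bar> \<le> \<bar>s\<bar> * (C * pot_growth p (\<bar>u x\<bar> + 1 * \<bar>v x\<bar>))"
      using C(2) by eventually_elim simp
    show "AE x in lebesgue_on \<Omega>. ((\<lambda>s. pot x (u x + s * v x)) has_real_derivative dpot x (u x) * v x) (at 0)"
      using AE_continuous
    proof eventually_elim
      case (elim x)
      have "((\<lambda>s. pot x (u x + s * v x)) has_real_derivative dpot x (u x + 0 * v x) * v x) (at 0)"
        by (rule DERIV_chain2[OF has_real_derivative_pot[OF elim]]) (auto intro!: derivative_eq_intros)
      then show ?case by simp
    qed
  qed
  have "J (\<lambda>x. u x + s * v x) = cN / p * ((LINT z|near. \<bar>?du z + s * ?dv z\<bar> powr p) + (LINT z|far \<Omega>. ?F z s))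
      + (LINT x|lebesgue_on \<Omega>. pot x (u x + s * v x))" for s
  proof -
    have e: "(u x + s * v x) - (u y + s * v y) = (u x - u y) + s * (v x - v y)" for x y by (simp add: algebra_simps)
    show ?thesis unfolding J_eq[OF uv] e ..
  qed
  then have "((\<lambda>s. J (\<lambda>x. u x + s * v x)) has_real_derivative cN / p * ((LINT z|near. p * (h p (?du z) * ?dv z))
      + (LINT z|far \<Omega>. p * Upsilon p (u (fst z)) (u (snd z)) (v (fst z)) (v (snd z)))) + (LINT x|lebesgue_on \<Omega>. dpot x (u x) * v x)) (at 0)"
    by (simp only:) (intro DERIV_add DERIV_cmult near far pot)
  moreover have "cN / p * (p * a + p * b) + c = cN * a + cN * b + c" for a b c :: real
    using p by (simp add: distrib_left)
  ultimately show ?thesis unfolding weak_residual_eq[OF u v] integral_mult_right_zero by simp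
qed

lemma minimizer_weak_residual:
  assumes m: "minimizer u" and v: "v \<in> X"
  shows "weak_residual u v = 0"
proof -
  have u: "u \<in> X" using m by (simp add: minimizer_def)
  show ?thesis
  proof (rule DERIV_local_min[OF has_real_derivative_J[OF u v], of 1])
    show "\<forall>s. \<bar>0 - s\<bar> < 1 \<longrightarrow> J (\<lambda>x. u x + 0 * v x) \<le> J (\<lambda>x. u x + s * v x)"
      using m X_add_scaled[OF u v] by (simp add: minimizer_def)
  qed simp
qed

lemma minimizer_weak_solution: "minimizer u \<Longrightarrow> weak_solution p \<Omega> g \<mu> u"
  using minimizer_weak_residual[of u] unfolding weak_solution_def weak_residual_def
  by (auto simp: minimizer_def)

lemma weak_solution_nehari:
  assumes "weak_solution p \<Omega> g \<mu> u" "nontrivial u"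
  shows "u \<in> nehari p \<Omega> g \<mu>"
proof -
  have e: "h p (u x) * ln \<bar>u x\<bar> * u x = \<bar>u x\<bar> powr p * ln \<bar>u x\<bar>" for x
    by (simp only: h_mult_self[symmetric] mult_ac)
  have u: "u \<in> X" using assms(1) by (simp add: weak_solution_def)
  have "E_form p u u = (LINT x|lebesgue_on \<Omega>. g x (u x) * u x)
        + \<mu> * (LINT x|lebesgue_on \<Omega>. h p (u x) * ln \<bar>u x\<bar> * u x)"
    using assms(1) u unfolding weak_solution_def by blast
  then show ?thesis using assms(2) u unfolding e nehari_def by simp
qed

section \<open>Negativity of the minimal energy, and least energy solutions as minimisers\<close>

lemma exists_bump: "\<exists>\<phi>\<in>X. (\<forall>x. 0 \<le> \<phi> x \<and> \<phi> x \<le> 1) \<and> nontrivial \<phi>"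
proof -
  obtain x0 r0 where r0: "0 < r0" "ball x0 r0 \<subseteq> \<Omega>"
    using open_Omega nonempty_Omega by (meson equals0I openE)
  define r where "r = min r0 1"
  have r: "0 < r" "r \<le> 1" "ball x0 r \<subseteq> \<Omega>" using r0 by (auto simp: r_def)
  \<comment> \<open>A Lipschitz tent supported in \<Omega>; the distance term of
    \<open>X_space_dominated\<close> alone places it in the space.\<close>
  define \<phi> where "\<phi> x = max 0 (r - dist x0 x)" for x
  have z: "\<phi> x = 0" if "x \<notin> \<Omega>" for x
  proof -
    have "\<not> dist x0 x < r" using that r(3) by auto
    then show ?thesis by (simp add: \<phi>_def)
  qed
  have b: "0 \<le> \<phi> x" "\<phi> x \<le> 1" for x
  proof -
    have "r - dist x0 x \<le> 1" using r(2) zero_le_dist[of x0 x] by linarith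
    then show "0 \<le> \<phi> x" "\<phi> x \<le> 1" by (simp_all add: \<phi>_def)
  qed
  have L: "\<bar>\<phi> x - \<phi> y\<bar> \<le> norm (x - y)" for x y
    using dist_triangle[of x0 x y] dist_triangle[of x0 y x] unfolding \<phi>_def
    by (simp add: dist_norm[symmetric] dist_commute)
  have "\<phi> \<in> X"
  proof (rule X_space_dominated[OF p lmeasurable_Omega zero_in_X zero_in_X, where K = 1])
    show "\<phi> \<in> borel_measurable lebesgue" unfolding \<phi>_def by measurable
    show "\<bar>\<phi> x\<bar> powr p \<le> 1 * (\<bar>0\<bar> powr p + \<bar>0\<bar> powr p + 1)" for x
      using powr_mono2[of p "\<bar>\<phi> x\<bar>" 1] b[of x] p by simp
    show "\<bar>\<phi> x - \<phi> y\<bar> powr p \<le> 1 * (\<bar>0 - 0\<bar> powr p + \<bar>0 - 0\<bar> powr p + norm (x - y) powr p * (indicator \<Omega> x + indicator \<Omega> y))" for x y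
    proof (cases "x \<in> \<Omega> \<or> y \<in> \<Omega>")
      case True
      have "\<bar>\<phi> x - \<phi> y\<bar> powr p \<le> norm (x - y) powr p" using L p by (intro powr_mono2) auto
      also have "\<dots> \<le> norm (x - y) powr p * (indicator \<Omega> x + indicator \<Omega> y)"
        using True by (auto simp: indicator_def)
      finally show ?thesis by simp
    qed (use z in simp)
  qed (use z in simp)
  moreover have "nontrivial \<phi>"
    unfolding nontrivial_def
  proof
    assume "AE x in lebesgue. \<phi> x = 0"
    then have "AE x in lebesgue. x \<notin> ball x0 r" by eventually_elim (auto simp: \<phi>_def max_def split: if_splits)
    then have "negligible (ball x0 r)"
      unfolding negligible_iff_null_sets by (subst AE_iff_null_sets) auto
    then show False using open_not_negligible[of "ball x0 r"] r by simp
  qed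
  ultimately show ?thesis using b by blast
qed

text \<open>The logarithm makes the bracket tend to minus infinity as \<open>t\<close> decreases to
  0, while all other contributions, including the primitive of \<open>g\<close>, are of size
  \<open>t powr p\<close>.\<close>

lemma pot_small_bound:
  "\<exists>C. AE x in lebesgue_on \<Omega>. \<forall>t. 0 \<le> t \<longrightarrow> t \<le> 1 \<longrightarrow> pot x t \<le> t powr p * (C - \<mu> / p * ln t)"
proof -
  obtain C where C: "0 < C" "AE x in lebesgue_on \<Omega>. \<forall>t. \<bar>g x t\<bar> \<le> \<bar>t\<bar> powr (p - 1) * (1 * ln (1 + \<bar>t\<bar>) + C)"
    using growth[of 1] by auto
  define D where "D = \<bar>rho_const DIM('a) p / p\<bar> + (1 + C) + \<mu> / p\<^sup>2"
  have "AE x in lebesgue_on \<Omega>. \<forall>t. 0 \<le> t \<longrightarrow> t \<le> 1 \<longrightarrow> pot x t \<le> t powr p * (D - \<mu> / p * ln t)"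
    using C(2) AE_continuous
  proof eventually_elim
    case (elim x)
    show ?case
    proof (intro allI impI)
      fix t :: real assume t: "0 \<le> t" "t \<le> 1"
      show "pot x t \<le> t powr p * (D - \<mu> / p * ln t)"
      proof (cases "t = 0")
        case False
        with t have t0: "0 < t" by simp
        obtain s where s: "0 < s" "s < t" "primitive g x t - primitive g x 0 = (t - 0) * g x s"
          using MVT2[OF t0 has_real_derivative_primitive[OF elim(2)]] by blast
        have "\<bar>primitive g x t\<bar> = t * \<bar>g x s\<bar>" using s t by (simp add: abs_mult)
        also have "\<dots> \<le> t * (t powr (p - 1) * (1 + C))"
        proof (intro mult_left_mono)
          have "\<bar>g x s\<bar> \<le> s powr (p - 1) * (ln (1 + s) + C)" using elim(1)[rule_format, of s] s by simp
          also have "\<dots> \<le> t powr (p - 1) * (1 + C)"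
            using s t p C(1) ln_add_one_self_le_self[of s] by (intro mult_mono powr_mono2 add_mono) auto
          finally show "\<bar>g x s\<bar> \<le> t powr (p - 1) * (1 + C)" .
        qed (use t in simp)
        also have "\<dots> = t powr p * (1 + C)" using powr_minus_one_mult_self[OF t(1), of p] by (simp add: mult_ac)
        finally have G: "- primitive g x t \<le> t powr p * (1 + C)" by linarith
        have "rho_const DIM('a) p / p * t powr p \<le> \<bar>rho_const DIM('a) p / p\<bar> * t powr p" by (intro mult_right_mono abs_ge_self) simp
        moreover have "\<mu> / p\<^sup>2 * (t powr p * (ln (t powr p) - 1)) = \<mu> / p * (t powr p * ln t) - \<mu> / p\<^sup>2 * t powr p"
          using t0 p by (simp add: ln_powr power2_eq_square field_simps)
        ultimately have "pot x t \<le> \<bar>rho_const DIM('a) p / p\<bar> * t powr p + t powr p * (1 + C) - (\<mu> / p * (t powr p * ln t) - \<mu> / p\<^sup>2 * t powr p)"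
          using G t by (simp add: pot_def)
        also have "\<dots> = t powr p * (D - \<mu> / p * ln t)" unfolding D_def by (simp add: algebra_simps)
        finally show ?thesis .
      qed simp
    qed
  qed
  then show ?thesis by blast
qed

text \<open>Scaling a bump by \<open>s\<close> multiplies the nonlocal terms by
  \<open>s powr p\<close>; the local term gains the additional factor \<open>ln s\<close>, which
  wins for small \<open>s\<close>. Consequently 0 is not a minimiser.\<close>

lemma J_negative: "\<exists>v\<in>X. J v < 0"
proof -
  obtain \<phi> where \<phi>: "\<phi> \<in> X" and b: "\<And>x. 0 \<le> \<phi> x" "\<And>x. \<phi> x \<le> 1" and nt: "nontrivial \<phi>" using exists_bump by blast
  obtain C where C: "AE x in lebesgue_on \<Omega>. \<forall>t. 0 \<le> t \<longrightarrow> t \<le> 1 \<longrightarrow> pot x t \<le> t powr p * (C - \<mu> / p * ln t)"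
    using pot_small_bound by blast
  define A where "A = cN / p * (near_energy \<phi> + far_energy \<phi>)"
  define B where "B = (LINT x|lebesgue_on \<Omega>. \<phi> x powr p)"
  have Bi: "integrable (lebesgue_on \<Omega>) (\<lambda>x. \<phi> x powr p)" using X_powr_Omega[OF \<phi>] b by simp
  have "B \<noteq> 0"
  proof
    assume "B = 0"
    then have "AE x in lebesgue_on \<Omega>. \<phi> x powr p = 0"
      unfolding B_def by (subst (asm) integral_nonneg_eq_0_iff_AE[OF Bi]) auto
    then have "AE x in lebesgue. \<phi> x = 0"
      using X_zero[OF \<phi>] by (auto simp: AE_restrict_space_iff elim!: eventually_mono)
    then show False using nt by (simp add: nontrivial_def)
  qed
  moreover have "0 \<le> B" unfolding B_def by (rule integral_nonneg_AE) simp
  ultimately have B: "0 < B" by simp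
  \<comment> \<open>Solved from \<open>A + (C + \<mu> / p * k) * B \<le> - 1\<close>. The maximum
    with 0 ensures \<open>s \<le> 1\<close>, the range of \<open>pot_small_bound\<close>.\<close>
  define k where "k = max 0 ((A + C * B + 1) * p / (- \<mu> * B))"
  define s where "s = exp (- k)"
  have s: "0 < s" "s \<le> 1" "ln s = - k" by (auto simp: s_def k_def)
  let ?v = "\<lambda>x. 0 + s * \<phi> x"
  have v: "?v \<in> X" by (rule X_add_scaled[OF zero_in_X \<phi>])
  have hom: "\<bar>s * a\<bar> powr p = s powr p * \<bar>a\<bar> powr p" for a using s by (simp add: abs_mult powr_mult)
  have e: "?v x - ?v y = s * (\<phi> x - \<phi> y)" for x y by (simp add: algebra_simps)
  have 1: "near_energy ?v = s powr p * near_energy \<phi>" unfolding e hom by simp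
  have 2: "far_energy ?v = s powr p * far_energy \<phi>"
    unfolding e by (simp add: hom right_diff_distrib[symmetric])
  have 3: "(LINT x|lebesgue_on \<Omega>. pot x (?v x)) \<le> (LINT x|lebesgue_on \<Omega>. s powr p * ((C + \<mu> / p * k) * \<phi> x powr p))"
  proof (rule integral_mono_AE[OF integrable_pot[OF v]])
    show "integrable (lebesgue_on \<Omega>) (\<lambda>x. s powr p * ((C + \<mu> / p * k) * \<phi> x powr p))" using Bi by simp
    show "AE x in lebesgue_on \<Omega>. pot x (?v x) \<le> s powr p * ((C + \<mu> / p * k) * \<phi> x powr p)"
      using C
    proof eventually_elim
      case (elim x)
      show ?case
      proof (cases "\<phi> x = 0")
        case False
        then have \<phi>0: "0 < \<phi> x" using b(1)[of x] by simp
        have "pot x (?v x) \<le> (s * \<phi> x) powr p * (C - \<mu> / p * ln (s * \<phi> x))"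
          using elim[rule_format, of "s * \<phi> x"] b[of x] s by (simp add: mult_le_one)
        also have "\<dots> \<le> (s * \<phi> x) powr p * (C + \<mu> / p * k)"
        proof (intro mult_left_mono)
          have "ln (s * \<phi> x) \<le> - k" using s \<phi>0 b(2)[of x] by (simp add: ln_mult)
          then have "\<mu> / p * (- k) \<le> \<mu> / p * ln (s * \<phi> x)" using mu p by (intro mult_left_mono_neg) (auto simp: divide_nonpos_pos)
          then show "C - \<mu> / p * ln (s * \<phi> x) \<le> C + \<mu> / p * k" by simp
        qed simp
        also have "\<dots> = s powr p * ((C + \<mu> / p * k) * \<phi> x powr p)" using s \<phi>0 by (simp add: powr_mult mult_ac)
        finally show ?thesis .
      qed simp
    qed
  qed
  have 4: "(LINT x|lebesgue_on \<Omega>. s powr p * ((C + \<mu> / p * k) * \<phi> x powr p)) = s powr p * ((C + \<mu> / p * k) * B)"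
    unfolding B_def by (simp only: integral_mult_right_zero)
  have "J ?v \<le> s powr p * (A + (C + \<mu> / p * k) * B)"
    using 3 unfolding 4 unfolding J_eq[OF v] 1 2 A_def by (simp add: algebra_simps)
  also have "\<dots> \<le> s powr p * (- 1)"
  proof (intro mult_left_mono)
    have "(A + C * B + 1) * p / (- \<mu> * B) \<le> k" by (simp add: k_def)
    then have "(A + C * B + 1) * p \<le> k * (- \<mu> * B)" using mu B by (subst (asm) pos_divide_le_eq) (auto simp: mult_neg_pos)
    then have "A + C * B + 1 \<le> - (\<mu> / p * k * B)" using p by (simp add: field_simps)
    then show "A + (C + \<mu> / p * k) * B \<le> - 1" by (simp add: algebra_simps)
  qed simp
  also have "\<dots> < 0" using s by simp
  finally show ?thesis using v by blast
qed

lemma J_trivial: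
  assumes u: "u \<in> X" and t: "AE x in lebesgue. u x = 0"
  shows "J u = 0"
proof -
  have LL0: "AE z in LL. u (fst z) = 0 \<and> u (snd z) = 0" using AE_LL_fst[OF t] AE_LL_snd[OF t] by eventually_elim simp
  have "AE z in LL. \<bar>u (fst z) - u (snd z)\<bar> powr p = 0"
    using LL0 by eventually_elim (use p in simp)
  then have 1: "near_energy u = 0" by (intro integral_eq_zero_AE AE_near)
  have "AE z in LL. \<bar>u (fst z) - u (snd z)\<bar> powr p - \<bar>u (fst z)\<bar> powr p - \<bar>u (snd z)\<bar> powr p = 0"
    using LL0 by eventually_elim (use p in simp)
  then have 2: "far_energy u = 0" by (intro integral_eq_zero_AE AE_far sets_Omega)
  have 3: "(LINT x|lebesgue_on \<Omega>. pot x (u x)) = 0"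
    by (rule integral_eq_zero_AE) (use t in \<open>auto simp: AE_restrict_space_iff elim!: eventually_mono\<close>)
  show ?thesis unfolding J_eq[OF u] 1 2 3 by simp
qed

lemma minimizer_J_neg: "minimizer u \<Longrightarrow> J u < 0"
  using J_negative unfolding minimizer_def by force

lemma minimizer_nontrivial: "minimizer u \<Longrightarrow> nontrivial u"
  using J_trivial minimizer_J_neg by (force simp: nontrivial_def minimizer_def)

text \<open>A minimiser is a nontrivial weak solution and therefore lies on the Nehari manifold. The
  infimum there is thus attained and equals the minimum over all of \<open>X\<close>, so attaining
  one is attaining the other.\<close>

lemma least_energy_iff_minimizer: "least_energy_solution p \<Omega> g \<mu> u \<longleftrightarrow> minimizer u"
proof -
  obtain u0 where u0: "minimizer u0" using exists_minimizer by blast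
  have u0N: "u0 \<in> nehari p \<Omega> g \<mu>"
    by (intro weak_solution_nehari minimizer_weak_solution minimizer_nontrivial u0)
  have "(INF v\<in>nehari p \<Omega> g \<mu>. ereal (J v)) = ereal (J u0)"
  proof (rule antisym)
    show "(INF v\<in>nehari p \<Omega> g \<mu>. ereal (J v)) \<le> ereal (J u0)" using u0N by (rule INF_lower)
    show "ereal (J u0) \<le> (INF v\<in>nehari p \<Omega> g \<mu>. ereal (J v))"
      using u0 by (intro INF_greatest) (auto simp: minimizer_def nehari_def)
  qed
  then have *: "least_energy_solution p \<Omega> g \<mu> u \<longleftrightarrow> weak_solution p \<Omega> g \<mu> u \<and> J u = J u0"
    by (simp add: least_energy_solution_def)
  show ?thesis
  proof
    assume "least_energy_solution p \<Omega> g \<mu> u"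
    then show "minimizer u" using u0 unfolding * minimizer_def weak_solution_def by auto
  next
    assume u: "minimizer u"
    then have "J u = J u0" using u0 unfolding minimizer_def by (intro antisym) auto
    then show "least_energy_solution p \<Omega> g \<mu> u" using minimizer_weak_solution[OF u] unfolding * by blast
  qed
qed

end

subsection \<open>Constant sign\<close>

context log_problem
begin

text \<open>Together the two densities are positive at every pair of distinct points of \<Omega>, so
  their null sets yield one null set for the product measure.\<close>

lemma AE_near_far_imp_LL:
  assumes "AE z in near. P z" "AE z in far \<Omega>. P z"
  shows "AE z in LL. fst z \<in> \<Omega> \<longrightarrow> snd z \<in> \<Omega> \<longrightarrow> fst z \<noteq> snd z \<longrightarrow> P z"
proof -
  have m1: "(\<lambda>z::'a \<times> 'a. ennreal (kern (fst z - snd z))) \<in> borel_measurable LL" by measurable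
  have m2: "(\<lambda>z. ennreal (kfar \<Omega> z)) \<in> borel_measurable LL" by measurable
  have "AE z in LL. 0 < ennreal (kern (fst z - snd z)) \<longrightarrow> P z" "AE z in LL. 0 < ennreal (kfar \<Omega> z) \<longrightarrow> P z"
    using assms unfolding near_def far_def AE_density[OF m1] AE_density[OF m2] by auto
  then show ?thesis
  proof eventually_elim
    case (elim z)
    show ?case
    proof (intro impI)
      assume z: "fst z \<in> \<Omega>" "snd z \<in> \<Omega>" "fst z \<noteq> snd z"
      show "P z"
      proof (cases "norm (fst z - snd z) \<le> 1")
        case True
        then have "0 < kern (fst z - snd z)" using z by (simp add: kern_def)
        then show ?thesis using elim(1) by simp
      next
        case False
        then have "0 < kfar \<Omega> z" using z by (simp add: kfar_def)
        then show ?thesis using elim(2) by simp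
      qed
    qed
  qed
qed

text \<open>The primed functions belong to the minimisers, the others to a competitor that is no
  worse in each of the three terms. Minimality reverses the inequality of the sums, so every term
  must be an equality, and ordered integrands with equal integrals agree almost everywhere.\<close>

lemma energy_rigidity:
  assumes v: "integrable near f" "integrable near f'" "integrable (far \<Omega>) k" "integrable (far \<Omega>) k'"
      "integrable (lebesgue_on \<Omega>) l" "integrable (lebesgue_on \<Omega>) l'"
    and le: "\<And>z. f z \<le> f' z" "\<And>z. k z \<le> k' z" "AE x in lebesgue_on \<Omega>. l x \<le> (l' x :: real)"
    and ge: "cN / p * ((LINT z|near. f' z) + (LINT z|far \<Omega>. k' z)) + (LINT x|lebesgue_on \<Omega>. l' x)
      \<le> cN / p * ((LINT z|near. f z) + (LINT z|far \<Omega>. k z)) + (LINT x|lebesgue_on \<Omega>. l x)"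
  shows "AE z in near. f z = f' z" "AE z in far \<Omega>. k z = k' z"
proof -
  have cp: "0 < cN / p" using cN_pos p by simp
  have 1: "(LINT z|near. f z) \<le> (LINT z|near. f' z)" using v le by (intro integral_mono) auto
  have 2: "(LINT z|far \<Omega>. k z) \<le> (LINT z|far \<Omega>. k' z)" using v le by (intro integral_mono) auto
  have 3: "(LINT x|lebesgue_on \<Omega>. l x) \<le> (LINT x|lebesgue_on \<Omega>. l' x)" using v le by (intro integral_mono_AE) auto
  have "cN / p * ((LINT z|near. f' z) + (LINT z|far \<Omega>. k' z)) \<le> cN / p * ((LINT z|near. f z) + (LINT z|far \<Omega>. k z))"
    using ge 3 by linarith
  then have "(LINT z|near. f' z) + (LINT z|far \<Omega>. k' z) \<le> (LINT z|near. f z) + (LINT z|far \<Omega>. k z)"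
    using cp by (rule mult_left_le_imp_le)
  then have e: "(LINT z|near. f' z - f z) = 0" "(LINT z|far \<Omega>. k' z - k z) = 0"
    using 1 2 v by (simp_all add: Bochner_Integration.integral_diff)
  have "AE z in near. f' z - f z = 0"
    using e(1) v le by (subst (asm) integral_nonneg_eq_0_iff_AE) auto
  then show "AE z in near. f z = f' z" by eventually_elim simp
  have "AE z in far \<Omega>. k' z - k z = 0"
    using e(2) v le by (subst (asm) integral_nonneg_eq_0_iff_AE) auto
  then show "AE z in far \<Omega>. k z = k' z" by eventually_elim simp
qed

text \<open>Passing to \<open>\<bar>u\<bar>\<close> strictly lowers
  \<open>\<bar>u x - u y\<bar>\<close> exactly for values of opposite sign. By rigidity almost no
  pair has opposite signs, and fixing one suitable point with a positive value settles the
  sign.\<close>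

lemma minimizer_constant_sign:
  assumes m: "minimizer u"
    and G: "AE x in lebesgue_on \<Omega>. \<forall>t. primitive g x t \<le> primitive g x \<bar>t\<bar>"
  shows "constant_sign_on \<Omega> u"
proof -
  have u: "u \<in> X" using m by (simp add: minimizer_def)
  have v: "(\<lambda>x. \<bar>u x\<bar>) \<in> X" using u by (rule X_abs)
  have le: "\<bar>\<bar>a\<bar> - \<bar>b\<bar>\<bar> powr p \<le> \<bar>a - b\<bar> powr p" for a b :: real using p by (intro powr_mono2) auto
  have less: "\<bar>\<bar>a\<bar> - \<bar>b\<bar>\<bar> powr p < \<bar>a - b\<bar> powr p" if "0 < a" "b < 0" for a b :: real
    using p that by (intro powr_less_mono2) auto
  have ge: "cN / p * (near_energy u + far_energy u) + (LINT x|lebesgue_on \<Omega>. pot x (u x))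
      \<le> cN / p * (near_energy (\<lambda>x. \<bar>u x\<bar>) + (LINT z|far \<Omega>. \<bar>\<bar>u (fst z)\<bar> - \<bar>u (snd z)\<bar>\<bar> powr p - \<bar>\<bar>u (fst z)\<bar>\<bar> powr p - \<bar>\<bar>u (snd z)\<bar>\<bar> powr p))
        + (LINT x|lebesgue_on \<Omega>. pot x \<bar>u x\<bar>)"
    using m v unfolding minimizer_def J_eq[OF u, symmetric] J_eq[OF v, symmetric] by blast
  have pot: "AE x in lebesgue_on \<Omega>. pot x \<bar>u x\<bar> \<le> pot x (u x)"
    using G by eventually_elim (simp add: pot_def)
  note E = energy_rigidity[OF X_near[OF v] X_near[OF u] integrable_far_diag[OF v] integrable_far_diag[OF u]
      integrable_pot[OF v] integrable_pot[OF u] le _ pot ge]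
  have "AE z in near. \<bar>\<bar>u (fst z)\<bar> - \<bar>u (snd z)\<bar>\<bar> powr p = \<bar>u (fst z) - u (snd z)\<bar> powr p"
    by (rule E(1)) (use le in auto)
  moreover have "AE z in far \<Omega>. \<bar>\<bar>u (fst z)\<bar> - \<bar>u (snd z)\<bar>\<bar> powr p - \<bar>\<bar>u (fst z)\<bar>\<bar> powr p - \<bar>\<bar>u (snd z)\<bar>\<bar> powr p
      = \<bar>u (fst z) - u (snd z)\<bar> powr p - \<bar>u (fst z)\<bar> powr p - \<bar>u (snd z)\<bar> powr p"
    by (rule E(2)) (use le in auto)
  then have "AE z in far \<Omega>. \<bar>\<bar>u (fst z)\<bar> - \<bar>u (snd z)\<bar>\<bar> powr p = \<bar>u (fst z) - u (snd z)\<bar> powr p"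
    by eventually_elim simp
  ultimately have "AE z in LL. fst z \<in> \<Omega> \<longrightarrow> snd z \<in> \<Omega> \<longrightarrow> fst z \<noteq> snd z \<longrightarrow> \<bar>\<bar>u (fst z)\<bar> - \<bar>u (snd z)\<bar>\<bar> powr p = \<bar>u (fst z) - u (snd z)\<bar> powr p"
    by (rule AE_near_far_imp_LL)
  then have "AE z in LL. \<not> (0 < u (fst z) \<and> u (snd z) < 0)"
  proof eventually_elim
    case (elim z)
    show ?case
    proof
      assume z: "0 < u (fst z) \<and> u (snd z) < 0"
      then have "fst z \<in> \<Omega>" "snd z \<in> \<Omega>" using X_zero[OF u] by force+
      moreover have "fst z \<noteq> snd z" using z by force
      ultimately show False using elim less[of "u (fst z)" "u (snd z)"] z by simp
    qed
  qed
  then have P: "AE x in lebesgue. AE y in lebesgue. \<not> (0 < u x \<and> u y < 0)"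
    using lebesgue_pair.AE_pair by fastforce
  show ?thesis
  proof (cases "AE x in lebesgue. u x \<le> 0")
    case True
    then have "AE x in lebesgue_on \<Omega>. u x \<le> 0" by (auto simp: AE_restrict_space_iff elim: eventually_mono)
    then show ?thesis unfolding constant_sign_on_def ..
  next
    case False
    have "\<exists>x. 0 < u x \<and> (AE y in lebesgue. \<not> (0 < u x \<and> u y < 0))"
    proof (rule ccontr)
      assume n: "\<not> ?thesis"
      have "AE x in lebesgue. u x \<le> 0" using P
      proof eventually_elim
        case (elim x)
        show ?case using n elim by (meson not_le)
      qed
      with False show False by blast
    qed
    then obtain x where "0 < u x" "AE y in lebesgue. \<not> (0 < u x \<and> u y < 0)" by blast
    then have "AE y in lebesgue. 0 \<le> u y" by (auto elim: eventually_mono)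
    then have "AE x in lebesgue_on \<Omega>. 0 \<le> u x" by (auto simp: AE_restrict_space_iff elim: eventually_mono)
    then show ?thesis unfolding constant_sign_on_def ..
  qed
qed

text \<open>Later arguments ask for pointwise conditions such as \<open>0 \<le> u x\<close>
  everywhere; this permits changing the representative to obtain them.\<close>

lemma X_cong_AE:
  assumes u: "u \<in> X" and v: "v \<in> borel_measurable lebesgue" "\<And>x. x \<notin> \<Omega> \<Longrightarrow> v x = 0" and e: "AE x in lebesgue. u x = v x"
  shows "v \<in> X" "J v = J u"
proof -
  note [measurable] = X_measurable[OF u] v(1)
  have eLL: "AE z in LL. u (fst z) = v (fst z) \<and> u (snd z) = v (snd z)"
    using AE_LL_fst[OF e] AE_LL_snd[OF e] by eventually_elim simp
  have n: "AE z in LL. \<bar>v (fst z) - v (snd z)\<bar> powr p = \<bar>u (fst z) - u (snd z)\<bar> powr p"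
    using eLL by eventually_elim simp
  have f: "AE z in LL. \<bar>v (fst z) - v (snd z)\<bar> powr p - \<bar>v (fst z)\<bar> powr p - \<bar>v (snd z)\<bar> powr p
    = \<bar>u (fst z) - u (snd z)\<bar> powr p - \<bar>u (fst z)\<bar> powr p - \<bar>u (snd z)\<bar> powr p"
    using eLL by eventually_elim simp
  have l: "AE x in lebesgue. \<bar>v x\<bar> powr p = \<bar>u x\<bar> powr p" using e by eventually_elim simp
  have "integrable lebesgue (\<lambda>x. \<bar>v x\<bar> powr p)"
    using X_powr[OF u] l by (subst integrable_cong_AE) auto
  moreover have "integrable near (\<lambda>z. \<bar>v (fst z) - v (snd z)\<bar> powr p)"
  proof (subst integrable_cong_AE[OF _ _ AE_near[OF n]])
    show "integrable near (\<lambda>z. \<bar>u (fst z) - u (snd z)\<bar> powr p)" by (rule X_near[OF u])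
  qed measurable
  ultimately show vX: "v \<in> X" using v by (simp add: X_iff)
  have 1: "near_energy v = near_energy u"
    by (rule integral_cong_AE[OF _ _ AE_near[OF n]]) measurable
  have 2: "far_energy v = far_energy u"
    by (rule integral_cong_AE[OF _ _ AE_far[OF sets_Omega f]]) measurable
  have 3: "(LINT x|lebesgue_on \<Omega>. pot x (v x)) = (LINT x|lebesgue_on \<Omega>. pot x (u x))"
    using measurable_pot[OF X_measurable_Omega[OF vX]] measurable_pot[OF X_measurable_Omega[OF u]] e
    by (intro integral_cong_AE) (auto simp: AE_restrict_space_iff elim: eventually_mono)
  show "J v = J u" unfolding J_eq[OF u] J_eq[OF vX] 1 2 3 ..
qed

lemma minimizer_cong_AE:
  assumes "minimizer u" "v \<in> borel_measurable lebesgue" "\<And>x. x \<notin> \<Omega> \<Longrightarrow> v x = 0" "AE x in lebesgue. u x = v x"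
  shows "minimizer v"
  using X_cong_AE[of u v] assms by (auto simp: minimizer_def)

end

subsection \<open>Behaviour at the boundary of the support\<close>

text \<open>\<open>S\<close> below is the essential support of \<open>A\<close>. It is compact, and
  nonempty because a locally negligible set is negligible; a maximum point of the linear functional
  given by \<open>e\<close> on it has the two properties.\<close>

lemma exists_extreme_support_point:
  fixes A :: "'a::euclidean_space set"
  assumes A: "bounded A" "\<not> negligible A"
  obtains x0 where "\<And>r. 0 < r \<Longrightarrow> \<not> negligible (A \<inter> ball x0 r)" "negligible {x \<in> A. x0 \<bullet> e < x \<bullet> e}"
proof -
  define S where "S = {x. \<forall>r>0. \<not> negligible (A \<inter> ball x r)}"
  have local: "negligible B" if "B \<subseteq> A" "B \<inter> S = {}" for B
  proof (rule locally_negligible_alt[THEN iffD2], intro ballI)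
    fix x assume x: "x \<in> B"
    then have "x \<notin> S" using that by blast
    then obtain r where r: "0 < r" "negligible (A \<inter> ball x r)" by (auto simp: S_def)
    show "\<exists>U. openin (top_of_set B) U \<and> x \<in> U \<and> negligible U"
    proof (intro exI conjI)
      show "openin (top_of_set B) (B \<inter> ball x r)" by (simp add: openin_open_Int)
      show "x \<in> B \<inter> ball x r" using x r by simp
      show "negligible (B \<inter> ball x r)" by (rule negligible_subset[OF r(2)]) (use that in auto)
    qed
  qed
  have "S \<noteq> {}"
  proof
    assume "S = {}"
    then have "negligible A" by (intro local) auto
    with A(2) show False ..
  qed
  moreover have "compact S"
  proof (rule compact_eq_bounded_closed[THEN iffD2], intro conjI)
    have "S \<subseteq> closure A"
    proof
      fix x assume "x \<in> S"
      have "\<exists>y\<in>A. dist y x < r" if "0 < r" for r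
      proof -
        have "\<not> negligible (A \<inter> ball x r)" using \<open>x \<in> S\<close> that by (simp add: S_def)
        then have "A \<inter> ball x r \<noteq> {}" by (metis negligible_empty)
        then show ?thesis by (auto simp: dist_commute)
      qed
      then show "x \<in> closure A" unfolding closure_approachable by blast
    qed
    then show "bounded S" using bounded_closure[OF A(1)] bounded_subset by blast
    have "open (- S)"
    proof (rule open_contains_ball[THEN iffD2], intro ballI)
      fix x assume "x \<in> - S"
      then obtain r where r: "0 < r" "negligible (A \<inter> ball x r)" by (auto simp: S_def)
      have "ball x r \<subseteq> - S"
      proof
        fix y assume y: "y \<in> ball x r"
        have "A \<inter> ball y (r - dist x y) \<subseteq> A \<inter> ball x r"
        proof -
          have "dist x w < r" if "dist y w < r - dist x y" for w
            using dist_triangle[of x w y] that by linarith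
          then show ?thesis by auto
        qed
        then have "negligible (A \<inter> ball y (r - dist x y))" using r(2) by (rule negligible_subset[rotated])
        then show "y \<in> - S" using y by (auto simp: S_def intro!: exI[of _ "r - dist x y"])
      qed
      with r(1) show "\<exists>r>0. ball x r \<subseteq> - S" by blast
    qed
    then show "closed S" by (simp add: closed_def)
  qed
  ultimately have "\<exists>x0\<in>S. \<forall>x\<in>S. x \<bullet> e \<le> x0 \<bullet> e"
    by (intro continuous_attains_sup continuous_on_inner continuous_on_id continuous_on_const)
  then obtain x0 where x0: "x0 \<in> S" "\<forall>x\<in>S. x \<bullet> e \<le> x0 \<bullet> e" by (elim bexE)
  have extreme: "\<not> x0 \<bullet> e < x \<bullet> e" if "x \<in> S" for x
    using bspec[OF x0(2) that] by (rule leD)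
  have "negligible {x \<in> A. x0 \<bullet> e < x \<bullet> e}"
    by (rule local) (use extreme in blast)+
  moreover have "\<not> negligible (A \<inter> ball x0 r)" if "0 < r" for r
    using x0(1) that unfolding S_def by blast
  ultimately show ?thesis by (intro that)
qed

text \<open>Tonelli, integrating first over the variable that does not occur in \<open>v\<close>;
  that inner integral is independent of the other point.\<close>

lemma nn_integral_near_convolution:
  fixes v :: "'a::euclidean_space \<Rightarrow> real" and \<beta> :: "'a \<Rightarrow> real"
  assumes [measurable]: "v \<in> borel_measurable lebesgue" "\<beta> \<in> borel_measurable borel"
    and "\<And>x. 0 \<le> v x" "\<And>z. 0 \<le> \<beta> z"
  shows "(\<integral>\<^sup>+z. ennreal (v (fst z) * \<beta> (fst z - snd z)) \<partial>near) = (\<integral>\<^sup>+z. ennreal (kern z * \<beta> z) \<partial>lborel) * (\<integral>\<^sup>+x. ennreal (v x) \<partial>lebesgue)"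
    and "(\<integral>\<^sup>+z. ennreal (v (snd z) * \<beta> (fst z - snd z)) \<partial>near) = (\<integral>\<^sup>+z. ennreal (kern z * \<beta> z) \<partial>lborel) * (\<integral>\<^sup>+x. ennreal (v x) \<partial>lebesgue)"
proof -
  have m: "(\<lambda>z. ennreal (v (fst z) * \<beta> (fst z - snd z))) \<in> borel_measurable LL"
    "(\<lambda>z. ennreal (v (snd z) * \<beta> (fst z - snd z))) \<in> borel_measurable LL" by measurable
  have "(\<integral>\<^sup>+y. ennreal (kern (x - y)) * ennreal (v x * \<beta> (x - y)) \<partial>lebesgue) = (\<integral>\<^sup>+z. ennreal (kern z * \<beta> z) \<partial>lborel) * ennreal (v x)" for x
  proof -
    have "(\<integral>\<^sup>+y. ennreal (kern (x - y)) * ennreal (v x * \<beta> (x - y)) \<partial>lebesgue) = (\<integral>\<^sup>+y. ennreal (kern (x - y) * \<beta> (x - y)) * ennreal (v x) \<partial>lebesgue)"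
      using assms by (intro nn_integral_cong) (simp add: ennreal_mult[symmetric] mult_ac)
    also have "\<dots> = (\<integral>\<^sup>+y. ennreal (kern (x - y) * \<beta> (x - y)) \<partial>lebesgue) * ennreal (v x)"
      by (rule nn_integral_multc) measurable
    also have "(\<integral>\<^sup>+y. ennreal (kern (x - y) * \<beta> (x - y)) \<partial>lebesgue) = (\<integral>\<^sup>+z. ennreal (kern z * \<beta> z) \<partial>lborel)"
      by (rule nn_integral_lebesgue_diff) measurable
    finally show ?thesis .
  qed
  then show "(\<integral>\<^sup>+z. ennreal (v (fst z) * \<beta> (fst z - snd z)) \<partial>near) = (\<integral>\<^sup>+z. ennreal (kern z * \<beta> z) \<partial>lborel) * (\<integral>\<^sup>+x. ennreal (v x) \<partial>lebesgue)"
    using nn_integral_near(1)[OF m(1)] by (simp add: nn_integral_cmult)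
  have "(\<integral>\<^sup>+x. ennreal (kern (x - y)) * ennreal (v y * \<beta> (x - y)) \<partial>lebesgue) = (\<integral>\<^sup>+z. ennreal (kern z * \<beta> z) \<partial>lborel) * ennreal (v y)" for y
  proof -
    have "(\<integral>\<^sup>+x. ennreal (kern (x - y)) * ennreal (v y * \<beta> (x - y)) \<partial>lebesgue) = (\<integral>\<^sup>+x. ennreal (kern (x - y) * \<beta> (x - y)) * ennreal (v y) \<partial>lebesgue)"
      using assms by (intro nn_integral_cong) (simp add: ennreal_mult[symmetric] mult_ac)
    also have "\<dots> = (\<integral>\<^sup>+x. ennreal (kern (x - y) * \<beta> (x - y)) \<partial>lebesgue) * ennreal (v y)"
      by (rule nn_integral_multc) measurable
    also have "(\<integral>\<^sup>+x. ennreal (kern (x - y) * \<beta> (x - y)) \<partial>lebesgue) = (\<integral>\<^sup>+z. ennreal (kern z * \<beta> z) \<partial>lborel)"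
      by (rule nn_integral_lebesgue_diff') measurable
    finally show ?thesis .
  qed
  then show "(\<integral>\<^sup>+z. ennreal (v (snd z) * \<beta> (fst z - snd z)) \<partial>near) = (\<integral>\<^sup>+z. ennreal (kern z * \<beta> z) \<partial>lborel) * (\<integral>\<^sup>+x. ennreal (v x) \<partial>lebesgue)"
    using nn_integral_near(2)[OF m(2)] by (simp add: nn_integral_cmult)
qed

lemma integral_near_convolution:
  fixes v :: "'a::euclidean_space \<Rightarrow> real" and \<beta> :: "'a \<Rightarrow> real"
  assumes v: "integrable lebesgue v" "\<And>x. 0 \<le> v x" and [measurable]: "\<beta> \<in> borel_measurable borel" and b0: "\<And>z. 0 \<le> \<beta> z"
    and D: "(\<integral>\<^sup>+z. ennreal (kern z * \<beta> z) \<partial>lborel) = ennreal D" "0 \<le> D"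
  shows "integrable near (\<lambda>z. v (fst z) * \<beta> (fst z - snd z))" "(LINT z|near. v (fst z) * \<beta> (fst z - snd z)) = D * (LINT x|lebesgue. v x)"
    and "integrable near (\<lambda>z. v (snd z) * \<beta> (fst z - snd z))" "(LINT z|near. v (snd z) * \<beta> (fst z - snd z)) = D * (LINT x|lebesgue. v x)"
proof -
  have [measurable]: "v \<in> borel_measurable lebesgue" using v(1) by simp
  have V: "(\<integral>\<^sup>+x. ennreal (v x) \<partial>lebesgue) = ennreal (LINT x|lebesgue. v x)" "0 \<le> (LINT x|lebesgue. v x)"
    using v by (auto intro!: nn_integral_eq_integral integral_nonneg_AE)
  have n: "(\<integral>\<^sup>+z. ennreal (v (fst z) * \<beta> (fst z - snd z)) \<partial>near) = ennreal (D * (LINT x|lebesgue. v x))"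
    "(\<integral>\<^sup>+z. ennreal (v (snd z) * \<beta> (fst z - snd z)) \<partial>near) = ennreal (D * (LINT x|lebesgue. v x))"
    unfolding ennreal_mult[OF D(2) V(2)] D(1)[symmetric] V(1)[symmetric]
    by (rule nn_integral_near_convolution; use v b0 in simp)+
  have nn: "0 \<le> v (fst z) * \<beta> (fst z - snd z)" "0 \<le> v (snd z) * \<beta> (fst z - snd z)" for z using v b0 by auto
  show i: "integrable near (\<lambda>z. v (fst z) * \<beta> (fst z - snd z))" "integrable near (\<lambda>z. v (snd z) * \<beta> (fst z - snd z))"
    by (intro integrableI_nonneg; use n nn in simp)+
  show "(LINT z|near. v (fst z) * \<beta> (fst z - snd z)) = D * (LINT x|lebesgue. v x)"
    "(LINT z|near. v (snd z) * \<beta> (fst z - snd z)) = D * (LINT x|lebesgue. v x)"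
    using n i nn D(2) V(2) by (simp_all add: nn_integral_eq_integral integral_nonneg_AE)
qed

text \<open>
  The weight \<open>barrier_weight\<close> bounds \<open>h (b - a)\<close> when \<open>a = u x < b = u y\<close> although the test function
  \<open>(u - \<psi>)\<^sub>+\<close> is not smaller at \<open>x\<close> than at \<open>y\<close>; the slope of \<open>\<psi>\<close> is \<open>M 2\<^sup>J\<close>.
\<close>

definition barrier_weight :: "real \<Rightarrow> real \<Rightarrow> real \<Rightarrow> nat \<Rightarrow> nat \<Rightarrow> 'a::euclidean_space \<Rightarrow> real" where
  "barrier_weight p M \<epsilon> j0 J z =
     M powr (p - 1) * ((2 ^ J * norm z) powr (p - 1) * indicator (cball 0 (1 / 2 ^ J)) z)
     + (2 * \<epsilon>) powr (p - 1) * indicator {z. 1 / 2 ^ J \<le> norm z} z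
     + M powr (p - 1) * indicator {z. 1 / 2 ^ j0 \<le> norm z} z"

lemma barrier_weight_nonneg: "0 \<le> barrier_weight p M \<epsilon> j0 J z"
  by (simp add: barrier_weight_def)

lemma measurable_barrier_weight [measurable]: "barrier_weight p M \<epsilon> j0 J \<in> borel_measurable borel"
proof -
  have [measurable]: "cball (0::'a) (1 / 2 ^ J) \<in> sets borel" by simp
  show ?thesis unfolding barrier_weight_def by measurable
qed

text \<open>Only the middle summand grows with \<open>J\<close>, and its coefficient
  \<open>(2 * \<epsilon>) powr (p - 1)\<close> can be made small; the steep part is bounded
  uniformly in \<open>J\<close>, the distant part depends on the fixed \<open>j0\<close>.\<close>

lemma nn_integral_barrier_weight:
  assumes "1 < p" "0 \<le> M"
  defines "C2 \<equiv> ball_vol TYPE('a::euclidean_space) * 2 ^ DIM('a)"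
  shows "(\<integral>\<^sup>+(z::'a). ennreal (kern z * barrier_weight p M \<epsilon> j0 J z) \<partial>lborel)
    \<le> ennreal (M powr (p - 1) * (C2 / (1 - 2 powr (- (p - 1)))) + (2 * \<epsilon>) powr (p - 1) * (real J * C2) + M powr (p - 1) * (real j0 * C2))"
proof -
  have [measurable]: "cball (0::'a) (1 / 2 ^ J) \<in> sets borel" by simp
  have C2: "0 \<le> C2" by (simp add: C2_def)
  have Cq: "0 \<le> C2 / (1 - 2 powr (- (p - 1)))"
    using assms(1) C2 powr_mono[of "- (p - 1)" 0 2] by (intro divide_nonneg_nonneg) auto
  let ?a = "\<lambda>z::'a. ennreal (kern z * (2 ^ J * norm z) powr (p - 1)) * indicator (cball 0 (1 / 2 ^ J)) z"
  let ?b = "\<lambda>(j::nat) (z::'a). ennreal (kern z) * indicator {z. 1 / 2 ^ j \<le> norm z} z"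
  have "ennreal (kern z * barrier_weight p M \<epsilon> j0 J z) = ennreal (M powr (p - 1)) * ?a z + ennreal ((2 * \<epsilon>) powr (p - 1)) * ?b J z
      + ennreal (M powr (p - 1)) * ?b j0 z" for z
    by (auto simp: barrier_weight_def indicator_def ennreal_mult[symmetric] ennreal_plus[symmetric] algebra_simps simp del: ennreal_plus)
  then have "(\<integral>\<^sup>+(z::'a). ennreal (kern z * barrier_weight p M \<epsilon> j0 J z) \<partial>lborel)
    = (\<integral>\<^sup>+z. ennreal (M powr (p - 1)) * ?a z + ennreal ((2 * \<epsilon>) powr (p - 1)) * ?b J z + ennreal (M powr (p - 1)) * ?b j0 z \<partial>lborel)"
    by (simp only:)
  also have "\<dots> = ennreal (M powr (p - 1)) * (\<integral>\<^sup>+z. ?a z \<partial>lborel) + ennreal ((2 * \<epsilon>) powr (p - 1)) * (\<integral>\<^sup>+z. ?b J z \<partial>lborel)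
      + ennreal (M powr (p - 1)) * (\<integral>\<^sup>+z. ?b j0 z \<partial>lborel)"
    by (simp add: nn_integral_add nn_integral_cmult)
  also have "\<dots> \<le> ennreal (M powr (p - 1)) * ennreal (C2 / (1 - 2 powr (- (p - 1)))) + ennreal ((2 * \<epsilon>) powr (p - 1)) * ennreal (real J * C2)
      + ennreal (M powr (p - 1)) * ennreal (real j0 * C2)"
    unfolding C2_def using assms(1)
    by (intro add_mono mult_left_mono nn_integral_kern_upper nn_integral_kern_power) auto
  also have "\<dots> = ennreal (M powr (p - 1) * (C2 / (1 - 2 powr (- (p - 1)))) + (2 * \<epsilon>) powr (p - 1) * (real J * C2) + M powr (p - 1) * (real j0 * C2))"
  proof -
    have *: "ennreal a * ennreal b + ennreal c * ennreal d + ennreal a * ennreal e = ennreal (a * b + c * d + a * e)"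
      if "0 \<le> a" "0 \<le> b" "0 \<le> c" "0 \<le> d" "0 \<le> e" for a b c d e
      using that by (simp add: ennreal_mult)
    show ?thesis using C2 Cq by (intro *) auto
  qed
  finally show ?thesis .
qed

text \<open>Where \<open>v x\<close> is positive, \<open>x\<close> is within
  \<open>1 / 2 ^ J\<close> of \<open>x0\<close>, since the cone exceeds \<open>M\<close> further
  out. A point \<open>y\<close> lying more than \<open>1 / 2 ^ J\<close> beyond \<open>x\<close> in
  direction \<open>e\<close> is then in the half space of zeros, and \<open>h\<close> gains at least
  \<open>(m - \<epsilon>) powr (p - 1)\<close>. For other \<open>y\<close>, \<open>h\<close> can be
  negative only if \<open>u x < u y\<close>, and \<open>barrier_weight\<close> bounds that
  loss.\<close>

lemma barrier_pointwise:
  fixes x y x0 e :: "'a::euclidean_space" and u :: "'a \<Rightarrow> real"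
  assumes p: "1 < p" and e: "norm e = 1" and M: "0 < M" and Jj: "j0 \<le> J" "2 / 2 ^ j0 \<le> r0"
    and u: "\<And>x. 0 \<le> u x" "\<And>x. u x \<le> M"
    and ux: "x \<in> ball x0 r0 \<longrightarrow> u x \<le> m + \<epsilon>" "y \<in> ball x0 r0 \<longrightarrow> u y \<le> m + \<epsilon>"
      "x0 \<bullet> e < x \<bullet> e \<longrightarrow> u x = 0" "x0 \<bullet> e < y \<bullet> e \<longrightarrow> u y = 0"
    and m: "0 < m - \<epsilon>" "0 < \<epsilon>"
    and v: "\<And>x. v x = max 0 (u x - (m - \<epsilon> + M * 2 ^ J * dist x0 x))"
    and xy: "v y \<le> v x"
  shows "v x * ((m - \<epsilon>) powr (p - 1) * indicator {z. 1 / 2 ^ J < - (z \<bullet> e)} (x - y) - barrier_weight p M \<epsilon> j0 J (x - y))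
      + v y * ((m - \<epsilon>) powr (p - 1) * indicator {z. 1 / 2 ^ J < z \<bullet> e} (x - y) - barrier_weight p M \<epsilon> j0 J (x - y))
    \<le> h p (u x - u y) * (v x - v y)"
proof -
  let ?B = "barrier_weight p M \<epsilon> j0 J (x - y)"
  let ?G = "(m - \<epsilon>) powr (p - 1)"
  have v0: "0 \<le> v x" for x by (simp add: v)
  have close: "dist x0 x < 1 / 2 ^ J" "m - \<epsilon> < u x" if "0 < v x" for x
  proof -
    have *: "m - \<epsilon> + M * 2 ^ J * dist x0 x < u x" using that by (simp add: v)
    then have "M * (2 ^ J * dist x0 x) < M * 1" using u(2)[of x] m(1) by (simp add: mult.assoc)
    then have "2 ^ J * dist x0 x < 1" using M by simp
    then show "dist x0 x < 1 / 2 ^ J" by (simp add: field_simps)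
    have "0 \<le> M * 2 ^ J * dist x0 x" using M by simp
    with * show "m - \<epsilon> < u x" by linarith
  qed
  have halfspace: "x0 \<bullet> e < b \<bullet> e" if "dist x0 a < 1 / 2 ^ J" "1 / 2 ^ J < (b - a) \<bullet> e" for a b
  proof -
    have "\<bar>(a - x0) \<bullet> e\<bar> \<le> dist x0 a" using Cauchy_Schwarz_ineq2[of "a - x0" e] e by (simp add: dist_norm norm_minus_commute)
    with that show ?thesis by (simp add: inner_diff_left)
  qed
  show ?thesis
  proof (cases "v x = 0")
    case True
    with xy v0[of y] have "v y = 0" by linarith
    with True show ?thesis by simp
  next
    case False
    with v0[of x] have vx: "0 < v x" by simp
    \<comment> \<open>If \<open>v y\<close> were positive with \<open>x\<close> beyond
      \<open>y\<close>, then \<open>x\<close> would be in the half space and \<open>u x = 0\<close>,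
      against \<open>v x > 0\<close>. So this summand never exceeds 0.\<close>
    have 1: "v y * (?G * indicator {z. 1 / 2 ^ J < z \<bullet> e} (x - y) - ?B) \<le> 0"
    proof (cases "0 < v y \<and> 1 / 2 ^ J < (x - y) \<bullet> e")
      case True
      then have "x0 \<bullet> e < x \<bullet> e" using halfspace[OF close(1)] by blast
      then have "u x = 0" using ux by simp
      then show ?thesis using close(2)[OF vx] m by simp
    next
      case False
      then show ?thesis using v0[of y] barrier_weight_nonneg[of p M \<epsilon> j0 J "x - y"]
        by (auto simp: indicator_def mult_nonneg_nonpos)
    qed
    have 2: "v x * (?G * indicator {z. 1 / 2 ^ J < - (z \<bullet> e)} (x - y) - ?B) \<le> h p (u x - u y) * (v x - v y)"
    proof (cases "1 / 2 ^ J < - ((x - y) \<bullet> e)")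
      case True
      then have "1 / 2 ^ J < (y - x) \<bullet> e" by (simp add: inner_diff_left)
      then have "x0 \<bullet> e < y \<bullet> e" using halfspace[OF close(1)[OF vx]] by blast
      then have uy: "u y = 0" using ux by simp
      then have vy: "v y = 0" using v0[of y] close(2)[of y] m by force
      have "v x * (?G - ?B) \<le> v x * ?G" using vx barrier_weight_nonneg[of p M \<epsilon> j0 J "x - y"] by (intro mult_left_mono) auto
      also have "\<dots> \<le> v x * u x powr (p - 1)"
        using vx close(2)[OF vx] m p by (intro mult_left_mono powr_mono2) auto
      also have "\<dots> = h p (u x - u y) * (v x - v y)" using uy vy u(1)[of x] by (simp add: h_nonneg mult.commute)
      finally show ?thesis using True by simp
    next
      case False
      have "- (v x * ?B) \<le> h p (u x - u y) * (v x - v y)"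
      proof (cases "u y \<le> u x")
        case True
        then have "0 \<le> h p (u x - u y) * (v x - v y)" using xy by (simp add: h_nonneg)
        moreover have "0 \<le> v x * ?B" using vx barrier_weight_nonneg[of p M \<epsilon> j0 J "x - y"] by simp
        ultimately show ?thesis by linarith
      next
        case False
        then have lt: "u x < u y" by simp
        have key: "(u y - u x) powr (p - 1) \<le> ?B"
        proof -
          \<comment> \<open>From \<open>v y \<le> v x\<close> the increase of \<open>u\<close> is at
            most the increase of the cone, hence bounded by its slope times the distance.\<close>
          have "u y - (m - \<epsilon> + M * 2 ^ J * dist x0 y) \<le> v y" by (simp add: v)
          moreover have "v x = u x - (m - \<epsilon> + M * 2 ^ J * dist x0 x)" using vx by (auto simp: v max_def split: if_splits)
          ultimately have "u y - u x \<le> M * 2 ^ J * dist x0 y - M * 2 ^ J * dist x0 x" using xy by linarith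
          also have "\<dots> = M * 2 ^ J * (dist x0 y - dist x0 x)" by (simp add: right_diff_distrib)
          also have "\<dots> \<le> M * 2 ^ J * norm (x - y)"
            using dist_triangle[of x0 y x] M by (intro mult_left_mono) (auto simp: dist_norm)
          finally have slope: "u y - u x \<le> M * (2 ^ J * norm (x - y))" by (simp add: mult.assoc)
          consider "norm (x - y) \<le> 1 / 2 ^ J" | "1 / 2 ^ J \<le> norm (x - y)" "norm (x - y) < 1 / 2 ^ j0" | "1 / 2 ^ j0 \<le> norm (x - y)"
            by linarith
          then show ?thesis
          proof cases
            case 1
            have "(u y - u x) powr (p - 1) \<le> (M * (2 ^ J * norm (x - y))) powr (p - 1)"
              using slope lt p by (intro powr_mono2) auto
            also have "\<dots> = M powr (p - 1) * (2 ^ J * norm (x - y)) powr (p - 1)"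
              using M by (subst powr_mult) auto
            also have "\<dots> \<le> ?B" using 1 by (simp add: barrier_weight_def)
            finally show ?thesis .
          next
            case 2
            \<comment> \<open>At intermediate distance \<open>y\<close> is still in the ball of
              radius \<open>r0\<close>, where \<open>u\<close> is at most
              \<open>m + \<epsilon>\<close>, while \<open>u x\<close> exceeds
              \<open>m - \<epsilon>\<close>.\<close>
            have "1 / 2 ^ J \<le> 1 / (2::real) ^ j0" using Jj by (intro divide_left_mono power_increasing) auto
            moreover have "dist x0 y \<le> dist x0 x + norm (x - y)" using dist_triangle[of x0 y x] by (simp add: dist_norm)
            ultimately have "dist x0 y < r0" using close(1)[OF vx] 2 Jj(2) by linarith
            then have "u y \<le> m + \<epsilon>" using ux by simp
            then have "u y - u x \<le> 2 * \<epsilon>" using close(2)[OF vx] by linarith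
            then have "(u y - u x) powr (p - 1) \<le> (2 * \<epsilon>) powr (p - 1)" using lt p by (intro powr_mono2) auto
            also have "\<dots> \<le> ?B" using 2 by (simp add: barrier_weight_def)
            finally show ?thesis .
          next
            case 3
            have "(u y - u x) powr (p - 1) \<le> M powr (p - 1)" using lt u(2)[of y] u(1)[of x] p by (intro powr_mono2) auto
            also have "\<dots> \<le> ?B" using 3 by (simp add: barrier_weight_def)
            finally show ?thesis .
          qed
        qed
        have "h p (u x - u y) = - ((u y - u x) powr (p - 1))" using lt by (simp add: h_sgn)
        then have "h p (u x - u y) * (v x - v y) = - ((u y - u x) powr (p - 1) * (v x - v y))" by simp
        moreover have "(u y - u x) powr (p - 1) * (v x - v y) \<le> ?B * v x"
          using key v0[of y] xy barrier_weight_nonneg[of p M \<epsilon> j0 J "x - y"] by (intro mult_mono) auto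
        ultimately show ?thesis by (simp add: mult.commute)
      qed
      then show ?thesis using False by simp
    qed
    show ?thesis using 1 2 by linarith
  qed
qed

context log_problem
begin

text \<open>
  A minimiser cannot jump at the boundary of its support.  Test with \<open>(u - \<psi>)\<^sub>+\<close>, where \<open>\<psi>\<close> is a steep
  cone whose tip lies slightly below the essential limit superior \<open>m\<close> of \<open>u\<close> at an extreme point
  \<open>x0\<close> of the support.  The half space beyond \<open>x0\<close> contributes \<open>(m - \<epsilon>)\<^sup>p\<^sup>-\<^sup>1\<close> times a logarithmically
  divergent integral, against only \<open>(2\<epsilon>)\<^sup>p\<^sup>-\<^sup>1\<close> times such an integral with the opposite sign.
\<close>

lemma minimizer_no_gap_aux:
  assumes mn: "minimizer u" and \<delta>: "0 < \<delta>" and gap: "\<And>x. u x = 0 \<or> (\<delta> \<le> u x \<and> u x \<le> M)"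
  shows False
proof -
  have uX: "u \<in> X" using mn by (simp add: minimizer_def)
  note [measurable] = X_measurable[OF uX]
  define A where "A = {x. u x \<noteq> 0}"
  have "A \<subseteq> \<Omega>" using X_zero[OF uX] by (auto simp: A_def)
  then have Ab: "bounded A" using bounded_Omega bounded_subset by blast
  have Am: "A \<in> sets lebesgue"
    unfolding A_def using measurable_sets[OF X_measurable[OF uX], of "- {0}"] by (simp add: vimage_def)
  have negl: "negligible (A \<inter> B) \<longleftrightarrow> (AE x in lebesgue. x \<in> B \<longrightarrow> u x = 0)" if B: "B \<in> sets lebesgue" for B
  proof -
    have "negligible (A \<inter> B) \<longleftrightarrow> (AE x in lebesgue. x \<notin> A \<inter> B)"
      unfolding negligible_iff_null_sets by (subst AE_iff_null_sets) (use Am B in auto)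
    moreover have "x \<notin> A \<inter> B \<longleftrightarrow> (x \<in> B \<longrightarrow> u x = 0)" for x by (auto simp: A_def)
    ultimately show ?thesis by (simp only:)
  qed
  have An: "\<not> negligible A"
    using minimizer_nontrivial[OF mn] negl[of UNIV] by (simp add: nontrivial_def)
  have M0: "\<delta> \<le> M"
  proof (rule ccontr)
    assume "\<not> \<delta> \<le> M"
    then have "u x = 0" for x using gap[of x] by linarith
    then show False using minimizer_nontrivial[OF mn] by (simp add: nontrivial_def)
  qed
  have Mpos: "0 < M" using M0 \<delta> by linarith
  have u0: "0 \<le> u x" and uM: "u x \<le> M" for x using gap[of x] \<delta> Mpos by auto
  obtain e :: 'a where e: "norm e = 1" using norm_Basis SOME_Basis by blast
  obtain x0 where x0: "\<And>r. 0 < r \<Longrightarrow> \<not> negligible (A \<inter> ball x0 r)" "negligible {x \<in> A. x0 \<bullet> e < x \<bullet> e}"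
    by (rule exists_extreme_support_point[OF Ab An, of e]) (rule that)
  have half: "AE x in lebesgue. x0 \<bullet> e < x \<bullet> e \<longrightarrow> u x = 0"
  proof -
    have "open {x. x0 \<bullet> e < x \<bullet> e}" by (intro open_Collect_less continuous_intros)
    then have "{x. x0 \<bullet> e < x \<bullet> e} \<in> sets lebesgue" by auto
    moreover have "A \<inter> {x. x0 \<bullet> e < x \<bullet> e} = {x \<in> A. x0 \<bullet> e < x \<bullet> e}" by blast
    ultimately show ?thesis using negl[of "{x. x0 \<bullet> e < x \<bullet> e}"] x0(2) by simp
  qed
  \<comment> \<open>The essential upper bounds of \<open>u\<close> near \<open>x0\<close>; their
    infimum \<open>m\<close> is the essential limit superior there, and the gap gives
    \<open>\<delta> \<le> m\<close>.\<close>
  define T where "T = {t. \<exists>r>0. AE x in lebesgue. x \<in> ball x0 r \<longrightarrow> u x \<le> t}"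
  have MT: "M \<in> T" using uM by (auto simp: T_def intro!: exI[of _ 1])
  have T\<delta>: "\<delta> \<le> t" if t: "t \<in> T" for t
  proof (rule ccontr)
    assume n: "\<not> \<delta> \<le> t"
    obtain r where r: "0 < r" "AE x in lebesgue. x \<in> ball x0 r \<longrightarrow> u x \<le> t" using t by (auto simp: T_def)
    have "AE x in lebesgue. x \<in> ball x0 r \<longrightarrow> u x = 0"
      using r(2)
    proof eventually_elim
      case (elim x)
      then show ?case using gap[of x] n by linarith
    qed
    then show False using x0(1)[OF r(1)] negl[of "ball x0 r"] by simp
  qed
  define m where "m = Inf T"
  have bdd: "bdd_below T" by (rule bdd_belowI[of _ \<delta>]) (rule T\<delta>)
  have m\<delta>: "\<delta> \<le> m" unfolding m_def using MT T\<delta> by (intro cInf_greatest) auto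
  define c1 where "c1 = ball_vol TYPE('a) / 4 ^ DIM('a)"
  define C2 where "C2 = ball_vol TYPE('a) * 2 ^ DIM('a)"
  have c1: "0 < c1" and C2: "0 < C2" by (auto simp: c1_def C2_def)
  define G0 where "G0 = (\<delta> / 2) powr (p - 1)"
  have G0: "0 < G0" using \<delta> by (simp add: G0_def)
  \<comment> \<open>\<open>c1\<close> and \<open>C2\<close> are the lower and upper kernel mass per
    dyadic scale. With this \<open>\<eta>\<close>, equal to \<open>2 * \<epsilon>\<close>, the loss
    per scale is at most half of the gain \<open>G0 * c1\<close>.\<close>
  define \<eta> where "\<eta> = min \<delta> ((G0 * c1 / (2 * C2)) powr (1 / (p - 1)))"
  have \<eta>: "0 < \<eta>" "\<eta> \<le> \<delta>" using \<delta> G0 c1 C2 by (auto simp: \<eta>_def)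
  have \<eta>p: "\<eta> powr (p - 1) * C2 \<le> G0 * c1 / 2"
  proof -
    have "\<eta> powr (p - 1) \<le> ((G0 * c1 / (2 * C2)) powr (1 / (p - 1))) powr (p - 1)"
      using \<eta> p by (intro powr_mono2) (auto simp: \<eta>_def)
    also have "\<dots> = G0 * c1 / (2 * C2)" using p G0 c1 C2 by (simp add: powr_powr)
    finally show ?thesis using C2 by (simp add: field_simps)
  qed
  define \<epsilon> where "\<epsilon> = \<eta> / 2"
  have \<epsilon>: "0 < \<epsilon>" "2 * \<epsilon> = \<eta>" "\<epsilon> \<le> \<delta> / 2" using \<eta> by (auto simp: \<epsilon>_def)
  have m\<epsilon>: "\<delta> / 2 \<le> m - \<epsilon>" using m\<delta> \<epsilon> by linarith
  have me0: "0 < m - \<epsilon>" using m\<epsilon> \<delta> by linarith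
  define G where "G = (m - \<epsilon>) powr (p - 1)"
  have GG0: "G0 \<le> G" unfolding G_def G0_def using m\<epsilon> \<delta> p by (intro powr_mono2) auto
  have "\<exists>t\<in>T. t < m + \<epsilon>" using cInf_lessD[of T "m + \<epsilon>"] MT \<epsilon> by (auto simp: m_def)
  then obtain t1 where t1: "t1 \<in> T" "t1 < m + \<epsilon>" by (elim bexE)
  obtain r0 where r0': "0 < r0" "AE x in lebesgue. x \<in> ball x0 r0 \<longrightarrow> u x \<le> t1"
    using t1(1) unfolding T_def by blast
  have r0: "0 < r0" "AE x in lebesgue. x \<in> ball x0 r0 \<longrightarrow> u x \<le> m + \<epsilon>"
    using r0' t1(2) by (auto elim!: eventually_mono)
  obtain j0 where "(1 / 2) ^ j0 < r0 / 2" using real_arch_pow_inv[of "r0 / 2" "1 / 2 :: real"] r0 by auto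
  then have j0: "2 / 2 ^ j0 \<le> r0" by (simp add: power_divide)
  obtain Cd where Cd: "0 < Cd" "AE x in lebesgue_on \<Omega>. \<forall>t s. \<bar>t\<bar> \<le> \<bar>s\<bar> \<longrightarrow> \<bar>dpot x t\<bar> * \<bar>s\<bar> \<le> Cd * pot_growth p s"
    using dpot_mult_bound by blast
  define K where "K = Cd * pot_growth p M / M"
  have K0: "0 \<le> K" using Cd Mpos pot_growth_ge_1[of p M] by (simp add: K_def)
  define D0 where "D0 = M powr (p - 1) * (C2 / (1 - 2 powr (- (p - 1)))) + M powr (p - 1) * (real j0 * C2)"
  define a where "a = measure lebesgue \<Omega>"
  define R where "R = cN * (2 * D0) + cN * (4 * M powr (p - 1) * a) + K"
  \<comment> \<open>\<open>R\<close> collects everything that stays bounded as \<open>J\<close>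
    grows; from this \<open>J\<close> on, the net logarithmic gain exceeds it.\<close>
  obtain J1 :: nat where J1: "R / (cN * (G0 * c1)) < real J1" using reals_Archimedean2 by blast
  define J where "J = max j0 J1"
  have cG: "0 < cN * (G0 * c1)" using cN_pos G0 c1 by simp
  have J: "j0 \<le> J" "R < cN * (G0 * c1) * real J"
  proof -
    have "R / (cN * (G0 * c1)) < real J" using J1 by (simp add: J_def)
    then show "R < cN * (G0 * c1) * real J" using cG by (subst (asm) pos_divide_less_eq) (auto simp: mult.commute)
  qed (simp add: J_def)
  define v where "v x = max 0 (u x - (m - \<epsilon> + M * 2 ^ J * dist x0 x))" for x
  have vle: "v x \<le> u x" for x
  proof -
    have "0 \<le> M * 2 ^ J * dist x0 x" using Mpos by simp
    then show ?thesis using u0[of x] me0 by (simp add: v_def)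
  qed
  have v0: "0 \<le> v x" for x by (simp add: v_def)
  have vz: "v x = 0" if "x \<notin> \<Omega>" for x using vle[of x] v0[of x] X_zero[OF uX that] by simp
  have vm[measurable]: "v \<in> borel_measurable lebesgue" unfolding v_def by measurable
  have vX: "v \<in> X"
  proof (rule X_space_dominated[OF p lmeasurable_Omega uX zero_in_X vm])
    let ?L = "M * 2 ^ J"
    let ?K = "2 powr p * (1 + ?L powr p)"
    have K1: "1 \<le> ?K"
      using p mult_mono[of 1 "2 powr p" 1 "1 + ?L powr p"] by (simp add: ge_one_powr_ge_zero)
    show "\<bar>v x\<bar> powr p \<le> ?K * (\<bar>u x\<bar> powr p + \<bar>0\<bar> powr p + 1)" for x
    proof -
      have "\<bar>v x\<bar> powr p \<le> 1 * (\<bar>u x\<bar> powr p + 1)"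
        using powr_mono2[of p "\<bar>v x\<bar>" "\<bar>u x\<bar>"] p v0[of x] vle[of x] by simp
      also have "\<dots> \<le> ?K * (\<bar>u x\<bar> powr p + 1)" using K1 by (intro mult_right_mono) auto
      finally show ?thesis by simp
    qed
    show "\<bar>v x - v y\<bar> powr p \<le> ?K * (\<bar>u x - u y\<bar> powr p + \<bar>0 - 0\<bar> powr p + norm (x - y) powr p * (indicator \<Omega> x + indicator \<Omega> y))" for x y
    proof (cases "x \<in> \<Omega> \<or> y \<in> \<Omega>")
      case True
      have t: "\<bar>dist x0 x - dist x0 y\<bar> \<le> norm (x - y)"
        using dist_triangle[of x0 x y] dist_triangle[of x0 y x] by (simp add: dist_norm[symmetric] dist_commute)
      have "\<bar>?L * dist x0 x - ?L * dist x0 y\<bar> = ?L * \<bar>dist x0 x - dist x0 y\<bar>"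
        using Mpos by (simp add: right_diff_distrib[symmetric] abs_mult)
      also have "\<dots> \<le> ?L * norm (x - y)" using t Mpos by (intro mult_left_mono) auto
      finally have "\<bar>v x - v y\<bar> \<le> \<bar>u x - u y\<bar> + ?L * norm (x - y)" unfolding v_def by linarith
      then have "\<bar>v x - v y\<bar> powr p \<le> (\<bar>u x - u y\<bar> + ?L * norm (x - y)) powr p"
        using p by (intro powr_mono2) auto
      also have "\<dots> \<le> 2 powr p * (\<bar>u x - u y\<bar> powr p + (?L * norm (x - y)) powr p)"
        using p Mpos by (intro powr_add_le) auto
      also have "\<dots> = 2 powr p * (\<bar>u x - u y\<bar> powr p + ?L powr p * norm (x - y) powr p)"
        using Mpos by (subst powr_mult) auto
      also have "\<dots> \<le> 2 powr p * ((1 + ?L powr p) * (\<bar>u x - u y\<bar> powr p + norm (x - y) powr p))"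
        by (intro mult_left_mono) (auto simp: algebra_simps)
      also have "\<dots> \<le> 2 powr p * ((1 + ?L powr p) * (\<bar>u x - u y\<bar> powr p + norm (x - y) powr p * (indicator \<Omega> x + indicator \<Omega> y)))"
        using True by (intro mult_left_mono add_left_mono) (auto simp: indicator_def)
      finally show ?thesis by (simp add: mult.assoc)
    qed (use vz in simp)
  qed (use vz in simp)
  have vi: "integrable lebesgue v"
  proof -
    have "\<bar>v x\<bar> \<le> M" for x using v0[of x] vle[of x] uM[of x] by linarith
    then have "integrable (lebesgue_on \<Omega>) v" by (rule integrable_bounded_Omega[OF X_measurable_Omega[OF vX]])
    then show ?thesis using restrict_Omega(2)[of v, OF vz] by simp
  qed
  define I where "I = (LINT x|lebesgue. v x)"
  have I\<Omega>: "(LINT x|lebesgue_on \<Omega>. v x) = I" unfolding I_def by (rule restrict_Omega(1)[symmetric]) (rule vz)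
  have I0: "0 < I"
  proof -
    have "0 \<le> I" unfolding I_def using v0 by (intro integral_nonneg_AE) auto
    moreover have "I \<noteq> 0"
    proof
      assume "I = 0"
      then have v00: "AE x in lebesgue. v x = 0"
        unfolding I_def by (subst (asm) integral_nonneg_eq_0_iff_AE[OF vi]) (use v0 in auto)
      \<comment> \<open>If \<open>v\<close> vanished almost everywhere, \<open>u\<close> would lie
        below the cone, hence below \<open>m - \<epsilon> / 2\<close> on this ball, contradicting
        the choice of \<open>m\<close> as infimum.\<close>
      define r1 where "r1 = \<epsilon> / (2 * (M * 2 ^ J))"
      have r1: "0 < r1" using \<epsilon> Mpos by (simp add: r1_def)
      have "AE x in lebesgue. x \<in> ball x0 r1 \<longrightarrow> u x \<le> m - \<epsilon> / 2"
        using v00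
      proof eventually_elim
        case (elim x)
        show ?case
        proof
          assume "x \<in> ball x0 r1"
          then have "M * 2 ^ J * dist x0 x \<le> M * 2 ^ J * r1" using Mpos by (intro mult_left_mono) auto
          also have "\<dots> = \<epsilon> / 2" using Mpos by (simp add: r1_def)
          finally show "u x \<le> m - \<epsilon> / 2" using elim unfolding v_def by linarith
        qed
      qed
      then have "m - \<epsilon> / 2 \<in> T" using r1 unfolding T_def by blast
      then have "m \<le> m - \<epsilon> / 2" unfolding m_def using bdd by (rule cInf_lower)
      then show False using \<epsilon> by simp
    qed
    ultimately show ?thesis by simp
  qed
  let ?\<beta>1 = "\<lambda>z::'a. indicat_real {z. 1 / 2 ^ J < - (z \<bullet> e)} z"
  let ?\<beta>2 = "\<lambda>z::'a. indicat_real {z. 1 / 2 ^ J < z \<bullet> e} z"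
  let ?B = "barrier_weight p M \<epsilon> j0 J :: 'a \<Rightarrow> real"
  have ext: "\<exists>D\<ge>real J * c1. (\<integral>\<^sup>+z. ennreal (kern z * indicat_real {z. 1 / 2 ^ J < z \<bullet> e'} z) \<partial>lborel) = ennreal D" if e': "norm e' = 1" for e' :: 'a
  proof -
    let ?n = "\<integral>\<^sup>+z. ennreal (kern z * indicat_real {z. 1 / 2 ^ J < z \<bullet> e'} z) \<partial>lborel"
    have eq: "?n = (\<integral>\<^sup>+z. ennreal (kern z) * indicator {z. 1 / 2 ^ J < z \<bullet> e'} z \<partial>lborel)"
      by (intro nn_integral_cong) (auto simp: indicator_def)
    have lo: "ennreal (real J * c1) \<le> ?n" unfolding eq c1_def by (rule nn_integral_kern_lower[OF e'])
    have "?n \<le> (\<integral>\<^sup>+z. ennreal (kern z) * indicator {z. 1 / 2 ^ J \<le> norm z} z \<partial>(lborel :: 'a measure))"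
      unfolding eq
    proof (intro nn_integral_mono)
      fix z :: 'a
      have "z \<bullet> e' \<le> norm z" using Cauchy_Schwarz_ineq2[of z e'] e' by auto
      then show "ennreal (kern z) * indicator {z. 1 / 2 ^ J < z \<bullet> e'} z \<le> ennreal (kern z) * indicator {z. 1 / 2 ^ J \<le> norm z} z"
        by (auto simp: indicator_def)
    qed
    also have "\<dots> \<le> ennreal (real J * C2)" unfolding C2_def by (rule nn_integral_kern_upper)
    finally have "?n < \<infinity>" by (simp add: le_less_trans[OF _ ennreal_less_top])
    then obtain D where "0 \<le> D" "?n = ennreal D" by (cases ?n) auto
    with lo c1 show ?thesis by (intro exI[of _ D]) auto
  qed
  obtain E2 where E2: "real J * c1 \<le> E2" "(\<integral>\<^sup>+z. ennreal (kern z * ?\<beta>2 z) \<partial>lborel) = ennreal E2" using ext[OF e] by blast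
  obtain E1 where E1: "real J * c1 \<le> E1" "(\<integral>\<^sup>+z. ennreal (kern z * ?\<beta>1 z) \<partial>lborel) = ennreal E1" using ext[of "- e"] e by auto
  have Jc: "0 \<le> real J * c1" using c1 by simp
  have \<beta>m[measurable]: "?\<beta>1 \<in> borel_measurable borel" "?\<beta>2 \<in> borel_measurable borel" by measurable
  note P1 = integral_near_convolution(1,2)[OF vi v0 \<beta>m(1) _ E1(2)]
  note P2 = integral_near_convolution(3,4)[OF vi v0 \<beta>m(2) _ E2(2)]
  have p1: "integrable near (\<lambda>z. v (fst z) * ?\<beta>1 (fst z - snd z))" "(LINT z|near. v (fst z) * ?\<beta>1 (fst z - snd z)) = E1 * I"
    unfolding I_def by (rule P1; use E1(1) Jc in simp)+
  have p2: "integrable near (\<lambda>z. v (snd z) * ?\<beta>2 (fst z - snd z))" "(LINT z|near. v (snd z) * ?\<beta>2 (fst z - snd z)) = E2 * I"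
    unfolding I_def by (rule P2; use E2(1) Jc in simp)+
  obtain DB where DB: "0 \<le> DB" "(\<integral>\<^sup>+z. ennreal (kern z * ?B z) \<partial>lborel) = ennreal DB" "DB \<le> D0 + \<eta> powr (p - 1) * (real J * C2)"
  proof -
    let ?n = "\<integral>\<^sup>+z. ennreal (kern z * ?B z) \<partial>lborel"
    have "?n \<le> ennreal (M powr (p - 1) * (C2 / (1 - 2 powr (- (p - 1)))) + (2 * \<epsilon>) powr (p - 1) * (real J * C2) + M powr (p - 1) * (real j0 * C2))"
      unfolding C2_def using p Mpos by (intro nn_integral_barrier_weight) auto
    then have n: "?n \<le> ennreal (D0 + \<eta> powr (p - 1) * (real J * C2))" by (simp add: D0_def \<epsilon>(2) add_ac)
    have "0 \<le> C2 / (1 - 2 powr (- (p - 1)))"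
      using p C2 powr_mono[of "- (p - 1)" 0 2] by (intro divide_nonneg_nonneg) auto
    then have nonneg: "0 \<le> D0 + \<eta> powr (p - 1) * (real J * C2)"
      unfolding D0_def using C2 by (intro add_nonneg_nonneg mult_nonneg_nonneg) auto
    have "?n < \<infinity>" using n by (simp add: le_less_trans[OF _ ennreal_less_top])
    then obtain D where D: "0 \<le> D" "?n = ennreal D" by (cases ?n) auto
    with n nonneg have "D \<le> D0 + \<eta> powr (p - 1) * (real J * C2)" by simp
    with D show ?thesis by (rule that)
  qed
  note q = integral_near_convolution[OF vi v0 measurable_barrier_weight barrier_weight_nonneg DB(2,1), folded I_def]
  let ?H = "\<lambda>z. h p (u (fst z) - u (snd z)) * (v (fst z) - v (snd z))"
  let ?W1 = "\<lambda>z. v (fst z) * (G * ?\<beta>1 (fst z - snd z) - ?B (fst z - snd z))"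
  let ?W2 = "\<lambda>z. v (snd z) * (G * ?\<beta>2 (fst z - snd z) - ?B (fst z - snd z))"
  have AEz: "AE z in LL. ?W1 z + ?W2 z \<le> ?H z"
    using AE_LL_fst[OF half] AE_LL_snd[OF half] AE_LL_fst[OF r0(2)] AE_LL_snd[OF r0(2)]
  proof eventually_elim
    case (elim z)
    let ?x = "fst z" and ?y = "snd z"
    note bp = barrier_pointwise[OF p e Mpos J(1) j0 u0 uM]
    show ?case
    proof (cases "v ?y \<le> v ?x")
      case True
      show ?thesis unfolding G_def
        by (rule bp[where m = m]) (use elim me0 \<epsilon> True in \<open>auto simp: v_def\<close>)
    next
      case False
      \<comment> \<open>The pointwise estimate assumes the larger test value at the first point.
        Exchanging the points leaves the weight unchanged and swaps the two half spaces.\<close>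
      have sym: "?B (?y - ?x) = ?B (?x - ?y)" by (simp add: barrier_weight_def indicator_def norm_minus_commute)
      have "v ?y * ((m - \<epsilon>) powr (p - 1) * indicator {z. 1 / 2 ^ J < - (z \<bullet> e)} (?y - ?x) - ?B (?y - ?x))
        + v ?x * ((m - \<epsilon>) powr (p - 1) * indicator {z. 1 / 2 ^ J < z \<bullet> e} (?y - ?x) - ?B (?y - ?x))
        \<le> h p (u ?y - u ?x) * (v ?y - v ?x)"
        by (rule bp[where m = m]) (use elim me0 \<epsilon> False in \<open>auto simp: v_def\<close>)
      moreover have "h p (u ?y - u ?x) * (v ?y - v ?x) = ?H z"
        using h_minus[of p "u ?x - u ?y"] by (simp add: algebra_simps)
      moreover have "indicat_real {z. 1 / 2 ^ J < - (z \<bullet> e)} (?y - ?x) = ?\<beta>2 (?x - ?y)"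
        "indicat_real {z. 1 / 2 ^ J < z \<bullet> e} (?y - ?x) = ?\<beta>1 (?x - ?y)"
        by (simp_all add: indicator_def inner_diff_left)
      ultimately show ?thesis unfolding G_def sym by simp
    qed
  qed
  have W: "integrable near (\<lambda>z. ?W1 z + ?W2 z)" "(LINT z|near. ?W1 z + ?W2 z) = (G * E1 * I - DB * I) + (G * E2 * I - DB * I)"
  proof -
    have e1: "?W1 z = G * (v (fst z) * ?\<beta>1 (fst z - snd z)) - v (fst z) * ?B (fst z - snd z)"
      and e2: "?W2 z = G * (v (snd z) * ?\<beta>2 (fst z - snd z)) - v (snd z) * ?B (fst z - snd z)" for z
      by (simp_all add: right_diff_distrib mult_ac)
    show "integrable near (\<lambda>z. ?W1 z + ?W2 z)"
      unfolding e1 e2 using p1(1) p2(1) q(1,3) by (intro Bochner_Integration.integrable_add Bochner_Integration.integrable_diff integrable_mult_right)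
    have i1: "integrable near (\<lambda>z. G * (v (fst z) * ?\<beta>1 (fst z - snd z)))" "integrable near (\<lambda>z. G * (v (snd z) * ?\<beta>2 (fst z - snd z)))"
      by (rule integrable_mult_right[OF p1(1)] integrable_mult_right[OF p2(1)])+
    have "(LINT z|near. ?W1 z + ?W2 z) = ((LINT z|near. G * (v (fst z) * ?\<beta>1 (fst z - snd z))) - (LINT z|near. v (fst z) * ?B (fst z - snd z)))
       + ((LINT z|near. G * (v (snd z) * ?\<beta>2 (fst z - snd z))) - (LINT z|near. v (snd z) * ?B (fst z - snd z)))"
      unfolding e1 e2
      by (subst Bochner_Integration.integral_add)
        (use i1 q(1,3) in \<open>auto intro!: Bochner_Integration.integrable_diff simp only: Bochner_Integration.integral_diff\<close>)
    then show "(LINT z|near. ?W1 z + ?W2 z) = (G * E1 * I - DB * I) + (G * E2 * I - DB * I)"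
      by (simp only: integral_mult_right_zero p1(2) p2(2) q(2,4) mult.assoc)
  qed
  have nearH: "2 * (G * (real J * c1) - DB) * I \<le> (LINT z|near. ?H z)"
  proof -
    have "(LINT z|near. ?W1 z + ?W2 z) \<le> (LINT z|near. ?H z)"
      by (rule integral_mono_AE[OF W(1) integrable_h_near[OF uX vX] AE_near[OF AEz]])
    moreover have "G * (real J * c1) * I \<le> G * E1 * I" "G * (real J * c1) * I \<le> G * E2 * I"
      using E1(1) E2(1) I0 GG0 G0 by (auto intro!: mult_right_mono mult_left_mono)
    ultimately show ?thesis unfolding W(2) by (simp add: algebra_simps)
  qed
  have farH: "- (4 * M powr (p - 1) * a * I) \<le> (LINT z|far \<Omega>. Upsilon p (u (fst z)) (u (snd z)) (v (fst z)) (v (snd z)))"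
  proof -
    note ff = far_fst_snd[OF vi v0 vz]
    have up: "\<bar>Upsilon p (u x) (u y) (v x) (v y)\<bar> \<le> 2 * M powr (p - 1) * (v x + v y)" for x y
    proof -
      have h1: "\<bar>h p t\<bar> \<le> M powr (p - 1)" if "\<bar>t\<bar> \<le> M" for t unfolding abs_h using that p by (intro powr_mono2) auto
      have 1: "\<bar>h p (u x - u y) * (v x - v y)\<bar> \<le> M powr (p - 1) * (v x + v y)"
        unfolding abs_mult using u0[of x] u0[of y] uM[of x] uM[of y] v0[of x] v0[of y] by (intro mult_mono h1) auto
      have 2: "\<bar>h p (u x) * v x\<bar> \<le> M powr (p - 1) * v x" "\<bar>h p (u y) * v y\<bar> \<le> M powr (p - 1) * v y"
        unfolding abs_mult using u0[of x] u0[of y] uM[of x] uM[of y] v0[of x] v0[of y] by (intro mult_mono h1; simp)+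
      show ?thesis unfolding Upsilon_def using 1 2 by (simp add: algebra_simps)
    qed
    have "- (2 * M powr (p - 1) * (2 * a * I)) \<le> - (2 * M powr (p - 1) * (LINT z|far \<Omega>. v (fst z) + v (snd z)))"
      using ff(2) unfolding I\<Omega> a_def by (intro le_imp_neg_le mult_left_mono) auto
    also have "\<dots> = (LINT z|far \<Omega>. - (2 * M powr (p - 1) * (v (fst z) + v (snd z))))" by simp
    also have "\<dots> \<le> (LINT z|far \<Omega>. Upsilon p (u (fst z)) (u (snd z)) (v (fst z)) (v (snd z)))"
    proof (rule integral_mono)
      show "integrable (far \<Omega>) (\<lambda>z. - (2 * M powr (p - 1) * (v (fst z) + v (snd z))))"
        using ff(1) by (intro Bochner_Integration.integrable_minus integrable_mult_right)
      show "- (2 * M powr (p - 1) * (v (fst z) + v (snd z))) \<le> Upsilon p (u (fst z)) (u (snd z)) (v (fst z)) (v (snd z))" for z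
        using up[of "fst z" "snd z"] by linarith
    qed (rule integrable_Upsilon[OF uX vX])
    finally show ?thesis by (simp add: mult_ac)
  qed
  have potH: "- (K * I) \<le> (LINT x|lebesgue_on \<Omega>. dpot x (u x) * v x)"
  proof -
    have vi\<Omega>: "integrable (lebesgue_on \<Omega>) v" using vi restrict_Omega(2)[of v] vz by blast
    have "- (K * I) = (LINT x|lebesgue_on \<Omega>. - (K * v x))" by (simp add: I\<Omega>)
    also have "\<dots> \<le> (LINT x|lebesgue_on \<Omega>. dpot x (u x) * v x)"
    proof (rule integral_mono_AE)
      show "integrable (lebesgue_on \<Omega>) (\<lambda>x. - (K * v x))" using vi\<Omega> by simp
      show "integrable (lebesgue_on \<Omega>) (\<lambda>x. dpot x (u x) * v x)" by (rule integrable_dpot_mult[OF uX vX])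
      show "AE x in lebesgue_on \<Omega>. - (K * v x) \<le> dpot x (u x) * v x"
        using Cd(2)
      proof eventually_elim
        case (elim x)
        have "\<bar>dpot x (u x)\<bar> * M \<le> Cd * pot_growth p M" using elim[rule_format, of "u x" M] u0[of x] uM[of x] Mpos by simp
        then have "\<bar>dpot x (u x)\<bar> \<le> K" using Mpos by (simp add: K_def pos_le_divide_eq)
        then have "\<bar>dpot x (u x) * v x\<bar> \<le> K * v x" unfolding abs_mult using v0[of x] by (simp add: mult_right_mono)
        then show ?case by linarith
      qed
    qed
    finally show ?thesis .
  qed
  have "weak_residual u v = 0" by (rule minimizer_weak_residual[OF mn vX])
  then have "cN * (2 * (G * (real J * c1) - DB) * I) + cN * (- (4 * M powr (p - 1) * a * I)) + (- (K * I)) \<le> 0"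
    unfolding weak_residual_eq[OF uX vX]
    using mult_left_mono[OF nearH less_imp_le[OF cN_pos]] mult_left_mono[OF farH less_imp_le[OF cN_pos]] potH by linarith
  then have "(cN * (2 * (G * (real J * c1) - DB)) - cN * (4 * M powr (p - 1) * a) - K) * I \<le> 0"
    by (simp add: algebra_simps)
  then have le0: "cN * (2 * (G * (real J * c1) - DB)) - cN * (4 * M powr (p - 1) * a) - K \<le> 0"
    using I0 by (simp add: mult_le_0_iff)
  \<comment> \<open>The two half spaces give a gain of \<open>2 * G0 * c1\<close> per scale, and the
    choice of \<open>\<eta>\<close> lets the weight consume at most half of it.\<close>
  have "G0 * c1 * real J - 2 * D0 \<le> 2 * (G * (real J * c1) - DB)"
  proof -
    have "\<eta> powr (p - 1) * (real J * C2) \<le> G0 * c1 / 2 * real J"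
      using mult_right_mono[OF \<eta>p, of "real J"] by (simp add: mult_ac)
    moreover have "G0 * (real J * c1) \<le> G * (real J * c1)" using GG0 Jc by (rule mult_right_mono)
    ultimately show ?thesis using DB(3) by (simp add: algebra_simps)
  qed
  then have "cN * (G0 * c1 * real J - 2 * D0) \<le> cN * (2 * (G * (real J * c1) - DB))"
    using cN_pos by (intro mult_left_mono) auto
  with le0 have "cN * (G0 * c1) * real J \<le> R" unfolding R_def by (simp add: algebra_simps)
  with J(2) show False by simp
qed

text \<open>The exact bounds and the gap hold almost everywhere; a representative is chosen for
  which they hold at every point.\<close>

lemma minimizer_no_gap:
  assumes mn: "minimizer u" and \<delta>: "0 < \<delta>"
  shows "\<not> (AE x in lebesgue. u x = 0 \<or> \<delta> \<le> u x)"
proof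
  assume gap: "AE x in lebesgue. u x = 0 \<or> \<delta> \<le> u x"
  obtain M where M: "1 \<le> M" "AE x in lebesgue_on \<Omega>. \<bar>u x\<bar> \<le> M" using minimizer_bounded mn by blast
  have uX: "u \<in> X" using mn by (simp add: minimizer_def)
  note [measurable] = X_measurable[OF uX]
  define w where "w x = (if \<delta> \<le> u x \<and> u x \<le> M then u x else 0)" for x
  have "AE x in lebesgue. x \<in> \<Omega> \<longrightarrow> \<bar>u x\<bar> \<le> M" using M(2) by (simp add: AE_restrict_space_iff)
  then have "AE x in lebesgue. u x = w x"
    using gap
  proof eventually_elim
    case (elim x)
    then show ?case using X_zero[OF uX, of x] by (cases "x \<in> \<Omega>") (auto simp: w_def)
  qed
  moreover have "w \<in> borel_measurable lebesgue" unfolding w_def by measurable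
  moreover have "w x = 0" if "x \<notin> \<Omega>" for x using X_zero[OF uX that] by (simp add: w_def)
  ultimately have "minimizer w" using minimizer_cong_AE[OF mn] by blast
  then show False by (rule minimizer_no_gap_aux[OF _ \<delta>, of w M]) (auto simp: w_def)
qed

end

subsection \<open>Hidden convexity and uniqueness\<close>

lemma abs_powr_strict_convex:
  fixes x y l :: real
  assumes "1 < p" "0 < l" "l < 1"
  shows "\<bar>l * x + (1 - l) * y\<bar> powr p \<le> l * \<bar>x\<bar> powr p + (1 - l) * \<bar>y\<bar> powr p"
    and "x \<noteq> y \<Longrightarrow> \<bar>l * x + (1 - l) * y\<bar> powr p < l * \<bar>x\<bar> powr p + (1 - l) * \<bar>y\<bar> powr p"
proof -
  define z where "z = l * x + (1 - l) * y"
  have comb: "l * (\<bar>z\<bar> powr p + p * h p z * (x - z)) + (1 - l) * (\<bar>z\<bar> powr p + p * h p z * (y - z)) = \<bar>z\<bar> powr p"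
  proof -
    have "l * (x - z) + (1 - l) * (y - z) = 0" by (simp add: z_def algebra_simps)
    then have "p * h p z * (l * (x - z) + (1 - l) * (y - z)) = 0" by simp
    then show ?thesis by (simp add: algebra_simps)
  qed
  have "l * (\<bar>z\<bar> powr p + p * h p z * (x - z)) \<le> l * \<bar>x\<bar> powr p"
    "(1 - l) * (\<bar>z\<bar> powr p + p * h p z * (y - z)) \<le> (1 - l) * \<bar>y\<bar> powr p"
    using assms by (auto intro!: mult_left_mono abs_powr_tangent(1))
  then show "\<bar>l * x + (1 - l) * y\<bar> powr p \<le> l * \<bar>x\<bar> powr p + (1 - l) * \<bar>y\<bar> powr p"
    using comb unfolding z_def[symmetric] by linarith
  show "\<bar>l * x + (1 - l) * y\<bar> powr p < l * \<bar>x\<bar> powr p + (1 - l) * \<bar>y\<bar> powr p" if "x \<noteq> y"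
  proof -
    have "z - x = (1 - l) * (y - x)" by (simp add: z_def algebra_simps)
    then have "z \<noteq> x" using that assms by auto
    then have "l * (\<bar>z\<bar> powr p + p * h p z * (x - z)) < l * \<bar>x\<bar> powr p"
      using assms by (intro mult_strict_left_mono abs_powr_tangent(2)) auto
    moreover have "(1 - l) * (\<bar>z\<bar> powr p + p * h p z * (y - z)) \<le> (1 - l) * \<bar>y\<bar> powr p"
      using assms by (auto intro!: mult_left_mono abs_powr_tangent(1))
    ultimately show ?thesis using comb unfolding z_def[symmetric] by linarith
  qed
qed

text \<open>The midpoint \<open>s = 1/2\<close> of the path in the overview; midpoint convexity
  already suffices to compare two minimisers.\<close>

definition power_mean :: "real \<Rightarrow> real \<Rightarrow> real \<Rightarrow> real" where
  "power_mean p a c = ((\<bar>a\<bar> powr p + \<bar>c\<bar> powr p) / 2) powr (1 / p)"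

lemma power_mean_nonneg [simp]: "0 \<le> power_mean p a c"
  by (simp add: power_mean_def)

lemma power_mean_powr: "1 < p \<Longrightarrow> power_mean p a c powr p = (\<bar>a\<bar> powr p + \<bar>c\<bar> powr p) / 2"
  by (simp add: power_mean_def powr_powr)

lemma power_mean_pos:
  assumes "1 < p" "a \<noteq> 0 \<or> c \<noteq> 0"
  shows "0 < power_mean p a c"
proof -
  have "0 < \<bar>a\<bar> powr p + \<bar>c\<bar> powr p"
    using assms(2) by (auto intro: add_pos_nonneg add_nonneg_pos)
  then show ?thesis unfolding power_mean_def by (subst powr_gt_zero) simp
qed

text \<open>Minkowski's inequality for two coordinates, from convexity of the \<open>p\<close>-th
  power with weights \<open>A / (A + B)\<close> and \<open>B / (A + B)\<close>. Strict convexity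
  makes the vectors proportional in the equality case.\<close>

lemma power_mean_scaled_split:
  fixes A B b1 b2 d1 d2 :: real
  assumes p: "1 < p" and AB: "0 < A" "0 < B"
    and a: "\<bar>b1\<bar> powr p + \<bar>b2\<bar> powr p = A powr p" and b: "\<bar>d1\<bar> powr p + \<bar>d2\<bar> powr p = B powr p"
  shows "\<bar>b1 + d1\<bar> powr p + \<bar>b2 + d2\<bar> powr p \<le> (A + B) powr p"
    and "\<bar>b1 + d1\<bar> powr p + \<bar>b2 + d2\<bar> powr p = (A + B) powr p \<Longrightarrow> B * b1 = A * d1 \<and> B * b2 = A * d2"
proof -
  \<comment> \<open>With these weights the rescaled vectors \<open>b / l\<close> and
    \<open>d / (1 - l)\<close> both have norm \<open>A + B\<close>.\<close>
  define l where "l = A / (A + B)"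
  have l: "0 < l" "l < 1" "1 - l = B / (A + B)" using AB by (auto simp: l_def field_simps)
  have part: "\<bar>b + d\<bar> powr p \<le> (A + B) powr (p - 1) * (A powr (1 - p) * \<bar>b\<bar> powr p + B powr (1 - p) * \<bar>d\<bar> powr p)"
    "B * b \<noteq> A * d \<Longrightarrow> \<bar>b + d\<bar> powr p < (A + B) powr (p - 1) * (A powr (1 - p) * \<bar>b\<bar> powr p + B powr (1 - p) * \<bar>d\<bar> powr p)" for b d
  proof -
    have e1: "l * (b / l) + (1 - l) * (d / (1 - l)) = b + d" using l(1,2) by simp
    have s: "k * (\<bar>t / k\<bar> powr p) = k powr (1 - p) * \<bar>t\<bar> powr p" if "0 < k" for k t :: real
    proof -
      have "k powr (1 - p) = k powr 1 / k powr p" using powr_diff[of k 1 p] by simp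
      then show ?thesis using that by (simp add: abs_divide powr_divide)
    qed
    have r: "(K / (A + B)) powr (1 - p) = (A + B) powr (p - 1) * K powr (1 - p)" if "0 < K" for K
    proof -
      have "(A + B) powr (p - 1) = 1 / (A + B) powr (1 - p)" using powr_minus_divide[of "A + B" "1 - p"] by simp
      then show ?thesis using that AB by (simp add: powr_divide)
    qed
    have e2: "l * \<bar>b / l\<bar> powr p + (1 - l) * \<bar>d / (1 - l)\<bar> powr p
      = (A + B) powr (p - 1) * (A powr (1 - p) * \<bar>b\<bar> powr p + B powr (1 - p) * \<bar>d\<bar> powr p)"
    proof -
      have "l * \<bar>b / l\<bar> powr p = (A + B) powr (p - 1) * A powr (1 - p) * \<bar>b\<bar> powr p"
        using s[OF l(1), of b] r[OF AB(1)] by (simp add: l_def)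
      moreover have "(1 - l) * \<bar>d / (1 - l)\<bar> powr p = (A + B) powr (p - 1) * B powr (1 - p) * \<bar>d\<bar> powr p"
        using s[of "1 - l" d] l r[OF AB(2)] by simp
      ultimately show ?thesis by (simp add: algebra_simps)
    qed
    show "\<bar>b + d\<bar> powr p \<le> (A + B) powr (p - 1) * (A powr (1 - p) * \<bar>b\<bar> powr p + B powr (1 - p) * \<bar>d\<bar> powr p)"
      using abs_powr_strict_convex(1)[OF p l(1,2), of "b / l" "d / (1 - l)"] unfolding e1 e2 .
    assume "B * b \<noteq> A * d"
    moreover have "b / l = d / (1 - l) \<longleftrightarrow> B * b = A * d"
    proof -
      have "b / l = (A + B) * (b / A)" "d / (1 - l) = (A + B) * (d / B)" unfolding l(3) unfolding l_def by simp_all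
      then have "b / l = d / (1 - l) \<longleftrightarrow> (A + B) * (b / A) = (A + B) * (d / B)" by (simp only:)
      also have "\<dots> \<longleftrightarrow> b / A = d / B" unfolding mult_cancel_left using AB by auto
      also have "\<dots> \<longleftrightarrow> B * b = A * d" using AB by (auto simp: field_simps)
      finally show ?thesis .
    qed
    ultimately show "\<bar>b + d\<bar> powr p < (A + B) powr (p - 1) * (A powr (1 - p) * \<bar>b\<bar> powr p + B powr (1 - p) * \<bar>d\<bar> powr p)"
      using abs_powr_strict_convex(2)[OF p l(1,2), of "b / l" "d / (1 - l)"] unfolding e1 e2 by blast
  qed
  have total: "(A + B) powr (p - 1) * (A powr (1 - p) * \<bar>b1\<bar> powr p + B powr (1 - p) * \<bar>d1\<bar> powr p)
    + (A + B) powr (p - 1) * (A powr (1 - p) * \<bar>b2\<bar> powr p + B powr (1 - p) * \<bar>d2\<bar> powr p) = (A + B) powr p"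
  proof -
    have "(A + B) powr (p - 1) * (A powr (1 - p) * \<bar>b1\<bar> powr p + B powr (1 - p) * \<bar>d1\<bar> powr p)
    + (A + B) powr (p - 1) * (A powr (1 - p) * \<bar>b2\<bar> powr p + B powr (1 - p) * \<bar>d2\<bar> powr p)
     = (A + B) powr (p - 1) * (A powr (1 - p) * (\<bar>b1\<bar> powr p + \<bar>b2\<bar> powr p) + B powr (1 - p) * (\<bar>d1\<bar> powr p + \<bar>d2\<bar> powr p))"
      by (simp add: algebra_simps)
    also have "\<dots> = (A + B) powr (p - 1) * (A + B)"
      unfolding a b using AB powr_add[of A "1 - p" p] powr_add[of B "1 - p" p] by simp
    also have "\<dots> = (A + B) powr p" using AB by (intro powr_minus_one_mult_self) auto
    finally show ?thesis .
  qed
  show "\<bar>b1 + d1\<bar> powr p + \<bar>b2 + d2\<bar> powr p \<le> (A + B) powr p"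
    using part(1)[of b1 d1] part(1)[of b2 d2] total by linarith
  assume eq: "\<bar>b1 + d1\<bar> powr p + \<bar>b2 + d2\<bar> powr p = (A + B) powr p"
  show "B * b1 = A * d1 \<and> B * b2 = A * d2"
    using part[of b1 d1] part[of b2 d2] total eq by argo
qed

text \<open>
  Convexity of the Gagliardo integrand along \<open>s \<mapsto> ((1 - s) u\<^sup>p + s w\<^sup>p)\<^sup>1\<^sup>/\<^sup>p\<close>: this is the triangle
  inequality in the two-dimensional \<open>\<ell>\<^sup>p\<close>, with its equality case.
\<close>

lemma power_mean_diff_aux:
  assumes p: "1 < p" and nn: "0 \<le> a" "0 \<le> b" "0 \<le> c" "0 \<le> d" and le: "power_mean p b d \<le> power_mean p a c"
  shows "\<bar>power_mean p a c - power_mean p b d\<bar> powr p \<le> (\<bar>a - b\<bar> powr p + \<bar>c - d\<bar> powr p) / 2"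
    and "\<bar>power_mean p a c - power_mean p b d\<bar> powr p = (\<bar>a - b\<bar> powr p + \<bar>c - d\<bar> powr p) / 2 \<Longrightarrow> a * d = b * c"
proof -
  let ?P = "power_mean p a c" and ?Q = "power_mean p b d"
  have *: "\<bar>?P - ?Q\<bar> powr p \<le> (\<bar>a - b\<bar> powr p + \<bar>c - d\<bar> powr p) / 2 \<and>
    (\<bar>?P - ?Q\<bar> powr p = (\<bar>a - b\<bar> powr p + \<bar>c - d\<bar> powr p) / 2 \<longrightarrow> a * d = b * c)"
  proof -
    consider "a = b \<and> c = d" | "b = 0 \<and> d = 0" | "(a \<noteq> b \<or> c \<noteq> d) \<and> (b \<noteq> 0 \<or> d \<noteq> 0)" by blast
    then show ?thesis
    proof cases
      case 1 then show ?thesis using p by simp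
    next
      case 2
      then have "?Q = 0" using p by (simp add: power_mean_def)
      then show ?thesis using 2 power_mean_powr[OF p, of a c] by simp
    next
      case 3
      define B where "B = power_mean p (a - b) (c - d)"
      have B: "0 < B" unfolding B_def using 3 p by (intro power_mean_pos) auto
      have Q: "0 < ?Q" using 3 p by (intro power_mean_pos) auto
      have Bp: "B powr p = (\<bar>a - b\<bar> powr p + \<bar>c - d\<bar> powr p) / 2" unfolding B_def by (rule power_mean_powr[OF p])
      \<comment> \<open>Removes the factor 1/2 of the mean: \<open>k\<close> times a power mean is
        the norm of the pair.\<close>
      define k where "k = (2::real) powr (1 / p)"
      have k: "0 < k" "k powr p = 2" using p by (simp_all add: k_def powr_powr)
      have sQ: "\<bar>b\<bar> powr p + \<bar>d\<bar> powr p = (k * ?Q) powr p"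
        using k Q power_mean_powr[OF p, of b d] by (simp add: powr_mult)
      have sB: "\<bar>a - b\<bar> powr p + \<bar>c - d\<bar> powr p = (k * B) powr p"
        using k B Bp by (simp add: powr_mult)
      have sP: "\<bar>a\<bar> powr p + \<bar>c\<bar> powr p = (k * ?P) powr p"
        using k power_mean_powr[OF p, of a c] by (subst powr_mult) auto
      have kk: "0 < k * ?Q" "0 < k * B" using k Q B by auto
      note S = power_mean_scaled_split[OF p kk sQ sB]
      have "(k * ?P) powr p \<le> (k * ?Q + k * B) powr p" using S(1) sP by simp
      then have "k * ?P \<le> k * ?Q + k * B"
        using powr_less_mono2[of p "k * ?Q + k * B" "k * ?P"] p kk by (meson add_pos_pos less_eq_real_def linorder_not_less not_less_iff_gr_or_eq order.trans zero_less_one less_trans)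
      then have PB: "?P - ?Q \<le> B" using k by (simp add: distrib_left[symmetric])
      have 1: "\<bar>?P - ?Q\<bar> powr p \<le> B powr p" using PB le p by (intro powr_mono2) auto
      have 2: "a * d = b * c" if eq: "\<bar>?P - ?Q\<bar> powr p = B powr p"
      proof -
        have "\<not> ?P - ?Q < B" using powr_less_mono2[of p "?P - ?Q" B] le p eq by auto
        \<comment> \<open>Equality in the triangle inequality makes \<open>(b, d)\<close>
          proportional to \<open>(a - b, c - d)\<close>, hence to \<open>(a, c)\<close>.\<close>
        then have "?P = ?Q + B" using PB by linarith
        then have "(k * ?P) powr p = (k * ?Q + k * B) powr p" by (simp add: distrib_left)
        then have "(k * B) * b = (k * ?Q) * (a - b) \<and> (k * B) * d = (k * ?Q) * (c - d)"
          using S(2) sP by simp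
        then have "B * b = ?Q * (a - b)" "B * d = ?Q * (c - d)" using k by (auto simp: mult.assoc)
        then have "(B + ?Q) * b = ?Q * a" "(B + ?Q) * d = ?Q * c" by (simp_all add: algebra_simps)
        then have "(B + ?Q) * (a * d) = (B + ?Q) * (b * c)" by (metis mult.assoc mult.commute mult.left_commute)
        then show ?thesis using B Q by simp
      qed
      show ?thesis using 1 2 Bp by simp
    qed
  qed
  then show "\<bar>?P - ?Q\<bar> powr p \<le> (\<bar>a - b\<bar> powr p + \<bar>c - d\<bar> powr p) / 2"
    "\<bar>?P - ?Q\<bar> powr p = (\<bar>a - b\<bar> powr p + \<bar>c - d\<bar> powr p) / 2 \<Longrightarrow> a * d = b * c" by blast+
qed

lemma power_mean_diff:
  assumes p: "1 < p" and nn: "0 \<le> a" "0 \<le> b" "0 \<le> c" "0 \<le> d"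
  shows "\<bar>power_mean p a c - power_mean p b d\<bar> powr p \<le> (\<bar>a - b\<bar> powr p + \<bar>c - d\<bar> powr p) / 2"
    and "\<bar>power_mean p a c - power_mean p b d\<bar> powr p = (\<bar>a - b\<bar> powr p + \<bar>c - d\<bar> powr p) / 2 \<Longrightarrow> a * d = b * c"
proof -
  show "\<bar>power_mean p a c - power_mean p b d\<bar> powr p \<le> (\<bar>a - b\<bar> powr p + \<bar>c - d\<bar> powr p) / 2"
    using power_mean_diff_aux(1)[OF p nn] power_mean_diff_aux(1)[OF p nn(2,1,4,3)]
    by (cases "power_mean p b d \<le> power_mean p a c") (auto simp: abs_minus_commute)
  assume "\<bar>power_mean p a c - power_mean p b d\<bar> powr p = (\<bar>a - b\<bar> powr p + \<bar>c - d\<bar> powr p) / 2"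
  then show "a * d = b * c"
    using power_mean_diff_aux(2)[OF p nn] power_mean_diff_aux(2)[OF p nn(2,1,4,3)]
    by (cases "power_mean p b d \<le> power_mean p a c") (auto simp: abs_minus_commute)
qed

lemma h_scale: "0 < c \<Longrightarrow> h p (c * t) = c powr (p - 1) * h p t"
  by (simp add: h_sgn abs_mult sgn_mult powr_mult)

lemma Upsilon_scale: "0 < c \<Longrightarrow> Upsilon p (c * a) (c * b) s t = c powr (p - 1) * Upsilon p a b s t"
  by (simp add: Upsilon_def h_scale right_diff_distrib[symmetric]) (simp add: algebra_simps)

section \<open>From convexity of the energy to uniqueness of nonnegative minimisers\<close>

context log_problem
begin

text \<open>For positive \<open>t\<close> this is \<open>dpot x t / t powr (p - 1)\<close>, that is,
  \<open>p\<close> times the derivative of \<open>pot x\<close> with respect to the variable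
  \<open>t powr p\<close>. Its monotonicity is convexity of the potential along the path of power
  means.\<close>

definition slope :: "'a \<Rightarrow> real \<Rightarrow> real" where
  "slope x t = rho_const DIM('a) p - g x t * t powr (1 - p) - \<mu> * ln t"

lemma dpot_slope:
  assumes "0 < t"
  shows "dpot x t = t powr (p - 1) * slope x t"
proof -
  have "t powr (p - 1) * t powr (1 - p) = 1" using assms powr_add[of t "p - 1" "1 - p"] by simp
  then have "t powr (p - 1) * (g x t * t powr (1 - p)) = g x t" by (metis mult.commute mult.left_commute mult.right_neutral)
  then show ?thesis using assms by (simp add: dpot_def slope_def h_nonneg algebra_simps)
qed

text \<open>The derivative of \<open>slope x\<close> at \<open>r\<close> is
  \<open>r powr (- p - 1)\<close> times the expression assumed nonnegative; this is where the
  structural hypothesis on \<open>g\<close> enters.\<close>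

lemma slope_mono:
  assumes d: "\<And>t. (g x has_real_derivative g' t) (at t)"
    and c: "\<And>t. 0 \<le> t \<Longrightarrow> 0 \<le> (p - 1) * t * g x t - g' t * t\<^sup>2 - \<mu> * t powr p"
    and st: "0 < s" "s \<le> t"
  shows "slope x s \<le> slope x t"
proof (rule DERIV_nonneg_imp_nondecreasing[where f = "slope x" and a = s and b = t, OF st(2)])
  fix r assume "s \<le> r" "r \<le> t"
  then have r: "0 < r" using st by linarith
  let ?D = "- (g' r * r powr (1 - p) + (1 - p) * r powr (- p) * g x r) - \<mu> * (1 / r)"
  have "((\<lambda>t. rho_const DIM('a) p - g x t * t powr (1 - p) - \<mu> * ln t) has_real_derivative ?D) (at r)"
    using r by (auto intro!: derivative_eq_intros d)
  then have D: "DERIV (slope x) r :> ?D" by (simp add: slope_def[abs_def])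
  have e1: "r powr (- p) = r powr (- p - 1) * r" using r powr_add[of r "- p - 1" 1] by simp
  have e2: "r powr (1 - p) = r powr (- p - 1) * r\<^sup>2" using r powr_add[of r "- p - 1" 2] by (simp add: powr_numeral)
  have e3: "1 / r = r powr (- p - 1) * r powr p" using r powr_add[of r "- p - 1" p] powr_minus_divide[of r 1] by simp
  have "?D = r powr (- p - 1) * ((p - 1) * r * g x r - g' r * r\<^sup>2 - \<mu> * r powr p)"
    unfolding e1 e2 e3 by (simp add: algebra_simps)
  then have "0 \<le> ?D" using c[of r] r by simp
  with D show "\<exists>y. DERIV (slope x) r :> y \<and> 0 \<le> y" by blast
qed

text \<open>Jensen's inequality in the variable \<open>t powr p\<close>, through a supporting line:
  subtracting the right multiple of \<open>\<bar>t\<bar> powr p\<close> gives a function minimal at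
  \<open>m\<close> among nonnegative arguments.\<close>

lemma pot_power_mean:
  assumes cont: "continuous_on UNIV (g x)" and g0: "g x 0 = 0"
    and mono: "\<And>s t. 0 < s \<Longrightarrow> s \<le> t \<Longrightarrow> slope x s \<le> slope x t" and ac: "0 \<le> a" "0 \<le> c"
  shows "pot x (power_mean p a c) \<le> (pot x a + pot x c) / 2"
proof (cases "a = 0 \<and> c = 0")
  case True then show ?thesis using p by (simp add: power_mean_def)
next
  case False
  define m where "m = power_mean p a c"
  have m: "0 < m" unfolding m_def using False p by (intro power_mean_pos) auto
  have mp: "m powr p = (a powr p + c powr p) / 2" unfolding m_def using power_mean_powr[OF p, of a c] ac by simp
  define F where "F t = pot x t - slope x m / p * \<bar>t\<bar> powr p" for t
  have D: "DERIV F t :> dpot x t - slope x m / p * (p * h p t)" for t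
    unfolding F_def by (intro DERIV_diff DERIV_cmult has_real_derivative_pot has_real_derivative_abs_powr p cont)
  have D': "dpot x t - slope x m / p * (p * h p t) = t powr (p - 1) * (slope x t - slope x m)" if "0 < t" for t
    using that p by (simp add: dpot_slope h_nonneg algebra_simps)
  have Fm: "F m \<le> F t" if t: "0 \<le> t" for t
  proof (cases "t \<le> m")
    case True
    show ?thesis
    proof (rule DERIV_nonpos_imp_nonincreasing[where f = F and a = t and b = m, OF True])
      fix r assume r: "t \<le> r" "r \<le> m"
      have "dpot x r - slope x m / p * (p * h p r) \<le> 0"
      proof (cases "r = 0")
        case True then show ?thesis by (simp add: dpot_def g0)
      next
        case False
        then have "0 < r" using r t by simp
        then show ?thesis using D'[of r] mono[of r m] r by (simp add: mult_nonneg_nonpos)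
      qed
      with D show "\<exists>y. DERIV F r :> y \<and> y \<le> 0" by blast
    qed
  next
    case False
    then have "m \<le> t" by simp
    then show ?thesis
    proof (rule DERIV_nonneg_imp_nondecreasing[where f = F and a = m and b = t])
      fix r assume r: "m \<le> r" "r \<le> t"
      then have "0 \<le> dpot x r - slope x m / p * (p * h p r)" using D'[of r] mono[of m r] m by simp
      with D show "\<exists>y. DERIV F r :> y \<and> 0 \<le> y" by blast
    qed
  qed
  have "slope x m / p * \<bar>m\<bar> powr p = (slope x m / p * \<bar>a\<bar> powr p + slope x m / p * \<bar>c\<bar> powr p) / 2"
    using m mp ac by (simp add: algebra_simps add_divide_distrib)
  moreover have "P \<le> (A + C) / 2" if "x = (y + w) / 2" "P - x \<le> A - y" "P - x \<le> C - w" for P A C x y w :: real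
    using that by argo
  ultimately show ?thesis using Fm[OF ac(1)] Fm[OF ac(2)] unfolding F_def m_def[symmetric] by blast
qed

text \<open>The power mean has at most the average energy, so \<open>energy_rigidity\<close>
  applies. The equality case of \<open>power_mean_diff\<close> gives
  \<open>u x * w y = u y * w x\<close> for almost all pairs; fixing one suitable \<open>x\<close>
  with \<open>u x \<noteq> 0\<close> yields the constant, which is positive because \<open>w\<close>
  is nontrivial.\<close>

lemma minimizers_proportional:
  assumes u: "minimizer u" "\<And>x. 0 \<le> u x" and w: "minimizer w" "\<And>x. 0 \<le> w x"
    and mono: "AE x in lebesgue_on \<Omega>. \<forall>s t. 0 < s \<longrightarrow> s \<le> t \<longrightarrow> slope x s \<le> slope x t"
  shows "\<exists>c>0. AE x in lebesgue. w x = c * u x"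
proof -
  have uX: "u \<in> X" and wX: "w \<in> X" using u w by (auto simp: minimizer_def)
  note [measurable] = X_measurable[OF uX] X_measurable[OF wX]
  define z where "z x = power_mean p (u x) (w x)" for x
  have z0: "z x = 0" if "x \<notin> \<Omega>" for x using p by (simp add: z_def power_mean_def X_zero[OF uX that] X_zero[OF wX that])
  have zp: "\<bar>z x\<bar> powr p = (\<bar>u x\<bar> powr p + \<bar>w x\<bar> powr p) / 2" for x
    using power_mean_powr[OF p, of "u x" "w x"] by (simp add: z_def)
  have zd: "\<bar>z x - z y\<bar> powr p \<le> (\<bar>u x - u y\<bar> powr p + \<bar>w x - w y\<bar> powr p) / 2" for x y
    unfolding z_def by (rule power_mean_diff(1)[OF p u(2) u(2) w(2) w(2)])
  have zm: "z \<in> borel_measurable lebesgue" unfolding z_def power_mean_def by measurable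
  have zX: "z \<in> X"
  proof (rule X_space_dominated[OF p lmeasurable_Omega uX wX zm z0, where K = 1])
    show "\<bar>z x\<bar> powr p \<le> 1 * (\<bar>u x\<bar> powr p + \<bar>w x\<bar> powr p + 1)" for x
      unfolding zp using powr_ge_zero[of "\<bar>u x\<bar>" p] powr_ge_zero[of "\<bar>w x\<bar>" p] by argo
    show "\<bar>z x - z y\<bar> powr p \<le> 1 * (\<bar>u x - u y\<bar> powr p + \<bar>w x - w y\<bar> powr p + norm (x - y) powr p * (indicator \<Omega> x + indicator \<Omega> y))" for x y
    proof -
      have "0 \<le> norm (x - y) powr p * (indicat_real \<Omega> x + indicat_real \<Omega> y)" by simp
      then show ?thesis
        using zd[of x y] powr_ge_zero[of "\<bar>u x - u y\<bar>" p] powr_ge_zero[of "\<bar>w x - w y\<bar>" p] by argo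
    qed
  qed
  let ?f = "\<lambda>v z. \<bar>v (fst z) - v (snd z)\<bar> powr p"
  let ?k = "\<lambda>v z. \<bar>v (fst z) - v (snd z)\<bar> powr p - \<bar>v (fst z)\<bar> powr p - \<bar>v (snd z)\<bar> powr p"
  have Jeq: "J u = J w" using u w by (intro antisym) (auto simp: minimizer_def)
  have Jz: "J u \<le> J z" using u zX by (simp add: minimizer_def)
  have i: "integrable near (\<lambda>s. (?f u s + ?f w s) / 2)" "integrable (far \<Omega>) (\<lambda>s. (?k u s + ?k w s) / 2)"
    "integrable (lebesgue_on \<Omega>) (\<lambda>x. (pot x (u x) + pot x (w x)) / 2)"
    by (rule integrable_divide, rule Bochner_Integration.integrable_add,
        rule X_near[OF uX] integrable_far_diag[OF uX] integrable_pot[OF uX],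
        rule X_near[OF wX] integrable_far_diag[OF wX] integrable_pot[OF wX])+
  have ge: "cN / p * ((LINT s|near. (?f u s + ?f w s) / 2) + (LINT s|far \<Omega>. (?k u s + ?k w s) / 2)) + (LINT x|lebesgue_on \<Omega>. (pot x (u x) + pot x (w x)) / 2)
    \<le> cN / p * (near_energy z + far_energy z) + (LINT x|lebesgue_on \<Omega>. pot x (z x))"
  proof -
    have "(LINT s|near. (?f u s + ?f w s) / 2) = (near_energy u + near_energy w) / 2"
      using X_near[OF uX] X_near[OF wX] by simp
    moreover have "(LINT s|far \<Omega>. (?k u s + ?k w s) / 2) = (far_energy u + far_energy w) / 2"
      using Bochner_Integration.integral_add[OF integrable_far_diag[OF uX] integrable_far_diag[OF wX]] by simp
    moreover have "(LINT x|lebesgue_on \<Omega>. (pot x (u x) + pot x (w x)) / 2) = ((LINT x|lebesgue_on \<Omega>. pot x (u x)) + (LINT x|lebesgue_on \<Omega>. pot x (w x))) / 2"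
      using integrable_pot[OF uX] integrable_pot[OF wX] by simp
    moreover have "cN / p * ((a + b) / 2 + (c + d) / 2) + (e + f) / 2 = ((cN / p * (a + c) + e) + (cN / p * (b + d) + f)) / 2" for a b c d e f
      by (simp add: algebra_simps add_divide_distrib)
    ultimately have "cN / p * ((LINT s|near. (?f u s + ?f w s) / 2) + (LINT s|far \<Omega>. (?k u s + ?k w s) / 2)) + (LINT x|lebesgue_on \<Omega>. (pot x (u x) + pot x (w x)) / 2)
      = (J u + J w) / 2"
      unfolding J_eq[OF uX] J_eq[OF wX] by simp
    also have "\<dots> \<le> J z" using Jeq Jz by simp
    finally show ?thesis unfolding J_eq[OF zX] .
  qed
  have potz: "AE x in lebesgue_on \<Omega>. pot x (z x) \<le> (pot x (u x) + pot x (w x)) / 2"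
    using AE_continuous AE_g_0 mono
  proof eventually_elim
    case (elim x)
    show ?case unfolding z_def by (rule pot_power_mean) (use elim u(2) w(2) in auto)
  qed
  have kz: "?k z s \<le> (?k u s + ?k w s) / 2" for s
    using zd[of "fst s" "snd s"] unfolding zp by (simp add: field_simps)
  have fz: "?f z s \<le> (?f u s + ?f w s) / 2" for s by (rule zd)
  note E = energy_rigidity[OF X_near[OF zX] i(1) integrable_far_diag[OF zX] i(2) integrable_pot[OF zX] i(3) fz kz potz ge]
  have "AE s in far \<Omega>. ?f z s = (?f u s + ?f w s) / 2"
    using E(2) by eventually_elim (simp add: zp field_simps)
  with E(1) have "AE s in LL. fst s \<in> \<Omega> \<longrightarrow> snd s \<in> \<Omega> \<longrightarrow> fst s \<noteq> snd s \<longrightarrow> ?f z s = (?f u s + ?f w s) / 2"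
    by (rule AE_near_far_imp_LL)
  then have "AE s in LL. u (fst s) * w (snd s) = u (snd s) * w (fst s)"
  proof eventually_elim
    case (elim s)
    show ?case
    proof (cases "fst s \<in> \<Omega> \<and> snd s \<in> \<Omega> \<and> fst s \<noteq> snd s")
      case True
      then show ?thesis using elim unfolding z_def by (intro power_mean_diff(2)[OF p u(2) u(2) w(2) w(2)]) simp
    next
      case False
      then show ?thesis by (auto simp: X_zero[OF uX] X_zero[OF wX])
    qed
  qed
  then have P: "AE x in lebesgue. AE y in lebesgue. u x * w y = u y * w x"
    using lebesgue_pair.AE_pair by fastforce
  have "\<exists>x. u x \<noteq> 0 \<and> (AE y in lebesgue. u x * w y = u y * w x)"
  proof (rule ccontr)
    assume n: "\<not> ?thesis"
    have "AE x in lebesgue. u x = 0" using P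
    proof eventually_elim
      case (elim x) then show ?case using n by blast
    qed
    then show False using minimizer_nontrivial[OF u(1)] by (simp add: nontrivial_def)
  qed
  then obtain x where x: "u x \<noteq> 0" "AE y in lebesgue. u x * w y = u y * w x" by blast
  have wy: "AE y in lebesgue. w y = w x / u x * u y"
    using x(2) by eventually_elim (use x(1) in \<open>simp add: field_simps\<close>)
  have "w x \<noteq> 0"
  proof
    assume "w x = 0"
    then have "AE y in lebesgue. w y = 0" using wy by simp
    then show False using minimizer_nontrivial[OF w(1)] by (simp add: nontrivial_def)
  qed
  then have "0 < w x / u x" using x(1) u(2)[of x] w(2)[of x] by simp
  with wy show ?thesis by blast
qed

text \<open>Both weak equations are tested with \<open>u\<close>. The nonlocal terms are homogeneous
  of degree \<open>p - 1\<close> in the first argument and cancel, leaving \<open>q\<close> with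
  integral 0. It is nonnegative by monotonicity of \<open>slope\<close>, so it vanishes, which is
  impossible at small positive values of \<open>u\<close> and thus produces the excluded
  gap.\<close>

lemma no_proportional_minimizers:
  assumes u: "minimizer u" "\<And>x. 0 \<le> u x" and c: "1 < c" and cu: "minimizer (\<lambda>x. c * u x)"
    and mono: "AE x in lebesgue_on \<Omega>. \<forall>s t. 0 < s \<longrightarrow> s \<le> t \<longrightarrow> slope x s \<le> slope x t"
  shows False
proof -
  have uX: "u \<in> X" and cuX: "(\<lambda>x. c * u x) \<in> X" using u cu by (auto simp: minimizer_def)
  have c0: "0 < c" using c by simp
  let ?P = "cN * (LINT z|near. h p (u (fst z) - u (snd z)) * (u (fst z) - u (snd z)))"
  let ?Q = "cN * (LINT z|far \<Omega>. Upsilon p (u (fst z)) (u (snd z)) (u (fst z)) (u (snd z)))"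
  have 1: "?P + ?Q + (LINT x|lebesgue_on \<Omega>. dpot x (u x) * u x) = 0"
    using minimizer_weak_residual[OF u(1) uX] unfolding weak_residual_eq[OF uX uX] .
  have e: "h p (c * u x - c * u y) = c powr (p - 1) * h p (u x - u y)" for x y
    using h_scale[OF c0, of p "u x - u y"] by (simp add: right_diff_distrib)
  have 2: "c powr (p - 1) * (?P + ?Q) + (LINT x|lebesgue_on \<Omega>. dpot x (c * u x) * u x) = 0"
    using minimizer_weak_residual[OF cu uX]
    unfolding weak_residual_eq[OF cuX uX] e Upsilon_scale[OF c0] mult.assoc integral_mult_right_zero
    by (simp only: distrib_left mult.left_commute[of cN "c powr (p - 1)"])
  define q where "q x = dpot x (c * u x) * u x - c powr (p - 1) * (dpot x (u x) * u x)" for x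
  have qi: "integrable (lebesgue_on \<Omega>) q"
    unfolding q_def by (intro Bochner_Integration.integrable_diff integrable_mult_right integrable_dpot_mult uX cuX)
  have "(LINT x|lebesgue_on \<Omega>. q x) = (LINT x|lebesgue_on \<Omega>. dpot x (c * u x) * u x) - c powr (p - 1) * (LINT x|lebesgue_on \<Omega>. dpot x (u x) * u x)"
    unfolding q_def using integrable_dpot_mult[OF cuX uX] integrable_dpot_mult[OF uX uX] by simp
  also have "\<dots> = - (c powr (p - 1) * (?P + ?Q)) - c powr (p - 1) * (- (?P + ?Q))"
  proof -
    have "(LINT x|lebesgue_on \<Omega>. dpot x (c * u x) * u x) = - (c powr (p - 1) * (?P + ?Q))" using 2 by linarith
    moreover have "(LINT x|lebesgue_on \<Omega>. dpot x (u x) * u x) = - (?P + ?Q)" using 1 by linarith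
    ultimately show ?thesis by (simp only:)
  qed
  also have "\<dots> = 0"
  proof -
    have "- (k * s) - k * (- s) = 0" for k s :: real by simp
    then show ?thesis .
  qed
  finally have q0: "(LINT x|lebesgue_on \<Omega>. q x) = 0" .
  have qs: "q x = c powr (p - 1) * u x powr p * (slope x (c * u x) - slope x (u x))" if "0 < u x" for x
  proof -
    have pw: "u x powr (p - 1) * u x = u x powr p" using that by (intro powr_minus_one_mult_self) auto
    have "dpot x (c * u x) * u x = c powr (p - 1) * ((u x powr (p - 1) * u x) * slope x (c * u x))"
      using that c0 by (simp add: dpot_slope powr_mult)
    moreover have "dpot x (u x) * u x = (u x powr (p - 1) * u x) * slope x (u x)"
      using that by (simp add: dpot_slope)
    ultimately show ?thesis unfolding q_def pw by (simp only: right_diff_distrib mult.assoc)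
  qed
  have "AE x in lebesgue_on \<Omega>. 0 \<le> q x"
    using mono
  proof eventually_elim
    case (elim x)
    show ?case
    proof (cases "u x = 0")
      case True then show ?thesis by (simp add: q_def)
    next
      case False
      then have ux: "0 < u x" using u(2)[of x] by simp
      then have "slope x (u x) \<le> slope x (c * u x)" using elim c by simp
      then show ?thesis unfolding qs[OF ux] by simp
    qed
  qed
  then have qz: "AE x in lebesgue_on \<Omega>. q x = 0" using q0 qi by (subst (asm) integral_nonneg_eq_0_iff_AE) auto
  obtain f where ul: "uniform_limit \<Omega> (\<lambda>t x. g x t / h p t) f (at 0)" using g3 by blast
  \<comment> \<open>The logarithm contributes \<open>- \<mu> * ln c\<close> to the difference of
    slopes. Half of it is allowed for each of the two quotients of \<open>g\<close>, whose common
    limit \<open>f x\<close> cancels.\<close>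
  have lc: "0 < - \<mu> * ln c / 2" using mu c by (simp add: mult_neg_pos)
  obtain t0 where t0: "0 < t0" "\<And>t x. t \<noteq> 0 \<Longrightarrow> \<bar>t\<bar> < t0 \<Longrightarrow> x \<in> \<Omega> \<Longrightarrow> \<bar>g x t / h p t - f x\<bar> < - \<mu> * ln c / 2"
    using uniform_limitD[OF ul lc] by (auto simp: eventually_at dist_real_def)
  have "AE x in lebesgue. x \<in> \<Omega> \<longrightarrow> q x = 0" using qz by (simp add: AE_restrict_space_iff)
  \<comment> \<open>The threshold \<open>t0 / c\<close> ensures that both \<open>u x\<close> and
    \<open>c * u x\<close> are below \<open>t0\<close>.\<close>
  then have "AE x in lebesgue. u x = 0 \<or> t0 / c \<le> u x"
  proof eventually_elim
    case (elim x)
    show ?case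
    proof (rule ccontr)
      assume n: "\<not> ?case"
      then have ux: "0 < u x" "c * u x < t0" using u(2)[of x] c0 by (auto simp: field_simps)
      then have x: "x \<in> \<Omega>" using X_zero[OF uX] by force
      have "1 * u x < c * u x" using ux c by (intro mult_strict_right_mono) auto
      then have ut: "u x < t0" using ux(2) by linarith
      have gh: "g x t * t powr (1 - p) = g x t / h p t" if "0 < t" for t
        using that powr_minus_divide[of t "p - 1"] by (simp add: h_nonneg)
      have "\<bar>g x (u x) / h p (u x) - f x\<bar> < - \<mu> * ln c / 2" "\<bar>g x (c * u x) / h p (c * u x) - f x\<bar> < - \<mu> * ln c / 2"
        using t0(2)[of "u x" x] t0(2)[of "c * u x" x] ux ut x c0 by auto
      then have "g x (c * u x) / h p (c * u x) - g x (u x) / h p (u x) < - \<mu> * ln c" by linarith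
      moreover have "slope x (c * u x) - slope x (u x) = - \<mu> * ln c - (g x (c * u x) / h p (c * u x) - g x (u x) / h p (u x))"
        using ux c0 by (simp add: slope_def gh ln_mult algebra_simps)
      ultimately have "0 < slope x (c * u x) - slope x (u x)" by linarith
      then have "0 < q x" unfolding qs[OF ux(1)] using ux c0 by simp
      then show False using elim x by simp
    qed
  qed
  then show False using minimizer_no_gap[OF u(1), of "t0 / c"] t0(1) c0 by simp
qed

lemma nonneg_minimizer_unique:
  assumes u: "minimizer u" "nonnegative_on \<Omega> u" and w: "minimizer w" "nonnegative_on \<Omega> w"
    and C1: "AE x in lebesgue_on \<Omega>. g x C1_differentiable_on UNIV \<and>
          (\<forall>t\<ge>0. (p - 1) * t * g x t - deriv (g x) t * t\<^sup>2 - \<mu> * t powr p \<ge> 0)"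
  shows "AE x in lebesgue. u x = w x"
proof -
  have mono: "AE x in lebesgue_on \<Omega>. \<forall>s t. 0 < s \<longrightarrow> s \<le> t \<longrightarrow> slope x s \<le> slope x t"
    using C1
  proof eventually_elim
    case (elim x)
    have "DERIV (g x) t :> deriv (g x) t" for t
      using elim by (simp add: DERIV_deriv_iff_real_differentiable C1_differentiable_on_eq)
    then show ?case using elim by (blast intro: slope_mono[where g' = "deriv (g x)"])
  qed
  \<comment> \<open>Replaces nonnegativity almost everywhere by nonnegativity at every point, as the
    preceding lemmas assume.\<close>
  have pos: "minimizer (\<lambda>x. max 0 (v x))" "AE x in lebesgue. v x = max 0 (v x)" if v: "minimizer v" "nonnegative_on \<Omega> v" for v
  proof -
    have vX: "v \<in> X" using v by (simp add: minimizer_def)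
    note [measurable] = X_measurable[OF vX]
    have "AE x in lebesgue. x \<in> \<Omega> \<longrightarrow> 0 \<le> v x" using v(2) by (simp add: nonnegative_on_def AE_restrict_space_iff)
    then show e: "AE x in lebesgue. v x = max 0 (v x)"
      by eventually_elim (use X_zero[OF vX] in force)
    show "minimizer (\<lambda>x. max 0 (v x))"
      by (rule minimizer_cong_AE[OF v(1) _ _ e]) (auto simp: X_zero[OF vX])
  qed
  let ?u = "\<lambda>x. max 0 (u x)" and ?w = "\<lambda>x. max 0 (w x)"
  have scaled: "minimizer (\<lambda>x. c * v x)" if "minimizer v" "minimizer v'" "AE x in lebesgue. v' x = c * v x" for v v' c
  proof (rule minimizer_cong_AE[OF that(2) _ _ that(3)])
    have vX: "v \<in> X" using that by (simp add: minimizer_def)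
    note [measurable] = X_measurable[OF vX]
    show "(\<lambda>x. c * v x) \<in> borel_measurable lebesgue" by measurable
    show "c * v x = 0" if "x \<notin> \<Omega>" for x using X_zero[OF vX that] by simp
  qed
  obtain c where c: "0 < c" "AE x in lebesgue. ?w x = c * ?u x"
    using minimizers_proportional[OF pos(1)[OF u] _ pos(1)[OF w] _ mono] by auto
  have "\<not> 1 < c"
    using no_proportional_minimizers[OF pos(1)[OF u] _ _ scaled[OF pos(1)[OF u] pos(1)[OF w] c(2)] mono] by auto
  \<comment> \<open>The roles of the two minimisers are exchanged, with the reciprocal factor
    \<open>1 / c\<close>.\<close>
  moreover have "\<not> c < 1"
  proof
    assume "c < 1"
    have "AE x in lebesgue. ?u x = (1 / c) * ?w x" using c(2) by eventually_elim (use c(1) in simp)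
    then have "minimizer (\<lambda>x. (1 / c) * ?w x)" by (rule scaled[OF pos(1)[OF w] pos(1)[OF u]])
    then show False
      using no_proportional_minimizers[OF pos(1)[OF w] _ _ _ mono, of "1 / c"] c(1) \<open>c < 1\<close> by simp
  qed
  ultimately have c1: "c = 1" by linarith
  show ?thesis using c(2) pos(2)[OF u] pos(2)[OF w] by eventually_elim (simp add: c1)
qed

end

theorem theorem2p13:
  fixes \<Omega> :: "'a::euclidean_space set"
    and p \<mu> :: real
    and g :: "'a \<Rightarrow> real \<Rightarrow> real"
  assumes p: "1 < p"
    and Omega: "bounded_lipschitz_domain \<Omega>"
    and mu: "\<mu> < 0"
    and carath: "caratheodory \<Omega> g"
    and g1: "\<And>K. compact K \<Longrightarrow> in_Linf (\<Omega> \<times> K) (\<lambda>(x, t). g x t)"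
    and g2: "uniform_limit \<Omega> (\<lambda>t x. g x t / (h p t * ln \<bar>t\<bar>)) (\<lambda>x. 0) at_infinity"
    and g3: "\<exists>f. in_Linf \<Omega> f \<and> uniform_limit \<Omega> (\<lambda>t x. g x t / h p t) f (at 0)"
  shows "(\<exists>u. least_energy_solution p \<Omega> g \<mu> u \<and> nontrivial u \<and> in_Linf \<Omega> u)
    \<and> ((AE x in lebesgue_on \<Omega>. \<forall>t. primitive g x t \<le> primitive g x \<bar>t\<bar>) \<longrightarrow>
        (\<forall>u. least_energy_solution p \<Omega> g \<mu> u \<longrightarrow> constant_sign_on \<Omega> u))
    \<and> ((AE x in lebesgue_on \<Omega>. g x C1_differentiable_on UNIV \<and>
          (\<forall>t\<ge>0. (p - 1) * t * g x t - deriv (g x) t * t\<^sup>2 - \<mu> * t powr p \<ge> 0)) \<longrightarrow>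
        (\<forall>u w. least_energy_solution p \<Omega> g \<mu> u \<and> nontrivial u \<and> nonnegative_on \<Omega> u \<and>
               least_energy_solution p \<Omega> g \<mu> w \<and> nontrivial w \<and> nonnegative_on \<Omega> w \<longrightarrow>
               (AE x in lebesgue. u x = w x)))"
proof -
  interpret log_problem \<Omega> p g \<mu>
    using p Omega mu carath g1 g2 g3
    by unfold_locales (auto simp: bounded_lipschitz_domain_def)
  obtain u where u: "minimizer u" using exists_minimizer by blast
  then have uX: "u \<in> X" by (simp add: minimizer_def)
  obtain M where "AE x in lebesgue_on \<Omega>. \<bar>u x\<bar> \<le> M" using minimizer_bounded u by blast
  then have "in_Linf \<Omega> u" using X_measurable_Omega[OF uX] by (auto simp: in_Linf_def)
  then show ?thesis
    unfolding least_energy_iff_minimizer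
    using u minimizer_nontrivial minimizer_constant_sign nonneg_minimizer_unique by blast
qed

end
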